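(* Let $L>0$, $\Omega=(0,L)^2$, $R>0$, $U\in\mathbb{R}$, $f\in L^2(\Omega)$, and let $\sigma:\overline{\Omega}\to\mathbb{R}$ be a measurable function with $\sigma_m\le\sigma(x)\le\sigma_M$ for all $x\in\overline{\Omega}$, for some constants $\sigma_m,\sigma_M>0$. Let $\Phi\in V^c$ and $\Phi_h\in V_h^c$ be the solutions of $$a(\Phi,v)=L(v)\ \ \text{for all } v\in V^c,\qquad a(\Phi_h,v_h)=L(v_h)\ \ \text{for all } v_h\in V_h^c,$$ respectively, where $V_h^c$ is the continuous piecewise linear finite element subspace of $V^c$. Suppose the $H^2$ regularity result holds in the following sense: there is a constant $C_{\mathrm{reg}}$ such that for every $g\in L^2(\Omega)$ the solution $w\in V^c$ of $a(w,v)=\int_\Omega g v\,dx$ for all $v\in V^c$ belongs to $H^2(\Omega)$ and satisfies $\|w\|_{2,\Omega}\le C_{\mathrm{reg}}\|g\|_{0,\Omega}$; and $\Phi\in H^2(\Omega)$. Then $$\|\Phi-\Phi_h\|_{0,\Omega}\le C\,h^2\,\|\Phi\|_{2,\Omega},$$ with a constant $C>0$ independent of $h$, $\Phi$, $f$ and $U$. Furthermore, when the regularity bound $\|\Phi\|_{2,\Omega}\le C_{\mathrm{reg}}\|f\|_{0,\Omega}$ holds for $\Phi$ itself, $$\|\Phi-\Phi_h\|_{0,\Omega}\le C'\,h^2\,\|f\|_{0,\Omega},$$ with a constant $C'>0$ independent of $h$, $\Phi$, $f$ and $U$. (Both $C$ and $C'$ may depend on $C_{\mathrm{reg}}$.)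
   Context: Write $\Gamma_1=\{(x,y)\in\partial\Omega: x=0\}$, $\Gamma_3=\{(x,y)\in\partial\Omega: x=L\}$, and let $|\Gamma_1|=L$ be the length of $\Gamma_1$. Boundary values are understood in the sense of traces. Let $$V^c=\{\Phi\in H^1(\Omega): \Phi|_{\Gamma_1}\text{ is a constant function},\ \Phi|_{\Gamma_3}=0\},$$ where the constant on $\Gamma_1$ is not prescribed. Define, for $\Phi,v\in V^c$, $$a(\Phi,v)=\int_\Omega \sigma\nabla\Phi\cdot\nabla v\,dx+\frac{1}{|\Gamma_1|R}\int_{\Gamma_1}\Phi v\,ds,\qquad L(v)=\int_\Omega f v\,dx+\frac{U}{|\Gamma_1|R}\int_{\Gamma_1}v\,ds.$$ (The symbol $L(\cdot)$ for the functional is distinct from the side length $L$.) $\mathcal{T}^h$ denotes a uniform triangular mesh of $\Omega$ with mesh size $h$: $\overline\Omega$ is divided into $M\times M$ congruent squares, each split into two triangles by a diagonal, all diagonals being parallel, with $h=L/M$. The finite element space is $$V_h^c=\{\Phi_h\in C(\overline\Omega)\cap V^c: \Phi_h|_{\mathcal K}\in P_1(\mathcal K)\ \text{for all } \mathcal K\in\mathcal T^h\},$$ where $P_1(\mathcal K)$ is the space of polynomials of degree at most $1$ on $\mathcal K$. $\|\cdot\|_{0,\Omega}$ is the $L^2(\Omega)$ norm and $\|\cdot\|_{2,\Omega}$ is the $H^2(\Omega)$ norm. *)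

theory Defs
  imports "HOL-Analysis.Analysis"
begin

section \<open>Square-integrable functions\<close>

text \<open>Elements of the function spaces below are represented by genuine functions;
  membership in the spaces, traces, norms and forms are invariant under changes on null sets,
  while continuity on the closure and piecewise linearity are pointwise conditions.\<close>

definition L2 :: "'a measure \<Rightarrow> ('a \<Rightarrow> real) set" where
  "L2 M = {f \<in> borel_measurable M. integrable M (\<lambda>x. (f x)\<^sup>2)}"

definition L2_norm :: "'a measure \<Rightarrow> ('a \<Rightarrow> real) \<Rightarrow> real" where
  "L2_norm M f = sqrt (LINT x|M. (f x)\<^sup>2)"


section \<open>Weak derivatives and Sobolev spaces in the plane\<close>

definition pderiv_dir :: "'a \<Rightarrow> ('a::euclidean_space \<Rightarrow> real) \<Rightarrow> 'a \<Rightarrow> real" where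
  "pderiv_dir e \<phi> = (\<lambda>x. frechet_derivative \<phi> (at x) e)"

text \<open>A function is smooth if all its iterated partial derivatives, in any order, exist and are
  (Frechet) differentiable, hence continuous.\<close>

definition smooth :: "('a::euclidean_space \<Rightarrow> real) \<Rightarrow> bool" where
  "smooth \<phi> \<longleftrightarrow>
     (\<forall>es. set es \<subseteq> Basis \<longrightarrow> (\<forall>x. foldr pderiv_dir es \<phi> differentiable (at x)))"

definition test_functions :: "'a::euclidean_space set \<Rightarrow> ('a \<Rightarrow> real) set" where
  "test_functions S =
     {\<phi>. smooth \<phi> \<and> compact (closure {x. \<phi> x \<noteq> 0}) \<and> closure {x. \<phi> x \<noteq> 0} \<subseteq> S}"

text \<open>The classical derivative of multi-index \<open>(i, j)\<close>.\<close>

definition D :: "nat \<Rightarrow> nat \<Rightarrow> (real \<times> real \<Rightarrow> real) \<Rightarrow> real \<times> real \<Rightarrow> real" where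
  "D i j \<phi> = (pderiv_dir (1, 0) ^^ i) ((pderiv_dir (0, 1) ^^ j) \<phi>)"

definition has_weak_deriv ::
  "(real \<times> real) set \<Rightarrow> nat \<Rightarrow> nat \<Rightarrow> (real \<times> real \<Rightarrow> real) \<Rightarrow> (real \<times> real \<Rightarrow> real) \<Rightarrow> bool" where
  "has_weak_deriv S i j u g \<longleftrightarrow>
     g \<in> L2 (lebesgue_on S) \<and>
     (\<forall>\<phi>\<in>test_functions S.
        (LINT x|lebesgue_on S. u x * D i j \<phi> x) = (-1) ^ (i + j) * (LINT x|lebesgue_on S. g x * \<phi> x))"

text \<open>The square-integrable weak derivative; it is determined only up to a null set.\<close>

definition weak_deriv ::
  "(real \<times> real) set \<Rightarrow> nat \<Rightarrow> nat \<Rightarrow> (real \<times> real \<Rightarrow> real) \<Rightarrow> real \<times> real \<Rightarrow> real" where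
  "weak_deriv S i j u = (SOME g. has_weak_deriv S i j u g)"

definition sobolev :: "nat \<Rightarrow> (real \<times> real) set \<Rightarrow> (real \<times> real \<Rightarrow> real) set" where
  "sobolev m S =
     {u \<in> L2 (lebesgue_on S). \<forall>i j. i + j \<le> m \<longrightarrow> (\<exists>g. has_weak_deriv S i j u g)}"

definition sobolev_norm :: "nat \<Rightarrow> (real \<times> real) set \<Rightarrow> (real \<times> real \<Rightarrow> real) \<Rightarrow> real" where
  "sobolev_norm m S u =
     sqrt (\<Sum>i\<le>m. \<Sum>j\<le>m - i. (L2_norm (lebesgue_on S) (weak_deriv S i j u))\<^sup>2)"


section \<open>The square, its vertical sides, and traces\<close>

definition square :: "real \<Rightarrow> (real \<times> real) set" where
  "square L = {0<..<L} \<times> {0<..<L}"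

text \<open>For \<open>c = 0\<close> and \<open>c = L\<close> these are the sides \<open>\<Gamma>\<^sub>1\<close> and \<open>\<Gamma>\<^sub>3\<close>.\<close>

definition side :: "real \<Rightarrow> real \<Rightarrow> (real \<times> real) set" where
  "side L c = {p \<in> frontier (square L). fst p = c}"

text \<open>Arc length on a vertical side: the image of one-dimensional Lebesgue measure under the
  isometry \<open>y \<mapsto> (c, y)\<close>, restricted to the side.\<close>

definition side_measure :: "real \<Rightarrow> real \<Rightarrow> (real \<times> real) measure" where
  "side_measure L c = restrict_space (distr lborel borel (\<lambda>y. (c, y))) (side L c)"

definition side_length :: "real \<Rightarrow> real \<Rightarrow> real" where
  "side_length L c = measure (side_measure L c) (side L c)"

lemma closure_square: "L > 0 \<Longrightarrow> closure (square L) = {0..L} \<times> {0..L}"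
  by (simp add: square_def closure_Times)

lemma side_eq:
  assumes "L > 0" "c = 0 \<or> c = L"
  shows "side L c = {c} \<times> {0..L}"
proof -
  have "open (square L)" unfolding square_def by (intro open_Times) auto
  hence "frontier (square L) = {0..L} \<times> {0..L} - square L"
    unfolding frontier_def closure_square[OF assms(1)] by (subst interior_open) auto
  hence "p \<in> side L c \<longleftrightarrow> p \<in> {0..L} \<times> {0..L} \<and> p \<notin> square L \<and> fst p = c" for p
    unfolding side_def by blast
  moreover have "p \<notin> square L" if "fst p = c" for p
    using that assms(2) unfolding square_def by (cases p) auto
  moreover have "c \<in> {0..L}" using assms by auto
  ultimately show ?thesis by (intro set_eqI) (auto simp del: atLeastAtMost_iff)
qed

lemma side_length_eq:
  assumes "L > 0" "c = 0 \<or> c = L"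
  shows "side_length L c = L"
proof -
  have "closed (side L c)" unfolding side_eq[OF assms] by (intro closed_Times) auto
  hence b: "side L c \<in> sets borel" by (rule borel_closed)
  have m: "(\<lambda>y::real. (c, y)) \<in> measurable lborel borel"
    by (simp add: borel_measurable_continuous_onI continuous_on_Pair)
  have pre: "(\<lambda>y. (c, y)) -` side L c = {0..L}" unfolding side_eq[OF assms] by auto
  have "side_length L c = measure (distr lborel borel (\<lambda>y. (c, y))) (side L c)"
    unfolding side_length_def side_measure_def
    by (rule measure_restrict_space) (use b in auto)
  also have "\<dots> = measure lborel ((\<lambda>y. (c, y)) -` side L c \<inter> space lborel)"
    by (rule measure_distr[OF m b])
  also have "\<dots> = L" unfolding pre using assms(1) by simp
  finally show ?thesis .
qed

text \<open>The trace operator is the continuous extension to \<open>H\<^sup>1\<close>, with values in \<open>L\<^sup>2\<close> of the side,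
  of restriction to the side on the functions in \<open>H\<^sup>1\<close> that are continuous up to the boundary.
  Its graph is thus the closure of the graph of the restriction map.\<close>

definition has_trace ::
  "real \<Rightarrow> real \<Rightarrow> (real \<times> real \<Rightarrow> real) \<Rightarrow> (real \<times> real \<Rightarrow> real) \<Rightarrow> bool" where
  "has_trace L c u t \<longleftrightarrow>
     u \<in> sobolev 1 (square L) \<and> t \<in> L2 (side_measure L c) \<and>
     (\<exists>w :: nat \<Rightarrow> real \<times> real \<Rightarrow> real.
        (\<forall>n. w n \<in> sobolev 1 (square L) \<and> continuous_on (closure (square L)) (w n)) \<and>
        (\<lambda>n. sobolev_norm 1 (square L) (\<lambda>x. w n x - u x)) \<longlonglongrightarrow> 0 \<and>
        (\<lambda>n. L2_norm (side_measure L c) (\<lambda>x. w n x - t x)) \<longlonglongrightarrow> 0)"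

text \<open>Determined only up to a null set of the side.\<close>

definition trace :: "real \<Rightarrow> real \<Rightarrow> (real \<times> real \<Rightarrow> real) \<Rightarrow> real \<times> real \<Rightarrow> real" where
  "trace L c u = (SOME t. has_trace L c u t)"


section \<open>The variational problem\<close>

definition Vc :: "real \<Rightarrow> (real \<times> real \<Rightarrow> real) set" where
  "Vc L = {\<Phi> \<in> sobolev 1 (square L).
     (\<exists>k. has_trace L 0 \<Phi> (\<lambda>_. k)) \<and> has_trace L L \<Phi> (\<lambda>_. 0)}"

definition bilinear_a ::
  "real \<Rightarrow> real \<Rightarrow> (real \<times> real \<Rightarrow> real) \<Rightarrow> (real \<times> real \<Rightarrow> real) \<Rightarrow> (real \<times> real \<Rightarrow> real) \<Rightarrow> real" where
  "bilinear_a L R \<sigma> \<Phi> v =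
     (LINT x|lebesgue_on (square L).
        \<sigma> x * (weak_deriv (square L) 1 0 \<Phi> x * weak_deriv (square L) 1 0 v x
             + weak_deriv (square L) 0 1 \<Phi> x * weak_deriv (square L) 0 1 v x))
     + 1 / (side_length L 0 * R) * (LINT s|side_measure L 0. trace L 0 \<Phi> s * trace L 0 v s)"

definition load ::
  "real \<Rightarrow> real \<Rightarrow> real \<Rightarrow> (real \<times> real \<Rightarrow> real) \<Rightarrow> (real \<times> real \<Rightarrow> real) \<Rightarrow> real" where
  "load L R U f v =
     (LINT x|lebesgue_on (square L). f x * v x)
     + U / (side_length L 0 * R) * (LINT s|side_measure L 0. trace L 0 v s)"


section \<open>Uniform meshes and piecewise linear elements\<close>

text \<open>The two families of parallel diagonals give two meshes: diagonals from lower left to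
  upper right, and from lower right to upper left.\<close>

definition mesh_up :: "real \<Rightarrow> nat \<Rightarrow> (real \<times> real) set set" where
  "mesh_up L M = (let h = L / real M; P = (\<lambda>i j. (real i * h, real j * h)) in
     (\<Union>i<M. \<Union>j<M. {convex hull {P i j, P (Suc i) j, P (Suc i) (Suc j)},
                    convex hull {P i j, P i (Suc j), P (Suc i) (Suc j)}}))"

definition mesh_down :: "real \<Rightarrow> nat \<Rightarrow> (real \<times> real) set set" where
  "mesh_down L M = (let h = L / real M; P = (\<lambda>i j. (real i * h, real j * h)) in
     (\<Union>i<M. \<Union>j<M. {convex hull {P i j, P (Suc i) j, P i (Suc j)},
                    convex hull {P (Suc i) j, P i (Suc j), P (Suc i) (Suc j)}}))"

definition uniform_mesh :: "real \<Rightarrow> nat \<Rightarrow> (real \<times> real) set set \<Rightarrow> bool" where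
  "uniform_mesh L M T \<longleftrightarrow> M \<ge> 1 \<and> (T = mesh_up L M \<or> T = mesh_down L M)"

definition P1_on :: "(real \<times> real) set \<Rightarrow> (real \<times> real \<Rightarrow> real) \<Rightarrow> bool" where
  "P1_on K u \<longleftrightarrow> (\<exists>a b c. \<forall>(x, y)\<in>K. u (x, y) = a + b * x + c * y)"

definition Vhc :: "real \<Rightarrow> (real \<times> real) set set \<Rightarrow> (real \<times> real \<Rightarrow> real) set" where
  "Vhc L T = {\<Phi>\<^sub>h \<in> Vc L. continuous_on (closure (square L)) \<Phi>\<^sub>h \<and> (\<forall>K\<in>T. P1_on K \<Phi>\<^sub>h)}"

definition weak_solution ::
  "real \<Rightarrow> real \<Rightarrow> (real \<times> real \<Rightarrow> real) \<Rightarrow> real \<Rightarrow> (real \<times> real \<Rightarrow> real) \<Rightarrow> (real \<times> real \<Rightarrow> real) \<Rightarrow> bool" where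
  "weak_solution L R \<sigma> U f \<Phi> \<longleftrightarrow>
     \<Phi> \<in> Vc L \<and> (\<forall>v\<in>Vc L. bilinear_a L R \<sigma> \<Phi> v = load L R U f v)"

definition fe_solution ::
  "real \<Rightarrow> real \<Rightarrow> (real \<times> real \<Rightarrow> real) \<Rightarrow> real \<Rightarrow> (real \<times> real \<Rightarrow> real)
    \<Rightarrow> (real \<times> real) set set \<Rightarrow> (real \<times> real \<Rightarrow> real) \<Rightarrow> bool" where
  "fe_solution L R \<sigma> U f T \<Phi>\<^sub>h \<longleftrightarrow>
     \<Phi>\<^sub>h \<in> Vhc L T \<and> (\<forall>v\<in>Vhc L T. bilinear_a L R \<sigma> \<Phi>\<^sub>h v = load L R U f v)"

text \<open>The regularity bound is required of every solution of the problem with right-hand side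
  \<open>g\<close>; existence of such a solution is not part of the hypothesis.\<close>

definition H2_regular :: "real \<Rightarrow> real \<Rightarrow> (real \<times> real \<Rightarrow> real) \<Rightarrow> real \<Rightarrow> bool" where
  "H2_regular L R \<sigma> C \<longleftrightarrow>
     (\<forall>g \<in> L2 (lebesgue_on (square L)). \<forall>w \<in> Vc L.
        (\<forall>v\<in>Vc L. bilinear_a L R \<sigma> w v = (LINT x|lebesgue_on (square L). g x * v x)) \<longrightarrow>
        w \<in> sobolev 2 (square L) \<and>
        sobolev_norm 2 (square L) w \<le> C * L2_norm (lebesgue_on (square L)) g)"

end

theory Submission
  imports Defs
begin

text \<open>A function on the square has a weak \<open>x\<close>-derivative \<open>g\<close> in \<open>L\<^sup>2\<close> if and only if almost everywhere
  \<open>u(x, y) = c(y) + \<integral>\<^sub>0\<^sup>x g(s, y) ds\<close> for some \<open>c\<close> in \<open>L\<^sup>2\<close>, and the traces of \<open>u\<close> on the vertical sides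
  are then the boundary values of this representation. Hence a function in \<open>V\<^sup>c\<close> is a constant plus the
  primitive of its \<open>x\<close>-derivative, which yields a Poincare inequality, the completeness of \<open>V\<^sup>c\<close> for the energy
  norm and, by Riesz' theorem, the solvability of the dual problem.

  A function in \<open>H\<^sup>2\<close> has a continuous representative; the differences of its nodal values along a mesh edge
  are integrals of a first weak derivative over that edge, so the gradient of the nodal interpolant is made of
  edge averages of the gradient. Comparing such an average with the derivative on the adjacent cell along
  horizontal and vertical lines bounds the interpolation error in the energy norm by \<open>h\<close> times the \<open>H\<^sup>2\<close> norm.
  Galerkin orthogonality (Cea) and the duality argument of Aubin and Nitsche give the second factor \<open>h\<close>.\<close>

section \<open>The space of square-integrable functions\<close>

text \<open>Weak derivatives and traces are choices determined only up to null sets, and a trace is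
  given merely as a limit of restrictions. The representation by primitives removes both
  vaguenesses: it turns traces into values at the endpoints of horizontal lines, and values at mesh
  nodes become meaningful. The regularity hypothesis bounds the solutions of the dual problem but
  does not supply them; completeness of the energy form and Riesz' theorem are there for this reason
  alone. Edge averages replace density of smooth functions in H2 and scaling to a reference
  triangle: the interpolation error is estimated directly by integration along lines. The
  interpolant takes the same constant on the left side as the interpolated function, so the boundary
  term of the form vanishes on the interpolation error and only gradients have to be estimated. The
  data \<open>f\<close> and \<open>U\<close> enter only through the load, which cancels in Galerkin
  orthogonality; hence constants free of them. The factor 32 is 4 * 4 * 2: the interpolation
  constant 4 is used for the solution and for the dual solution, and 2 comes from bounding the
  square of a sum by squares.\<close>

lemma L2_measurable [measurable_dest]: "f \<in> L2 M \<Longrightarrow> f \<in> borel_measurable M"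
  and L2_square_integrable: "f \<in> L2 M \<Longrightarrow> integrable M (\<lambda>x. (f x)\<^sup>2)"
  by (auto simp: L2_def)

lemma L2I: "f \<in> borel_measurable M \<Longrightarrow> integrable M (\<lambda>x. (f x)\<^sup>2) \<Longrightarrow> f \<in> L2 M"
  by (simp add: L2_def)

lemma L2_mult_integrable:
  assumes f: "f \<in> L2 M" and g: "g \<in> L2 M"
  shows "integrable M (\<lambda>x. f x * g x)"
proof (rule Bochner_Integration.integrable_bound)
  show "integrable M (\<lambda>x. (f x)\<^sup>2 + (g x)\<^sup>2)"
    using L2_square_integrable[OF f] L2_square_integrable[OF g] by simp
  show "(\<lambda>x. f x * g x) \<in> borel_measurable M" using f g by measurable
  have "\<bar>a * b\<bar> \<le> a\<^sup>2 + b\<^sup>2" for a b :: real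
  proof -
    have "0 \<le> \<bar>a\<bar> * \<bar>b\<bar>" by simp
    moreover have "2 * (\<bar>a\<bar> * \<bar>b\<bar>) \<le> a\<^sup>2 + b\<^sup>2"
      using sum_squares_bound[of "\<bar>a\<bar>" "\<bar>b\<bar>"] by (simp add: mult.assoc)
    ultimately show ?thesis unfolding abs_mult by linarith
  qed
  then show "AE x in M. norm (f x * g x) \<le> norm ((f x)\<^sup>2 + (g x)\<^sup>2)" by auto
qed

lemma L2_lincomb:
  assumes f: "f \<in> L2 M" and g: "g \<in> L2 M"
  shows "(\<lambda>x. a * f x + b * g x) \<in> L2 M"
proof (rule L2I)
  show "(\<lambda>x. a * f x + b * g x) \<in> borel_measurable M" using f g by measurable
  have "(\<lambda>x. (a * f x + b * g x)\<^sup>2) = (\<lambda>x. a\<^sup>2 * (f x)\<^sup>2 + b\<^sup>2 * (g x)\<^sup>2 + (2 * a * b) * (f x * g x))"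
    by (auto simp: power2_eq_square algebra_simps)
  then show "integrable M (\<lambda>x. (a * f x + b * g x)\<^sup>2)"
    using L2_square_integrable[OF f] L2_square_integrable[OF g] L2_mult_integrable[OF f g] by simp
qed

lemma L2_add: "f \<in> L2 M \<Longrightarrow> g \<in> L2 M \<Longrightarrow> (\<lambda>x. f x + g x) \<in> L2 M"
  and L2_diff: "f \<in> L2 M \<Longrightarrow> g \<in> L2 M \<Longrightarrow> (\<lambda>x. f x - g x) \<in> L2 M"
  and L2_cmult: "f \<in> L2 M \<Longrightarrow> (\<lambda>x. c * f x) \<in> L2 M"
  using L2_lincomb[of f M g 1 1] L2_lincomb[of f M g 1 "-1"] L2_lincomb[of f M f c 0] by simp_all

lemma L2_AE_cong:
  assumes "f \<in> L2 M" "g \<in> borel_measurable M" "AE x in M. f x = g x"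
  shows "g \<in> L2 M"
proof (rule L2I[OF assms(2)])
  have "integrable M (\<lambda>x. (f x)\<^sup>2) \<longleftrightarrow> integrable M (\<lambda>x. (g x)\<^sup>2)"
    by (rule integrable_cong_AE) (use assms in \<open>auto intro!: borel_measurable_power dest: L2_measurable\<close>)
  then show "integrable M (\<lambda>x. (g x)\<^sup>2)" using L2_square_integrable[OF assms(1)] by simp
qed

lemma L2_bounded:
  assumes "finite_measure M" "f \<in> borel_measurable M" "\<And>x. x \<in> space M \<Longrightarrow> \<bar>f x\<bar> \<le> B"
  shows "f \<in> L2 M"
proof (rule L2I[OF assms(2)])
  show "integrable M (\<lambda>x. (f x)\<^sup>2)"
  proof (rule finite_measure.integrable_const_bound[OF assms(1), of _ "B\<^sup>2"])
    show "AE x in M. norm ((f x)\<^sup>2) \<le> B\<^sup>2"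
    proof (rule AE_I2)
      fix x assume "x \<in> space M"
      then have "(f x)\<^sup>2 \<le> B\<^sup>2" using assms(3) by (metis abs_ge_zero power2_abs power_mono)
      then show "norm ((f x)\<^sup>2) \<le> B\<^sup>2" by simp
    qed
    show "(\<lambda>x. (f x)\<^sup>2) \<in> borel_measurable M" by (intro borel_measurable_power assms(2))
  qed
qed

lemma L2_bounded_mult:
  assumes f: "f \<in> L2 M" and g: "g \<in> borel_measurable M" and "\<And>x. x \<in> space M \<Longrightarrow> \<bar>g x\<bar> \<le> B"
  shows "(\<lambda>x. g x * f x) \<in> L2 M"
proof (rule L2I)
  show "(\<lambda>x. g x * f x) \<in> borel_measurable M" using f g by measurable
  show "integrable M (\<lambda>x. (g x * f x)\<^sup>2)"
  proof (rule Bochner_Integration.integrable_bound)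
    show "integrable M (\<lambda>x. B\<^sup>2 * (f x)\<^sup>2)" using L2_square_integrable[OF f] by simp
    show "(\<lambda>x. (g x * f x)\<^sup>2) \<in> borel_measurable M" using f g by measurable
    have "(g x * f x)\<^sup>2 \<le> B\<^sup>2 * (f x)\<^sup>2" if "x \<in> space M" for x
    proof -
      have "(g x)\<^sup>2 \<le> B\<^sup>2" using assms(3)[OF that] by (metis abs_ge_zero power2_abs power_mono)
      then show ?thesis by (simp add: power_mult_distrib mult_right_mono)
    qed
    then show "AE x in M. norm ((g x * f x)\<^sup>2) \<le> norm (B\<^sup>2 * (f x)\<^sup>2)" by (auto intro!: AE_I2)
  qed
qed

lemma L2_norm_nonneg [simp]: "0 \<le> L2_norm M f"
  by (simp add: L2_norm_def)

lemma L2_norm_power2: "(L2_norm M f)\<^sup>2 = (LINT x|M. (f x)\<^sup>2)"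
  by (simp add: L2_norm_def)

lemma L2_norm_cong_AE:
  assumes "f \<in> borel_measurable M" "g \<in> borel_measurable M" "AE x in M. f x = g x"
  shows "L2_norm M f = L2_norm M g"
  unfolding L2_norm_def
  by (intro arg_cong[where f = sqrt] integral_cong_AE) (use assms in auto)

text \<open>The integral of \<open>(f + t g)^2\<close> is a nonnegative quadratic polynomial in
  \<open>t\<close>. Its minimum gives the inequality; when \<open>g\<close> vanishes almost
  everywhere the polynomial is affine in \<open>t\<close>, and nonnegativity forces the linear
  coefficient to vanish.\<close>

lemma L2_Cauchy_Schwarz:
  assumes f: "f \<in> L2 M" and g: "g \<in> L2 M"
  shows "\<bar>LINT x|M. f x * g x\<bar> \<le> L2_norm M f * L2_norm M g"
proof -
  define A B C where "A = (LINT x|M. (f x)\<^sup>2)" and "B = (LINT x|M. (g x)\<^sup>2)"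
    and "C = (LINT x|M. f x * g x)"
  have q: "0 \<le> A + 2 * t * C + t\<^sup>2 * B" for t
  proof -
    have "0 \<le> (LINT x|M. (f x + t * g x)\<^sup>2)" by simp
    also have "\<dots> = (LINT x|M. (f x)\<^sup>2 + (2 * t) * (f x * g x) + t\<^sup>2 * (g x)\<^sup>2)"
      by (rule Bochner_Integration.integral_cong) (auto simp: power2_eq_square algebra_simps)
    also have "\<dots> = A + 2 * t * C + t\<^sup>2 * B"
      unfolding A_def B_def C_def
      using L2_square_integrable[OF f] L2_square_integrable[OF g] L2_mult_integrable[OF f g] by simp
    finally show ?thesis .
  qed
  have "A \<ge> 0" "B \<ge> 0" unfolding A_def B_def by auto
  have "C\<^sup>2 \<le> A * B"
  proof (cases "B = 0")
    case True
    have "C = 0"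
    proof (rule ccontr)
      assume "C \<noteq> 0"
      \<comment> \<open>With \<open>B = 0\<close> the polynomial takes the value \<open>-1\<close>
        at this \<open>t\<close>.\<close>
      then show False using q[of "- (A + 1) / (2 * C)"] True by (simp add: field_simps)
    qed
    then show ?thesis using True by simp
  next
    case False
    then have "B > 0" using \<open>B \<ge> 0\<close> by simp
    have "0 \<le> A - C\<^sup>2 / B" using q[of "- C / B"] False by (simp add: power2_eq_square field_simps)
    then show ?thesis using \<open>B > 0\<close> by (simp add: field_simps)
  qed
  then have "\<bar>C\<bar> \<le> sqrt (A * B)" by (metis real_sqrt_abs real_sqrt_le_mono)
  then show ?thesis unfolding L2_norm_def A_def B_def C_def by (simp add: real_sqrt_mult)
qed

lemma L2_norm_triangle:
  assumes f: "f \<in> L2 M" and g: "g \<in> L2 M"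
  shows "L2_norm M (\<lambda>x. f x + g x) \<le> L2_norm M f + L2_norm M g"
proof (rule power2_le_imp_le)
  have "(L2_norm M (\<lambda>x. f x + g x))\<^sup>2 = (LINT x|M. (f x)\<^sup>2 + 2 * (f x * g x) + (g x)\<^sup>2)"
    unfolding L2_norm_power2
    by (rule Bochner_Integration.integral_cong) (auto simp: power2_eq_square algebra_simps)
  also have "\<dots> = (L2_norm M f)\<^sup>2 + 2 * (LINT x|M. f x * g x) + (L2_norm M g)\<^sup>2"
    unfolding L2_norm_power2
    using L2_square_integrable[OF f] L2_square_integrable[OF g] L2_mult_integrable[OF f g] by simp
  also have "\<dots> \<le> (L2_norm M f + L2_norm M g)\<^sup>2"
    using L2_Cauchy_Schwarz[OF f g] by (simp add: power2_eq_square algebra_simps)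
  finally show "(L2_norm M (\<lambda>x. f x + g x))\<^sup>2 \<le> (L2_norm M f + L2_norm M g)\<^sup>2" .
qed simp

lemma L2_norm_cmult: "L2_norm M (\<lambda>x. c * f x) = \<bar>c\<bar> * L2_norm M f"
  by (simp add: L2_norm_def power_mult_distrib real_sqrt_mult)

lemma L2_norm_triangle_diff:
  assumes f: "f \<in> L2 M" and g: "g \<in> L2 M" and h: "h \<in> L2 M"
  shows "L2_norm M (\<lambda>x. f x - h x) \<le> L2_norm M (\<lambda>x. f x - g x) + L2_norm M (\<lambda>x. g x - h x)"
  using L2_norm_triangle[OF L2_diff[OF f g] L2_diff[OF g h]] by simp

lemma L2_norm_minus_commute: "L2_norm M (\<lambda>x. f x - g x) = L2_norm M (\<lambda>x. g x - f x)"
  by (simp add: L2_norm_def power2_commute)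

lemma L2_norm_eq_0_iff:
  assumes f: "f \<in> L2 M"
  shows "L2_norm M f = 0 \<longleftrightarrow> (AE x in M. f x = 0)"
  using integral_nonneg_eq_0_iff_AE[OF L2_square_integrable[OF f]] by (simp add: L2_norm_def)

lemma L2_integrable:
  assumes "finite_measure M" "f \<in> L2 M"
  shows "integrable M f"
  using finite_measure.square_integrable_imp_integrable[OF assms(1)] assms(2)
  by (auto simp: L2_def)

lemma L1_le_L2_norm:
  assumes M: "finite_measure M" and f: "f \<in> L2 M"
  shows "(LINT x|M. \<bar>f x\<bar>) \<le> sqrt (measure M (space M)) * L2_norm M f"
proof -
  interpret finite_measure M by fact
  have a: "(\<lambda>x. \<bar>f x\<bar>) \<in> L2 M" using f by (auto simp: L2_def)
  have b: "(\<lambda>_. 1) \<in> L2 M" by (rule L2_bounded[OF M, of _ 1]) auto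
  show ?thesis using L2_Cauchy_Schwarz[OF b a] by (simp add: L2_norm_def)
qed

lemma L2_norm_tendsto_limits_AE_eq:
  assumes f: "\<And>n. f n \<in> L2 M" and g: "g \<in> L2 M" and h: "h \<in> L2 M"
    and fg: "(\<lambda>n. L2_norm M (\<lambda>x. f n x - g x)) \<longlonglongrightarrow> 0"
    and fh: "(\<lambda>n. L2_norm M (\<lambda>x. f n x - h x)) \<longlonglongrightarrow> 0"
  shows "AE x in M. g x = h x"
proof -
  have "L2_norm M (\<lambda>x. g x - h x) \<le> 0"
  proof (rule tendsto_lowerbound[OF _ always_eventually])
    show "(\<lambda>n. L2_norm M (\<lambda>x. f n x - g x) + L2_norm M (\<lambda>x. f n x - h x)) \<longlonglongrightarrow> 0"
      using tendsto_add[OF fg fh] by simp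
    show "\<forall>n. L2_norm M (\<lambda>x. g x - h x) \<le> L2_norm M (\<lambda>x. f n x - g x) + L2_norm M (\<lambda>x. f n x - h x)"
      using L2_norm_triangle_diff[OF g f h] L2_norm_minus_commute[of M g] by simp
  qed simp
  then have "L2_norm M (\<lambda>x. g x - h x) = 0" using L2_norm_nonneg[of M "\<lambda>x. g x - h x"] by linarith
  then show ?thesis using L2_norm_eq_0_iff[OF L2_diff[OF g h]] by simp
qed

text \<open>The Riesz-Fischer argument: a subsequence whose consecutive differences decay
  geometrically converges almost everywhere by telescoping, and Fatou's lemma along it bounds the
  distance of the whole sequence from the pointwise limit.\<close>

lemma L2_complete:
  assumes M: "finite_measure M" and f: "\<And>n. f n \<in> L2 M"
    and Cauchy: "\<And>e. e > 0 \<Longrightarrow> \<exists>N. \<forall>m\<ge>N. \<forall>n\<ge>N. L2_norm M (\<lambda>x. f m x - f n x) < e"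
  shows "\<exists>g\<in>L2 M. (\<lambda>n. L2_norm M (\<lambda>x. f n x - g x)) \<longlonglongrightarrow> 0"
proof -
  interpret finite_measure M by fact
  have [measurable]: "f n \<in> borel_measurable M" for n using f by (rule L2_measurable)
  have "\<exists>N. \<forall>m\<ge>N. \<forall>n\<ge>N. L2_norm M (\<lambda>x. f m x - f n x) < (1/2)^k" for k
    by (rule Cauchy) simp
  then obtain N where N: "\<And>k m n. m \<ge> N k \<Longrightarrow> n \<ge> N k \<Longrightarrow> L2_norm M (\<lambda>x. f m x - f n x) < (1/2)^k"
    by metis
  \<comment> \<open>The sum dominates every \<open>N i\<close> with \<open>i \<le> k\<close>, so
    both \<open>r k\<close> and \<open>r (Suc k)\<close> lie beyond \<open>N k\<close>; the summand
    \<open>k\<close> makes the indices tend to infinity.\<close>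
  define r where "r k = (\<Sum>i\<le>k. N i) + k" for k
  have rN: "r k \<ge> N k" for k unfolding r_def by (simp add: trans_le_add1 member_le_sum)
  have rmono: "r (Suc k) \<ge> N k" for k
    unfolding r_def using member_le_sum[of k "{..Suc k}" N] by simp
  have rk: "r k \<ge> k" for k unfolding r_def by simp
  define d where "d k x = f (r (Suc k)) x - f (r k) x" for k x
  have dL2: "d k \<in> L2 M" for k unfolding d_def using f by (intro L2_diff)
  have [measurable]: "d k \<in> borel_measurable M" for k using dL2 by (rule L2_measurable)
  have dn: "L2_norm M (d k) \<le> (1/2)^k" for k
    using N[of k "r (Suc k)" "r k"] rN rmono unfolding d_def by simp
  define S where "S = sqrt (measure M (space M))"
  have dint: "integrable M (d k)" for k using dL2 L2_integrable[OF M] by blast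
  \<comment> \<open>On a finite measure space the L2 bound passes to L1, where the sum of the
    differences can be integrated term by term and is therefore finite almost everywhere.\<close>
  have d1: "(LINT x|M. \<bar>d k x\<bar>) \<le> S * (1/2)^k" for k
    using L1_le_L2_norm[OF M dL2, of k] mult_left_mono[OF dn, of S k] unfolding S_def by simp
  have "(\<integral>\<^sup>+x. (\<Sum>k. ennreal \<bar>d k x\<bar>) \<partial>M) = (\<Sum>k. \<integral>\<^sup>+x. ennreal \<bar>d k x\<bar> \<partial>M)"
    by (rule nn_integral_suminf) measurable
  also have "\<dots> \<le> (\<Sum>k. ennreal (S * (1/2)^k))"
  proof (rule suminf_le)
    show "(\<integral>\<^sup>+x. ennreal \<bar>d k x\<bar> \<partial>M) \<le> ennreal (S * (1/2)^k)" for k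
      using nn_integral_eq_integral[of M "\<lambda>x. \<bar>d k x\<bar>"] dint d1[of k] by (simp add: ennreal_leI)
  qed auto
  also have "\<dots> = ennreal (\<Sum>k. S * (1/2)^k)"
    by (rule suminf_ennreal2) (auto simp: S_def intro!: summable_mult summable_geometric)
  also have "\<dots> < \<infinity>" by simp
  finally have "AE x in M. (\<Sum>k. ennreal \<bar>d k x\<bar>) \<noteq> \<infinity>"
    by (intro nn_integral_PInf_AE) (auto, measurable)
  then have summ: "AE x in M. summable (\<lambda>k. \<bar>d k x\<bar>)"
    by eventually_elim (intro summable_suminf_not_top, auto)
  define g where "g x = lim (\<lambda>k. f (r k) x)" for x
  have [measurable]: "g \<in> borel_measurable M" unfolding g_def by measurable
  have conv: "AE x in M. (\<lambda>k. f (r k) x) \<longlonglongrightarrow> g x"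
    using summ
  proof eventually_elim
    case (elim x)
    have "summable (\<lambda>k. d k x)" using elim by (rule summable_rabs_cancel)
    then have "convergent (\<lambda>n. \<Sum>k<n. d k x)" by (simp add: summable_iff_convergent)
    moreover have "(\<Sum>k<n. d k x) = f (r n) x - f (r 0) x" for n
      unfolding d_def by (rule sum_lessThan_telescope)
    ultimately have "convergent (\<lambda>n. f (r n) x - f (r 0) x)" by simp
    then obtain l where "(\<lambda>n. f (r n) x - f (r 0) x) \<longlonglongrightarrow> l" by (auto simp: convergent_def)
    from tendsto_add[OF this tendsto_const[of "f (r 0) x"]]
    have "(\<lambda>n. f (r n) x) \<longlonglongrightarrow> l + f (r 0) x" by simp
    then show ?case unfolding g_def using limI by metis
  qed
  \<comment> \<open>Fatou's lemma is applied to \<open>(f n - f (r k))^2\<close> with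
    \<open>n\<close> fixed and \<open>k\<close> tending to infinity.\<close>
  have sq: "integrable M (\<lambda>x. (f n x - g x)\<^sup>2) \<and> (LINT x|M. (f n x - g x)\<^sup>2) \<le> e\<^sup>2"
    if nN: "n \<ge> K" and e: "e > 0" and K: "\<forall>m\<ge>K. \<forall>n\<ge>K. L2_norm M (\<lambda>x. f m x - f n x) < e" for n K e
  proof -
    have "(\<integral>\<^sup>+x. ennreal ((f n x - g x)\<^sup>2) \<partial>M) = (\<integral>\<^sup>+x. liminf (\<lambda>k. ennreal ((f n x - f (r k) x)\<^sup>2)) \<partial>M)"
    proof (rule nn_integral_cong_AE, use conv in eventually_elim)
      case (elim x)
      have "(\<lambda>k. ennreal ((f n x - f (r k) x)\<^sup>2)) \<longlonglongrightarrow> ennreal ((f n x - g x)\<^sup>2)"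
        by (intro tendsto_ennrealI tendsto_power tendsto_diff tendsto_const elim)
      from lim_imp_Liminf[OF sequentially_bot this] show ?case by (rule sym)
    qed
    also have "\<dots> \<le> liminf (\<lambda>k. \<integral>\<^sup>+x. ennreal ((f n x - f (r k) x)\<^sup>2) \<partial>M)"
      by (rule nn_integral_liminf) measurable
    also have "\<dots> \<le> ennreal (e\<^sup>2)"
    proof (rule Liminf_le)
      have "\<forall>\<^sub>F k in sequentially. k \<ge> K" by (rule eventually_ge_at_top)
      then show "\<forall>\<^sub>F k in sequentially. (\<integral>\<^sup>+x. ennreal ((f n x - f (r k) x)\<^sup>2) \<partial>M) \<le> ennreal (e\<^sup>2)"
      proof eventually_elim
        case (elim k)
        have "(\<integral>\<^sup>+x. ennreal ((f n x - f (r k) x)\<^sup>2) \<partial>M) = ennreal ((L2_norm M (\<lambda>x. f n x - f (r k) x))\<^sup>2)"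
          unfolding L2_norm_power2
          by (rule nn_integral_eq_integral) (use L2_square_integrable[OF L2_diff[OF f f]] in auto)
        also have "\<dots> \<le> ennreal (e\<^sup>2)"
          using K nN rk[of k] elim by (intro ennreal_leI power_mono) (auto intro!: less_imp_le)
        finally show ?case .
      qed
    qed simp
    finally have le: "(\<integral>\<^sup>+x. ennreal ((f n x - g x)\<^sup>2) \<partial>M) \<le> ennreal (e\<^sup>2)" .
    have int: "integrable M (\<lambda>x. (f n x - g x)\<^sup>2)"
      by (rule integrableI_bounded) (use le_less_trans[OF le] in auto)
    then have "ennreal (LINT x|M. (f n x - g x)\<^sup>2) \<le> ennreal (e\<^sup>2)"
      using le nn_integral_eq_integral[OF int] by simp
    then show ?thesis using int by simp
  qed
  obtain K1 where K1: "\<forall>m\<ge>K1. \<forall>n\<ge>K1. L2_norm M (\<lambda>x. f m x - f n x) < 1" using Cauchy[of 1] by auto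
  have "(\<lambda>x. f K1 x - g x) \<in> L2 M" using sq[of K1 K1 1] K1 by (intro L2I) auto
  from L2_diff[OF f[of K1] this] have g: "g \<in> L2 M" by simp
  have "(\<lambda>n. L2_norm M (\<lambda>x. f n x - g x)) \<longlonglongrightarrow> 0"
  proof (rule LIMSEQ_I)
    fix e :: real assume e: "e > 0"
    obtain K where K: "\<forall>m\<ge>K. \<forall>n\<ge>K. L2_norm M (\<lambda>x. f m x - f n x) < e/2" using Cauchy[of "e/2"] e by auto
    have "L2_norm M (\<lambda>x. f n x - g x) \<le> e/2" if "n \<ge> K" for n
      using sq[OF that _ K] e unfolding L2_norm_def by (intro real_le_lsqrt) auto
    then show "\<exists>no. \<forall>n\<ge>no. norm (L2_norm M (\<lambda>x. f n x - g x) - 0) < e"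
      using e by (intro exI[of _ K]) force
  qed
  then show ?thesis using g by blast
qed

section \<open>Lebesgue measure on the interval and the square\<close>

text \<open>A density in place of a restricted space keeps the whole line as space and the Borel
  sets as sigma-algebra, so that functions defined everywhere are measurable without side conditions
  on the interval.\<close>

definition lseg :: "real \<Rightarrow> real measure" where
  "lseg L = density lborel (indicator {0<..<L})"

text \<open>As a product of Borel measures, \<open>lsq L\<close> gives direct access to Fubini's theorem, in contrast to
  the completed measure \<open>lebesgue_on (square L)\<close>.\<close>

definition lsq :: "real \<Rightarrow> (real \<times> real) measure" where
  "lsq L = lseg L \<Otimes>\<^sub>M lseg L"

lemma sets_lseg [measurable_cong, simp]: "sets (lseg L) = sets borel"
  and space_lseg [simp]: "space (lseg L) = UNIV"
  by (auto simp: lseg_def)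

lemma sets_lsq [measurable_cong, simp]: "sets (lsq L) = sets (borel \<Otimes>\<^sub>M borel)"
  and space_lsq [simp]: "space (lsq L) = UNIV"
proof -
  have "sets (lseg L \<Otimes>\<^sub>M lseg L) = sets (borel \<Otimes>\<^sub>M (borel :: real measure))"
    by (rule sets_pair_measure_cong) auto
  then show "sets (lsq L) = sets (borel \<Otimes>\<^sub>M borel)" by (simp only: lsq_def)
  show "space (lsq L) = UNIV" by (auto simp: lsq_def space_pair_measure)
qed

lemma emeasure_lseg: "L > 0 \<Longrightarrow> emeasure (lseg L) UNIV = ennreal L"
  by (simp add: lseg_def emeasure_density)

interpretation lseg: finite_measure "lseg L" for L
proof
  have "emeasure (lseg L) UNIV = emeasure lborel {0<..<L}"
    by (simp add: lseg_def emeasure_density)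
  also have "\<dots> \<noteq> \<infinity>" by (cases "0 \<le> L") auto
  finally show "emeasure (lseg L) (space (lseg L)) \<noteq> \<infinity>" by simp
qed

lemma finite_measure_lsq: "finite_measure (lsq L)"
proof
  have "space (lsq L) = UNIV \<times> UNIV" by simp
  then have "emeasure (lsq L) (space (lsq L)) = emeasure (lseg L) UNIV * emeasure (lseg L) UNIV"
    unfolding lsq_def by (simp only:) (rule lseg.emeasure_pair_measure_Times, auto)
  also have "\<dots> \<noteq> \<infinity>"
    using lseg.emeasure_finite[of L UNIV] by (simp add: ennreal_mult_eq_top_iff)
  finally show "emeasure (lsq L) (space (lsq L)) \<noteq> \<infinity>" .
qed

interpretation lsqf: finite_measure "lsq L" for L by (rule finite_measure_lsq)

lemma open_square: "open (square L)" unfolding square_def by (intro open_Times) auto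

lemma square_borel [measurable]: "square L \<in> sets (borel \<Otimes>\<^sub>M borel)"
  and square_lebesgue [simp, measurable]: "square L \<in> sets lebesgue" "square L \<in> sets borel"
  unfolding borel_prod using borel_open[OF open_square[of L]] by (simp_all)

lemma lsq_eq_density: "lsq L = density lborel (indicator (square L))"
proof -
  have "lsq L = density (lborel \<Otimes>\<^sub>M lborel) (\<lambda>(x, y). indicator {0<..<L} x * indicator {0<..<L} y)"
    unfolding lsq_def lseg_def
    by (rule pair_measure_density)
      (use lseg.sigma_finite_measure_axioms[of L] in \<open>auto simp: lseg_def intro: sigma_finite_lborel\<close>)
  also have "(\<lambda>(x, y). indicator {0<..<L} x * indicator {0<..<L} y) = (indicator (square L) :: _ \<Rightarrow> ennreal)"
    by (auto simp: square_def indicator_def split: if_splits)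
  finally show ?thesis by (simp add: lborel_prod)
qed

lemma AE_lseg: "(AE x in lseg L. P x) \<longleftrightarrow> (AE x in lborel. 0 < x \<and> x < L \<longrightarrow> P x)"
  unfolding lseg_def by (subst AE_density) (auto simp: indicator_def)

lemma AE_lseg_in: "AE x in lseg L. 0 < x \<and> x < L"
  by (simp add: AE_lseg)

lemma integral_lseg:
  fixes f :: "real \<Rightarrow> real"
  assumes [measurable]: "f \<in> borel_measurable borel"
  shows "(LINT x|lseg L. f x) = (LINT x|lborel. indicator {0<..<L} x * f x)"
proof -
  have "lseg L = density lborel (\<lambda>x. ennreal (indicator {0<..<L} x))"
    unfolding lseg_def by (simp add: ennreal_indicator)
  then show ?thesis by (simp add: integral_density)
qed

lemma measure_lseg: "L > 0 \<Longrightarrow> measure (lseg L) UNIV = L"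
  by (simp add: measure_def emeasure_lseg)

section \<open>Fubini's theorem and the exchange of coordinates\<close>

lemma distr_swap_lsq: "distr (lsq L) (lsq L) prod.swap = lsq L"
proof -
  interpret pair_sigma_finite "lseg L" "lseg L" ..
  have "prod.swap = (\<lambda>(x :: real, y :: real). (y, x))" by auto
  then show ?thesis unfolding lsq_def using distr_pair_swap by simp
qed

lemma measurable_swap [measurable]: "prod.swap \<in> measurable (lsq L) (lsq L)"
proof -
  have "(\<lambda>z. (snd z, fst z)) \<in> measurable (lseg L \<Otimes>\<^sub>M lseg L) (lseg L \<Otimes>\<^sub>M lseg L)" by measurable
  moreover have "prod.swap = (\<lambda>z :: real \<times> real. (snd z, fst z))" by auto
  ultimately show ?thesis unfolding lsq_def by simp
qed

lemma integral_swap_lsq: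
  fixes f :: "real \<times> real \<Rightarrow> real"
  assumes [measurable]: "f \<in> borel_measurable (borel \<Otimes>\<^sub>M borel)"
  shows "(LINT z|lsq L. f (prod.swap z)) = (LINT z|lsq L. f z)"
  by (subst (2) distr_swap_lsq[symmetric]) (subst integral_distr, auto)

lemma integrable_swap_lsq:
  fixes f :: "real \<times> real \<Rightarrow> real"
  assumes [measurable]: "f \<in> borel_measurable (borel \<Otimes>\<^sub>M borel)"
  shows "integrable (lsq L) (\<lambda>z. f (prod.swap z)) \<longleftrightarrow> integrable (lsq L) f"
  by (subst (2) distr_swap_lsq[symmetric]) (subst integrable_distr_eq, auto)

lemma AE_swap_lsq: "AE z in lsq L. P z \<Longrightarrow> AE z in lsq L. P (prod.swap z)"
  using AE_distrD[OF measurable_swap, of P L] unfolding distr_swap_lsq .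

lemma borel_measurable_swap [measurable]:
  "prod.swap \<in> measurable (borel \<Otimes>\<^sub>M borel) (borel \<Otimes>\<^sub>M borel :: (real \<times> real) measure)"
proof -
  have "(\<lambda>z. (snd z, fst z)) \<in> measurable (borel \<Otimes>\<^sub>M borel) (borel \<Otimes>\<^sub>M borel :: (real \<times> real) measure)" by measurable
  moreover have "prod.swap = (\<lambda>z :: real \<times> real. (snd z, fst z))" by auto
  ultimately show ?thesis by simp
qed

lemma L2_swap_lsq: "f \<in> L2 (lsq L) \<Longrightarrow> (\<lambda>z. f (prod.swap z)) \<in> L2 (lsq L)"
  using integrable_swap_lsq[of "\<lambda>z. (f z)\<^sup>2" L] by (auto simp: L2_def)

lemma integral_lsq_yx:
  fixes f :: "real \<times> real \<Rightarrow> real"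
  assumes "integrable (lsq L) f"
  shows "(LINT z|lsq L. f z) = (LINT y|lseg L. LINT x|lseg L. f (x, y))"
    and "AE y in lseg L. integrable (lseg L) (\<lambda>x. f (x, y))"
    and "integrable (lseg L) (\<lambda>y. LINT x|lseg L. f (x, y))"
proof -
  interpret pair_sigma_finite "lseg L" "lseg L" ..
  have f: "integrable (lseg L \<Otimes>\<^sub>M lseg L) (case_prod (\<lambda>x y. f (x, y)))"
    using assms unfolding lsq_def by simp
  show "(LINT z|lsq L. f z) = (LINT y|lseg L. LINT x|lseg L. f (x, y))"
    unfolding lsq_def using integral_snd[OF f] by simp
  show "AE y in lseg L. integrable (lseg L) (\<lambda>x. f (x, y))" using AE_integrable_snd[OF f] .
  show "integrable (lseg L) (\<lambda>y. LINT x|lseg L. f (x, y))" using integrable_snd[OF f] .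
qed

lemma integral_lsq_xy:
  fixes f :: "real \<times> real \<Rightarrow> real"
  assumes "integrable (lsq L) f"
  shows "(LINT z|lsq L. f z) = (LINT x|lseg L. LINT y|lseg L. f (x, y))"
proof -
  interpret pair_sigma_finite "lseg L" "lseg L" ..
  show ?thesis using integral_fst'[of f] assms unfolding lsq_def by simp
qed

lemma AE_lsq_xy: "AE z in lsq L. P z \<Longrightarrow> AE x in lseg L. AE y in lseg L. P (x, y)"
proof -
  interpret pair_sigma_finite "lseg L" "lseg L" ..
  show "AE z in lsq L. P z \<Longrightarrow> AE x in lseg L. AE y in lseg L. P (x, y)"
    unfolding lsq_def by (rule AE_pair)
qed

lemma AE_lsq_yx: "AE z in lsq L. P z \<Longrightarrow> AE y in lseg L. AE x in lseg L. P (x, y)"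
  using AE_lsq_xy[of "\<lambda>z. P (prod.swap z)" L] AE_swap_lsq[of P L] by simp

lemma AE_lsq_if_xy:
  assumes "Measurable.pred (borel \<Otimes>\<^sub>M borel) P" "AE x in lseg L. AE y in lseg L. P (x, y)"
  shows "AE z in lsq L. P z"
proof -
  interpret pair_sigma_finite "lseg L" "lseg L" ..
  have "{x \<in> space (lseg L \<Otimes>\<^sub>M lseg L). P x} \<in> sets (lsq L)"
    using assms(1) by (simp add: space_pair_measure pred_def)
  then show ?thesis using AE_pair_measure[OF _ assms(2)] unfolding lsq_def by simp
qed

lemma AE_lsq_if_yx:
  assumes [measurable]: "Measurable.pred (borel \<Otimes>\<^sub>M borel) P" and "AE y in lseg L. AE x in lseg L. P (x, y)"
  shows "AE z in lsq L. P z"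
proof -
  have "AE z in lsq L. P (prod.swap z)"
    by (rule AE_lsq_if_xy) (use assms(2) in auto)
  from AE_swap_lsq[OF this] show ?thesis by simp
qed

text \<open>As \<open>P\<close> need not be measurable, it is replaced by the complement of a Borel
  null set that contains all its exceptions before Fubini is applied.\<close>

lemma AE_lsq_fst:
  assumes "AE x in lseg L. P x"
  shows "AE z in lsq L. P (fst z)"
proof -
  obtain N where N: "{x \<in> space (lseg L). \<not> P x} \<subseteq> N" "emeasure (lseg L) N = 0" "N \<in> sets (lseg L)"
    using assms by (rule AE_E)
  have [measurable]: "N \<in> sets borel" using N(3) by simp
  have "AE x in lseg L. x \<notin> N" by (rule AE_I[of _ _ N]) (use N in auto)
  then have "AE x in lseg L. AE y in lseg L. fst (x, y :: real) \<notin> N" by eventually_elim simp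
  then have "AE z in lsq L. fst z \<notin> N" by (rule AE_lsq_if_xy[rotated]) measurable
  then show ?thesis by eventually_elim (use N(1) in auto)
qed

lemma AE_lsq_snd: "AE x in lseg L. P x \<Longrightarrow> AE z in lsq L. P (snd z)"
  using AE_swap_lsq[OF AE_lsq_fst[of P L]] by simp

lemma AE_lsq_in: "AE z in lsq L. z \<in> square L"
  unfolding lsq_eq_density by (subst AE_density) (auto simp: indicator_def)

section \<open>The completed measure on the square and Borel versions\<close>

lemma AE_lebesgue_on_square: "(AE z in lebesgue_on (square L). P z) \<longleftrightarrow> (AE z in lsq L. P z)"
proof -
  have "(AE z in lebesgue_on (square L). P z) \<longleftrightarrow> (AE z in lebesgue. z \<in> square L \<longrightarrow> P z)"
    by (rule AE_restrict_space_iff) auto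
  also have "\<dots> \<longleftrightarrow> (AE z in lborel. z \<in> square L \<longrightarrow> P z)" by (rule AE_completion_iff)
  also have "\<dots> \<longleftrightarrow> (AE z in lsq L. P z)"
    unfolding lsq_eq_density by (subst AE_density) (auto simp: indicator_def)
  finally show ?thesis .
qed

lemma borel_measurable_lebesgue_on_square [measurable (raw)]:
  "f \<in> borel_measurable (borel \<Otimes>\<^sub>M borel) \<Longrightarrow> f \<in> borel_measurable (lebesgue_on (square L))"
  by (intro measurable_restrict_space1 measurable_completion) (simp add: borel_prod)

lemma integrable_lebesgue_on_square:
  fixes f :: "real \<times> real \<Rightarrow> real"
  assumes [measurable]: "f \<in> borel_measurable (borel \<Otimes>\<^sub>M borel)"
  shows "integrable (lebesgue_on (square L)) f \<longleftrightarrow> integrable (lsq L) f"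
proof -
  have "lsq L = density lborel (\<lambda>x. ennreal (indicator (square L) x))"
    unfolding lsq_eq_density by (simp add: ennreal_indicator)
  then show ?thesis
    using assms unfolding borel_prod
    by (simp add: integrable_density integrable_restrict_space integrable_completion)
qed

lemma integral_lebesgue_on_square:
  fixes f :: "real \<times> real \<Rightarrow> real"
  assumes [measurable]: "f \<in> borel_measurable (borel \<Otimes>\<^sub>M borel)"
  shows "integral\<^sup>L (lebesgue_on (square L)) f = integral\<^sup>L (lsq L) f"
proof -
  have "lsq L = density lborel (\<lambda>x. ennreal (indicator (square L) x))"
    unfolding lsq_eq_density by (simp add: ennreal_indicator)
  then show ?thesis
    using assms unfolding borel_prod
    by (simp add: integral_density integral_restrict_space integral_completion)
qed

lemma finite_measure_lebesgue_on_square: "finite_measure (lebesgue_on (square L))"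
proof
  have "emeasure (lebesgue_on (square L)) (square L) = emeasure lborel (square L)"
    by (simp add: emeasure_restrict_space)
  also have "\<dots> = emeasure (lsq L) UNIV"
    unfolding lsq_eq_density by (simp add: emeasure_density)
  also have "\<dots> \<noteq> \<infinity>" using lsqf.emeasure_finite[of L UNIV] by simp
  finally show "emeasure (lebesgue_on (square L)) (space (lebesgue_on (square L))) \<noteq> \<infinity>"
    by simp
qed

text \<open>Extended by zero to the plane, a Lebesgue measurable function agrees with a Borel one
  off a null set. Passing to that version is what gives access to the sections and iterated
  integrals of \<open>lsq L\<close>.\<close>

lemma ex_borel_version:
  fixes u :: "real \<times> real \<Rightarrow> real"
  assumes "u \<in> borel_measurable (lebesgue_on (square L))"
  shows "\<exists>u'\<in>borel_measurable (borel \<Otimes>\<^sub>M borel). AE z in lsq L. u z = u' z"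
proof -
  have "(\<lambda>z. indicator (square L) z *\<^sub>R u z) \<in> borel_measurable lebesgue"
    using assms by (subst (asm) borel_measurable_restrict_space_iff) auto
  from completion_ex_borel_measurable_real[OF this]
  obtain u' where u': "u' \<in> borel_measurable lborel" "AE z in lborel. indicator (square L) z *\<^sub>R u z = u' z"
    by auto
  have "AE z in lsq L. u z = u' z"
    unfolding lsq_eq_density using u'(2) by (subst AE_density) (auto simp: indicator_def elim!: eventually_mono)
  then show ?thesis using u'(1) by (auto simp: borel_prod)
qed

lemma L2_lebesgue_on_square_iff:
  "f \<in> borel_measurable (borel \<Otimes>\<^sub>M borel) \<Longrightarrow> f \<in> L2 (lebesgue_on (square L)) \<longleftrightarrow> f \<in> L2 (lsq L)"
  by (simp add: L2_def integrable_lebesgue_on_square)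
    
lemma L2_lsq_imp: "f \<in> L2 (lsq L) \<Longrightarrow> f \<in> L2 (lebesgue_on (square L))"
proof -
  assume f: "f \<in> L2 (lsq L)"
  from L2_measurable[OF this] have "f \<in> borel_measurable (borel \<Otimes>\<^sub>M borel)" by simp
  from L2_lebesgue_on_square_iff[OF this] f show ?thesis by simp
qed

lemma L2_norm_lebesgue_on_square:
  "f \<in> borel_measurable (borel \<Otimes>\<^sub>M borel) \<Longrightarrow> L2_norm (lebesgue_on (square L)) f = L2_norm (lsq L) f"
  by (simp add: L2_norm_def integral_lebesgue_on_square)

lemma ex_L2_borel_version:
  assumes "u \<in> L2 (lebesgue_on (square L))"
  shows "\<exists>u'\<in>L2 (lsq L). AE z in lsq L. u z = u' z"
proof -
  obtain u' where u': "u' \<in> borel_measurable (borel \<Otimes>\<^sub>M borel)" "AE z in lsq L. u z = u' z"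
    using ex_borel_version[OF L2_measurable[OF assms]] by blast
  have "u' \<in> L2 (lebesgue_on (square L))"
    by (rule L2_AE_cong[OF assms]) (use u' in \<open>auto simp: AE_lebesgue_on_square\<close>)
  then show ?thesis using u' L2_lebesgue_on_square_iff by blast
qed

text \<open>Open boxes form an intersection-stable generator of the Borel sets, so by Dynkin's
  induction the integral of \<open>f\<close> vanishes over every Borel set; uniqueness of densities
  concludes.\<close>

lemma AE_eq_0_if_integral_rectangles_eq_0:
  fixes f :: "real \<times> real \<Rightarrow> real"
  assumes f: "integrable (lsq L) f"
    and rect: "\<And>a b c d. 0 \<le> a \<Longrightarrow> b \<le> L \<Longrightarrow> 0 \<le> c \<Longrightarrow> d \<le> L \<Longrightarrow>
       (LINT z|lsq L. indicator {a<..<b} (fst z) * indicator {c<..<d} (snd z) * f z) = 0"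
  shows "AE z in lsq L. f z = 0"
proof -
  have [measurable]: "f \<in> borel_measurable (borel \<Otimes>\<^sub>M borel)" using f by simp
  have [measurable]: "box a b \<in> sets (borel \<Otimes>\<^sub>M borel)" for a b :: "real \<times> real"
    unfolding borel_prod by simp
  have boxes: "(LINT z:box a b|lsq L. f z) = 0" for a b :: "real \<times> real"
  proof -
    \<comment> \<open>The measure sits on the square, so an arbitrary box may be clipped to one
      inside it, for which the hypothesis speaks.\<close>
    have "(LINT z:box a b|lsq L. f z) =
      (LINT z|lsq L. indicator {max 0 (fst a)<..<min L (fst b)} (fst z) *
          indicator {max 0 (snd a)<..<min L (snd b)} (snd z) * f z)"
      unfolding set_lebesgue_integral_def
    proof (rule integral_cong_AE)
      show "AE z in lsq L. indicator (box a b) z *\<^sub>R f z =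
         indicator {max 0 (fst a)<..<min L (fst b)} (fst z) *
          indicator {max 0 (snd a)<..<min L (snd b)} (snd z) * f z"
        using AE_lsq_in
        by eventually_elim (auto simp: square_def box_def indicator_def Basis_prod_def inner_prod_def)
    qed measurable
    then show ?thesis by (simp add: rect)
  qed
  \<comment> \<open>The whole plane is needed for complements; up to a null set it is the box
    \<open>(0, L) \<times> (0, L)\<close>.\<close>
  have "(LINT z|lsq L. f z) = (LINT z:box (0,0) (L,L)|lsq L. f z)"
    unfolding set_lebesgue_integral_def
  proof (rule integral_cong_AE)
    show "AE z in lsq L. f z = indicator (box (0,0) (L,L)) z *\<^sub>R f z"
      using AE_lsq_in
      by eventually_elim (auto simp: square_def box_def indicator_def Basis_prod_def inner_prod_def)
  qed measurable
  then have tot: "(LINT z|lsq L. f z) = 0" by (simp add: boxes)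
  have si: "set_integrable (lsq L) A f" if "A \<in> sets (borel \<Otimes>\<^sub>M borel)" for A
    unfolding set_integrable_def using that f by (intro integrable_mult_indicator) auto
  have all: "(LINT z:A|lsq L. f z) = 0" if "A \<in> sets (borel \<Otimes>\<^sub>M borel)" for A
  proof -
    have Asig: "A \<in> sigma_sets UNIV (range (\<lambda>(a, b). box a b :: (real \<times> real) set))"
      using that[unfolded borel_prod] unfolding borel_eq_box by simp
    have "Int_stable (range (\<lambda>(a, b). box a b :: (real \<times> real) set))"
      by (auto simp: Int_stable_def box_Int_box)
    moreover have "range (\<lambda>(a, b). box a b :: (real \<times> real) set) \<subseteq> Pow UNIV" by simp
    ultimately show ?thesis using Asig
    proof (induction rule: sigma_sets_induct_disjoint)
      case (basic A)
      then show ?case using boxes by auto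
    next
      case empty
      show ?case by (simp add: set_lebesgue_integral_def)
    next
      case (compl A)
      then have A: "A \<in> sets (borel \<Otimes>\<^sub>M borel)" unfolding borel_prod unfolding borel_eq_box by simp
      have "UNIV - A \<in> sets (borel \<Otimes>\<^sub>M borel)"
        using sets.compl_sets[OF A] by (simp add: space_pair_measure)
      with A have "(LINT z:A \<union> (UNIV - A)|lsq L. f z) = (LINT z:A|lsq L. f z) + (LINT z:UNIV - A|lsq L. f z)"
        by (intro set_integral_Un si) (simp_all only: Diff_disjoint)
      then show ?case using compl tot by (simp add: set_lebesgue_integral_def)
    next
      case (union A)
      have A: "A i \<in> sets (borel \<Otimes>\<^sub>M borel)" for i using union(2) unfolding borel_prod unfolding borel_eq_box by auto
      then have "(LINT z:(\<Union>i. A i)|lsq L. f z) = (\<Sum>i. LINT z:A i|lsq L. f z)"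
        using union(1) by (intro lebesgue_integral_countable_add si) (auto simp: disjoint_family_on_def)
      then show ?case using union(3) by simp
    qed
  qed
  show ?thesis
    using density_unique_real[of "lsq L" f "\<lambda>_. 0"] f all by (simp add: set_lebesgue_integral_def)
qed

section \<open>Smooth functions with compact support\<close>

fun diffn :: "nat \<Rightarrow> (real \<Rightarrow> real) \<Rightarrow> bool" where
  "diffn 0 f = True"
| "diffn (Suc n) f = (\<exists>f'. (\<forall>x. (f has_real_derivative f' x) (at x)) \<and> diffn n f')"

text \<open>Smoothness is split into its finite orders, because each order is closed under sums,
  products and affine substitutions by a plain induction on the order.\<close>

definition cinf :: "(real \<Rightarrow> real) \<Rightarrow> bool" where
  "cinf f \<longleftrightarrow> (\<forall>n. diffn n f)"

lemma diffn_SucI: "(\<And>x. (f has_real_derivative f' x) (at x)) \<Longrightarrow> diffn n f' \<Longrightarrow> diffn (Suc n) f"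
  by auto

text \<open>Needed for products: in \<open>f' g + g' f\<close> the undifferentiated factors still
  have one order more than the induction hypothesis asks for.\<close>

lemma diffn_Suc_imp: "diffn (Suc n) f \<Longrightarrow> diffn n f"
proof (induction n arbitrary: f)
  case (Suc n)
  then obtain f' where "\<forall>x. (f has_real_derivative f' x) (at x)" "diffn (Suc n) f'" by auto
  then show ?case using Suc.IH by auto
qed simp

lemma diffn_add: "diffn n f \<Longrightarrow> diffn n g \<Longrightarrow> diffn n (\<lambda>x. f x + g x)"
proof (induction n arbitrary: f g)
  case (Suc n)
  then obtain f' g' where "\<forall>x. (f has_real_derivative f' x) (at x)" "diffn n f'"
    "\<forall>x. (g has_real_derivative g' x) (at x)" "diffn n g'" by auto
  then show ?case using Suc.IH[of f' g']
    by (auto intro!: exI[of _ "\<lambda>x. f' x + g' x"] derivative_intros)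
qed simp

lemma diffn_cmult: "diffn n f \<Longrightarrow> diffn n (\<lambda>x. c * f x)"
proof (induction n arbitrary: f)
  case (Suc n)
  then obtain f' where "\<forall>x. (f has_real_derivative f' x) (at x)" "diffn n f'" by auto
  then show ?case using Suc.IH[of f']
    by (auto intro!: exI[of _ "\<lambda>x. c * f' x"] DERIV_cmult)
qed simp

lemma diffn_mult: "diffn n f \<Longrightarrow> diffn n g \<Longrightarrow> diffn n (\<lambda>x. f x * g x)"
proof (induction n arbitrary: f g)
  case (Suc n)
  then obtain f' g' where d: "\<forall>x. (f has_real_derivative f' x) (at x)" "diffn n f'"
    "\<forall>x. (g has_real_derivative g' x) (at x)" "diffn n g'" by auto
  have "diffn n (\<lambda>x. f' x * g x + g' x * f x)"
    using Suc.IH[of f' g] Suc.IH[of g' f] d diffn_Suc_imp Suc.prems by (intro diffn_add) auto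
  moreover have "((\<lambda>x. f x * g x) has_real_derivative f' x * g x + g' x * f x) (at x)" for x
    using d by (intro DERIV_mult) auto
  ultimately show ?case by (rule diffn_SucI[rotated])
qed simp

lemma diffn_affine: "diffn n f \<Longrightarrow> diffn n (\<lambda>x. f (a * x + b))"
proof (induction n arbitrary: f)
  case (Suc n)
  then obtain f' where d: "\<forall>x. (f has_real_derivative f' x) (at x)" "diffn n f'" by auto
  have "((\<lambda>x. f (a * x + b)) has_real_derivative a * f' (a * x + b)) (at x)" for x
  proof -
    have "((\<lambda>x. a * x + b) has_real_derivative a) (at x)" by (auto intro!: derivative_eq_intros)
    from DERIV_chain2[OF d(1)[rule_format] this] show ?thesis by (simp add: mult.commute)
  qed
  moreover have "diffn n (\<lambda>x. a * f' (a * x + b))" using Suc.IH[OF d(2)] by (rule diffn_cmult)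
  ultimately show ?case by (rule diffn_SucI)
qed simp

lemma cinf_lincomb: "cinf f \<Longrightarrow> cinf g \<Longrightarrow> cinf (\<lambda>x. f x + c * g x)"
  by (auto simp: cinf_def diffn_add diffn_cmult)

lemma cinf_mult: "cinf f \<Longrightarrow> cinf g \<Longrightarrow> cinf (\<lambda>x. f x * g x)"
  by (auto simp: cinf_def diffn_mult)

lemma cinf_affine: "cinf f \<Longrightarrow> cinf (\<lambda>x. f (a * x + b))"
  by (auto simp: cinf_def diffn_affine)

text \<open>Each order provides a derivative of its own; uniqueness of derivatives makes them all
  the same function, which is thus differentiable to every order.\<close>

lemma cinf_derivE:
  assumes "cinf f"
  obtains f' where "\<And>x. (f has_real_derivative f' x) (at x)" "cinf f'"
proof -
  have "diffn (Suc 0) f" using assms unfolding cinf_def by blast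
  then obtain f' where f': "\<And>x. (f has_real_derivative f' x) (at x)" by auto
  have "diffn n f'" for n
  proof -
    have "diffn (Suc n) f" using assms unfolding cinf_def by blast
    then obtain g where g: "\<And>x. (f has_real_derivative g x) (at x)" "diffn n g" by auto
    have "g = f'" using DERIV_unique[OF g(1) f'] by auto
    then show ?thesis using g(2) by simp
  qed
  then show ?thesis using that f' by (auto simp: cinf_def)
qed

lemma cinf_if_deriv:
  assumes "\<And>x. (f has_real_derivative f' x) (at x)" "cinf f'"
  shows "cinf f"
  unfolding cinf_def
proof
  show "diffn n f" for n using assms by (cases n) (auto simp: cinf_def)
qed

lemma cinf_continuous_on: "cinf f \<Longrightarrow> continuous_on S f"
  by (erule cinf_derivE) (meson DERIV_isCont continuous_at_imp_continuous_on)

lemma cinf_borel: "cinf f \<Longrightarrow> f \<in> borel_measurable borel"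
  by (intro borel_measurable_continuous_onI cinf_continuous_on)

text \<open>Carrying the powers of \<open>1/x\<close> along makes this family closed under differentiation.\<close>

definition flat :: "nat \<Rightarrow> real \<Rightarrow> real" where
  "flat n x = (if x > 0 then (1 / x) ^ n * exp (- (1 / x)) else 0)"

text \<open>With \<open>t = 1/x\<close> and \<open>N = n + 2\<close>, raising
  \<open>t/N \<le> exp (t/N)\<close> to the power \<open>N\<close> gives
  \<open>t^(n+2) exp (-t) \<le> N^N\<close>; two of the powers of \<open>t\<close> are then traded
  for \<open>x^2\<close>. The quadratic bound is what differentiability at 0 requires.\<close>

lemma flat_le: "\<bar>flat n x\<bar> \<le> real (n + 2) ^ (n + 2) * x\<^sup>2"
proof (cases "x > 0")
  case True
  define t where "t = 1 / x"
  have "t > 0" unfolding t_def using True by simp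
  define N where "N = real (n + 2)"
  have "N > 0" unfolding N_def by simp
  have "t / N \<le> exp (t / N)" using exp_ge_add_one_self[of "t / N"] by linarith
  then have "(t / N) ^ (n + 2) \<le> exp (t / N) ^ (n + 2)"
    using \<open>t > 0\<close> \<open>N > 0\<close> by (intro power_mono) auto
  also have "\<dots> = exp (N * (t / N))" unfolding N_def by (rule exp_of_nat_mult[symmetric])
  also have "N * (t / N) = t" using \<open>N > 0\<close> by simp
  finally have "t ^ (n + 2) / N ^ (n + 2) \<le> exp t" by (simp only: power_divide)
  then have "t ^ (n + 2) \<le> exp t * N ^ (n + 2)"
    using \<open>N > 0\<close> by (subst (asm) pos_divide_le_eq) auto
  then have "t ^ (n + 2) * exp (- t) \<le> exp t * N ^ (n + 2) * exp (- t)"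
    by (rule mult_right_mono) simp
  also have "\<dots> = N ^ (n + 2)" by (simp add: exp_minus)
  finally have "t ^ (n + 2) * exp (- t) \<le> real (n + 2) ^ (n + 2)" unfolding N_def .
  then have le: "t ^ (n + 2) * exp (- t) * x\<^sup>2 \<le> real (n + 2) ^ (n + 2) * x\<^sup>2"
    by (rule mult_right_mono) simp
  have "t ^ (n + 2) * exp (- t) * x\<^sup>2 = t ^ n * exp (- t) * (t * x)\<^sup>2"
    by (simp add: power_add power_mult_distrib power2_eq_square)
  also have "t * x = 1" using True unfolding t_def by simp
  finally have "t ^ (n + 2) * exp (- t) * x\<^sup>2 = t ^ n * exp (- t)" by (simp only: power_one mult_1_right)
  with le have "t ^ n * exp (- t) \<le> real (n + 2) ^ (n + 2) * x\<^sup>2" by (simp only:)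
  moreover have "flat n x = t ^ n * exp (- t)" unfolding flat_def t_def using True by simp
  moreover have "0 \<le> t ^ n * exp (- t)" using \<open>t > 0\<close> by simp
  ultimately show ?thesis by linarith
qed (simp add: flat_def)

text \<open>Away from 0 the function agrees locally with a classical formula. At 0 the bound
  \<open>flat_le\<close> makes the difference quotient at most a constant times
  \<open>\<bar>h\<bar>\<close>, so the derivative there is 0.\<close>

lemma flat_deriv: "(flat n has_real_derivative flat (n + 2) x - real n * flat (Suc n) x) (at x)"
proof -
  consider "x > 0" | "x < 0" | "x = 0" by linarith
  then show ?thesis
  proof cases
    case 1
    have "((\<lambda>x. (1 / x) ^ n) has_real_derivative real n * (1 / x) ^ (n - 1) * (- 1 / x\<^sup>2)) (at x)"
      using 1 by (auto intro!: derivative_eq_intros simp: power2_eq_square)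
    also have "real n * (1 / x) ^ (n - 1) * (- 1 / x\<^sup>2) = - real n * (1 / x) ^ Suc n"
      by (cases n) (simp_all add: power2_eq_square ring_distribs add_divide_distrib diff_divide_distrib)
    finally have d1: "((\<lambda>x. (1 / x) ^ n) has_real_derivative - real n * (1 / x) ^ Suc n) (at x)" .
    have d2: "((\<lambda>x. exp (- (1 / x))) has_real_derivative (1 / x)\<^sup>2 * exp (- (1 / x))) (at x)"
      using 1 by (auto intro!: derivative_eq_intros simp: power2_eq_square)
    have "((\<lambda>x. (1 / x) ^ n * exp (- (1 / x))) has_real_derivative
        flat (n + 2) x - real n * flat (Suc n) x) (at x)"
      using DERIV_mult[OF d1 d2] 1
      by (simp add: flat_def power_add power2_eq_square mult.assoc mult.commute mult.left_commute)
    then show ?thesis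
      by (rule has_field_derivative_transform_within_open[where S = "{0<..}"]) (use 1 in \<open>auto simp: flat_def\<close>)
  next
    case 2
    have "((\<lambda>_. 0 :: real) has_real_derivative flat (n + 2) x - real n * flat (Suc n) x) (at x)"
      using 2 by (simp add: flat_def)
    then show ?thesis
      by (rule has_field_derivative_transform_within_open[where S = "{..<0}"]) (use 2 in \<open>auto simp: flat_def\<close>)
  next
    case 3
    have "((\<lambda>h. flat n h / h) \<longlongrightarrow> 0) (at 0)"
    proof (rule Lim_null_comparison)
      show "\<forall>\<^sub>F h in at 0. norm (flat n h / h) \<le> real (n + 2) ^ (n + 2) * \<bar>h\<bar>"
      proof (rule eventually_mono[OF eventually_at_topological[THEN iffD2]])
        show "norm (flat n h / h) \<le> real (n + 2) ^ (n + 2) * \<bar>h\<bar>" if "h \<noteq> 0" for h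
        proof -
          have "norm (flat n h / h) = \<bar>flat n h\<bar> / \<bar>h\<bar>" by simp
          also have "\<dots> \<le> real (n + 2) ^ (n + 2) * \<bar>h\<bar>\<^sup>2 / \<bar>h\<bar>"
            unfolding power2_abs by (intro divide_right_mono flat_le) simp
          also have "\<dots> = real (n + 2) ^ (n + 2) * \<bar>h\<bar> * \<bar>h\<bar> / \<bar>h\<bar>" by (simp only: power2_eq_square mult.assoc)
          also have "\<dots> = real (n + 2) ^ (n + 2) * \<bar>h\<bar>"
            by (rule nonzero_mult_div_cancel_right) (use that in simp)
          finally show ?thesis .
        qed
      qed (auto intro: exI[of _ UNIV])
      show "((\<lambda>h. real (n + 2) ^ (n + 2) * \<bar>h\<bar>) \<longlongrightarrow> 0) (at 0)"
        by (auto intro!: tendsto_eq_intros)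
    qed
    then show ?thesis using 3 by (simp add: flat_def has_field_derivative_iff)
  qed
qed

lemma cinf_flat: "cinf (flat n)"
  unfolding cinf_def
proof
  fix m show "diffn m (flat n)"
  proof (induction m arbitrary: n)
    case (Suc m)
    have "diffn m (\<lambda>x. flat (n + 2) x + (- real n) * flat (Suc n) x)"
      by (intro diffn_add diffn_cmult Suc.IH)
    then show ?case using flat_deriv[of n] by (intro diffn_SucI[of "flat n"]) simp_all
  qed simp
qed

section \<open>Smooth bumps inside the interval\<close>

definition bump :: "real \<Rightarrow> (real \<Rightarrow> real) \<Rightarrow> bool" where
  "bump L \<alpha> \<longleftrightarrow> cinf \<alpha> \<and> (\<exists>a b. 0 < a \<and> b < L \<and> (\<forall>x. \<alpha> x \<noteq> 0 \<longrightarrow> a \<le> x \<and> x \<le> b))"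

text \<open>Positive exactly where \<open>a + 1/n < x < b - 1/n\<close>, and tending to the indicator of the interval.\<close>

definition plateau :: "real \<Rightarrow> real \<Rightarrow> nat \<Rightarrow> real \<Rightarrow> real" where
  "plateau a b n x = flat 0 (real n * x + (- real n * a - 1)) * flat 0 (- real n * x + (real n * b - 1))"

lemma cinf_plateau: "cinf (plateau a b n)"
  unfolding plateau_def by (intro cinf_mult cinf_affine cinf_flat)

lemma bump_plateau:
  assumes "0 \<le> a" "b \<le> L"
  shows "bump L (plateau a b (Suc n))"
  unfolding bump_def
proof (intro conjI exI allI impI cinf_plateau)
  let ?e = "1 / real (Suc n)"
  have "?e > 0" by simp
  then show "0 < a + ?e" "b - ?e < L" using assms by linarith+
  fix x assume "plateau a b (Suc n) x \<noteq> 0"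
  then have "real (Suc n) * x + (- real (Suc n) * a - 1) > 0" "- real (Suc n) * x + (real (Suc n) * b - 1) > 0"
    by (auto simp: plateau_def flat_def split: if_splits)
  then have "1 < real (Suc n) * (x - a)" "1 < real (Suc n) * (b - x)" by (simp_all add: algebra_simps)
  then have "?e < x - a" "?e < b - x"
    by (simp_all only: pos_divide_less_eq[OF of_nat_0_less_iff[THEN iffD2, OF zero_less_Suc]] mult.commute)
  then show "a + ?e \<le> x" "x \<le> b - ?e" by auto
qed

lemma plateau_bounds: "0 \<le> plateau a b n x" "plateau a b n x \<le> 1"
proof -
  have *: "0 \<le> flat 0 x" "flat 0 x \<le> 1" for x by (simp_all add: flat_def)
  show "0 \<le> plateau a b n x" unfolding plateau_def by (intro mult_nonneg_nonneg *)
  show "plateau a b n x \<le> 1" unfolding plateau_def by (intro mult_le_one *)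
qed

text \<open>Inside the interval both arguments of \<open>flat 0\<close> grow without bound, and
  \<open>flat 0\<close> tends to 1 at infinity. Outside, one argument is at most \<open>-1\<close>,
  so every member of the sequence vanishes.\<close>

lemma plateau_tendsto: "(\<lambda>n. plateau a b (Suc n) x) \<longlonglongrightarrow> indicator {a<..<b} x"
proof (cases "a < x \<and> x < b")
  case True
  have flat1: "(\<lambda>n. flat 0 (real (Suc n) * d - 1)) \<longlonglongrightarrow> 1" if "d > 0" for d
  proof -
    have *: "filterlim (\<lambda>n. real (Suc n) * d - 1) at_top sequentially"
    proof -
      have "filterlim (\<lambda>n. -1 + real (Suc n) * d) at_top sequentially"
        by (rule filterlim_tendsto_add_at_top[OF tendsto_const])
          (rule filterlim_at_top_mult_tendsto_pos[OF tendsto_const that], 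
           rule filterlim_compose[OF filterlim_real_sequentially filterlim_Suc])
      then show ?thesis by (simp add: algebra_simps)
    qed
    have "(\<lambda>n. exp (- (1 / (real (Suc n) * d - 1)))) \<longlonglongrightarrow> exp (- 0)"
      by (intro tendsto_exp tendsto_minus real_tendsto_divide_at_top[OF tendsto_const *])
    moreover have "\<forall>\<^sub>F n in sequentially. flat 0 (real (Suc n) * d - 1) = exp (- (1 / (real (Suc n) * d - 1)))"
      using filterlim_at_top_dense[THEN iffD1, OF *, rule_format, of 0]
      by eventually_elim (auto simp: flat_def)
    ultimately show ?thesis by (simp add: tendsto_cong)
  qed
  have "(\<lambda>n. flat 0 (real (Suc n) * (x - a) - 1) * flat 0 (real (Suc n) * (b - x) - 1)) \<longlonglongrightarrow> 1 * 1"
    using True by (intro tendsto_mult flat1) auto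
  then show ?thesis using True unfolding plateau_def by (simp add: algebra_simps)
next
  case False
  then have "x \<le> a \<or> b \<le> x" by auto
  then have "plateau a b (Suc n) x = 0" for n
  proof
    assume "x \<le> a"
    then have "real (Suc n) * x \<le> real (Suc n) * a" by (intro mult_left_mono) auto
    then have "flat 0 (real (Suc n) * x + (- real (Suc n) * a - 1)) = 0"
      unfolding flat_def by (intro if_not_P) linarith
    then show ?thesis unfolding plateau_def by simp
  next
    assume "b \<le> x"
    then have "real (Suc n) * b \<le> real (Suc n) * x" by (intro mult_left_mono) auto
    then have "flat 0 (- real (Suc n) * x + (real (Suc n) * b - 1)) = 0"
      unfolding flat_def by (intro if_not_P) linarith
    then show ?thesis unfolding plateau_def by simp
  qed
  then show ?thesis using False by simp
qed

lemma bump_borel: "bump L \<alpha> \<Longrightarrow> \<alpha> \<in> borel_measurable borel"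
  by (auto simp: bump_def intro: cinf_borel)

lemma bump_bounded:
  assumes "bump L \<alpha>"
  obtains B where "B \<ge> 0" "\<And>x. \<bar>\<alpha> x\<bar> \<le> B"
proof -
  from assms obtain a b where ab: "\<And>x. \<alpha> x \<noteq> 0 \<Longrightarrow> a \<le> x \<and> x \<le> b" and c: "cinf \<alpha>"
    unfolding bump_def by blast
  have "compact (\<alpha> ` {a..b})" using c by (intro compact_continuous_image cinf_continuous_on) auto
  then have "bounded (\<alpha> ` {a..b})" by (rule compact_imp_bounded)
  then obtain B where "\<forall>y\<in>\<alpha> ` {a..b}. norm y \<le> B" unfolding bounded_iff by blast
  then have B: "\<And>x. x \<in> {a..b} \<Longrightarrow> \<bar>\<alpha> x\<bar> \<le> B" by simp
  have "\<bar>\<alpha> x\<bar> \<le> max B 0" for x using ab[of x] B[of x] by (cases "\<alpha> x = 0") auto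
  then show ?thesis using that[of "max B 0"] by simp
qed

text \<open>The fundamental lemma of the calculus of variations, with products of one-dimensional
  bumps as the only test functions: products of plateaus converge boundedly to indicators of
  rectangles.\<close>

lemma AE_eq_0_if_tensor_bumps:
  fixes f :: "real \<times> real \<Rightarrow> real"
  assumes f: "integrable (lsq L) f"
    and t: "\<And>\<alpha> \<beta>. bump L \<alpha> \<Longrightarrow> bump L \<beta> \<Longrightarrow> (LINT z|lsq L. f z * (\<alpha> (fst z) * \<beta> (snd z))) = 0"
  shows "AE z in lsq L. f z = 0"
proof (rule AE_eq_0_if_integral_rectangles_eq_0[OF f])
  fix a b c d :: real assume "0 \<le> a" "b \<le> L" "0 \<le> c" "d \<le> L"
  let ?s = "\<lambda>n z. f z * (plateau a b (Suc n) (fst z) * plateau c d (Suc n) (snd z))"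
  have [measurable]: "f \<in> borel_measurable (borel \<Otimes>\<^sub>M borel)" using borel_measurable_integrable[OF f] by simp
  have [measurable]: "plateau a b n \<in> borel_measurable borel" for a b n
    by (intro cinf_borel cinf_plateau)
  have "(\<lambda>n. LINT z|lsq L. ?s n z) \<longlonglongrightarrow>
      (LINT z|lsq L. f z * (indicator {a<..<b} (fst z) * indicator {c<..<d} (snd z)))"
  proof (rule integral_dominated_convergence[where w = "\<lambda>z. \<bar>f z\<bar>"])
    show "integrable (lsq L) (\<lambda>z. \<bar>f z\<bar>)" using f by simp
    show "AE z in lsq L. (\<lambda>n. ?s n z) \<longlonglongrightarrow> f z * (indicator {a<..<b} (fst z) * indicator {c<..<d} (snd z))"
      by (intro AE_I2 tendsto_mult tendsto_const plateau_tendsto)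
    show "AE z in lsq L. norm (?s n z) \<le> \<bar>f z\<bar>" for n
    proof (rule AE_I2)
      fix z
      have "\<bar>plateau a b (Suc n) (fst z) * plateau c d (Suc n) (snd z)\<bar> \<le> 1"
        using plateau_bounds by (auto simp: abs_mult intro!: mult_le_one)
      then show "norm (?s n z) \<le> \<bar>f z\<bar>" by (simp add: abs_mult mult_left_le)
    qed
  qed measurable
  moreover have "(LINT z|lsq L. ?s n z) = 0" for n
    by (intro t bump_plateau) fact+
  ultimately have "(LINT z|lsq L. f z * (indicator {a<..<b} (fst z) * indicator {c<..<d} (snd z))) = 0"
    by (simp add: LIMSEQ_const_iff)
  then show "(LINT z|lsq L. indicator {a<..<b} (fst z) * indicator {c<..<d} (snd z) * f z) = 0"
    by (simp add: mult.commute)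
qed

text \<open>The cut at \<open>s\<close> anticipates integration by parts: once the order of
  integration is exchanged, the inner integral runs over the points to the right of
  \<open>s\<close>.\<close>

lemma lseg_FTC:
  fixes F f :: "real \<Rightarrow> real"
  assumes d: "\<And>x. (F has_real_derivative f x) (at x)" and c: "\<And>x. isCont f x"
    and s: "0 \<le> s" "s \<le> L"
  shows "(LINT x|lseg L. indicator {s<..} x * f x) = F L - F s"
proof -
  have [measurable]: "f \<in> borel_measurable borel"
    by (intro borel_measurable_continuous_onI continuous_at_imp_continuous_on) (use c in auto)
  have "(LINT x|lseg L. indicator {s<..} x * f x) = (LINT x|lborel. indicator {0<..<L} x * (indicator {s<..} x * f x))"
    by (rule integral_lseg) measurable
  also have "\<dots> = (LINT x|lborel. f x * indicator {s..L} x)"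
  proof (rule integral_cong_AE)
    have "AE x in lborel. x \<noteq> s" "AE x in lborel. x \<noteq> L" by (rule AE_lborel_singleton)+
    then show "AE x in lborel. indicator {0<..<L} x * (indicator {s<..} x * f x) = f x * indicator {s..L} x"
      by eventually_elim (use s in \<open>auto simp: indicator_def\<close>)
  qed measurable
  also have "\<dots> = F L - F s"
    by (rule integral_FTC_Icc_real) (use assms in auto)
  finally show ?thesis .
qed

lemma lseg_FTC0:
  fixes F f :: "real \<Rightarrow> real"
  assumes d: "\<And>x. (F has_real_derivative f x) (at x)" and c: "\<And>x. isCont f x" and "0 \<le> L"
  shows "(LINT x|lseg L. f x) = F L - F 0"
proof -
  have [measurable]: "f \<in> borel_measurable borel"
    by (intro borel_measurable_continuous_onI continuous_at_imp_continuous_on) (use c in auto)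
  have "(LINT x|lseg L. f x) = (LINT x|lseg L. indicator {0<..} x * f x)"
  proof (rule integral_cong_AE)
    show "AE x in lseg L. f x = indicator {0<..} x * f x"
      using AE_lseg_in[of L] by eventually_elim simp
  qed measurable
  then show ?thesis using lseg_FTC[OF d c, of 0 L] assms by simp
qed

text \<open>Any primitive is constant to the left and to the right of the support of
  \<open>\<alpha>\<close>. Normalised to vanish at 0, it vanishes on the left; the zero mean says
  exactly that it vanishes at \<open>L\<close> too, hence on the right.\<close>

lemma bump_primitive:
  assumes \<alpha>: "bump L \<alpha>" and L: "L > 0" and z: "(LINT x|lseg L. \<alpha> x) = 0"
  obtains A where "bump L A" "\<And>x. (A has_real_derivative \<alpha> x) (at x)"
proof -
  from \<alpha> obtain a b where ab: "0 < a" "b < L" "\<And>x. \<alpha> x \<noteq> 0 \<Longrightarrow> a \<le> x \<and> x \<le> b" and c: "cinf \<alpha>"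
    unfolding bump_def by blast
  have cont: "isCont \<alpha> x" for x
    using cinf_continuous_on[OF c, of UNIV] by (simp add: continuous_on_eq_continuous_at)
  obtain G where G: "\<And>x. (G has_real_derivative \<alpha> x) (at x)"
    using einterval_antiderivative[of "-\<infinity>" \<infinity> \<alpha>] cont
    by (auto simp: has_real_derivative_iff_has_vector_derivative)
  define A where "A x = G x - G 0" for x
  have A: "(A has_real_derivative \<alpha> x) (at x)" for x
    unfolding A_def using G[of x] by (auto intro!: derivative_eq_intros)
  have "A L = 0" using lseg_FTC0[OF G cont, of L] z L unfolding A_def by simp
  have "A 0 = 0" unfolding A_def by simp
  have lo: "A x = 0" if "x < a" for x
  proof -
    have "\<exists>c. \<forall>x\<in>{..<a}. A x = c"
    proof (rule has_field_derivative_zero_constant)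
      show "(A has_real_derivative 0) (at x within {..<a})" if "x \<in> {..<a}" for x
      proof -
        have "\<alpha> x = 0" using ab(3)[of x] that by force
        then show ?thesis using A[of x] by (simp add: has_field_derivative_at_within)
      qed
    qed simp
    then show ?thesis using \<open>A 0 = 0\<close> that ab by force
  qed
  have hi: "A x = 0" if "x > b" for x
  proof -
    have "\<exists>c. \<forall>x\<in>{b<..}. A x = c"
    proof (rule has_field_derivative_zero_constant)
      show "(A has_real_derivative 0) (at x within {b<..})" if "x \<in> {b<..}" for x
      proof -
        have "\<alpha> x = 0" using ab(3)[of x] that by force
        then show ?thesis using A[of x] by (simp add: has_field_derivative_at_within)
      qed
    qed simp
    then show ?thesis using \<open>A L = 0\<close> that ab by force
  qed
  have "bump L A"
    unfolding bump_def
  proof (intro conjI exI allI impI)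
    show "cinf A" by (rule cinf_if_deriv[OF A c])
    show "0 < a" "b < L" using ab by auto
    show "a \<le> x" "x \<le> b" if "A x \<noteq> 0" for x using that lo hi by (force simp: not_less[symmetric])+
  qed
  then show ?thesis using A that by blast
qed

lemma bump_lincomb:
  assumes "bump L \<alpha>" "bump L \<beta>"
  shows "bump L (\<lambda>x. \<alpha> x + c * \<beta> x)"
proof -
  from assms obtain a b a' b' where *: "0 < a" "b < L" "\<And>x. \<alpha> x \<noteq> 0 \<Longrightarrow> a \<le> x \<and> x \<le> b"
    "0 < a'" "b' < L" "\<And>x. \<beta> x \<noteq> 0 \<Longrightarrow> a' \<le> x \<and> x \<le> b'" and "cinf \<alpha>" "cinf \<beta>"
    unfolding bump_def by blast
  have "min a a' \<le> x \<and> x \<le> max b b'" if "\<alpha> x + c * \<beta> x \<noteq> 0" for x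
    using *(3)[of x] *(6)[of x] that by (cases "\<alpha> x = 0"; cases "\<beta> x = 0") auto
  then show ?thesis unfolding bump_def using * \<open>cinf \<alpha>\<close> \<open>cinf \<beta>\<close>
    by (intro conjI cinf_lincomb exI[of _ "min a a'"] exI[of _ "max b b'"]) auto
qed

lemma ex_unit_bump:
  assumes L: "L > 0"
  obtains \<eta> where "bump L \<eta>" "(LINT x|lseg L. \<eta> x) = 1"
proof -
  have [measurable]: "plateau a b n \<in> borel_measurable borel" for a b n
    by (intro cinf_borel cinf_plateau)
  have "(\<lambda>n. LINT x|lseg L. plateau 0 L (Suc n) x) \<longlonglongrightarrow> (LINT x|lseg L. indicator {0<..<L} x)"
    by (rule integral_dominated_convergence[where w = "\<lambda>_. 1"])
      (auto intro!: AE_I2 plateau_tendsto plateau_bounds simp: plateau_bounds)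
  moreover have "(LINT x|lseg L. indicator {0<..<L} x) = (LINT x|lseg L. 1 :: real)"
  proof (rule integral_cong_AE)
    show "AE x in lseg L. indicator {0<..<L} x = (1 :: real)"
      using AE_lseg_in[of L] by eventually_elim simp
  qed measurable
  ultimately have "(\<lambda>n. LINT x|lseg L. plateau 0 L (Suc n) x) \<longlonglongrightarrow> L"
    using L by (simp add: measure_lseg)
  then have "\<forall>\<^sub>F n in sequentially. (LINT x|lseg L. plateau 0 L (Suc n) x) > 0"
    using L by (rule order_tendstoD)
  then obtain n where n: "(LINT x|lseg L. plateau 0 L (Suc n) x) > 0"
    by (auto simp: eventually_sequentially)
  let ?c = "1 / (LINT x|lseg L. plateau 0 L (Suc n) x)"
  \<comment> \<open>The multiple by \<open>?c\<close> is written as one plateau plus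
    \<open>?c - 1\<close> times the same plateau, so that \<open>bump_lincomb\<close> covers
    it.\<close>
  have "bump L (\<lambda>x. ?c * plateau 0 L (Suc n) x)"
    using bump_lincomb[OF bump_plateau bump_plateau, of 0 L L 0 L n "?c - 1" n]
    by (simp add: algebra_simps)
  moreover have "(LINT x|lseg L. ?c * plateau 0 L (Suc n) x) = 1" using n by simp
  ultimately show ?thesis using that by blast
qed

lemma bump_deriv:
  assumes "bump L \<alpha>"
  obtains \<alpha>' where "bump L \<alpha>'" "\<And>x. (\<alpha> has_real_derivative \<alpha>' x) (at x)"
proof -
  from assms obtain a b where ab: "0 < a" "b < L" "\<And>x. \<alpha> x \<noteq> 0 \<Longrightarrow> a \<le> x \<and> x \<le> b" and c: "cinf \<alpha>"
    unfolding bump_def by blast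
  obtain f' where f': "\<And>x. (\<alpha> has_real_derivative f' x) (at x)" "cinf f'" using cinf_derivE[OF c] by blast
  have "a \<le> x \<and> x \<le> b" if "f' x \<noteq> 0" for x
  proof (rule ccontr)
    assume "\<not> ?thesis"
    then have x: "x \<in> - {a..b}" by auto
    have "((\<lambda>_. 0) has_real_derivative f' x) (at x)"
      using f'(1)[of x] by (rule has_field_derivative_transform_within_open[where S = "- {a..b}"])
        (use x ab(3) in auto)
    then show False using that DERIV_unique[OF _ DERIV_const] by blast
  qed
  then have "bump L f'" unfolding bump_def using ab f'(2) by blast
  then show ?thesis using f' that by blast
qed

section \<open>Tensor products of bumps as test functions\<close>

lemma tensor_pderiv:
  assumes \<alpha>: "\<And>x. (\<alpha> has_real_derivative \<alpha>' x) (at x)" and \<beta>: "\<And>x. (\<beta> has_real_derivative \<beta>' x) (at x)"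
  shows "pderiv_dir (1, 0) (\<lambda>z. \<alpha> (fst z) * \<beta> (snd z)) = (\<lambda>z. \<alpha>' (fst z) * \<beta> (snd z))"
    and "pderiv_dir (0, 1) (\<lambda>z. \<alpha> (fst z) * \<beta> (snd z)) = (\<lambda>z. \<alpha> (fst z) * \<beta>' (snd z))"
    and "(\<lambda>z. \<alpha> (fst z) * \<beta> (snd z)) differentiable (at z)"
proof -
  have d: "((\<lambda>z. \<alpha> (fst z) * \<beta> (snd z)) has_derivative
      (\<lambda>h. \<alpha> (fst z) * (\<beta>' (snd z) * snd h) + (\<alpha>' (fst z) * fst h) * \<beta> (snd z))) (at z)" for z :: "real \<times> real"
  proof (rule has_derivative_mult)
    show "((\<lambda>z. \<alpha> (fst z)) has_derivative (\<lambda>h. \<alpha>' (fst z) * fst h)) (at z)"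
      using has_derivative_compose[OF bounded_linear_imp_has_derivative[OF bounded_linear_fst]
          \<alpha>[of "fst z", unfolded has_field_derivative_def]] by simp
    show "((\<lambda>z. \<beta> (snd z)) has_derivative (\<lambda>h. \<beta>' (snd z) * snd h)) (at z)"
      using has_derivative_compose[OF bounded_linear_imp_has_derivative[OF bounded_linear_snd]
          \<beta>[of "snd z", unfolded has_field_derivative_def]] by simp
  qed
  show "pderiv_dir (1, 0) (\<lambda>z. \<alpha> (fst z) * \<beta> (snd z)) = (\<lambda>z. \<alpha>' (fst z) * \<beta> (snd z))"
    unfolding pderiv_dir_def frechet_derivative_at[OF d, symmetric] by simp
  show "pderiv_dir (0, 1) (\<lambda>z. \<alpha> (fst z) * \<beta> (snd z)) = (\<lambda>z. \<alpha> (fst z) * \<beta>' (snd z))"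
    unfolding pderiv_dir_def frechet_derivative_at[OF d, symmetric] by simp
  show "(\<lambda>z. \<alpha> (fst z) * \<beta> (snd z)) differentiable (at z)" using d differentiableI by blast
qed

lemma Basis_plane: "(Basis :: (real \<times> real) set) = {(1, 0), (0, 1)}"
  by (auto simp: Basis_prod_def)

text \<open>A partial derivative of a tensor product is again a tensor product of smooth factors.
  Strengthened to this form, the claim passes through any list of directions by induction.\<close>

lemma smooth_tensor:
  assumes "cinf \<alpha>" "cinf \<beta>"
  shows "smooth (\<lambda>z. \<alpha> (fst z) * \<beta> (snd z))"
  unfolding smooth_def
proof (intro allI impI)
  fix es :: "(real \<times> real) list" and z :: "real \<times> real"
  assume "set es \<subseteq> Basis"
  then have "\<exists>\<alpha>' \<beta>'. cinf \<alpha>' \<and> cinf \<beta>' \<and>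
    foldr pderiv_dir es (\<lambda>z. \<alpha> (fst z) * \<beta> (snd z)) = (\<lambda>z. \<alpha>' (fst z) * \<beta>' (snd z))"
  proof (induction es)
    case Nil
    then show ?case using assms by auto
  next
    case (Cons e es)
    then obtain \<alpha>' \<beta>' where ab: "cinf \<alpha>'" "cinf \<beta>'"
      "foldr pderiv_dir es (\<lambda>z. \<alpha> (fst z) * \<beta> (snd z)) = (\<lambda>z. \<alpha>' (fst z) * \<beta>' (snd z))" by auto
    obtain a where a: "\<And>x. (\<alpha>' has_real_derivative a x) (at x)" "cinf a" using cinf_derivE[OF ab(1)] by blast
    obtain b where b: "\<And>x. (\<beta>' has_real_derivative b x) (at x)" "cinf b" using cinf_derivE[OF ab(2)] by blast
    have "e = (1, 0) \<or> e = (0, 1)" using Cons.prems Basis_plane by auto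
    then show ?case using tensor_pderiv[OF a(1) b(1)] a b ab by auto
  qed
  then obtain \<alpha>' \<beta>' where ab: "cinf \<alpha>'" "cinf \<beta>'"
    "foldr pderiv_dir es (\<lambda>z. \<alpha> (fst z) * \<beta> (snd z)) = (\<lambda>z. \<alpha>' (fst z) * \<beta>' (snd z))" by auto
  obtain a where a: "\<And>x. (\<alpha>' has_real_derivative a x) (at x)" using cinf_derivE[OF ab(1)] by blast
  obtain b where b: "\<And>x. (\<beta>' has_real_derivative b x) (at x)" using cinf_derivE[OF ab(2)] by blast
  show "foldr pderiv_dir es (\<lambda>z. \<alpha> (fst z) * \<beta> (snd z)) differentiable at z"
    unfolding ab(3) by (rule tensor_pderiv(3)[OF a b])
qed

lemma compact_closure_subset: "compact K \<Longrightarrow> closure X \<subseteq> K \<Longrightarrow> compact (closure X)"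
  using compact_Int_closed[of K "closure X"] by (simp add: inf.absorb2)

lemma test_functions_tensor:
  assumes "bump L \<alpha>" "bump L \<beta>"
  shows "(\<lambda>z. \<alpha> (fst z) * \<beta> (snd z)) \<in> test_functions (square L)"
proof -
  from assms obtain a b a' b' where *: "0 < a" "b < L" "\<And>x. \<alpha> x \<noteq> 0 \<Longrightarrow> a \<le> x \<and> x \<le> b"
    "0 < a'" "b' < L" "\<And>x. \<beta> x \<noteq> 0 \<Longrightarrow> a' \<le> x \<and> x \<le> b'" and "cinf \<alpha>" "cinf \<beta>"
    unfolding bump_def by blast
  have "{z. \<alpha> (fst z) * \<beta> (snd z) \<noteq> 0} \<subseteq> {a..b} \<times> {a'..b'}" using *(3,6) by fastforce
  then have cl: "closure {z. \<alpha> (fst z) * \<beta> (snd z) \<noteq> 0} \<subseteq> {a..b} \<times> {a'..b'}"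
    by (rule closure_minimal) (intro closed_Times closed_atLeastAtMost)
  have "compact ({a..b} \<times> {a'..b'})" by (intro compact_Times compact_Icc)
  then have "compact (closure {z. \<alpha> (fst z) * \<beta> (snd z) \<noteq> 0})"
    using cl by (rule compact_closure_subset)
  moreover have "{a..b} \<times> {a'..b'} \<subseteq> square L" using * unfolding square_def by auto
  ultimately show ?thesis
    unfolding test_functions_def using cl smooth_tensor[OF \<open>cinf \<alpha>\<close> \<open>cinf \<beta>\<close>] by auto
qed

section \<open>Derivatives, bounds and lines of test functions\<close>

lemma test_functions_differentiable:
  assumes "\<phi> \<in> test_functions S"
  shows "\<phi> differentiable (at z)"
proof -
  have "smooth \<phi>" using assms by (simp add: test_functions_def)
  from this[unfolded smooth_def, rule_format, of "[]" z] show ?thesis by simp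
qed

text \<open>Iterated derivatives of \<open>pderiv_dir e \<phi>\<close> are those of
  \<open>\<phi>\<close> along the list with \<open>e\<close> appended at its inner end. The support
  cannot grow, since \<open>\<phi>\<close> vanishes identically near any point outside its closed
  support.\<close>

lemma test_functions_pderiv:
  fixes \<phi> :: "'a::euclidean_space \<Rightarrow> real"
  assumes "\<phi> \<in> test_functions S" "e \<in> Basis"
  shows "pderiv_dir e \<phi> \<in> test_functions S"
proof -
  have "smooth (pderiv_dir e \<phi>)"
    unfolding smooth_def
  proof (intro allI impI)
    fix es :: "'a list" and x :: 'a assume "set es \<subseteq> Basis"
    then have "set (es @ [e]) \<subseteq> Basis" using assms(2) by simp
    moreover have "smooth \<phi>" using assms(1) by (simp add: test_functions_def)
    ultimately have "foldr pderiv_dir (es @ [e]) \<phi> differentiable at x" unfolding smooth_def by blast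
    then show "foldr pderiv_dir es (pderiv_dir e \<phi>) differentiable at x" by simp
  qed
  moreover have "{x. pderiv_dir e \<phi> x \<noteq> 0} \<subseteq> closure {x. \<phi> x \<noteq> 0}"
  proof (rule ccontr)
    assume "\<not> ?thesis"
    then obtain x where x: "pderiv_dir e \<phi> x \<noteq> 0" "x \<in> - closure {x. \<phi> x \<noteq> 0}" by auto
    have z: "0 = \<phi> y" if "y \<in> - closure {x. \<phi> x \<noteq> 0}" for y
      using that closure_subset[of "{x. \<phi> x \<noteq> 0}"] by auto
    have "((\<lambda>_. 0) has_derivative (\<lambda>_. 0)) (at x)" by simp
    then have "(\<phi> has_derivative (\<lambda>_. 0)) (at x)"
      by (rule has_derivative_transform_within_open[OF _ open_Compl[OF closed_closure] x(2) z])
    from frechet_derivative_at[OF this] x(1) show False by (simp add: pderiv_dir_def fun_eq_iff)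
  qed
  then have cl: "closure {x. pderiv_dir e \<phi> x \<noteq> 0} \<subseteq> closure {x. \<phi> x \<noteq> 0}"
    by (intro closure_minimal) auto
  ultimately show ?thesis using assms(1) compact_closure_subset[OF _ cl] unfolding test_functions_def
    by auto
qed

lemma test_functions_continuous_on: "\<phi> \<in> test_functions S \<Longrightarrow> continuous_on A \<phi>"
  by (meson continuous_at_imp_continuous_on differentiable_imp_continuous_within test_functions_differentiable)

lemma test_functions_zero: "\<phi> \<in> test_functions S \<Longrightarrow> z \<notin> S \<Longrightarrow> \<phi> z = 0"
  using closure_subset[of "{z. \<phi> z \<noteq> 0}"] by (auto simp: test_functions_def)

lemma test_functions_bounded:
  assumes "\<phi> \<in> test_functions S"
  obtains B where "B \<ge> 0" "\<And>z. \<bar>\<phi> z\<bar> \<le> B"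
proof -
  let ?K = "closure {z. \<phi> z \<noteq> 0}"
  have "compact (\<phi> ` ?K)"
    using assms test_functions_continuous_on[OF assms]
    by (intro compact_continuous_image) (auto simp: test_functions_def)
  then have "bounded (\<phi> ` ?K)" by (rule compact_imp_bounded)
  then obtain B where "\<forall>y\<in>\<phi> ` ?K. norm y \<le> B" unfolding bounded_iff by blast
  then have B: "\<And>z. z \<in> ?K \<Longrightarrow> \<bar>\<phi> z\<bar> \<le> B" by simp
  have "\<bar>\<phi> z\<bar> \<le> max B 0" for z
    using B[of z] closure_subset[of "{z. \<phi> z \<noteq> 0}"] by (cases "\<phi> z = 0") auto
  then show ?thesis using that[of "max B 0"] by simp
qed

lemma test_functions_borel:
  assumes "\<phi> \<in> test_functions S"
  shows "\<phi> \<in> borel_measurable (borel \<Otimes>\<^sub>M borel)"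
  unfolding borel_prod
  by (intro borel_measurable_continuous_onI test_functions_continuous_on[OF assms])

lemma test_functions_deriv_line:
  assumes "\<phi> \<in> test_functions S"
  shows "((\<lambda>x. \<phi> (x, y)) has_real_derivative pderiv_dir (1, 0) \<phi> (x, y)) (at x)"
    and "((\<lambda>y. \<phi> (x, y)) has_real_derivative pderiv_dir (0, 1) \<phi> (x, y)) (at y)"
proof -
  have d: "(\<phi> has_derivative frechet_derivative \<phi> (at (x, y))) (at (x, y))"
    using test_functions_differentiable[OF assms] by (rule frechet_derivative_works[THEN iffD1])
  then have lin: "linear (frechet_derivative \<phi> (at (x, y)))" using has_derivative_linear by blast
  have "((\<lambda>x. \<phi> (x, y)) has_derivative (\<lambda>h. frechet_derivative \<phi> (at (x, y)) (h, 0))) (at x)"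
    by (rule has_derivative_compose[of "\<lambda>x. (x, y)" "\<lambda>h. (h, 0)" x UNIV \<phi>, OF _ d]) (auto intro!: derivative_eq_intros)
  moreover have "(\<lambda>h. frechet_derivative \<phi> (at (x, y)) (h, 0)) = (*) (pderiv_dir (1, 0) \<phi> (x, y))"
  proof
    fix h :: real
    show "frechet_derivative \<phi> (at (x, y)) (h, 0) = pderiv_dir (1, 0) \<phi> (x, y) * h"
      using linear_scale[OF lin, of h "(1, 0)"] by (simp add: pderiv_dir_def)
  qed
  ultimately show "((\<lambda>x. \<phi> (x, y)) has_real_derivative pderiv_dir (1, 0) \<phi> (x, y)) (at x)"
    by (simp add: has_field_derivative_def)
  have "((\<lambda>y. \<phi> (x, y)) has_derivative (\<lambda>h. frechet_derivative \<phi> (at (x, y)) (0, h))) (at y)"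
    by (rule has_derivative_compose[of "\<lambda>y. (x, y)" "\<lambda>h. (0, h)" y UNIV \<phi>, OF _ d]) (auto intro!: derivative_eq_intros)
  moreover have "(\<lambda>h. frechet_derivative \<phi> (at (x, y)) (0, h)) = (*) (pderiv_dir (0, 1) \<phi> (x, y))"
  proof
    fix h :: real
    show "frechet_derivative \<phi> (at (x, y)) (0, h) = pderiv_dir (0, 1) \<phi> (x, y) * h"
      using linear_scale[OF lin, of h "(0, 1)"] by (simp add: pderiv_dir_def)
  qed
  ultimately show "((\<lambda>y. \<phi> (x, y)) has_real_derivative pderiv_dir (0, 1) \<phi> (x, y)) (at y)"
    by (simp add: has_field_derivative_def)
qed

section \<open>Functions of one coordinate, and sections of functions on the square\<close>

lemma lseg_product_fst:
  fixes c :: "real \<Rightarrow> real"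
  assumes c: "integrable (lseg L) c" and L: "L > 0"
  shows "integrable (lsq L) (\<lambda>z. c (fst z))" "(LINT z|lsq L. c (fst z)) = L * (LINT x|lseg L. c x)"
proof -
  interpret pair_sigma_finite "lseg L" "lseg L" ..
  have [measurable]: "c \<in> borel_measurable borel" using borel_measurable_integrable[OF c] by simp
  show i: "integrable (lsq L) (\<lambda>z. c (fst z))"
    unfolding lsq_def
  proof (rule Fubini_integrable)
    show "integrable (lseg L) (\<lambda>x. LINT y|lseg L. norm (c (fst (x, y))))"
      using integrable_mult_left[OF integrable_abs[OF c], of "measure (lseg L) UNIV"]
      by (simp add: mult.commute)
    show "AE x in lseg L. integrable (lseg L) (\<lambda>y. c (fst (x, y)))" by simp
  qed measurable
  show "(LINT z|lsq L. c (fst z)) = L * (LINT x|lseg L. c x)"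
    using integral_lsq_xy[OF i] L by (simp add: measure_lseg)
qed

lemma lseg_product_snd:
  fixes c :: "real \<Rightarrow> real"
  assumes c: "integrable (lseg L) c" and L: "L > 0"
  shows "integrable (lsq L) (\<lambda>z. c (snd z))" "(LINT z|lsq L. c (snd z)) = L * (LINT x|lseg L. c x)"
proof -
  have [measurable]: "c \<in> borel_measurable borel" using borel_measurable_integrable[OF c] by simp
  show "integrable (lsq L) (\<lambda>z. c (snd z))"
    using integrable_swap_lsq[of "\<lambda>z. c (fst z)" L] lseg_product_fst(1)[OF assms] by simp
  show "(LINT z|lsq L. c (snd z)) = L * (LINT x|lseg L. c x)"
    using integral_swap_lsq[of "\<lambda>z. c (fst z)" L] lseg_product_fst(2)[OF assms] by simp
qed

lemma L2_lsq_snd: "c \<in> L2 (lseg L) \<Longrightarrow> L > 0 \<Longrightarrow> (\<lambda>z. c (snd z)) \<in> L2 (lsq L)"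
  by (auto simp: L2_def lseg_product_snd(1)[of L "\<lambda>x. (c x)\<^sup>2"])

lemma L2_norm_lsq_snd:
  assumes "c \<in> L2 (lseg L)" "L > 0"
  shows "L2_norm (lsq L) (\<lambda>z. c (snd z)) = sqrt L * L2_norm (lseg L) c"
  using lseg_product_snd(2)[OF L2_square_integrable[OF assms(1)] assms(2)]
  by (simp add: L2_norm_def real_sqrt_mult)

lemma L2_lsq_sections:
  assumes g: "g \<in> L2 (lsq L)"
  shows "AE y in lseg L. (\<lambda>x. g (x, y)) \<in> L2 (lseg L)"
proof -
  have [measurable]: "g \<in> borel_measurable (borel \<Otimes>\<^sub>M borel)" using L2_measurable[OF g] by simp
  show ?thesis
    using integral_lsq_yx(2)[OF L2_square_integrable[OF g]] by eventually_elim (auto simp: L2_def)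
qed

section \<open>Weak derivatives and absolute continuity on lines\<close>

text \<open>The primitive of \<open>g\<close> in the first variable that vanishes at the left side.
  Cutting off the integrand rather than the domain makes joint measurability automatic, and the
  integral over the whole line segment is a bound that does not depend on the endpoint.\<close>

definition primx :: "real \<Rightarrow> (real \<times> real \<Rightarrow> real) \<Rightarrow> real \<times> real \<Rightarrow> real" where
  "primx L g z = (LINT s|lseg L. (if s < fst z then g (s, snd z) else 0))"

lemma primx_Pair: "primx L g (x, y) = (LINT s|lseg L. (if s < x then g (s, y) else 0))"
  by (simp only: primx_def fst_conv snd_conv)

lemma primx_measurable [measurable]:
  assumes [measurable]: "g \<in> borel_measurable (borel \<Otimes>\<^sub>M borel)"
  shows "primx L g \<in> borel_measurable (borel \<Otimes>\<^sub>M borel)"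
  unfolding primx_def by measurable

lemma integrable_if_less:
  assumes "integrable (lseg L) f"
  shows "integrable (lseg L) (\<lambda>s. if s < x then f s else 0 :: real)"
proof (rule Bochner_Integration.integrable_bound[OF assms])
  have [measurable]: "f \<in> borel_measurable borel" using borel_measurable_integrable[OF assms] by simp
  show "(\<lambda>s. if s < x then f s else 0) \<in> borel_measurable (lseg L)" by measurable
qed auto

lemma primx_abs_le:
  assumes "integrable (lseg L) (\<lambda>s. g (s, snd z))"
  shows "\<bar>primx L g z\<bar> \<le> (LINT s|lseg L. \<bar>g (s, snd z)\<bar>)"
proof -
  have "\<bar>primx L g z\<bar> \<le> (LINT s|lseg L. \<bar>(if s < fst z then g (s, snd z) else 0)\<bar>)"
    unfolding primx_def using integral_norm_bound[of "lseg L" "\<lambda>s. (if s < fst z then g (s, snd z) else 0)"] by simp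
  also have "\<dots> \<le> (LINT s|lseg L. \<bar>g (s, snd z)\<bar>)"
    using integrable_if_less[OF assms, of "fst z"] assms by (intro integral_mono) auto
  finally show ?thesis .
qed

lemma lseg_L1_le_L2:
  assumes "f \<in> L2 (lseg L)" "L > 0"
  shows "(LINT s|lseg L. \<bar>f s\<bar>)\<^sup>2 \<le> L * (LINT s|lseg L. (f s)\<^sup>2)"
proof -
  have "(LINT s|lseg L. \<bar>f s\<bar>) \<le> sqrt L * L2_norm (lseg L) f"
    using L1_le_L2_norm[OF lseg.finite_measure_axioms assms(1)] assms(2) by (simp add: measure_lseg)
  then have "(LINT s|lseg L. \<bar>f s\<bar>)\<^sup>2 \<le> (sqrt L * L2_norm (lseg L) f)\<^sup>2"
    by (rule power_mono) simp
  then show ?thesis using assms(2) by (simp add: power_mult_distrib L2_norm_power2)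
qed

lemma lseg_integrable: "f \<in> L2 (lseg L) \<Longrightarrow> integrable (lseg L) f"
  by (rule L2_integrable[OF lseg.finite_measure_axioms])

lemma lsq_integrable: "f \<in> L2 (lsq L) \<Longrightarrow> integrable (lsq L) f"
  by (rule L2_integrable[OF finite_measure_lsq])

text \<open>Along almost every horizontal line the primitive is bounded, at any endpoint, by the L1
  norm of the section, hence by \<open>sqrt L\<close> times its L2 norm; integrating over the square
  costs another \<open>sqrt L\<close>. The endpoint \<open>p z\<close> is left free in order to
  cover both \<open>primx\<close> itself and its value on a vertical line, spread over the
  square.\<close>

lemma L2_primx_at:
  assumes g: "g \<in> L2 (lsq L)" and L: "L > 0" and [measurable]: "p \<in> borel_measurable (borel \<Otimes>\<^sub>M borel)"
  defines "e \<equiv> \<lambda>z. primx L g (p z, snd z)"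
  shows "e \<in> L2 (lsq L)" "L2_norm (lsq L) e \<le> L * L2_norm (lsq L) g"
proof -
  have [measurable]: "g \<in> borel_measurable (borel \<Otimes>\<^sub>M borel)" using L2_measurable[OF g] by simp
  have [measurable]: "e \<in> borel_measurable (borel \<Otimes>\<^sub>M borel)" unfolding e_def by measurable
  let ?G = "\<lambda>y. LINT s|lseg L. (g (s, y))\<^sup>2"
  have G: "integrable (lseg L) ?G" by (rule integral_lsq_yx(3)[OF L2_square_integrable[OF g]])
  have le: "AE z in lsq L. (e z)\<^sup>2 \<le> L * ?G (snd z)"
    using AE_lsq_snd[OF L2_lsq_sections[OF g]]
  proof eventually_elim
    case (elim z)
    have "(e z)\<^sup>2 \<le> (LINT s|lseg L. \<bar>g (s, snd z)\<bar>)\<^sup>2"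
      using power_mono[OF primx_abs_le[of L g "(p z, snd z)"], of 2] lseg_integrable[OF elim]
      unfolding e_def by simp
    also have "\<dots> \<le> L * ?G (snd z)" by (rule lseg_L1_le_L2[OF elim L])
    finally show ?case .
  qed
  have GL: "integrable (lsq L) (\<lambda>z. L * ?G (snd z))" using lseg_product_snd(1)[OF G L] by simp
  have i: "integrable (lsq L) (\<lambda>z. (e z)\<^sup>2)"
  proof (rule Bochner_Integration.integrable_bound[OF GL])
    show "AE z in lsq L. norm ((e z)\<^sup>2) \<le> norm (L * ?G (snd z))"
      using le by eventually_elim simp
  qed measurable
  then show "e \<in> L2 (lsq L)" by (intro L2I) measurable
  have "(L2_norm (lsq L) e)\<^sup>2 \<le> (LINT z|lsq L. L * ?G (snd z))"
    unfolding L2_norm_power2 by (rule integral_mono_AE[OF i GL le])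
  also have "\<dots> = (L * L2_norm (lsq L) g)\<^sup>2"
    using lseg_product_snd(2)[OF G L] integral_lsq_yx(1)[OF L2_square_integrable[OF g]]
    by (simp add: power_mult_distrib L2_norm_power2) (simp add: power2_eq_square)
  finally show "L2_norm (lsq L) e \<le> L * L2_norm (lsq L) g"
    by (rule power2_le_imp_le) (use L in simp)
qed

lemma L2_primx:
  assumes "g \<in> L2 (lsq L)" "L > 0"
  shows "primx L g \<in> L2 (lsq L)" "L2_norm (lsq L) (primx L g) \<le> L * L2_norm (lsq L) g"
  using L2_primx_at[OF assms, of fst] by simp_all

lemma Basis_unit_vectors [simp]: "(1, 0) \<in> (Basis :: (real \<times> real) set)" "(0, 1) \<in> (Basis :: (real \<times> real) set)"
  by (auto simp: Basis_plane)

lemma test_functions_isCont_line: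
  fixes \<phi> :: "real \<times> real \<Rightarrow> real"
  assumes "\<phi> \<in> test_functions S"
  shows "isCont (\<lambda>x. \<phi> (x, y)) x" "isCont (\<lambda>y. \<phi> (x, y)) y"
  using test_functions_deriv_line[OF assms] DERIV_isCont by blast+

lemma test_function_line_FTC:
  assumes \<phi>: "\<phi> \<in> test_functions (square L)" and s: "0 \<le> s" "s \<le> L"
  shows "(LINT x|lseg L. (if s < x then pderiv_dir (1, 0) \<phi> (x, y) else 0)) = - \<phi> (s, y)"
proof -
  have "(LINT x|lseg L. indicator {s<..} x * pderiv_dir (1, 0) \<phi> (x, y)) = \<phi> (L, y) - \<phi> (s, y)"
    by (rule lseg_FTC[OF test_functions_deriv_line(1)[OF \<phi>] test_functions_isCont_line(1)[OF test_functions_pderiv[OF \<phi>]]])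
      (use s in auto)
  moreover have "\<phi> (L, y) = 0" by (rule test_functions_zero[OF \<phi>]) (simp add: square_def)
  moreover have "indicator {s<..} x * pderiv_dir (1, 0) \<phi> (x, y) = (if s < x then pderiv_dir (1, 0) \<phi> (x, y) else 0)" for x
    by auto
  ultimately show ?thesis by simp
qed

text \<open>On each line, Fubini over the triangle \<open>s < x\<close> moves the primitive from
  \<open>g\<close> to the derivative of \<open>\<phi>\<close>, whose integral from \<open>s\<close>
  to \<open>L\<close> is \<open>- \<phi> (s, y)\<close> because test functions vanish at the right
  side.\<close>

lemma primx_integral_by_parts:
  assumes g: "integrable (lsq L) g" and \<phi>: "\<phi> \<in> test_functions (square L)" and L: "L > 0"
  shows "(LINT z|lsq L. primx L g z * pderiv_dir (1, 0) \<phi> z) = - (LINT z|lsq L. g z * \<phi> z)"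
proof -
  interpret pair_sigma_finite "lseg L" "lseg L" ..
  let ?d = "pderiv_dir (1, 0) \<phi>"
  have [measurable]: "g \<in> borel_measurable (borel \<Otimes>\<^sub>M borel)" using borel_measurable_integrable[OF g] by simp
  have d: "?d \<in> test_functions (square L)" by (rule test_functions_pderiv[OF \<phi>]) simp
  have [measurable]: "?d \<in> borel_measurable (borel \<Otimes>\<^sub>M borel)" "\<phi> \<in> borel_measurable (borel \<Otimes>\<^sub>M borel)"
    using test_functions_borel d \<phi> by auto
  obtain B where B: "B \<ge> 0" "\<And>z. \<bar>?d z\<bar> \<le> B" using test_functions_bounded[OF d] by blast
  obtain B' where B': "B' \<ge> 0" "\<And>z. \<bar>\<phi> z\<bar> \<le> B'" using test_functions_bounded[OF \<phi>] by blast
  have gabs: "integrable (lsq L) (\<lambda>z. \<bar>g z\<bar>)" using g by simp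
  let ?G = "\<lambda>y. LINT s|lseg L. \<bar>g (s, y)\<bar>"
  have G: "integrable (lseg L) ?G" by (rule integral_lsq_yx(3)[OF gabs])
  have vline: "AE y in lseg L. integrable (lseg L) (\<lambda>x. g (x, y))" by (rule integral_lsq_yx(2)[OF g])
  have i1: "integrable (lsq L) (\<lambda>z. primx L g z * ?d z)"
  proof (rule Bochner_Integration.integrable_bound)
    show "integrable (lsq L) (\<lambda>z. ?G (snd z) * B)" using lseg_product_snd(1)[OF G L] by simp
    show "AE z in lsq L. norm (primx L g z * ?d z) \<le> norm (?G (snd z) * B)"
      using AE_lsq_snd[OF vline]
    proof eventually_elim
      case (elim z)
      have "\<bar>primx L g z * ?d z\<bar> \<le> ?G (snd z) * B"
        unfolding abs_mult by (intro mult_mono primx_abs_le elim B) auto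
      then show ?case using B(1) by (simp add: abs_mult)
    qed
  qed measurable
  have i2: "integrable (lsq L) (\<lambda>z. g z * \<phi> z)"
  proof (rule Bochner_Integration.integrable_bound)
    show "integrable (lsq L) (\<lambda>z. g z * B')" using g by simp
    show "AE z in lsq L. norm (g z * \<phi> z) \<le> norm (g z * B')"
      using B' by (auto simp: abs_mult intro!: mult_left_mono)
  qed measurable
  have "(LINT z|lsq L. primx L g z * ?d z) = (LINT y|lseg L. LINT x|lseg L. primx L g (x, y) * ?d (x, y))"
    by (rule integral_lsq_yx(1)[OF i1])
  also have "\<dots> = (LINT y|lseg L. - (LINT s|lseg L. g (s, y) * \<phi> (s, y)))"
  proof (rule integral_cong_AE)
    show "AE y in lseg L. (LINT x|lseg L. primx L g (x, y) * ?d (x, y)) = - (LINT s|lseg L. g (s, y) * \<phi> (s, y))"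
      using vline
    proof eventually_elim
      case (elim y)
      let ?f = "\<lambda>s x. (if s < x then g (s, y) * ?d (x, y) else 0)"
      \<comment> \<open>Here \<open>y\<close> is fixed and \<open>lsq L\<close> serves as the
        measure for the pair \<open>(s, x)\<close> of points on one line.\<close>
      have fi: "integrable (lseg L \<Otimes>\<^sub>M lseg L) (case_prod ?f)"
        unfolding lsq_def[symmetric]
      proof (rule Bochner_Integration.integrable_bound)
        show "integrable (lsq L) (\<lambda>z. g (fst z, y) * B)" using lseg_product_fst(1)[OF elim L] by simp
        show "AE z in lsq L. norm (case z of (s, x) \<Rightarrow> ?f s x) \<le> norm (g (fst z, y) * B)"
          using B by (intro AE_I2) (auto simp: abs_mult split_beta intro!: mult_left_mono)
      qed measurable
      have "(LINT x|lseg L. primx L g (x, y) * ?d (x, y)) = (LINT x|lseg L. LINT s|lseg L. ?f s x)"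
      proof (rule Bochner_Integration.integral_cong[OF refl])
        fix x
        have "(LINT s|lseg L. ?f s x) = (LINT s|lseg L. (if s < x then g (s, y) else 0) * ?d (x, y))"
          by (rule Bochner_Integration.integral_cong) auto
        then show "primx L g (x, y) * ?d (x, y) = (LINT s|lseg L. ?f s x)"
          by (simp add: primx_Pair)
      qed
      also have "\<dots> = (LINT s|lseg L. LINT x|lseg L. ?f s x)" by (rule Fubini_integral[OF fi])
      also have "\<dots> = (LINT s|lseg L. - (g (s, y) * \<phi> (s, y)))"
      proof (rule integral_cong_AE)
        show "AE s in lseg L. (LINT x|lseg L. ?f s x) = - (g (s, y) * \<phi> (s, y))"
          using AE_lseg_in[of L]
        proof eventually_elim
          case (elim s)
          have "(LINT x|lseg L. ?f s x) = (LINT x|lseg L. g (s, y) * (if s < x then ?d (x, y) else 0))"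
            by (rule Bochner_Integration.integral_cong) auto
          then show ?case using test_function_line_FTC[OF \<phi>, of s y] elim by simp
        qed
      qed measurable
      finally show ?case by simp
    qed
  qed measurable
  also have "\<dots> = - (LINT z|lsq L. g z * \<phi> z)" by (simp add: integral_lsq_yx(1)[OF i2])
  finally show ?thesis .
qed

text \<open>The summand depending on \<open>y\<close> only contributes nothing: on each line the
  derivative of the test function integrates to zero. The primitive is handled by
  \<open>primx_integral_by_parts\<close>.\<close>

lemma ac_imp_weak_deriv_x:
  assumes c: "c \<in> L2 (lseg L)" and g: "g \<in> L2 (lsq L)"
    and u [measurable]: "u \<in> borel_measurable (borel \<Otimes>\<^sub>M borel)"
    and eq: "AE z in lsq L. u z = c (snd z) + primx L g z" and \<phi>: "\<phi> \<in> test_functions (square L)" and L: "L > 0"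
  shows "(LINT z|lsq L. u z * pderiv_dir (1, 0) \<phi> z) = - (LINT z|lsq L. g z * \<phi> z)"
proof -
  let ?d = "pderiv_dir (1, 0) \<phi>"
  have d: "?d \<in> test_functions (square L)" by (rule test_functions_pderiv[OF \<phi>]) simp
  have [measurable]: "c \<in> borel_measurable borel" using L2_measurable[OF c] by simp
  have [measurable]: "g \<in> borel_measurable (borel \<Otimes>\<^sub>M borel)" using L2_measurable[OF g] by simp
  have [measurable]: "?d \<in> borel_measurable (borel \<Otimes>\<^sub>M borel)" using test_functions_borel d by auto
  have dL2: "?d \<in> L2 (lsq L)"
    by (rule test_functions_bounded[OF d], rule L2_bounded[OF finite_measure_lsq]) auto
  have ci: "integrable (lsq L) (\<lambda>z. c (snd z) * ?d z)"
    by (rule L2_mult_integrable[OF L2_lsq_snd[OF c L] dL2])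
  have pi: "integrable (lsq L) (\<lambda>z. primx L g z * ?d z)"
    by (rule L2_mult_integrable[OF L2_primx(1)[OF g L] dL2])
  have "(LINT z|lsq L. c (snd z) * ?d z) = (LINT y|lseg L. LINT x|lseg L. c y * ?d (x, y))"
    using integral_lsq_yx(1)[OF ci] by simp
  also have "\<dots> = (LINT y|lseg L. 0)"
  proof (rule Bochner_Integration.integral_cong[OF refl])
    fix y
    have "(LINT x|lseg L. ?d (x, y)) = \<phi> (L, y) - \<phi> (0, y)"
      by (rule lseg_FTC0[OF test_functions_deriv_line(1)[OF \<phi>] test_functions_isCont_line(1)[OF d]]) (use L in simp)
    also have "\<dots> = 0" using test_functions_zero[OF \<phi>] by (simp add: square_def)
    finally show "(LINT x|lseg L. c y * ?d (x, y)) = 0" by simp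
  qed
  finally have c0: "(LINT z|lsq L. c (snd z) * ?d z) = 0" by simp
  have "(LINT z|lsq L. u z * ?d z) = (LINT z|lsq L. c (snd z) * ?d z + primx L g z * ?d z)"
  proof (rule integral_cong_AE)
    show "AE z in lsq L. u z * ?d z = c (snd z) * ?d z + primx L g z * ?d z"
      using eq by eventually_elim (simp add: algebra_simps)
  qed measurable
  also have "\<dots> = - (LINT z|lsq L. g z * \<phi> z)"
    using ci pi c0 primx_integral_by_parts[OF lsq_integrable[OF g] \<phi> L] by simp
  finally show ?thesis .
qed

lemma bump_L2: "bump L \<alpha> \<Longrightarrow> \<alpha> \<in> L2 (lseg L)"
  using bump_borel[of L \<alpha>] by (auto elim!: bump_bounded intro!: L2_bounded[OF lseg.finite_measure_axioms])

lemma bump_tensor_L2: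
  assumes "bump L \<alpha>" "bump L \<beta>"
  shows "(\<lambda>z. \<alpha> (fst z) * \<beta> (snd z)) \<in> L2 (lsq L)"
proof -
  note t = test_functions_tensor[OF assms]
  show ?thesis
    by (rule test_functions_bounded[OF t], rule L2_bounded[OF finite_measure_lsq])
      (use test_functions_borel[OF t] in auto)
qed

text \<open>The remainder \<open>u - primx L g\<close> is orthogonal to all tensor products whose first factor has mean zero, as
  such a factor is the derivative of a bump. Splitting an arbitrary first factor into a mean-zero
  part and a multiple of a fixed unit bump shows that the remainder depends on \<open>y\<close> only.\<close>

lemma weak_deriv_x_imp_ac:
  assumes u: "u \<in> L2 (lsq L)" and g: "g \<in> L2 (lsq L)" and L: "L > 0"
    and w: "\<And>\<phi>. \<phi> \<in> test_functions (square L) \<Longrightarrow>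
      (LINT z|lsq L. u z * pderiv_dir (1, 0) \<phi> z) = - (LINT z|lsq L. g z * \<phi> z)"
  obtains c where "c \<in> L2 (lseg L)" "AE z in lsq L. u z = c (snd z) + primx L g z"
proof -
  interpret pair_sigma_finite "lseg L" "lseg L" ..
  define h where "h z = u z - primx L g z" for z
  have h: "h \<in> L2 (lsq L)" unfolding h_def by (intro L2_diff u L2_primx(1)[OF g L])
  have [measurable]: "h \<in> borel_measurable (borel \<Otimes>\<^sub>M borel)" using L2_measurable[OF h] by simp
  have h0: "(LINT z|lsq L. h z * (\<zeta> (fst z) * \<beta> (snd z))) = 0"
    if \<zeta>: "bump L \<zeta>" "(LINT x|lseg L. \<zeta> x) = 0" and \<beta>: "bump L \<beta>" for \<zeta> \<beta>
  proof -
    obtain \<alpha> where \<alpha>: "bump L \<alpha>" "\<And>x. (\<alpha> has_real_derivative \<zeta> x) (at x)"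
      using bump_primitive[OF \<zeta>(1) L \<zeta>(2)] by blast
    obtain \<beta>' where \<beta>': "\<And>x. (\<beta> has_real_derivative \<beta>' x) (at x)"
      using bump_deriv[OF \<beta>] by blast
    have pd: "pderiv_dir (1, 0) (\<lambda>z. \<alpha> (fst z) * \<beta> (snd z)) = (\<lambda>z. \<zeta> (fst z) * \<beta> (snd z))"
      by (rule tensor_pderiv(1)[OF \<alpha>(2) \<beta>'])
    note t = test_functions_tensor[OF \<alpha>(1) \<beta>]
    note b = bump_tensor_L2[OF \<zeta>(1) \<beta>]
    have "(LINT z|lsq L. h z * (\<zeta> (fst z) * \<beta> (snd z))) =
      (LINT z|lsq L. u z * (\<zeta> (fst z) * \<beta> (snd z)) - primx L g z * (\<zeta> (fst z) * \<beta> (snd z)))"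
      unfolding h_def by (rule Bochner_Integration.integral_cong) (auto simp: algebra_simps)
    also have "\<dots> = (LINT z|lsq L. u z * (\<zeta> (fst z) * \<beta> (snd z))) - (LINT z|lsq L. primx L g z * (\<zeta> (fst z) * \<beta> (snd z)))"
      by (rule Bochner_Integration.integral_diff[OF L2_mult_integrable[OF u b] L2_mult_integrable[OF L2_primx(1)[OF g L] b]])
    also have "\<dots> = 0"
      using w[OF t] primx_integral_by_parts[OF lsq_integrable[OF g] t L] unfolding pd by simp
    finally show ?thesis .
  qed
  obtain \<eta> where \<eta>: "bump L \<eta>" "(LINT x|lseg L. \<eta> x) = 1" using ex_unit_bump[OF L] by blast
  have [measurable]: "\<eta> \<in> borel_measurable borel" by (rule bump_borel[OF \<eta>(1)])
  obtain B where B: "B \<ge> 0" "\<And>x. \<bar>\<eta> x\<bar> \<le> B" using bump_bounded[OF \<eta>(1)] by blast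
  \<comment> \<open>The mean of the remainder along the line, weighted by the unit bump: if the
    remainder depends on \<open>y\<close> only, this weighted mean recovers it.\<close>
  define c where "c y = (LINT s|lseg L. h (s, y) * \<eta> s)" for y
  have [measurable]: "c \<in> borel_measurable borel" unfolding c_def by measurable
  have hs: "AE y in lseg L. (\<lambda>s. h (s, y)) \<in> L2 (lseg L)" by (rule L2_lsq_sections[OF h])
  have G: "integrable (lseg L) (\<lambda>y. LINT s|lseg L. (h (s, y))\<^sup>2)"
    by (rule integral_lsq_yx(3)[OF L2_square_integrable[OF h]])
  have c: "c \<in> L2 (lseg L)"
  proof (rule L2I)
    show "integrable (lseg L) (\<lambda>y. (c y)\<^sup>2)"
    proof (rule Bochner_Integration.integrable_bound)
      show "integrable (lseg L) (\<lambda>y. (LINT s|lseg L. (\<eta> s)\<^sup>2) * (LINT s|lseg L. (h (s, y))\<^sup>2))"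
        using G by simp
      show "AE y in lseg L. norm ((c y)\<^sup>2) \<le> norm ((LINT s|lseg L. (\<eta> s)\<^sup>2) * (LINT s|lseg L. (h (s, y))\<^sup>2))"
        using hs
      proof eventually_elim
        case (elim y)
        have "\<bar>c y\<bar>\<^sup>2 \<le> (L2_norm (lseg L) (\<lambda>s. h (s, y)) * L2_norm (lseg L) \<eta>)\<^sup>2"
          unfolding c_def by (intro power_mono L2_Cauchy_Schwarz elim bump_L2 \<eta>) simp
        then show ?case by (simp add: power_mult_distrib L2_norm_power2 mult.commute)
      qed
    qed measurable
  qed measurable
  have "AE z in lsq L. h z - c (snd z) = 0"
  proof (rule AE_eq_0_if_tensor_bumps)
    show "integrable (lsq L) (\<lambda>z. h z - c (snd z))"
      by (intro lsq_integrable L2_diff h L2_lsq_snd c L)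
    fix \<alpha> \<beta> assume \<alpha>: "bump L \<alpha>" and \<beta>: "bump L \<beta>"
    have [measurable]: "\<alpha> \<in> borel_measurable borel" "\<beta> \<in> borel_measurable borel"
      using \<alpha> \<beta> by (auto intro: bump_borel)
    define m where "m = (LINT x|lseg L. \<alpha> x)"
    have i: "integrable (lsq L) (\<lambda>z. h z * (\<alpha> (fst z) * \<beta> (snd z)))" if "bump L \<alpha>" for \<alpha>
      by (rule L2_mult_integrable[OF h bump_tensor_L2[OF that \<beta>]])
    have ic: "integrable (lsq L) (\<lambda>z. c (snd z) * (\<alpha> (fst z) * \<beta> (snd z)))"
      by (rule L2_mult_integrable[OF L2_lsq_snd[OF c L] bump_tensor_L2[OF \<alpha> \<beta>]])
    have "(LINT z|lsq L. h z * ((\<alpha> (fst z) + (- m) * \<eta> (fst z)) * \<beta> (snd z))) = 0"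
    proof (rule h0[OF bump_lincomb[OF \<alpha> \<eta>(1)] _ \<beta>])
      show "(LINT x|lseg L. \<alpha> x + - m * \<eta> x) = 0"
        using \<eta> lseg_integrable[OF bump_L2[OF \<alpha>]] lseg_integrable[OF bump_L2[OF \<eta>(1)]]
        by (simp add: m_def)
    qed
    also have "(\<lambda>z. h z * ((\<alpha> (fst z) + (- m) * \<eta> (fst z)) * \<beta> (snd z))) =
      (\<lambda>z. h z * (\<alpha> (fst z) * \<beta> (snd z)) - m * (h z * (\<eta> (fst z) * \<beta> (snd z))))"
      by (auto simp: algebra_simps)
    finally have A: "(LINT z|lsq L. h z * (\<alpha> (fst z) * \<beta> (snd z))) = m * (LINT z|lsq L. h z * (\<eta> (fst z) * \<beta> (snd z)))"
      using i[OF \<alpha>] i[OF \<eta>(1)] by simp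
    have "(LINT z|lsq L. h z * (\<eta> (fst z) * \<beta> (snd z))) = (LINT y|lseg L. LINT x|lseg L. (h (x, y) * \<eta> x) * \<beta> y)"
      using integral_lsq_yx(1)[OF i[OF \<eta>(1)]] by (simp add: mult.assoc)
    also have "\<dots> = (LINT y|lseg L. c y * \<beta> y)" by (simp add: c_def)
    finally have Bq: "(LINT z|lsq L. h z * (\<eta> (fst z) * \<beta> (snd z))) = (LINT y|lseg L. c y * \<beta> y)" .
    have "(LINT z|lsq L. c (snd z) * (\<alpha> (fst z) * \<beta> (snd z))) = (LINT y|lseg L. LINT x|lseg L. \<alpha> x * (c y * \<beta> y))"
      using integral_lsq_yx(1)[OF ic] by (simp add: mult.assoc mult.commute mult.left_commute)
    also have "\<dots> = m * (LINT y|lseg L. c y * \<beta> y)" by (simp add: m_def)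
    finally have Cq: "(LINT z|lsq L. c (snd z) * (\<alpha> (fst z) * \<beta> (snd z))) = m * (LINT y|lseg L. c y * \<beta> y)" .
    have "(LINT z|lsq L. (h z - c (snd z)) * (\<alpha> (fst z) * \<beta> (snd z))) =
      (LINT z|lsq L. h z * (\<alpha> (fst z) * \<beta> (snd z)) - c (snd z) * (\<alpha> (fst z) * \<beta> (snd z)))"
      by (rule Bochner_Integration.integral_cong) (auto simp: algebra_simps)
    also have "\<dots> = 0" using i[OF \<alpha>] ic A Bq Cq by simp
    finally show "(LINT z|lsq L. (h z - c (snd z)) * (\<alpha> (fst z) * \<beta> (snd z))) = 0" .
  qed
  then have "AE z in lsq L. u z = c (snd z) + primx L g z"
    by eventually_elim (simp add: h_def)
  then show ?thesis using that c by blast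
qed

section \<open>The vertical direction, by exchange of coordinates\<close>

definition primy :: "real \<Rightarrow> (real \<times> real \<Rightarrow> real) \<Rightarrow> real \<times> real \<Rightarrow> real" where
  "primy L g z = (LINT t|lseg L. (if t < snd z then g (fst z, t) else 0))"

lemma primy_swap: "primy L g (prod.swap z) = primx L (\<lambda>z. g (prod.swap z)) z"
  by (cases z) (simp only: primy_def primx_def swap_simp fst_conv snd_conv)

lemma primy_Pair: "primy L g (x, y) = (LINT t|lseg L. (if t < y then g (x, t) else 0))"
  by (simp only: primy_def fst_conv snd_conv)

lemma pderiv_dir_swap:
  fixes \<phi> :: "real \<times> real \<Rightarrow> real"
  assumes "\<And>z. \<phi> differentiable (at z)"
  shows "pderiv_dir e (\<lambda>z. \<phi> (prod.swap z)) = (\<lambda>z. pderiv_dir (prod.swap e) \<phi> (prod.swap z))"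
    and "(\<lambda>z. \<phi> (prod.swap z)) differentiable (at z)"
proof -
  have sw: "(prod.swap has_derivative prod.swap) (at z)" for z :: "real \<times> real"
  proof -
    have "((\<lambda>z :: real \<times> real. (snd z, fst z)) has_derivative (\<lambda>z. (snd z, fst z))) (at z)"
      by (auto intro!: derivative_eq_intros)
    moreover have "prod.swap = (\<lambda>z :: real \<times> real. (snd z, fst z))" by auto
    ultimately show ?thesis by simp
  qed
  have d: "((\<lambda>z. \<phi> (prod.swap z)) has_derivative (\<lambda>h. frechet_derivative \<phi> (at (prod.swap z)) (prod.swap h))) (at z)" for z
    by (rule has_derivative_compose[OF sw frechet_derivative_works[THEN iffD1, OF assms]])
  show "pderiv_dir e (\<lambda>z. \<phi> (prod.swap z)) = (\<lambda>z. pderiv_dir (prod.swap e) \<phi> (prod.swap z))"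
    unfolding pderiv_dir_def frechet_derivative_at[OF d, symmetric] by simp
  show "(\<lambda>z. \<phi> (prod.swap z)) differentiable (at z)" using d by (rule differentiableI)
qed

text \<open>Iterated derivatives of the reflected function are reflections of those taken along the
  reflected directions, and both the basis and the square are symmetric.\<close>

lemma test_functions_swap:
  assumes \<phi>: "\<phi> \<in> test_functions (square L)"
  shows "(\<lambda>z. \<phi> (prod.swap z)) \<in> test_functions (square L)"
proof -
  have sm: "smooth \<phi>" using \<phi> by (simp add: test_functions_def)
  have "smooth (\<lambda>z. \<phi> (prod.swap z))"
    unfolding smooth_def
  proof (intro allI impI)
    fix es :: "(real \<times> real) list" and z
    assume es: "set es \<subseteq> Basis"
    have sB: "prod.swap ` S \<subseteq> Basis" if "S \<subseteq> Basis" for S :: "(real \<times> real) set"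
      using that by (auto simp: Basis_plane)
    have "set es \<subseteq> Basis \<Longrightarrow> foldr pderiv_dir es (\<lambda>z. \<phi> (prod.swap z)) = (\<lambda>z. foldr pderiv_dir (map prod.swap es) \<phi> (prod.swap z))"
    proof (induction es)
      case (Cons e es)
      have "foldr pderiv_dir (map prod.swap es) \<phi> differentiable (at z)" for z
        using sB[of "set es"] Cons.prems by (intro sm[unfolded smooth_def, rule_format]) simp
      from pderiv_dir_swap(1)[OF this] Cons show ?case by simp
    qed simp
    note eq = this[OF es]
    have "foldr pderiv_dir (map prod.swap es) \<phi> differentiable (at z)" for z
      using sB[of "set es"] es by (intro sm[unfolded smooth_def, rule_format]) simp
    from pderiv_dir_swap(2)[OF this]
    show "foldr pderiv_dir es (\<lambda>z. \<phi> (prod.swap z)) differentiable at z" unfolding eq .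
  qed
  moreover
  let ?K = "prod.swap ` closure {z. \<phi> z \<noteq> 0}"
  have K: "compact ?K"
    using \<phi> by (intro compact_continuous_image continuous_on_swap) (simp add: test_functions_def)
  have "{z. \<phi> (prod.swap z) \<noteq> 0} \<subseteq> ?K"
  proof
    fix z assume "z \<in> {z. \<phi> (prod.swap z) \<noteq> 0}"
    then have "prod.swap z \<in> closure {z. \<phi> z \<noteq> 0}"
      using closure_subset[of "{z. \<phi> z \<noteq> 0}"] by auto
    then have "prod.swap (prod.swap z) \<in> ?K" by (rule imageI)
    then show "z \<in> ?K" by simp
  qed
  then have cl: "closure {z. \<phi> (prod.swap z) \<noteq> 0} \<subseteq> ?K"
    by (rule closure_minimal) (rule compact_imp_closed[OF K])
  moreover have "compact (closure {z. \<phi> (prod.swap z) \<noteq> 0})" by (rule compact_closure_subset[OF K cl])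
  moreover have "?K \<subseteq> square L" using \<phi> by (auto simp: test_functions_def square_def)
  ultimately show ?thesis using \<open>smooth (\<lambda>z. \<phi> (prod.swap z))\<close> by (auto simp: test_functions_def)
qed

lemma test_functions_swap_pderiv:
  assumes \<phi>: "\<phi> \<in> test_functions (square L)"
  shows "pderiv_dir (1, 0) (\<lambda>z. \<phi> (prod.swap z)) z = pderiv_dir (0, 1) \<phi> (prod.swap z)"
    and "pderiv_dir (0, 1) (\<lambda>z. \<phi> (prod.swap z)) z = pderiv_dir (1, 0) \<phi> (prod.swap z)"
  using pderiv_dir_swap(1)[of \<phi>, OF test_functions_differentiable[OF \<phi>]] by auto

lemma ac_imp_weak_deriv_y:
  assumes c: "c \<in> L2 (lseg L)" and g: "g \<in> L2 (lsq L)"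
    and u [measurable]: "u \<in> borel_measurable (borel \<Otimes>\<^sub>M borel)"
    and eq: "AE z in lsq L. u z = c (fst z) + primy L g z" and \<phi>: "\<phi> \<in> test_functions (square L)" and L: "L > 0"
  shows "(LINT z|lsq L. u z * pderiv_dir (0, 1) \<phi> z) = - (LINT z|lsq L. g z * \<phi> z)"
proof -
  have [measurable]: "g \<in> borel_measurable (borel \<Otimes>\<^sub>M borel)" using L2_measurable[OF g] by simp
  have [measurable]: "\<phi> \<in> borel_measurable (borel \<Otimes>\<^sub>M borel)" "pderiv_dir (0, 1) \<phi> \<in> borel_measurable (borel \<Otimes>\<^sub>M borel)"
    using test_functions_borel[OF \<phi>] test_functions_borel[OF test_functions_pderiv[OF \<phi>, of "(0, 1)"]] by auto
  have "AE z in lsq L. u (prod.swap z) = c (snd z) + primx L (\<lambda>z. g (prod.swap z)) z"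
    using AE_swap_lsq[OF eq] by eventually_elim (simp add: primy_swap)
  from ac_imp_weak_deriv_x[OF c L2_swap_lsq[OF g] _ this test_functions_swap[OF \<phi>] L]
  have "(LINT z|lsq L. u (prod.swap z) * pderiv_dir (0, 1) \<phi> (prod.swap z)) = - (LINT z|lsq L. g (prod.swap z) * \<phi> (prod.swap z))"
    by (simp add: test_functions_swap_pderiv[OF \<phi>])
  then show ?thesis
    using integral_swap_lsq[of "\<lambda>z. u z * pderiv_dir (0, 1) \<phi> z" L] integral_swap_lsq[of "\<lambda>z. g z * \<phi> z" L] by simp
qed

lemma weak_deriv_y_imp_ac:
  assumes u: "u \<in> L2 (lsq L)" and g: "g \<in> L2 (lsq L)" and L: "L > 0"
    and w: "\<And>\<phi>. \<phi> \<in> test_functions (square L) \<Longrightarrow>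
      (LINT z|lsq L. u z * pderiv_dir (0, 1) \<phi> z) = - (LINT z|lsq L. g z * \<phi> z)"
  obtains c where "c \<in> L2 (lseg L)" "AE z in lsq L. u z = c (fst z) + primy L g z"
proof -
  have [measurable]: "g \<in> borel_measurable (borel \<Otimes>\<^sub>M borel)" "u \<in> borel_measurable (borel \<Otimes>\<^sub>M borel)"
    using L2_measurable[OF g] L2_measurable[OF u] by auto
  have "(LINT z|lsq L. u (prod.swap z) * pderiv_dir (1, 0) \<phi> z) = - (LINT z|lsq L. g (prod.swap z) * \<phi> z)"
    if \<phi>: "\<phi> \<in> test_functions (square L)" for \<phi>
  proof -
    have [measurable]: "\<phi> \<in> borel_measurable (borel \<Otimes>\<^sub>M borel)" "pderiv_dir (1, 0) \<phi> \<in> borel_measurable (borel \<Otimes>\<^sub>M borel)"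
      using test_functions_borel[OF \<phi>] test_functions_borel[OF test_functions_pderiv[OF \<phi>, of "(1, 0)"]] by auto
    show ?thesis
      using w[OF test_functions_swap[OF \<phi>]] integral_swap_lsq[of "\<lambda>z. u (prod.swap z) * pderiv_dir (1, 0) \<phi> z" L]
        integral_swap_lsq[of "\<lambda>z. g (prod.swap z) * \<phi> z" L]
      by (simp add: test_functions_swap_pderiv[OF \<phi>])
  qed
  from weak_deriv_x_imp_ac[OF L2_swap_lsq[OF u] L2_swap_lsq[OF g] L this]
  obtain c where c: "c \<in> L2 (lseg L)" "AE z in lsq L. u (prod.swap z) = c (snd z) + primx L (\<lambda>z. g (prod.swap z)) z"
    by blast
  have "AE z in lsq L. u z = c (fst z) + primy L g z"
    using AE_swap_lsq[OF c(2)] by eventually_elim (simp add: primy_swap[symmetric])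
  then show ?thesis using that c(1) by blast
qed

section \<open>Sobolev functions on the square\<close>

abbreviation (input) leb :: "real \<Rightarrow> (real \<times> real) measure" where
  "leb L \<equiv> lebesgue_on (square L)"

lemma AE_leb: "(AE z in leb L. P z) \<longleftrightarrow> (AE z in lsq L. P z)"
  by (rule AE_lebesgue_on_square)

lemma integral_leb_version:
  fixes u u' \<phi> :: "real \<times> real \<Rightarrow> real"
  assumes [measurable]: "u \<in> borel_measurable (leb L)" "u' \<in> borel_measurable (borel \<Otimes>\<^sub>M borel)"
      "\<phi> \<in> borel_measurable (borel \<Otimes>\<^sub>M borel)"
    and eq: "AE z in lsq L. u z = u' z"
  shows "(LINT z|leb L. u z * \<phi> z) = (LINT z|lsq L. u' z * \<phi> z)"
proof -
  have [measurable]: "u' \<in> borel_measurable (leb L)" "\<phi> \<in> borel_measurable (leb L)"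
    using assms(2,3) by (auto intro: borel_measurable_lebesgue_on_square)
  have "(LINT z|leb L. u z * \<phi> z) = (LINT z|leb L. u' z * \<phi> z)"
  proof (rule integral_cong_AE)
    show "AE z in leb L. u z * \<phi> z = u' z * \<phi> z"
      unfolding AE_leb using eq by eventually_elim simp
  qed measurable
  also have "\<dots> = (LINT z|lsq L. u' z * \<phi> z)" by (rule integral_lebesgue_on_square) measurable
  finally show ?thesis .
qed

lemma D_test_functions: "\<phi> \<in> test_functions S \<Longrightarrow> D i j \<phi> \<in> test_functions S"
proof -
  assume \<phi>: "\<phi> \<in> test_functions S"
  have "(pderiv_dir (0, 1) ^^ j) \<phi> \<in> test_functions S"
    by (induction j) (auto intro: \<phi> test_functions_pderiv)
  then show ?thesis unfolding D_def by (induction i) (auto intro: test_functions_pderiv)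
qed

lemma D_simps: "D 1 0 \<phi> = pderiv_dir (1, 0) \<phi>" "D 0 1 \<phi> = pderiv_dir (0, 1) \<phi>" "D 0 0 \<phi> = \<phi>"
  "D (Suc 0) 0 \<phi> = pderiv_dir (1, 0) \<phi>" "D 0 (Suc 0) \<phi> = pderiv_dir (0, 1) \<phi>"
  by (simp_all add: D_def)

lemma test_functions_L2: "\<phi> \<in> test_functions S \<Longrightarrow> \<phi> \<in> L2 (lsq L)"
  by (rule test_functions_bounded, assumption, rule L2_bounded[OF finite_measure_lsq])
    (auto dest: test_functions_borel)

lemma test_functions_L2_leb: "\<phi> \<in> test_functions S \<Longrightarrow> \<phi> \<in> L2 (leb L)"
  by (intro L2_lsq_imp test_functions_L2)

lemma has_weak_deriv_L2: "has_weak_deriv S i j u g \<Longrightarrow> g \<in> L2 (lebesgue_on S)"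
  by (simp add: has_weak_deriv_def)

text \<open>Two candidates have the same integrals against all tensor bumps, so a Borel version of
  their difference vanishes almost everywhere. This is what makes the arbitrary choice in
  \<open>weak_deriv\<close> harmless.\<close>

lemma has_weak_deriv_unique:
  assumes "has_weak_deriv (square L) i j u g" "has_weak_deriv (square L) i j u h"
  shows "AE z in lsq L. g z = h z"
proof -
  let ?d = "\<lambda>z. g z - h z"
  have g: "g \<in> L2 (leb L)" and h: "h \<in> L2 (leb L)" using assms has_weak_deriv_L2 by auto
  then have d: "?d \<in> L2 (leb L)" by (rule L2_diff)
  then obtain d' where d': "d' \<in> L2 (lsq L)" "AE z in lsq L. ?d z = d' z"
    using ex_L2_borel_version by blast
  have "AE z in lsq L. d' z = 0"
  proof (rule AE_eq_0_if_tensor_bumps)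
    show "integrable (lsq L) d'" using d'(1) by (rule lsq_integrable)
    fix \<alpha> \<beta> assume "bump L \<alpha>" "bump L \<beta>"
    then have t: "(\<lambda>z. \<alpha> (fst z) * \<beta> (snd z)) \<in> test_functions (square L)" (is "?\<phi> \<in> _")
      by (rule test_functions_tensor)
    have "(-1) ^ (i + j) * (LINT z|leb L. g z * ?\<phi> z) = (-1) ^ (i + j) * (LINT z|leb L. h z * ?\<phi> z)"
    proof -
      have "(LINT z|leb L. u z * D i j ?\<phi> z) = (-1) ^ (i + j) * (LINT z|leb L. g z * ?\<phi> z)"
        "(LINT z|leb L. u z * D i j ?\<phi> z) = (-1) ^ (i + j) * (LINT z|leb L. h z * ?\<phi> z)"
        using assms t unfolding has_weak_deriv_def by blast+
      then show ?thesis by linarith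
    qed
    then have "(LINT z|leb L. g z * ?\<phi> z) = (LINT z|leb L. h z * ?\<phi> z)" by simp
    then have "(LINT z|leb L. ?d z * ?\<phi> z) = 0"
      using L2_mult_integrable[OF g test_functions_L2_leb[OF t]] L2_mult_integrable[OF h test_functions_L2_leb[OF t]]
      by (simp add: left_diff_distrib)
    then show "(LINT z|lsq L. d' z * ?\<phi> z) = 0"
      using integral_leb_version[OF L2_measurable[OF d] _ test_functions_borel[OF t] d'(2)] L2_measurable[OF d'(1)]
      by simp
  qed
  then show ?thesis using d'(2) by eventually_elim simp
qed

lemma has_weak_deriv_lincomb:
  assumes u: "u \<in> L2 (leb L)" "has_weak_deriv (square L) i j u g"
    and v: "v \<in> L2 (leb L)" "has_weak_deriv (square L) i j v h"
  shows "has_weak_deriv (square L) i j (\<lambda>z. a * u z + b * v z) (\<lambda>z. a * g z + b * h z)"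
  unfolding has_weak_deriv_def
proof (intro conjI ballI)
  have g: "g \<in> L2 (leb L)" and h: "h \<in> L2 (leb L)" using assms has_weak_deriv_L2 by auto
  then show "(\<lambda>z. a * g z + b * h z) \<in> L2 (leb L)" by (rule L2_lincomb)
  fix \<phi> assume \<phi>: "\<phi> \<in> test_functions (square L)"
  note t = test_functions_L2_leb[OF \<phi>, of L] test_functions_L2_leb[OF D_test_functions[OF \<phi>, of i j], of L]
  have lin: "(LINT z|leb L. (a * p z + b * q z) * \<psi> z) = a * (LINT z|leb L. p z * \<psi> z) + b * (LINT z|leb L. q z * \<psi> z)"
    if "p \<in> L2 (leb L)" "q \<in> L2 (leb L)" "\<psi> \<in> L2 (leb L)" for p q \<psi>
    using L2_mult_integrable[OF that(1,3)] L2_mult_integrable[OF that(2,3)]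
    by (simp add: distrib_right mult.assoc)
  show "(LINT z|leb L. (a * u z + b * v z) * D i j \<phi> z) = (-1) ^ (i + j) * (LINT z|leb L. (a * g z + b * h z) * \<phi> z)"
    using assms \<phi> unfolding lin[OF u(1) v(1) t(2)] lin[OF g h t(1)] has_weak_deriv_def
    by (simp add: algebra_simps)
qed

lemma has_weak_deriv_0_0: "u \<in> L2 (leb L) \<Longrightarrow> has_weak_deriv (square L) 0 0 u u"
  by (simp add: has_weak_deriv_def D_simps)

text \<open>In \<open>D 1 1\<close> the derivative in \<open>x\<close> is the outer one, so
  \<open>D 1 1 \<phi> = D 1 0 (D 0 1 \<phi>)\<close> and the defining identity of \<open>g\<close>
  can be used with the test function \<open>D 0 1 \<phi>\<close>. The opposite order would ask for
  partial derivatives to commute; the vertical derivative is treated through Fubini instead.\<close>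

lemma has_weak_deriv_iterate:
  assumes w: "has_weak_deriv (square L) 1 0 w g"
  shows "has_weak_deriv (square L) 2 0 w h \<Longrightarrow> has_weak_deriv (square L) 1 0 g h"
    and "has_weak_deriv (square L) 1 1 w h \<Longrightarrow> has_weak_deriv (square L) 0 1 g h"
proof -
  have *: "(LINT z|leb L. w z * D 1 0 \<phi> z) = - (LINT z|leb L. g z * \<phi> z)" if "\<phi> \<in> test_functions (square L)" for \<phi>
    using w that by (simp add: has_weak_deriv_def)
  have D: "D 2 0 \<phi> = D 1 0 (D 1 0 \<phi>)" "D 1 1 \<phi> = D 1 0 (D 0 1 \<phi>)" for \<phi>
    by (simp_all add: D_def numeral_2_eq_2)
  show "has_weak_deriv (square L) 1 0 g h" if h: "has_weak_deriv (square L) 2 0 w h"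
    unfolding has_weak_deriv_def
  proof (intro conjI ballI has_weak_deriv_L2[OF h])
    fix \<phi> assume \<phi>: "\<phi> \<in> test_functions (square L)"
    have "(LINT z|leb L. w z * D 2 0 \<phi> z) = (LINT z|leb L. h z * \<phi> z)"
      using h \<phi> by (simp add: has_weak_deriv_def)
    then show "(LINT z|leb L. g z * D 1 0 \<phi> z) = (-1) ^ (1 + 0) * (LINT z|leb L. h z * \<phi> z)"
      unfolding D using *[OF D_test_functions[OF \<phi>, of 1 0]] by simp
  qed
  show "has_weak_deriv (square L) 0 1 g h" if h: "has_weak_deriv (square L) 1 1 w h"
    unfolding has_weak_deriv_def
  proof (intro conjI ballI has_weak_deriv_L2[OF h])
    fix \<phi> assume \<phi>: "\<phi> \<in> test_functions (square L)"
    have "(LINT z|leb L. w z * D 1 1 \<phi> z) = (LINT z|leb L. h z * \<phi> z)"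
      using h \<phi> by (simp add: has_weak_deriv_def)
    then show "(LINT z|leb L. g z * D 0 1 \<phi> z) = (-1) ^ (0 + 1) * (LINT z|leb L. h z * \<phi> z)"
      unfolding D using *[OF D_test_functions[OF \<phi>, of 0 1]] by simp
  qed
qed

lemma has_weak_deriv_iterate_y:
  assumes w: "has_weak_deriv (square L) 0 1 w g"
  shows "has_weak_deriv (square L) 0 2 w h \<Longrightarrow> has_weak_deriv (square L) 0 1 g h"
proof -
  have *: "(LINT z|leb L. w z * D 0 1 \<phi> z) = - (LINT z|leb L. g z * \<phi> z)" if "\<phi> \<in> test_functions (square L)" for \<phi>
    using w that by (simp add: has_weak_deriv_def)
  have D: "D 0 2 \<phi> = D 0 1 (D 0 1 \<phi>)" for \<phi>
    by (simp_all add: D_def numeral_2_eq_2)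
  show "has_weak_deriv (square L) 0 1 g h" if h: "has_weak_deriv (square L) 0 2 w h"
    unfolding has_weak_deriv_def
  proof (intro conjI ballI has_weak_deriv_L2[OF h])
    fix \<phi> assume \<phi>: "\<phi> \<in> test_functions (square L)"
    have "(LINT z|leb L. w z * D 0 2 \<phi> z) = (LINT z|leb L. h z * \<phi> z)"
      using h \<phi> by (simp add: has_weak_deriv_def)
    then show "(LINT z|leb L. g z * D 0 1 \<phi> z) = (-1) ^ (0 + 1) * (LINT z|leb L. h z * \<phi> z)"
      unfolding D using *[OF D_test_functions[OF \<phi>, of 0 1]] by simp
  qed
qed

lemma has_weak_deriv_some:
  "has_weak_deriv S i j u g \<Longrightarrow> has_weak_deriv S i j u (weak_deriv S i j u)"
  unfolding weak_deriv_def by (rule someI[of "\<lambda>g. has_weak_deriv S i j u g"])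

lemma weak_deriv_eqI: "has_weak_deriv (square L) i j u g \<Longrightarrow> AE z in lsq L. weak_deriv (square L) i j u z = g z"
  by (rule has_weak_deriv_unique[OF has_weak_deriv_some])

lemma has_weak_deriv_weak_deriv:
  "u \<in> sobolev m (square L) \<Longrightarrow> i + j \<le> m \<Longrightarrow> has_weak_deriv (square L) i j u (weak_deriv (square L) i j u)"
  using has_weak_deriv_some unfolding sobolev_def by blast

lemma sobolev_L2: "u \<in> sobolev m (square L) \<Longrightarrow> u \<in> L2 (leb L)"
  by (simp add: sobolev_def)

lemma sobolev_1I:
  assumes "u \<in> L2 (leb L)" "has_weak_deriv (square L) 1 0 u g" "has_weak_deriv (square L) 0 1 u h"
  shows "u \<in> sobolev 1 (square L)"
proof -
  have "\<exists>g. has_weak_deriv (square L) i j u g" if "i + j \<le> 1" for i j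
  proof -
    from that consider "i = 0" "j = 0" | "i = 1" "j = 0" | "i = 0" "j = 1" by linarith
    then show ?thesis using assms has_weak_deriv_0_0 by cases blast+
  qed
  then show ?thesis using assms(1) by (simp add: sobolev_def)
qed

lemma L2_norm_weak_deriv:
  assumes "has_weak_deriv (square L) i j u g"
  shows "L2_norm (leb L) (weak_deriv (square L) i j u) = L2_norm (leb L) g"
proof (rule L2_norm_cong_AE)
  have "has_weak_deriv (square L) i j u (weak_deriv (square L) i j u)"
    by (rule has_weak_deriv_some[OF assms])
  then show "weak_deriv (square L) i j u \<in> borel_measurable (leb L)"
    by (intro L2_measurable has_weak_deriv_L2)
  show "g \<in> borel_measurable (leb L)" using assms by (intro L2_measurable has_weak_deriv_L2)
  show "AE z in leb L. weak_deriv (square L) i j u z = g z"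
    unfolding AE_leb by (rule weak_deriv_eqI[OF assms])
qed

lemma sobolev_norm_1:
  assumes "u \<in> L2 (leb L)" "has_weak_deriv (square L) 1 0 u g" "has_weak_deriv (square L) 0 1 u h"
  shows "sobolev_norm 1 (square L) u = sqrt ((L2_norm (leb L) u)\<^sup>2 + (L2_norm (leb L) g)\<^sup>2 + (L2_norm (leb L) h)\<^sup>2)"
proof -
  have *: "{..1 :: nat} = {0, 1}" "{..1 - 0 :: nat} = {0, 1}" "{..1 - 1 :: nat} = {0}" by auto
  have "sobolev_norm 1 (square L) u = sqrt ((L2_norm (leb L) (weak_deriv (square L) 0 0 u))\<^sup>2
      + (L2_norm (leb L) (weak_deriv (square L) 0 1 u))\<^sup>2 + (L2_norm (leb L) (weak_deriv (square L) 1 0 u))\<^sup>2)"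
    unfolding sobolev_norm_def by (simp add: *)
  then show ?thesis
    using L2_norm_weak_deriv[OF has_weak_deriv_0_0[OF assms(1)]] L2_norm_weak_deriv[OF assms(2)]
      L2_norm_weak_deriv[OF assms(3)] by simp
qed

section \<open>Weak derivatives and primitives for Lebesgue measurable functions\<close>

lemma has_weak_deriv_x_imp_ac:
  assumes u: "u \<in> L2 (leb L)" and w: "has_weak_deriv (square L) 1 0 u g" and L: "L > 0"
    and g': "g' \<in> L2 (lsq L)" "AE z in lsq L. g z = g' z"
  obtains c where "c \<in> L2 (lseg L)" "AE z in lsq L. u z = c (snd z) + primx L g' z"
proof -
  obtain u' where u': "u' \<in> L2 (lsq L)" "AE z in lsq L. u z = u' z" using ex_L2_borel_version[OF u] by blast
  have g: "g \<in> L2 (leb L)" using w by (rule has_weak_deriv_L2)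
  have "(LINT z|lsq L. u' z * pderiv_dir (1, 0) \<phi> z) = - (LINT z|lsq L. g' z * \<phi> z)"
    if \<phi>: "\<phi> \<in> test_functions (square L)" for \<phi>
  proof -
    have d: "pderiv_dir (1, 0) \<phi> \<in> test_functions (square L)" by (rule test_functions_pderiv[OF \<phi>]) simp
    have "(LINT z|leb L. u z * pderiv_dir (1, 0) \<phi> z) = - (LINT z|leb L. g z * \<phi> z)"
      using w \<phi> by (simp add: has_weak_deriv_def D_simps)
    then show ?thesis
      using integral_leb_version[OF L2_measurable[OF u] _ test_functions_borel[OF d] u'(2)] L2_measurable[OF u'(1)]
        integral_leb_version[OF L2_measurable[OF g] _ test_functions_borel[OF \<phi>] g'(2)] L2_measurable[OF g'(1)]
      by simp
  qed
  from weak_deriv_x_imp_ac[OF u'(1) g'(1) L this] obtain c where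
    c: "c \<in> L2 (lseg L)" "AE z in lsq L. u' z = c (snd z) + primx L g' z" by blast
  have "AE z in lsq L. u z = c (snd z) + primx L g' z" using c(2) u'(2) by eventually_elim simp
  then show ?thesis using that c(1) by blast
qed

lemma has_weak_deriv_y_imp_ac:
  assumes u: "u \<in> L2 (leb L)" and w: "has_weak_deriv (square L) 0 1 u g" and L: "L > 0"
    and g': "g' \<in> L2 (lsq L)" "AE z in lsq L. g z = g' z"
  obtains c where "c \<in> L2 (lseg L)" "AE z in lsq L. u z = c (fst z) + primy L g' z"
proof -
  obtain u' where u': "u' \<in> L2 (lsq L)" "AE z in lsq L. u z = u' z" using ex_L2_borel_version[OF u] by blast
  have g: "g \<in> L2 (leb L)" using w by (rule has_weak_deriv_L2)
  have "(LINT z|lsq L. u' z * pderiv_dir (0, 1) \<phi> z) = - (LINT z|lsq L. g' z * \<phi> z)"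
    if \<phi>: "\<phi> \<in> test_functions (square L)" for \<phi>
  proof -
    have d: "pderiv_dir (0, 1) \<phi> \<in> test_functions (square L)" by (rule test_functions_pderiv[OF \<phi>]) simp
    have "(LINT z|leb L. u z * pderiv_dir (0, 1) \<phi> z) = - (LINT z|leb L. g z * \<phi> z)"
      using w \<phi> by (simp add: has_weak_deriv_def D_simps)
    then show ?thesis
      using integral_leb_version[OF L2_measurable[OF u] _ test_functions_borel[OF d] u'(2)] L2_measurable[OF u'(1)]
        integral_leb_version[OF L2_measurable[OF g] _ test_functions_borel[OF \<phi>] g'(2)] L2_measurable[OF g'(1)]
      by simp
  qed
  from weak_deriv_y_imp_ac[OF u'(1) g'(1) L this] obtain c where
    c: "c \<in> L2 (lseg L)" "AE z in lsq L. u' z = c (fst z) + primy L g' z" by blast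
  have "AE z in lsq L. u z = c (fst z) + primy L g' z" using c(2) u'(2) by eventually_elim simp
  then show ?thesis using that c(1) by blast
qed

lemma ac_imp_has_weak_deriv_x:
  assumes c: "c \<in> L2 (lseg L)" and g: "g \<in> L2 (lsq L)" and u: "u \<in> borel_measurable (borel \<Otimes>\<^sub>M borel)"
    and eq: "AE z in lsq L. u z = c (snd z) + primx L g z" and L: "L > 0"
  shows "has_weak_deriv (square L) 1 0 u g"
  unfolding has_weak_deriv_def
proof (intro conjI ballI L2_lsq_imp g)
  fix \<phi> assume \<phi>: "\<phi> \<in> test_functions (square L)"
  have [measurable]: "\<phi> \<in> borel_measurable (borel \<Otimes>\<^sub>M borel)" "pderiv_dir (1, 0) \<phi> \<in> borel_measurable (borel \<Otimes>\<^sub>M borel)"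
      "u \<in> borel_measurable (borel \<Otimes>\<^sub>M borel)" "g \<in> borel_measurable (borel \<Otimes>\<^sub>M borel)"
    using test_functions_borel[OF \<phi>] test_functions_borel[OF test_functions_pderiv[OF \<phi>, of "(1, 0)"]] u
      L2_measurable[OF g] by auto
  show "(LINT z|leb L. u z * D 1 0 \<phi> z) = (- 1) ^ (1 + 0) * (LINT z|leb L. g z * \<phi> z)"
    using ac_imp_weak_deriv_x[OF c g u eq \<phi> L] by (simp add: D_simps integral_lebesgue_on_square)
qed

lemma ac_imp_has_weak_deriv_y:
  assumes c: "c \<in> L2 (lseg L)" and g: "g \<in> L2 (lsq L)" and u: "u \<in> borel_measurable (borel \<Otimes>\<^sub>M borel)"
    and eq: "AE z in lsq L. u z = c (fst z) + primy L g z" and L: "L > 0"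
  shows "has_weak_deriv (square L) 0 1 u g"
  unfolding has_weak_deriv_def
proof (intro conjI ballI L2_lsq_imp g)
  fix \<phi> assume \<phi>: "\<phi> \<in> test_functions (square L)"
  have [measurable]: "\<phi> \<in> borel_measurable (borel \<Otimes>\<^sub>M borel)" "pderiv_dir (0, 1) \<phi> \<in> borel_measurable (borel \<Otimes>\<^sub>M borel)"
      "u \<in> borel_measurable (borel \<Otimes>\<^sub>M borel)" "g \<in> borel_measurable (borel \<Otimes>\<^sub>M borel)"
    using test_functions_borel[OF \<phi>] test_functions_borel[OF test_functions_pderiv[OF \<phi>, of "(0, 1)"]] u
      L2_measurable[OF g] by auto
  show "(LINT z|leb L. u z * D 0 1 \<phi> z) = (- 1) ^ (0 + 1) * (LINT z|leb L. g z * \<phi> z)"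
    using ac_imp_weak_deriv_y[OF c g u eq \<phi> L] by (simp add: D_simps integral_lebesgue_on_square)
qed

section \<open>Limits and linear combinations\<close>

lemma L2_norm_tendsto_lincomb:
  assumes f: "\<And>n. f n \<in> L2 M" "f' \<in> L2 M" "(\<lambda>n. L2_norm M (\<lambda>x. f n x - f' x)) \<longlonglongrightarrow> 0"
    and g: "\<And>n. g n \<in> L2 M" "g' \<in> L2 M" "(\<lambda>n. L2_norm M (\<lambda>x. g n x - g' x)) \<longlonglongrightarrow> 0"
  shows "(\<lambda>n. L2_norm M (\<lambda>x. (a * f n x + b * g n x) - (a * f' x + b * g' x))) \<longlonglongrightarrow> 0"
proof (rule Lim_null_comparison[OF always_eventually])
  show "\<forall>n. norm (L2_norm M (\<lambda>x. (a * f n x + b * g n x) - (a * f' x + b * g' x)))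
      \<le> \<bar>a\<bar> * L2_norm M (\<lambda>x. f n x - f' x) + \<bar>b\<bar> * L2_norm M (\<lambda>x. g n x - g' x)"
  proof
    fix n
    have "(\<lambda>x. (a * f n x + b * g n x) - (a * f' x + b * g' x)) = (\<lambda>x. a * (f n x - f' x) + b * (g n x - g' x))"
      by (auto simp: algebra_simps)
    then show "norm (L2_norm M (\<lambda>x. (a * f n x + b * g n x) - (a * f' x + b * g' x)))
      \<le> \<bar>a\<bar> * L2_norm M (\<lambda>x. f n x - f' x) + \<bar>b\<bar> * L2_norm M (\<lambda>x. g n x - g' x)"
      using L2_norm_triangle[OF L2_cmult[OF L2_diff[OF f(1,2)]] L2_cmult[OF L2_diff[OF g(1,2)]], of a n b n]
      by (simp add: L2_norm_cmult)
  qed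
  show "(\<lambda>n. \<bar>a\<bar> * L2_norm M (\<lambda>x. f n x - f' x) + \<bar>b\<bar> * L2_norm M (\<lambda>x. g n x - g' x)) \<longlonglongrightarrow> 0"
    using tendsto_add[OF tendsto_mult[OF tendsto_const f(3), of "\<bar>a\<bar>"] tendsto_mult[OF tendsto_const g(3), of "\<bar>b\<bar>"]]
    by simp
qed

lemma L2_integral_tendsto:
  assumes f: "\<And>n. f n \<in> L2 M" "f' \<in> L2 M" "(\<lambda>n. L2_norm M (\<lambda>x. f n x - f' x)) \<longlonglongrightarrow> 0"
    and \<psi>: "\<psi> \<in> L2 M"
  shows "(\<lambda>n. LINT x|M. f n x * \<psi> x) \<longlonglongrightarrow> (LINT x|M. f' x * \<psi> x)"
proof (rule LIM_zero_cancel, rule Lim_null_comparison[OF always_eventually])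
  show "\<forall>n. norm ((LINT x|M. f n x * \<psi> x) - (LINT x|M. f' x * \<psi> x)) \<le> L2_norm M (\<lambda>x. f n x - f' x) * L2_norm M \<psi>"
  proof
    fix n
    have "(LINT x|M. f n x * \<psi> x) - (LINT x|M. f' x * \<psi> x) = (LINT x|M. (f n x - f' x) * \<psi> x)"
      using L2_mult_integrable[OF f(1) \<psi>] L2_mult_integrable[OF f(2) \<psi>] by (simp add: left_diff_distrib)
    then show "norm ((LINT x|M. f n x * \<psi> x) - (LINT x|M. f' x * \<psi> x)) \<le> L2_norm M (\<lambda>x. f n x - f' x) * L2_norm M \<psi>"
      using L2_Cauchy_Schwarz[OF L2_diff[OF f(1,2)] \<psi>] by simp
  qed
  show "(\<lambda>n. L2_norm M (\<lambda>x. f n x - f' x) * L2_norm M \<psi>) \<longlonglongrightarrow> 0"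
    using tendsto_mult[OF f(3) tendsto_const[of "L2_norm M \<psi>"]] by simp
qed

text \<open>Both sides of the defining identity are, for a fixed test function, continuous in the L2
  norm. Completeness of the energy norm rests on this closedness.\<close>

lemma has_weak_deriv_limit:
  assumes u: "\<And>n. u n \<in> L2 (leb L)" "u' \<in> L2 (leb L)" "(\<lambda>n. L2_norm (leb L) (\<lambda>x. u n x - u' x)) \<longlonglongrightarrow> 0"
    and g: "\<And>n. has_weak_deriv (square L) i j (u n) (g n)" "g' \<in> L2 (leb L)"
      "(\<lambda>n. L2_norm (leb L) (\<lambda>x. g n x - g' x)) \<longlonglongrightarrow> 0"
  shows "has_weak_deriv (square L) i j u' g'"
  unfolding has_weak_deriv_def
proof (intro conjI ballI g(2))
  fix \<phi> assume \<phi>: "\<phi> \<in> test_functions (square L)"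
  note t = test_functions_L2_leb[OF \<phi>, of L] test_functions_L2_leb[OF D_test_functions[OF \<phi>, of i j], of L]
  have "(LINT x|leb L. u n x * D i j \<phi> x) = (-1) ^ (i + j) * (LINT x|leb L. g n x * \<phi> x)" for n
    using g(1)[of n] \<phi> by (simp add: has_weak_deriv_def)
  moreover have "(\<lambda>n. LINT x|leb L. u n x * D i j \<phi> x) \<longlonglongrightarrow> (LINT x|leb L. u' x * D i j \<phi> x)"
    by (rule L2_integral_tendsto[OF u t(2)])
  ultimately have "(\<lambda>n. (-1) ^ (i + j) * (LINT x|leb L. g n x * \<phi> x)) \<longlonglongrightarrow> (LINT x|leb L. u' x * D i j \<phi> x)"
    by simp
  moreover have "(\<lambda>n. (-1) ^ (i + j) * (LINT x|leb L. g n x * \<phi> x)) \<longlonglongrightarrow> (-1) ^ (i + j) * (LINT x|leb L. g' x * \<phi> x)"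
    by (intro tendsto_mult tendsto_const L2_integral_tendsto[OF has_weak_deriv_L2[OF g(1)] g(2,3) t(1)])
  ultimately show "(LINT x|leb L. u' x * D i j \<phi> x) = (-1) ^ (i + j) * (LINT x|leb L. g' x * \<phi> x)"
    by (rule LIMSEQ_unique)
qed

lemma sobolev_lincomb:
  assumes u: "u \<in> sobolev m (square L)" and v: "v \<in> sobolev m (square L)"
  shows "(\<lambda>z. a * u z + b * v z) \<in> sobolev m (square L)"
proof -
  have "\<exists>g. has_weak_deriv (square L) i j (\<lambda>z. a * u z + b * v z) g" if "i + j \<le> m" for i j
    using has_weak_deriv_lincomb[OF sobolev_L2[OF u] has_weak_deriv_weak_deriv[OF u that]
        sobolev_L2[OF v] has_weak_deriv_weak_deriv[OF v that]] by blast
  then show ?thesis using L2_lincomb[OF sobolev_L2[OF u] sobolev_L2[OF v]] by (simp add: sobolev_def)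
qed

lemma sobolev_1_weak_derivs:
  assumes "u \<in> sobolev 1 (square L)"
  shows "has_weak_deriv (square L) 1 0 u (weak_deriv (square L) 1 0 u)"
    "has_weak_deriv (square L) 0 1 u (weak_deriv (square L) 0 1 u)"
    "weak_deriv (square L) 1 0 u \<in> L2 (leb L)" "weak_deriv (square L) 0 1 u \<in> L2 (leb L)"
  using has_weak_deriv_weak_deriv[OF assms, of 1 0] has_weak_deriv_weak_deriv[OF assms, of 0 1] has_weak_deriv_L2
  by auto

lemma sobolev_norm_1_bounds:
  assumes "u \<in> L2 (leb L)" "has_weak_deriv (square L) 1 0 u g" "has_weak_deriv (square L) 0 1 u h"
  shows "L2_norm (leb L) u \<le> sobolev_norm 1 (square L) u" "L2_norm (leb L) g \<le> sobolev_norm 1 (square L) u"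
    "L2_norm (leb L) h \<le> sobolev_norm 1 (square L) u"
    "sobolev_norm 1 (square L) u \<le> L2_norm (leb L) u + L2_norm (leb L) g + L2_norm (leb L) h"
  unfolding sobolev_norm_1[OF assms]
proof -
  show "L2_norm (leb L) u \<le> sqrt ((L2_norm (leb L) u)\<^sup>2 + (L2_norm (leb L) g)\<^sup>2 + (L2_norm (leb L) h)\<^sup>2)"
    by (rule real_le_rsqrt) simp
  show "L2_norm (leb L) g \<le> sqrt ((L2_norm (leb L) u)\<^sup>2 + (L2_norm (leb L) g)\<^sup>2 + (L2_norm (leb L) h)\<^sup>2)"
    by (rule real_le_rsqrt) simp
  show "L2_norm (leb L) h \<le> sqrt ((L2_norm (leb L) u)\<^sup>2 + (L2_norm (leb L) g)\<^sup>2 + (L2_norm (leb L) h)\<^sup>2)"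
    by (rule real_le_rsqrt) simp
  have "p\<^sup>2 + q\<^sup>2 + r\<^sup>2 \<le> (p + q + r)\<^sup>2" if "p \<ge> 0" "q \<ge> 0" "r \<ge> 0" for p q r :: real
    using mult_nonneg_nonneg[OF that(1,2)] mult_nonneg_nonneg[OF that(1,3)] mult_nonneg_nonneg[OF that(2,3)]
    by (simp add: power2_eq_square algebra_simps)
  then show "sqrt ((L2_norm (leb L) u)\<^sup>2 + (L2_norm (leb L) g)\<^sup>2 + (L2_norm (leb L) h)\<^sup>2)
      \<le> L2_norm (leb L) u + L2_norm (leb L) g + L2_norm (leb L) h"
    by (intro real_le_lsqrt) auto
qed

text \<open>The factor 3 counts the function and its two first derivatives, each bounded by the same
  combination of norms. The estimate serves convergence to zero, where the factor is
  immaterial.\<close>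

lemma sobolev_norm_1_lincomb_le:
  assumes u: "u \<in> sobolev 1 (square L)" and v: "v \<in> sobolev 1 (square L)"
  shows "sobolev_norm 1 (square L) (\<lambda>z. a * u z + b * v z) \<le>
    3 * (\<bar>a\<bar> * sobolev_norm 1 (square L) u + \<bar>b\<bar> * sobolev_norm 1 (square L) v)"
proof -
  note du = sobolev_1_weak_derivs[OF u] and dv = sobolev_1_weak_derivs[OF v]
  note lu = sobolev_L2[OF u] and lv = sobolev_L2[OF v]
  note bu = sobolev_norm_1_bounds[OF lu du(1,2)] and bv = sobolev_norm_1_bounds[OF lv dv(1,2)]
  have tri: "L2_norm (leb L) (\<lambda>z. a * f z + b * g z) \<le> \<bar>a\<bar> * sobolev_norm 1 (square L) u + \<bar>b\<bar> * sobolev_norm 1 (square L) v"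
    if "f \<in> L2 (leb L)" "g \<in> L2 (leb L)" "L2_norm (leb L) f \<le> sobolev_norm 1 (square L) u"
      "L2_norm (leb L) g \<le> sobolev_norm 1 (square L) v" for f g
  proof -
    have "L2_norm (leb L) (\<lambda>z. a * f z + b * g z) \<le> \<bar>a\<bar> * L2_norm (leb L) f + \<bar>b\<bar> * L2_norm (leb L) g"
      using L2_norm_triangle[OF L2_cmult[OF that(1)] L2_cmult[OF that(2)], of a b] by (simp add: L2_norm_cmult)
    also have "\<dots> \<le> \<bar>a\<bar> * sobolev_norm 1 (square L) u + \<bar>b\<bar> * sobolev_norm 1 (square L) v"
      by (intro add_mono mult_left_mono that) auto
    finally show ?thesis .
  qed
  have "sobolev_norm 1 (square L) (\<lambda>z. a * u z + b * v z) \<le>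
    L2_norm (leb L) (\<lambda>z. a * u z + b * v z)
    + L2_norm (leb L) (\<lambda>z. a * weak_deriv (square L) 1 0 u z + b * weak_deriv (square L) 1 0 v z)
    + L2_norm (leb L) (\<lambda>z. a * weak_deriv (square L) 0 1 u z + b * weak_deriv (square L) 0 1 v z)"
    by (rule sobolev_norm_1_bounds(4)[OF L2_lincomb[OF lu lv] has_weak_deriv_lincomb[OF lu du(1) lv dv(1)]
          has_weak_deriv_lincomb[OF lu du(2) lv dv(2)]])
  also have "\<dots> \<le> 3 * (\<bar>a\<bar> * sobolev_norm 1 (square L) u + \<bar>b\<bar> * sobolev_norm 1 (square L) v)"
  proof -
    have "p + q + r \<le> 3 * Q" if "p \<le> Q" "q \<le> Q" "r \<le> Q" for p q r Q :: real using that by linarith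
    from this[OF tri[OF lu lv bu(1) bv(1)] tri[OF du(3) dv(3) bu(2) bv(2)] tri[OF du(4) dv(4) bu(3) bv(3)]]
    show ?thesis .
  qed
  finally show ?thesis .
qed

lemma sobolev_norm_nonneg: "0 \<le> sobolev_norm m S u"
  unfolding sobolev_norm_def by (intro real_sqrt_ge_zero sum_nonneg) auto

section \<open>Traces on the vertical sides\<close>

text \<open>A function on a vertical side read as a function on the line. It is extended by zero
  because functions on the side are measurable there only, whereas \<open>lseg L\<close> lives on
  the whole line.\<close>

definition vline :: "real \<Rightarrow> real \<Rightarrow> (real \<times> real \<Rightarrow> real) \<Rightarrow> real \<Rightarrow> real" where
  "vline L c t y = (if 0 \<le> y \<and> y \<le> L then t (c, y) else 0)"

lemma integrable_lseg:
  fixes f :: "real \<Rightarrow> real"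
  assumes [measurable]: "f \<in> borel_measurable borel"
  shows "integrable (lseg L) f \<longleftrightarrow> integrable lborel (\<lambda>x. indicator {0<..<L} x * f x)"
proof -
  have "lseg L = density lborel (\<lambda>x. ennreal (indicator {0<..<L} x))"
    unfolding lseg_def by (simp add: ennreal_indicator)
  then show ?thesis by (simp add: integrable_density)
qed

text \<open>The side corresponds to the closed interval and \<open>lseg L\<close> to the open one;
  they differ by two points of measure zero.\<close>

lemma side_measure_integral:
  assumes L: "L > 0" and c: "c = 0 \<or> c = L" and t: "t \<in> borel_measurable (side_measure L c)"
  shows "vline L c t \<in> borel_measurable borel"
    and "integrable (side_measure L c) t \<longleftrightarrow> integrable (lseg L) (vline L c t)"
    and "(LINT z|side_measure L c. t z) = (LINT y|lseg L. vline L c t y)"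
proof -
  let ?S = "side L c" and ?D = "distr lborel borel (\<lambda>y. (c, y))"
  let ?T = "\<lambda>z. indicator ?S z *\<^sub>R t z"
  have "closed ?S" unfolding side_eq[OF L c] by (intro closed_Times) auto
  then have S: "?S \<in> sets borel" by (rule borel_closed)
  have m: "(\<lambda>y. (c, y)) \<in> measurable lborel borel"
    by (simp add: borel_measurable_continuous_onI continuous_on_Pair)
  have T: "?T \<in> borel_measurable borel"
    using t S unfolding side_measure_def by (subst (asm) borel_measurable_restrict_space_iff) auto
  have eq: "?T (c, y) = vline L c t y" for y
    unfolding side_eq[OF L c] vline_def by (auto simp: indicator_def)
  from measurable_compose[OF m T]
  show sm [measurable]: "vline L c t \<in> borel_measurable borel" unfolding eq by simp
  have ae: "AE y in lborel. vline L c t y = indicator {0<..<L} y * vline L c t y"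
    using AE_lborel_singleton[of 0] AE_lborel_singleton[of L]
    by eventually_elim (auto simp: vline_def indicator_def)
  have "integrable (side_measure L c) t \<longleftrightarrow> integrable ?D ?T"
    unfolding side_measure_def using S by (subst integrable_restrict_space) (auto simp: set_integrable_def)
  also have "\<dots> \<longleftrightarrow> integrable lborel (vline L c t)"
    using integrable_distr_eq[OF m T] unfolding eq by simp
  also have "\<dots> \<longleftrightarrow> integrable lborel (\<lambda>y. indicator {0<..<L} y * vline L c t y)"
    by (rule integrable_cong_AE) (use ae in auto)
  finally show "integrable (side_measure L c) t \<longleftrightarrow> integrable (lseg L) (vline L c t)"
    by (simp add: integrable_lseg)
  have "(LINT z|side_measure L c. t z) = (LINT z|?D. ?T z)"
    unfolding side_measure_def using S by (subst integral_restrict_space) auto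
  also have "\<dots> = (LINT y|lborel. vline L c t y)"
    using integral_distr[OF m T] unfolding eq by simp
  also have "\<dots> = (LINT y|lborel. indicator {0<..<L} y * vline L c t y)"
    by (rule integral_cong_AE) (use ae in auto)
  finally show "(LINT z|side_measure L c. t z) = (LINT y|lseg L. vline L c t y)"
    by (simp add: integral_lseg)
qed

lemma L2_side_vline:
  assumes L: "L > 0" and c: "c = 0 \<or> c = L" and t: "t \<in> L2 (side_measure L c)"
  shows "vline L c t \<in> L2 (lseg L)" and "L2_norm (side_measure L c) t = L2_norm (lseg L) (vline L c t)"
proof -
  have tm: "t \<in> borel_measurable (side_measure L c)" by (rule L2_measurable[OF t])
  then have t2: "(\<lambda>z. (t z)\<^sup>2) \<in> borel_measurable (side_measure L c)" by measurable
  have eq: "vline L c (\<lambda>z. (t z)\<^sup>2) = (\<lambda>y. (vline L c t y)\<^sup>2)" by (auto simp: vline_def)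
  note 1 = side_measure_integral[OF L c tm] and 2 = side_measure_integral[OF L c t2, unfolded eq]
  show "vline L c t \<in> L2 (lseg L)"
    using 1(1) 2(2) L2_square_integrable[OF t] by (intro L2I) auto
  show "L2_norm (side_measure L c) t = L2_norm (lseg L) (vline L c t)"
    unfolding L2_norm_def 2(3) ..
qed

lemma vline_diff: "vline L c (\<lambda>x. f x - g x) = (\<lambda>y. vline L c f y - vline L c g y)"
  by (auto simp: vline_def)

lemma continuous_L2_side:
  assumes L: "L > 0" and c: "c = 0 \<or> c = L" and w: "continuous_on (closure (square L)) w"
  shows "w \<in> L2 (side_measure L c)"
proof -
  have S: "side L c = {c} \<times> {0..L}" by (rule side_eq[OF L c])
  have sub: "side L c \<subseteq> closure (square L)" unfolding S closure_square[OF L] using c L by auto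
  have cS: "closed (side L c)" unfolding S by (intro closed_Times) auto
  have w': "continuous_on (side L c) w" using w sub by (rule continuous_on_subset)
  have "w \<in> borel_measurable (restrict_space borel (side L c))"
    by (rule borel_measurable_continuous_on_restrict[OF w'])
  then have m: "w \<in> borel_measurable (side_measure L c)"
    unfolding side_measure_def by (subst measurable_cong_sets[OF sets_restrict_space_cong refl]) auto
  have "compact (w ` side L c)"
    using w' unfolding S by (intro compact_continuous_image compact_Times) auto
  then have "bounded (w ` side L c)" by (rule compact_imp_bounded)
  then obtain B where "\<forall>y\<in>w ` side L c. norm y \<le> B" unfolding bounded_iff by blast
  then have B: "\<bar>w z\<bar> \<le> B" if "z \<in> side L c" for z using that by auto
  have sp: "space (side_measure L c) = side L c"
    by (simp add: side_measure_def space_restrict_space)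
  \<comment> \<open>\<open>measure\<close> assigns 0 to a set of infinite measure, so the positive
    value \<open>L\<close> shows that the side has finite measure.\<close>
  have "measure (side_measure L c) (side L c) = L" using side_length_eq[OF L c] by (simp add: side_length_def)
  then have "emeasure (side_measure L c) (space (side_measure L c)) \<noteq> \<infinity>"
    using L unfolding sp measure_def by (metis enn2real_top infinity_ennreal_def less_irrefl)
  then have "finite_measure (side_measure L c)" by (rule finite_measureI)
  from L2_bounded[OF this m] B sp show ?thesis by blast
qed

lemma has_trace_lincomb:
  assumes L: "L > 0" and c: "c = 0 \<or> c = L" and u: "has_trace L c u t" and v: "has_trace L c v s"
  shows "has_trace L c (\<lambda>z. a * u z + b * v z) (\<lambda>z. a * t z + b * s z)"
proof -
  from u obtain w where u': "u \<in> sobolev 1 (square L)" "t \<in> L2 (side_measure L c)"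
    and w: "\<And>n. w n \<in> sobolev 1 (square L)" "\<And>n. continuous_on (closure (square L)) (w n)"
      "(\<lambda>n. sobolev_norm 1 (square L) (\<lambda>x. w n x - u x)) \<longlonglongrightarrow> 0"
      "(\<lambda>n. L2_norm (side_measure L c) (\<lambda>x. w n x - t x)) \<longlonglongrightarrow> 0"
    unfolding has_trace_def by blast
  from v obtain w' where v': "v \<in> sobolev 1 (square L)" "s \<in> L2 (side_measure L c)"
    and w': "\<And>n. w' n \<in> sobolev 1 (square L)" "\<And>n. continuous_on (closure (square L)) (w' n)"
      "(\<lambda>n. sobolev_norm 1 (square L) (\<lambda>x. w' n x - v x)) \<longlonglongrightarrow> 0"
      "(\<lambda>n. L2_norm (side_measure L c) (\<lambda>x. w' n x - s x)) \<longlonglongrightarrow> 0"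
    unfolding has_trace_def by blast
  let ?w = "\<lambda>n z. a * w n z + b * w' n z"
  have diff: "(\<lambda>z. p z - q z) \<in> sobolev 1 (square L)" if "p \<in> sobolev 1 (square L)" "q \<in> sobolev 1 (square L)" for p q
    using sobolev_lincomb[OF that, of 1 "-1"] by simp
  have "(\<lambda>n. sobolev_norm 1 (square L) (\<lambda>x. ?w n x - (a * u x + b * v x))) \<longlonglongrightarrow> 0"
  proof (rule Lim_null_comparison[OF always_eventually])
    show "\<forall>n. norm (sobolev_norm 1 (square L) (\<lambda>x. ?w n x - (a * u x + b * v x))) \<le>
      3 * (\<bar>a\<bar> * sobolev_norm 1 (square L) (\<lambda>x. w n x - u x) + \<bar>b\<bar> * sobolev_norm 1 (square L) (\<lambda>x. w' n x - v x))"
    proof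
      fix n
      have "(\<lambda>x. ?w n x - (a * u x + b * v x)) = (\<lambda>x. a * (w n x - u x) + b * (w' n x - v x))"
        by (auto simp: algebra_simps)
      then show "norm (sobolev_norm 1 (square L) (\<lambda>x. ?w n x - (a * u x + b * v x))) \<le>
        3 * (\<bar>a\<bar> * sobolev_norm 1 (square L) (\<lambda>x. w n x - u x) + \<bar>b\<bar> * sobolev_norm 1 (square L) (\<lambda>x. w' n x - v x))"
        using sobolev_norm_1_lincomb_le[OF diff[OF w(1) u'(1)] diff[OF w'(1) v'(1)], of a n b n]
        by (simp add: sobolev_norm_nonneg)
    qed
    show "(\<lambda>n. 3 * (\<bar>a\<bar> * sobolev_norm 1 (square L) (\<lambda>x. w n x - u x) + \<bar>b\<bar> * sobolev_norm 1 (square L) (\<lambda>x. w' n x - v x))) \<longlonglongrightarrow> 0"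
      using tendsto_mult[OF tendsto_const[of 3] tendsto_add[OF tendsto_mult[OF tendsto_const w(3), of "\<bar>a\<bar>"]
          tendsto_mult[OF tendsto_const w'(3), of "\<bar>b\<bar>"]]] by simp
  qed
  moreover have "(\<lambda>n. L2_norm (side_measure L c) (\<lambda>x. ?w n x - (a * t x + b * s x))) \<longlonglongrightarrow> 0"
    by (rule L2_norm_tendsto_lincomb[OF continuous_L2_side[OF L c w(2)] u'(2) w(4) continuous_L2_side[OF L c w'(2)] v'(2) w'(4)])
  moreover have "continuous_on (closure (square L)) (?w n)" "?w n \<in> sobolev 1 (square L)" for n
    by (intro continuous_intros w w') (rule sobolev_lincomb[OF w(1) w'(1)])
  ultimately show ?thesis unfolding has_trace_def
    by (intro conjI exI[of _ ?w] allI sobolev_lincomb[OF u'(1) v'(1)] L2_lincomb[OF u'(2) v'(2)])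
qed

text \<open>The graph of the trace is a closure and hence closed: for each \<open>n\<close> a
  continuous approximant of \<open>u n\<close> is chosen that is within \<open>1/(n+1)\<close> both
  in the Sobolev norm and on the side.\<close>

lemma has_trace_limit:
  assumes L: "L > 0" and c: "c = 0 \<or> c = L"
    and u: "\<And>n. has_trace L c (u n) (t n)" and u': "u' \<in> sobolev 1 (square L)" and t': "t' \<in> L2 (side_measure L c)"
    and cu: "(\<lambda>n. sobolev_norm 1 (square L) (\<lambda>x. u n x - u' x)) \<longlonglongrightarrow> 0"
    and ct: "(\<lambda>n. L2_norm (side_measure L c) (\<lambda>x. t n x - t' x)) \<longlonglongrightarrow> 0"
  shows "has_trace L c u' t'"
proof -
  let ?e = "\<lambda>n. inverse (real (Suc n))"
  have us: "u n \<in> sobolev 1 (square L)" and ts: "t n \<in> L2 (side_measure L c)" for n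
    using u[of n] by (auto simp: has_trace_def)
  have "\<exists>w. w \<in> sobolev 1 (square L) \<and> continuous_on (closure (square L)) w \<and>
    sobolev_norm 1 (square L) (\<lambda>x. w x - u n x) < ?e n \<and> L2_norm (side_measure L c) (\<lambda>x. w x - t n x) < ?e n" for n
  proof -
    from u[of n] obtain w where
      w: "\<And>m. w m \<in> sobolev 1 (square L)" "\<And>m. continuous_on (closure (square L)) (w m)"
      "(\<lambda>m. sobolev_norm 1 (square L) (\<lambda>x. w m x - u n x)) \<longlonglongrightarrow> 0"
      "(\<lambda>m. L2_norm (side_measure L c) (\<lambda>x. w m x - t n x)) \<longlonglongrightarrow> 0"
      unfolding has_trace_def by blast
    have "?e n > 0" by simp
    then have "\<forall>\<^sub>F m in sequentially. sobolev_norm 1 (square L) (\<lambda>x. w m x - u n x) < ?e n \<and>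
        L2_norm (side_measure L c) (\<lambda>x. w m x - t n x) < ?e n"
      using order_tendstoD(2)[OF w(3)] order_tendstoD(2)[OF w(4)] by (simp add: eventually_conj)
    then show ?thesis using w(1,2) unfolding eventually_sequentially by blast
  qed
  then obtain w where w: "\<And>n. w n \<in> sobolev 1 (square L)" "\<And>n. continuous_on (closure (square L)) (w n)"
    "\<And>n. sobolev_norm 1 (square L) (\<lambda>x. w n x - u n x) < ?e n"
    "\<And>n. L2_norm (side_measure L c) (\<lambda>x. w n x - t n x) < ?e n" by metis
  have diff: "(\<lambda>z. p z - q z) \<in> sobolev 1 (square L)" if "p \<in> sobolev 1 (square L)" "q \<in> sobolev 1 (square L)" for p q
    using sobolev_lincomb[OF that, of 1 "-1"] by simp
  have e0: "?e \<longlonglongrightarrow> 0" by (rule LIMSEQ_inverse_real_of_nat)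
  have "(\<lambda>n. sobolev_norm 1 (square L) (\<lambda>x. w n x - u' x)) \<longlonglongrightarrow> 0"
  proof (rule Lim_null_comparison[OF always_eventually])
    show "\<forall>n. norm (sobolev_norm 1 (square L) (\<lambda>x. w n x - u' x)) \<le>
      3 * (?e n + sobolev_norm 1 (square L) (\<lambda>x. u n x - u' x))"
    proof
      fix n
      show "norm (sobolev_norm 1 (square L) (\<lambda>x. w n x - u' x)) \<le> 3 * (?e n + sobolev_norm 1 (square L) (\<lambda>x. u n x - u' x))"
        using sobolev_norm_1_lincomb_le[OF diff[OF w(1) us] diff[OF us u'], of 1 n n 1 n] w(3)[of n]
        by (simp add: sobolev_norm_nonneg)
    qed
    show "(\<lambda>n. 3 * (?e n + sobolev_norm 1 (square L) (\<lambda>x. u n x - u' x))) \<longlonglongrightarrow> 0"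
      using tendsto_mult[OF tendsto_const[of 3] tendsto_add[OF e0 cu]] by simp
  qed
  moreover have "(\<lambda>n. L2_norm (side_measure L c) (\<lambda>x. w n x - t' x)) \<longlonglongrightarrow> 0"
  proof (rule Lim_null_comparison[OF always_eventually])
    show "\<forall>n. norm (L2_norm (side_measure L c) (\<lambda>x. w n x - t' x)) \<le> ?e n + L2_norm (side_measure L c) (\<lambda>x. t n x - t' x)"
    proof
      fix n
      show "norm (L2_norm (side_measure L c) (\<lambda>x. w n x - t' x)) \<le> ?e n + L2_norm (side_measure L c) (\<lambda>x. t n x - t' x)"
        using L2_norm_triangle_diff[OF continuous_L2_side[OF L c w(2)] ts t', of n n] w(4)[of n] by simp
    qed
    show "(\<lambda>n. ?e n + L2_norm (side_measure L c) (\<lambda>x. t n x - t' x)) \<longlonglongrightarrow> 0"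
      using tendsto_add[OF e0 ct] by simp
  qed
  ultimately show ?thesis unfolding has_trace_def using u' t' w by blast
qed

text \<open>The function is its own approximating sequence. This is how the interpolant is
  recognised as a member of the space.\<close>

lemma has_trace_continuous:
  assumes L: "L > 0" and c: "c = 0 \<or> c = L" and w: "w \<in> sobolev 1 (square L)" "continuous_on (closure (square L)) w"
    and eq: "\<And>y. 0 \<le> y \<Longrightarrow> y \<le> L \<Longrightarrow> w (c, y) = k"
  shows "has_trace L c w (\<lambda>_. k)"
proof -
  have 0: "sobolev_norm 1 (square L) (\<lambda>x. w x - w x) = 0"
    using sobolev_norm_1_lincomb_le[OF w(1) w(1), of 0 0] sobolev_norm_nonneg[of 1 "square L" "\<lambda>_. 0"] by simp
  have k: "(\<lambda>_. k) \<in> L2 (side_measure L c)" by (rule continuous_L2_side[OF L c]) simp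
  have "(\<lambda>x. w x - k) \<in> L2 (side_measure L c)" by (intro L2_diff continuous_L2_side[OF L c w(2)] k)
  from L2_side_vline(2)[OF L c this] have "L2_norm (side_measure L c) (\<lambda>x. w x - k) = L2_norm (lseg L) (\<lambda>_. 0)"
    using eq by (simp add: vline_def[abs_def] cong: if_cong)
  then have "L2_norm (side_measure L c) (\<lambda>x. w x - k) = 0" by (simp add: L2_norm_def)
  then show ?thesis unfolding has_trace_def using w k 0 by (intro conjI exI[of _ "\<lambda>_. w"]) auto
qed

lemma AE_lseg_ex:
  assumes P: "AE x in lseg L. P x" and ab: "0 \<le> a" "a < b" "b \<le> L"
  shows "\<exists>x. a < x \<and> x < b \<and> P x"
proof (rule ccontr)
  assume no: "\<not> ?thesis"
  have "AE x in lborel. x \<notin> {a<..<b}"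
    using P unfolding AE_lseg by eventually_elim (use no ab in auto)
  then have "emeasure lborel {a<..<b} = 0"
    by (subst (asm) AE_iff_measurable[of "{a<..<b}"]) auto
  then show False using ab by simp
qed

lemma AE_lseg_const:
  assumes "AE x in lseg L. P" "L > 0"
  shows P
  using AE_lseg_ex[OF assms(1), of 0 L] assms(2) by auto


section \<open>Boundary values of the representation by primitives\<close>

lemma primx_at_0:
  assumes [measurable]: "g \<in> borel_measurable (borel \<Otimes>\<^sub>M borel)"
  shows "primx L g (0, y) = 0"
proof -
  have "(LINT s|lseg L. (if s < 0 then g (s, y) else 0)) = (LINT s|lseg L. 0)"
  proof (rule integral_cong_AE)
    show "AE s in lseg L. (if s < 0 then g (s, y) else 0) = 0"
      using AE_lseg_in[of L] by eventually_elim simp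
  qed measurable
  then show ?thesis by (simp add: primx_Pair)
qed

lemma primx_tendsto:
  assumes g: "integrable (lseg L) (\<lambda>s. g (s, y))" and [measurable]: "g \<in> borel_measurable (borel \<Otimes>\<^sub>M borel)"
    and x: "x \<longlonglongrightarrow> X"
  shows "(\<lambda>n. primx L g (x n, y)) \<longlonglongrightarrow> primx L g (X, y)"
  unfolding primx_Pair
proof (rule integral_dominated_convergence[where w = "\<lambda>s. \<bar>g (s, y)\<bar>"])
  show "integrable (lseg L) (\<lambda>s. \<bar>g (s, y)\<bar>)" using g by simp
  have "AE s in lborel. s \<noteq> X" by (rule AE_lborel_singleton)
  then have "AE s in lseg L. s \<noteq> X" unfolding AE_lseg by eventually_elim simp
  then show "AE s in lseg L. (\<lambda>n. if s < x n then g (s, y) else 0) \<longlonglongrightarrow> (if s < X then g (s, y) else 0)"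
  proof eventually_elim
    case (elim s)
    have "\<forall>\<^sub>F n in sequentially. (if s < x n then g (s, y) else 0) = (if s < X then g (s, y) else 0)"
    proof (cases "s < X")
      case True
      from order_tendstoD(1)[OF x this] show ?thesis by eventually_elim (use True in simp)
    next
      case False
      then have "X < s" using elim by simp
      from order_tendstoD(2)[OF x this] show ?thesis by eventually_elim (use \<open>X < s\<close> in simp)
    qed
    then show ?case by (simp add: tendsto_eventually)
  qed
  show "AE s in lseg L. norm (if s < x n then g (s, y) else 0) \<le> \<bar>g (s, y)\<bar>" for n by simp
qed measurable

text \<open>On almost every line the representation holds at almost every point, hence at some
  sequence of points converging to the endpoint. Along it the left side converges by continuity of
  \<open>w\<close> and the right side by continuity of the primitive.\<close>

lemma AE_boundary_value_continuous:
  assumes L: "L > 0" and X: "X = 0 \<or> X = L" and w: "continuous_on (closure (square L)) w"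
    and g: "g \<in> L2 (lsq L)" and eq: "AE z in lsq L. w z = c (snd z) + primx L g z"
  shows "AE y in lseg L. w (X, y) = c y + primx L g (X, y)"
proof -
  have [measurable]: "g \<in> borel_measurable (borel \<Otimes>\<^sub>M borel)" using L2_measurable[OF g] by simp
  show ?thesis
    using AE_lsq_yx[OF eq] L2_lsq_sections[OF g] AE_lseg_in[of L]
  proof eventually_elim
    case (elim y)
    have "\<exists>x. 0 < x \<and> x < L \<and> \<bar>x - X\<bar> \<le> L * inverse (real (Suc n)) \<and> w (x, y) = c y + primx L g (x, y)" for n
    proof -
      define e where "e = L * inverse (real (Suc n))"
      have e: "0 < e" "e \<le> L" unfolding e_def using L by (auto simp: field_simps)
      have "\<exists>x. 0 < x \<and> x < L \<and> \<bar>x - X\<bar> \<le> e \<and> w (x, y) = c y + primx L g (x, y)"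
      proof (cases "X = 0")
        case True
        obtain x where "0 < x" "x < e" "w (x, y) = c y + primx L g (x, y)"
          using AE_lseg_ex[OF elim(1), of 0 e] e by auto
        then show ?thesis using True e by (intro exI[of _ x]) auto
      next
        case False
        then have "X = L" using X by simp
        obtain x where "L - e < x" "x < L" "w (x, y) = c y + primx L g (x, y)"
          using AE_lseg_ex[OF elim(1), of "L - e" L] e by auto
        then show ?thesis using \<open>X = L\<close> e by (intro exI[of _ x]) auto
      qed
      then show ?thesis unfolding e_def .
    qed
    then obtain x where x: "\<And>n. 0 < x n" "\<And>n. x n < L" "\<And>n. \<bar>x n - X\<bar> \<le> L * inverse (real (Suc n))"
      "\<And>n. w (x n, y) = c y + primx L g (x n, y)" by metis
    have xX: "x \<longlonglongrightarrow> X"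
    proof (rule LIM_zero_cancel, rule Lim_null_comparison[OF always_eventually])
      show "\<forall>n. norm (x n - X) \<le> L * inverse (real (Suc n))" using x(3) by simp
      show "(\<lambda>n. L * inverse (real (Suc n))) \<longlonglongrightarrow> 0"
        using tendsto_mult[OF tendsto_const LIMSEQ_inverse_real_of_nat, of L] by simp
    qed
    have "(\<lambda>n. w (x n, y)) \<longlonglongrightarrow> w (X, y)"
    proof (rule continuous_on_tendsto_compose[OF w])
      show "(\<lambda>n. (x n, y)) \<longlonglongrightarrow> (X, y)" by (intro tendsto_Pair xX tendsto_const)
      show "(X, y) \<in> closure (square L)" using X L elim unfolding closure_square[OF L] by auto
      show "\<forall>\<^sub>F n in sequentially. (x n, y) \<in> closure (square L)"
        using x elim unfolding closure_square[OF L] by (auto intro!: always_eventually less_imp_le)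
    qed
    moreover have "(\<lambda>n. w (x n, y)) \<longlonglongrightarrow> c y + primx L g (X, y)"
      unfolding x(4) by (intro tendsto_add tendsto_const primx_tendsto[OF lseg_integrable[OF elim(2)] _ xX]) measurable
    ultimately show ?case by (rule LIMSEQ_unique)
  qed
qed

lemma L2_lsq_snd_imp:
  assumes "(\<lambda>z. f (snd z)) \<in> L2 (lsq L)" "f \<in> borel_measurable borel" "L > 0"
  shows "f \<in> L2 (lseg L)"
proof (rule L2I)
  have "integrable (lseg L) (\<lambda>y. LINT x|lseg L. (f (snd (x, y)))\<^sup>2)"
    by (rule integral_lsq_yx(3)[OF L2_square_integrable[OF assms(1)]])
  then show "integrable (lseg L) (\<lambda>y. (f y)\<^sup>2)" using assms(3) by (simp add: measure_lseg)
  show "f \<in> borel_measurable (lseg L)" using assms(2) by simp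
qed

lemma L2_norm_leb_lsq:
  assumes "u \<in> L2 (leb L)" "u' \<in> L2 (lsq L)" "AE z in lsq L. u z = u' z"
  shows "L2_norm (leb L) u = L2_norm (lsq L) u'"
proof -
  have "L2_norm (leb L) u = L2_norm (leb L) u'"
    by (rule L2_norm_cong_AE) (use assms in \<open>auto simp: AE_leb intro: L2_measurable L2_lsq_imp\<close>)
  also have "\<dots> = L2_norm (lsq L) u'"
    by (rule L2_norm_lebesgue_on_square) (use L2_measurable[OF assms(2)] in simp)
  finally show ?thesis .
qed

text \<open>A trace inequality. The boundary value at \<open>X\<close> is \<open>u\<close> minus the
  primitive at \<open>x\<close> plus the primitive at \<open>X\<close>; read on the square, each
  primitive costs \<open>L\<close> times the norm of \<open>g\<close>. The factor
  \<open>sqrt L\<close> arises because a function of \<open>y\<close> alone is spread over the width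
  of the square.\<close>

lemma boundary_value_L2:
  assumes L: "L > 0" and g: "g \<in> L2 (lsq L)" and c: "c \<in> L2 (lseg L)"
    and u: "u \<in> L2 (leb L)" and eq: "AE z in lsq L. u z = c (snd z) + primx L g z"
  shows "(\<lambda>y. c y + primx L g (X, y)) \<in> L2 (lseg L)"
    and "sqrt L * L2_norm (lseg L) (\<lambda>y. c y + primx L g (X, y)) \<le> L2_norm (leb L) u + 2 * L * L2_norm (lsq L) g"
proof -
  have [measurable]: "g \<in> borel_measurable (borel \<Otimes>\<^sub>M borel)" "c \<in> borel_measurable borel"
    using L2_measurable[OF g] L2_measurable[OF c] by auto
  have e: "(\<lambda>z. primx L g (X, snd z)) \<in> L2 (lsq L)" "L2_norm (lsq L) (\<lambda>z. primx L g (X, snd z)) \<le> L * L2_norm (lsq L) g"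
    using L2_primx_at[OF g L, of "\<lambda>_. X"] by simp_all
  note cs = L2_lsq_snd[OF c L] and p = L2_primx[OF g L]
  have b: "(\<lambda>z. c (snd z) + primx L g (X, snd z)) \<in> L2 (lsq L)" by (rule L2_add[OF cs e(1)])
  have mb: "(\<lambda>y. c y + primx L g (X, y)) \<in> borel_measurable borel" by measurable
  show bl: "(\<lambda>y. c y + primx L g (X, y)) \<in> L2 (lseg L)"
    by (rule L2_lsq_snd_imp[OF b mb L])
  have u': "(\<lambda>z. c (snd z) + primx L g z) \<in> L2 (lsq L)" by (rule L2_add[OF cs p(1)])
  have um: "L2_norm (lsq L) (\<lambda>z. c (snd z) + primx L g z) = L2_norm (leb L) u"
    by (rule L2_norm_leb_lsq[OF u u' eq, symmetric])
  have "sqrt L * L2_norm (lseg L) (\<lambda>y. c y + primx L g (X, y)) = L2_norm (lsq L) (\<lambda>z. c (snd z) + primx L g (X, snd z))"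
    using L2_norm_lsq_snd[OF bl L] by simp
  also have "\<dots> = L2_norm (lsq L) (\<lambda>z. ((c (snd z) + primx L g z) + (- 1) * primx L g z) + primx L g (X, snd z))"
    by simp
  also have "\<dots> \<le> L2_norm (lsq L) (\<lambda>z. (c (snd z) + primx L g z) + (- 1) * primx L g z) + L2_norm (lsq L) (\<lambda>z. primx L g (X, snd z))"
    by (rule L2_norm_triangle[OF L2_add[OF u' L2_cmult[OF p(1)]] e(1)])
  also have "\<dots> \<le> (L2_norm (lsq L) (\<lambda>z. c (snd z) + primx L g z) + L2_norm (lsq L) (\<lambda>z. (- 1) * primx L g z)) + L * L2_norm (lsq L) g"
    by (intro add_mono L2_norm_triangle[OF u' L2_cmult[OF p(1)]] e(2))
  also have "\<dots> \<le> (L2_norm (leb L) u + L * L2_norm (lsq L) g) + L * L2_norm (lsq L) g"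
    using p(2) unfolding um L2_norm_cmult by simp
  finally show "sqrt L * L2_norm (lseg L) (\<lambda>y. c y + primx L g (X, y)) \<le> L2_norm (leb L) u + 2 * L * L2_norm (lsq L) g"
    by simp
qed

lemma primx_diff:
  assumes "integrable (lseg L) (\<lambda>s. g (s, y))" "integrable (lseg L) (\<lambda>s. h (s, y))"
  shows "primx L (\<lambda>z. g z - h z) (x, y) = primx L g (x, y) - primx L h (x, y)"
proof -
  have "(LINT s|lseg L. (if s < x then g (s, y) - h (s, y) else 0)) =
    (LINT s|lseg L. (if s < x then g (s, y) else 0) - (if s < x then h (s, y) else 0))"
    by (rule Bochner_Integration.integral_cong) auto
  then show ?thesis using integrable_if_less[OF assms(1)] integrable_if_less[OF assms(2)] by (simp add: primx_Pair)
qed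

lemma sobolev_diff:
  "u \<in> sobolev m (square L) \<Longrightarrow> v \<in> sobolev m (square L) \<Longrightarrow> (\<lambda>z. u z - v z) \<in> sobolev m (square L)"
  using sobolev_lincomb[of u m L v 1 "-1"] by simp

text \<open>Applied to the difference of a continuous approximant and \<open>u\<close>, the trace
  inequality shows that the boundary values of the approximants converge to that of the
  representation. They also converge to \<open>t\<close> by definition, and L2 limits are
  unique.\<close>

lemma has_trace_AE_eq:
  assumes L: "L > 0" and X: "X = 0 \<or> X = L" and tr: "has_trace L X u t"
    and w: "has_weak_deriv (square L) 1 0 u g0" and g: "g \<in> L2 (lsq L)" "AE z in lsq L. g0 z = g z"
    and c: "c \<in> L2 (lseg L)" and eq: "AE z in lsq L. u z = c (snd z) + primx L g z"
  shows "AE y in lseg L. t (X, y) = c y + primx L g (X, y)"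
proof -
  from tr obtain v where u: "u \<in> sobolev 1 (square L)" and t: "t \<in> L2 (side_measure L X)"
    and v: "\<And>n. v n \<in> sobolev 1 (square L)" "\<And>n. continuous_on (closure (square L)) (v n)"
      "(\<lambda>n. sobolev_norm 1 (square L) (\<lambda>x. v n x - u x)) \<longlonglongrightarrow> 0"
      "(\<lambda>n. L2_norm (side_measure L X) (\<lambda>x. v n x - t x)) \<longlonglongrightarrow> 0"
    unfolding has_trace_def by blast
  let ?b = "\<lambda>y. c y + primx L g (X, y)"
  have bL2: "?b \<in> L2 (lseg L)" by (rule boundary_value_L2(1)[OF L g(1) c sobolev_L2[OF u] eq])
  have sv: "vline L X (v n) \<in> L2 (lseg L)" for n by (rule L2_side_vline(1)[OF L X continuous_L2_side[OF L X v(2)]])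
  have st: "vline L X t \<in> L2 (lseg L)" by (rule L2_side_vline(1)[OF L X t])
  have bound: "sqrt L * L2_norm (lseg L) (\<lambda>y. vline L X (v n) y - ?b y) \<le> (1 + 2 * L) * sobolev_norm 1 (square L) (\<lambda>x. v n x - u x)" for n
  proof -
    note dv = sobolev_1_weak_derivs[OF v(1)[of n]]
    obtain h where h: "h \<in> L2 (lsq L)" "AE z in lsq L. weak_deriv (square L) 1 0 (v n) z = h z"
      using ex_L2_borel_version[OF dv(3)] by blast
    obtain d where d: "d \<in> L2 (lseg L)" "AE z in lsq L. v n z = d (snd z) + primx L h z"
      using has_weak_deriv_x_imp_ac[OF sobolev_L2[OF v(1)] dv(1) L h] by blast
    have bv: "AE y in lseg L. v n (X, y) = d y + primx L h (X, y)"
      by (rule AE_boundary_value_continuous[OF L X v(2) h(1) d(2)])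
    have pd: "AE y in lseg L. \<forall>x. primx L (\<lambda>z. h z - g z) (x, y) = primx L h (x, y) - primx L g (x, y)"
      using L2_lsq_sections[OF h(1)] L2_lsq_sections[OF g(1)]
      by eventually_elim (intro allI primx_diff lseg_integrable)
    have deq: "AE z in lsq L. v n z - u z = (d (snd z) - c (snd z)) + primx L (\<lambda>z. h z - g z) z"
      using d(2) eq AE_lsq_snd[OF pd]
    proof eventually_elim
      case (elim z)
      have "primx L (\<lambda>z. h z - g z) z = primx L h z - primx L g z"
        using elim(3)[rule_format, of "fst z"] by simp
      then show ?case using elim by simp
    qed
    have dL: "(\<lambda>z. v n z - u z) \<in> L2 (leb L)" by (rule L2_diff[OF sobolev_L2[OF v(1)] sobolev_L2[OF u]])
    have wd: "has_weak_deriv (square L) 1 0 (\<lambda>z. v n z - u z) (\<lambda>z. weak_deriv (square L) 1 0 (v n) z - g0 z)"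
      using has_weak_deriv_lincomb[OF sobolev_L2[OF v(1)] dv(1) sobolev_L2[OF u] w, of 1 "-1"] by simp
    have wy: "has_weak_deriv (square L) 0 1 (\<lambda>z. v n z - u z) (weak_deriv (square L) 0 1 (\<lambda>z. v n z - u z))"
      using sobolev_1_weak_derivs(2)[OF sobolev_diff[OF v(1) u]] .
    note nb = sobolev_norm_1_bounds[OF dL wd wy]
    have hg: "L2_norm (leb L) (\<lambda>z. weak_deriv (square L) 1 0 (v n) z - g0 z) = L2_norm (lsq L) (\<lambda>z. h z - g z)"
    proof (rule L2_norm_leb_lsq)
      show "(\<lambda>z. weak_deriv (square L) 1 0 (v n) z - g0 z) \<in> L2 (leb L)"
        by (intro L2_diff dv has_weak_deriv_L2[OF w])
      show "(\<lambda>z. h z - g z) \<in> L2 (lsq L)" by (intro L2_diff h g)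
      show "AE z in lsq L. weak_deriv (square L) 1 0 (v n) z - g0 z = h z - g z"
        using h(2) g(2) by eventually_elim simp
    qed
    have "L2_norm (lseg L) (\<lambda>y. vline L X (v n) y - ?b y) = L2_norm (lseg L) (\<lambda>y. (d y - c y) + primx L (\<lambda>z. h z - g z) (X, y))"
    proof (rule L2_norm_cong_AE)
      show "AE y in lseg L. vline L X (v n) y - ?b y = (d y - c y) + primx L (\<lambda>z. h z - g z) (X, y)"
        using bv pd AE_lseg_in[of L] by eventually_elim (simp add: vline_def)
      show "(\<lambda>y. vline L X (v n) y - ?b y) \<in> borel_measurable (lseg L)" by (rule L2_measurable[OF L2_diff[OF sv bL2]])
      show "(\<lambda>y. (d y - c y) + primx L (\<lambda>z. h z - g z) (X, y)) \<in> borel_measurable (lseg L)"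
        by (rule L2_measurable[OF boundary_value_L2(1)[OF L L2_diff[OF h(1) g(1)] L2_diff[OF d(1) c] dL deq]])
    qed
    then have "sqrt L * L2_norm (lseg L) (\<lambda>y. vline L X (v n) y - ?b y) \<le> L2_norm (leb L) (\<lambda>z. v n z - u z) + 2 * L * L2_norm (lsq L) (\<lambda>z. h z - g z)"
      using boundary_value_L2(2)[OF L L2_diff[OF h(1) g(1)] L2_diff[OF d(1) c] dL deq, of X] by simp
    also have "\<dots> \<le> sobolev_norm 1 (square L) (\<lambda>x. v n x - u x) + 2 * L * sobolev_norm 1 (square L) (\<lambda>x. v n x - u x)"
      using nb(1,2) L hg by (intro add_mono mult_left_mono) auto
    finally show ?thesis by (simp add: algebra_simps)
  qed
  have "(\<lambda>n. L2_norm (lseg L) (\<lambda>y. vline L X (v n) y - ?b y)) \<longlonglongrightarrow> 0"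
  proof (rule Lim_null_comparison[OF always_eventually])
    show "\<forall>n. norm (L2_norm (lseg L) (\<lambda>y. vline L X (v n) y - ?b y)) \<le> (1 + 2 * L) / sqrt L * sobolev_norm 1 (square L) (\<lambda>x. v n x - u x)"
      using bound L by (simp add: field_simps)
    show "(\<lambda>n. (1 + 2 * L) / sqrt L * sobolev_norm 1 (square L) (\<lambda>x. v n x - u x)) \<longlonglongrightarrow> 0"
      by (rule tendsto_mult_right_zero[OF v(3)])
  qed
  moreover have "(\<lambda>n. L2_norm (lseg L) (\<lambda>y. vline L X (v n) y - vline L X t y)) \<longlonglongrightarrow> 0"
    using v(4) L2_side_vline(2)[OF L X L2_diff[OF continuous_L2_side[OF L X v(2)] t]] by (simp add: vline_diff)
  ultimately have "AE y in lseg L. vline L X t y = ?b y"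
    by (intro L2_norm_tendsto_limits_AE_eq[OF sv st bL2])
  then show ?thesis using AE_lseg_in[of L] by eventually_elim (simp add: vline_def)
qed

section \<open>The space with a floating constant\<close>

definition tr0 :: "real \<Rightarrow> (real \<times> real \<Rightarrow> real) \<Rightarrow> real" where
  "tr0 L u = (SOME k. has_trace L 0 u (\<lambda>_. k))"

lemma Vc_trace:
  assumes "u \<in> Vc L"
  shows "has_trace L 0 u (\<lambda>_. tr0 L u)" "has_trace L L u (\<lambda>_. 0)" "u \<in> sobolev 1 (square L)"
  using assms unfolding Vc_def tr0_def by (auto intro: someI)

text \<open>Both traces equal the left boundary value of one and the same representation of
  \<open>u\<close>. In particular the constant selected by \<open>tr0\<close> is unique.\<close>

lemma has_trace_const_AE:
  assumes L: "L > 0" and u: "has_trace L 0 u t" and k: "has_trace L 0 u (\<lambda>_. k)"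
  shows "AE y in lseg L. t (0, y) = k"
proof -
  have us: "u \<in> sobolev 1 (square L)" using u by (simp add: has_trace_def)
  note d = sobolev_1_weak_derivs[OF us]
  obtain g where g: "g \<in> L2 (lsq L)" "AE z in lsq L. weak_deriv (square L) 1 0 u z = g z"
    using ex_L2_borel_version[OF d(3)] by blast
  obtain c where c: "c \<in> L2 (lseg L)" "AE z in lsq L. u z = c (snd z) + primx L g z"
    using has_weak_deriv_x_imp_ac[OF sobolev_L2[OF us] d(1) L g] by blast
  have "AE y in lseg L. t (0, y) = c y + primx L g (0, y)" "AE y in lseg L. k = c y + primx L g (0, y)"
    using has_trace_AE_eq[OF L _ u d(1) g c] has_trace_AE_eq[OF L _ k d(1) g c] by simp_all
  then show ?thesis by eventually_elim simp
qed

lemma tr0_eqI: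
  assumes L: "L > 0" and k: "has_trace L 0 u (\<lambda>_. k)"
  shows "tr0 L u = k"
proof -
  have "has_trace L 0 u (\<lambda>_. tr0 L u)" unfolding tr0_def using k by (rule someI)
  from AE_lseg_const[OF has_trace_const_AE[OF L this k] L] show ?thesis .
qed

lemma VcI:
  "has_trace L 0 u (\<lambda>_. k) \<Longrightarrow> has_trace L L u (\<lambda>_. 0) \<Longrightarrow> u \<in> Vc L"
  unfolding Vc_def has_trace_def by blast

lemma Vc_lincomb:
  assumes L: "L > 0" and u: "u \<in> Vc L" and v: "v \<in> Vc L"
  shows "(\<lambda>z. a * u z + b * v z) \<in> Vc L" "tr0 L (\<lambda>z. a * u z + b * v z) = a * tr0 L u + b * tr0 L v"
proof -
  note t0 = has_trace_lincomb[OF L _ Vc_trace(1)[OF u] Vc_trace(1)[OF v], of a b, simplified]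
  note tL = has_trace_lincomb[OF L _ Vc_trace(2)[OF u] Vc_trace(2)[OF v], of a b, simplified]
  show "(\<lambda>z. a * u z + b * v z) \<in> Vc L" by (rule VcI[OF t0 tL])
  show "tr0 L (\<lambda>z. a * u z + b * v z) = a * tr0 L u + b * tr0 L v" by (rule tr0_eqI[OF L t0])
qed

text \<open>At the left side the primitive vanishes, so the trace there is \<open>c\<close> itself
  and \<open>c\<close> is the trace constant almost everywhere. The zero trace on the right side is
  then a relation between this constant and the full integral of \<open>g\<close> along the
  line.\<close>

lemma Vc_repr:
  assumes L: "L > 0" and u: "u \<in> Vc L" and g: "g \<in> L2 (lsq L)" "AE z in lsq L. weak_deriv (square L) 1 0 u z = g z"
  shows "AE z in lsq L. u z = tr0 L u + primx L g z" "AE y in lseg L. tr0 L u + primx L g (L, y) = 0"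
proof -
  note us = Vc_trace(3)[OF u]
  note d = sobolev_1_weak_derivs[OF us]
  have [measurable]: "g \<in> borel_measurable (borel \<Otimes>\<^sub>M borel)" using L2_measurable[OF g(1)] by simp
  obtain c where c: "c \<in> L2 (lseg L)" "AE z in lsq L. u z = c (snd z) + primx L g z"
    using has_weak_deriv_x_imp_ac[OF sobolev_L2[OF us] d(1) L g] by blast
  have "AE y in lseg L. tr0 L u = c y + primx L g (0, y)"
    using has_trace_AE_eq[OF L _ Vc_trace(1)[OF u] d(1) g c] by simp
  then have ck: "AE y in lseg L. c y = tr0 L u" by eventually_elim (simp add: primx_at_0)
  show "AE z in lsq L. u z = tr0 L u + primx L g z"
    using c(2) AE_lsq_snd[OF ck] by eventually_elim simp
  have "AE y in lseg L. 0 = c y + primx L g (L, y)"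
    using has_trace_AE_eq[OF L _ Vc_trace(2)[OF u] d(1) g c] by simp
  then show "AE y in lseg L. tr0 L u + primx L g (L, y) = 0"
    using ck by eventually_elim simp
qed

text \<open>By the representation \<open>u\<close> is a constant plus the primitive of its
  derivative. The constant has norm \<open>L\<close> times its absolute value, as the square has
  area \<open>L^2\<close>.\<close>

lemma Vc_poincare:
  assumes L: "L > 0" and u: "u \<in> Vc L"
  shows "L2_norm (leb L) u \<le> L * \<bar>tr0 L u\<bar> + L * L2_norm (leb L) (weak_deriv (square L) 1 0 u)"
proof -
  note us = Vc_trace(3)[OF u]
  note d = sobolev_1_weak_derivs[OF us]
  obtain g where g: "g \<in> L2 (lsq L)" "AE z in lsq L. weak_deriv (square L) 1 0 u z = g z"
    using ex_L2_borel_version[OF d(3)] by blast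
  have k: "(\<lambda>_. tr0 L u) \<in> L2 (lsq L)" by (rule L2_bounded[OF finite_measure_lsq]) auto
  have kn: "L2_norm (lsq L) (\<lambda>_. tr0 L u) = L * \<bar>tr0 L u\<bar>"
  proof -
    have "(LINT z|lsq L. (1 :: real)) = L * L"
      using lseg_product_fst(2)[of L "\<lambda>_. 1"] L by (simp add: measure_lseg)
    then have "measure (lsq L) UNIV = L * L" by simp
    then show ?thesis using L by (simp add: L2_norm_def real_sqrt_mult)
  qed
  have "L2_norm (leb L) u = L2_norm (lsq L) (\<lambda>z. tr0 L u + primx L g z)"
    by (rule L2_norm_leb_lsq[OF sobolev_L2[OF us] L2_add[OF k L2_primx(1)[OF g(1) L]] Vc_repr(1)[OF L u g]])
  also have "\<dots> \<le> L2_norm (lsq L) (\<lambda>_. tr0 L u) + L2_norm (lsq L) (primx L g)"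
    by (rule L2_norm_triangle[OF k L2_primx(1)[OF g(1) L]])
  also have "\<dots> \<le> L * \<bar>tr0 L u\<bar> + L * L2_norm (lsq L) g"
    using kn L2_primx(2)[OF g(1) L] by simp
  also have "L2_norm (lsq L) g = L2_norm (leb L) (weak_deriv (square L) 1 0 u)"
    by (rule L2_norm_leb_lsq[OF d(3) g, symmetric])
  finally show ?thesis .
qed

text \<open>\<open>trace\<close> and \<open>tr0\<close> are separate choices; they agree almost
  everywhere on the side, which has length \<open>L\<close>.\<close>

lemma side_integral_traces:
  assumes L: "L > 0" and u: "u \<in> Vc L" and v: "v \<in> Vc L"
  shows "(LINT s|side_measure L 0. trace L 0 u s * trace L 0 v s) = L * (tr0 L u * tr0 L v)"
proof -
  have t: "has_trace L 0 u (trace L 0 u)" if "u \<in> Vc L" for u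
    unfolding trace_def using someI[of "\<lambda>t. has_trace L 0 u t", OF Vc_trace(1)[OF that]] by simp
  have m: "trace L 0 u \<in> borel_measurable (side_measure L 0)" if "u \<in> Vc L" for u
    using t[OF that] by (intro L2_measurable) (simp add: has_trace_def)
  have ae: "AE y in lseg L. trace L 0 u (0, y) = tr0 L u" if "u \<in> Vc L" for u
    by (rule has_trace_const_AE[OF L t[OF that] Vc_trace(1)[OF that]])
  have mm: "(\<lambda>s. trace L 0 u s * trace L 0 v s) \<in> borel_measurable (side_measure L 0)"
    using m[OF u] m[OF v] by measurable
  have "(LINT s|side_measure L 0. trace L 0 u s * trace L 0 v s) = (LINT y|lseg L. vline L 0 (\<lambda>s. trace L 0 u s * trace L 0 v s) y)"
    by (rule side_measure_integral(3)[OF L _ mm]) simp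
  also have "\<dots> = (LINT y|lseg L. tr0 L u * tr0 L v)"
  proof (rule integral_cong_AE)
    show "vline L 0 (\<lambda>s. trace L 0 u s * trace L 0 v s) \<in> borel_measurable (lseg L)"
      using side_measure_integral(1)[OF L _ mm] by simp
    show "AE y in lseg L. vline L 0 (\<lambda>s. trace L 0 u s * trace L 0 v s) y = tr0 L u * tr0 L v"
      using ae[OF u] ae[OF v] AE_lseg_in[of L] by eventually_elim (simp add: vline_def)
  qed simp
  finally show "(LINT s|side_measure L 0. trace L 0 u s * trace L 0 v s) = L * (tr0 L u * tr0 L v)"
    using L by (simp add: measure_lseg)
qed

section \<open>The Riesz representation theorem and the dual problem\<close>

text \<open>The functional is represented by the limit of a minimising sequence of \<open>a u u - 2 l u\<close>, which is
  Cauchy by the parallelogram law. The form may be degenerate, since functions differing on null sets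
  are not identified.\<close>

lemma riesz_representation:
  fixes V :: "('a \<Rightarrow> real) set" and a :: "('a \<Rightarrow> real) \<Rightarrow> ('a \<Rightarrow> real) \<Rightarrow> real" and l :: "('a \<Rightarrow> real) \<Rightarrow> real"
  assumes V: "\<And>u v \<alpha> \<beta>. u \<in> V \<Longrightarrow> v \<in> V \<Longrightarrow> (\<lambda>x. \<alpha> * u x + \<beta> * v x) \<in> V" and ne: "u0 \<in> V"
    and sym: "\<And>u v. u \<in> V \<Longrightarrow> v \<in> V \<Longrightarrow> a u v = a v u"
    and lin: "\<And>u v w \<alpha> \<beta>. u \<in> V \<Longrightarrow> v \<in> V \<Longrightarrow> w \<in> V \<Longrightarrow> a (\<lambda>x. \<alpha> * u x + \<beta> * v x) w = \<alpha> * a u w + \<beta> * a v w"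
    and pos: "\<And>u. u \<in> V \<Longrightarrow> 0 \<le> a u u"
    and llin: "\<And>u v \<alpha> \<beta>. u \<in> V \<Longrightarrow> v \<in> V \<Longrightarrow> l (\<lambda>x. \<alpha> * u x + \<beta> * v x) = \<alpha> * l u + \<beta> * l v"
    and lb: "\<And>u. u \<in> V \<Longrightarrow> \<bar>l u\<bar> \<le> K * sqrt (a u u)"
    and complete: "\<And>s. (\<And>n. s n \<in> V) \<Longrightarrow>
      (\<And>e. e > 0 \<Longrightarrow> \<exists>N :: nat. \<forall>m\<ge>N. \<forall>n\<ge>N. a (\<lambda>x. s m x - s n x) (\<lambda>x. s m x - s n x) < e) \<Longrightarrow>
      \<exists>u\<in>V. (\<lambda>n. a (\<lambda>x. s n x - u x) (\<lambda>x. s n x - u x)) \<longlonglongrightarrow> 0"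
  shows "\<exists>w\<in>V. \<forall>v\<in>V. a w v = l v"
proof -
  have lin2: "a w (\<lambda>x. \<alpha> * u x + \<beta> * v x) = \<alpha> * a w u + \<beta> * a w v" if "u \<in> V" "v \<in> V" "w \<in> V" for u v w \<alpha> \<beta>
    using lin[OF that, of \<alpha> \<beta>] sym[OF that(3) V[OF that(1,2)], of \<alpha> \<beta>] sym[OF that(3,1)] sym[OF that(3,2)] by simp
  have quad: "a (\<lambda>x. \<alpha> * u x + \<beta> * v x) (\<lambda>x. \<alpha> * u x + \<beta> * v x) = \<alpha>\<^sup>2 * a u u + 2 * \<alpha> * \<beta> * a u v + \<beta>\<^sup>2 * a v v"
    if "u \<in> V" "v \<in> V" for u v \<alpha> \<beta>
    unfolding lin[OF that V[OF that]] lin2[OF that that(1)] lin2[OF that that(2)]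
    using sym[OF that] by (simp add: power2_eq_square algebra_simps)
  have CS: "\<bar>a u v\<bar> \<le> sqrt (a u u) * sqrt (a v v)" if uv: "u \<in> V" "v \<in> V" for u v
  proof -
    have q: "0 \<le> a u u + 2 * t * a u v + t\<^sup>2 * a v v" for t
      using pos[OF V[OF uv, of 1 t]] quad[OF uv, of 1 t] by simp
    have "(a u v)\<^sup>2 \<le> a u u * a v v"
    proof (cases "a v v = 0")
      case True
      have "a u v = 0"
      proof (rule ccontr)
        assume "a u v \<noteq> 0"
        then show False using q[of "- (a u u + 1) / (2 * a u v)"] True by (simp add: field_simps)
      qed
      then show ?thesis using True by simp
    next
      case False
      then have p: "a v v > 0" using pos[OF uv(2)] by simp
      have "0 \<le> a u u - (a u v)\<^sup>2 / a v v"
        using q[of "- a u v / a v v"] False by (simp add: power2_eq_square field_simps)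
      then show ?thesis using p by (simp add: field_simps)
    qed
    then have "\<bar>a u v\<bar> \<le> sqrt (a u u * a v v)" by (metis real_sqrt_abs real_sqrt_le_mono)
    then show ?thesis by (simp add: real_sqrt_mult)
  qed
  define J where "J u = a u u - 2 * l u" for u
  \<comment> \<open>The bound on \<open>l\<close> completes the square in
    \<open>sqrt (a u u)\<close>, so the infimum below is finite.\<close>
  have Jlow: "- K\<^sup>2 \<le> J u" if "u \<in> V" for u
  proof -
    have "0 \<le> (sqrt (a u u) - K)\<^sup>2" by simp
    then have "0 \<le> a u u - 2 * (K * sqrt (a u u)) + K\<^sup>2" using pos[OF that] by (simp add: power2_diff algebra_simps)
    then show ?thesis using lb[OF that] unfolding J_def by linarith
  qed
  define m where "m = Inf (J ` V)"
  have bdd: "bdd_below (J ` V)" by (rule bdd_belowI2[of _ "- K\<^sup>2"]) (rule Jlow)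
  have mle: "m \<le> J u" if "u \<in> V" for u unfolding m_def using that by (intro cInf_lower bdd) auto
  have "\<exists>u\<in>V. J u < m + inverse (real (Suc n))" for n
  proof -
    have "\<exists>x\<in>J ` V. x < m + inverse (real (Suc n))"
      using cInf_less_iff[of "J ` V" "m + inverse (real (Suc n))"] bdd ne unfolding m_def by auto
    then show ?thesis by auto
  qed
  then obtain s where s: "\<And>n. s n \<in> V" "\<And>n. J (s n) < m + inverse (real (Suc n))" by metis
  \<comment> \<open>The parallelogram law: the left side is \<open>2 J u + 2 J v - 4 J\<close> of
    the midpoint, and the midpoint has \<open>J\<close> at least \<open>m\<close>.\<close>
  have par: "a (\<lambda>x. u x - v x) (\<lambda>x. u x - v x) \<le> 2 * (J u - m) + 2 * (J v - m)" if uv: "u \<in> V" "v \<in> V" for u v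
  proof -
    have "J (\<lambda>x. 1/2 * u x + 1/2 * v x) = (a u u + 2 * a u v + a v v) / 4 - (l u + l v)"
      unfolding J_def quad[OF uv] llin[OF uv] by (simp add: power2_eq_square field_simps)
    moreover have "m \<le> J (\<lambda>x. 1/2 * u x + 1/2 * v x)" by (rule mle[OF V[OF uv]])
    moreover have "a (\<lambda>x. u x - v x) (\<lambda>x. u x - v x) = a u u - 2 * a u v + a v v"
      using quad[OF uv, of 1 "-1"] by simp
    ultimately show ?thesis unfolding J_def by (simp add: field_simps)
  qed
  have "\<exists>N. \<forall>i\<ge>N. \<forall>j\<ge>N. a (\<lambda>x. s i x - s j x) (\<lambda>x. s i x - s j x) < e" if e: "e > 0" for e
  proof -
    obtain N where N: "inverse (real (Suc N)) < e / 4" using reals_Archimedean[OF divide_pos_pos[OF e zero_less_numeral]] by blast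
    have small: "J (s i) - m < e / 4" if "i \<ge> N" for i
    proof -
      have "inverse (real (Suc i)) \<le> inverse (real (Suc N))" using that by (intro le_imp_inverse_le) auto
      then show ?thesis using s(2)[of i] N by linarith
    qed
    have "x < e" if "x \<le> 2 * p + 2 * q" "p < e / 4" "q < e / 4" for x p q using that by linarith
    from this[OF par[OF s(1) s(1)] small small]
    have "a (\<lambda>x. s i x - s j x) (\<lambda>x. s i x - s j x) < e" if "i \<ge> N" "j \<ge> N" for i j
      using that by blast
    then show ?thesis by blast
  qed
  from complete[OF s(1) this] obtain w where w: "w \<in> V" "(\<lambda>n. a (\<lambda>x. s n x - w x) (\<lambda>x. s n x - w x)) \<longlonglongrightarrow> 0" by blast
  have "a w v = l v" if v: "v \<in> V" for v
  proof -
    have "(\<lambda>n. a (s n) v - a w v) \<longlonglongrightarrow> 0"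
    proof (rule Lim_null_comparison[OF always_eventually])
      show "\<forall>n. norm (a (s n) v - a w v) \<le> sqrt (a (\<lambda>x. s n x - w x) (\<lambda>x. s n x - w x)) * sqrt (a v v)"
      proof
        fix n
        have "a (s n) v - a w v = a (\<lambda>x. s n x - w x) v" using lin[OF s(1) w(1) v, of 1 n "-1"] by simp
        moreover have "(\<lambda>x. s n x - w x) \<in> V" using V[OF s(1) w(1), of 1 n "-1"] by simp
        ultimately show "norm (a (s n) v - a w v) \<le> sqrt (a (\<lambda>x. s n x - w x) (\<lambda>x. s n x - w x)) * sqrt (a v v)"
          using CS[of "\<lambda>x. s n x - w x" v] v by simp
      qed
      have "(\<lambda>n. sqrt (a (\<lambda>x. s n x - w x) (\<lambda>x. s n x - w x))) \<longlonglongrightarrow> 0"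
        using tendsto_real_sqrt[OF w(2)] by simp
      then show "(\<lambda>n. sqrt (a (\<lambda>x. s n x - w x) (\<lambda>x. s n x - w x)) * sqrt (a v v)) \<longlonglongrightarrow> 0"
        by (rule tendsto_mult_left_zero)
    qed
    then have lim: "(\<lambda>n. a (s n) v) \<longlonglongrightarrow> a w v" by (rule LIM_zero_cancel)
    \<comment> \<open>Minimality is used for \<open>s n + t v\<close> and carried to the limit
      \<open>w\<close>; the error \<open>1/(n+1)\<close> is the gap of \<open>s n\<close> from the
      infimum.\<close>
    have q: "0 \<le> 2 * t * (a w v - l v) + t\<^sup>2 * a v v" for t
    proof (rule tendsto_lowerbound[OF _ always_eventually])
      show "(\<lambda>n. 2 * t * (a (s n) v - l v) + t\<^sup>2 * a v v + inverse (real (Suc n))) \<longlonglongrightarrow> 2 * t * (a w v - l v) + t\<^sup>2 * a v v"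
        using tendsto_add[OF tendsto_add[OF tendsto_mult[OF tendsto_const tendsto_diff[OF lim tendsto_const]] tendsto_const]
            LIMSEQ_inverse_real_of_nat, of "2 * t" "l v" "t\<^sup>2 * a v v"] by simp
      show "\<forall>n. 0 \<le> 2 * t * (a (s n) v - l v) + t\<^sup>2 * a v v + inverse (real (Suc n))"
      proof
        fix n
        have "m \<le> J (\<lambda>x. 1 * s n x + t * v x)" by (rule mle[OF V[OF s(1) v]])
        also have "\<dots> = J (s n) + 2 * t * (a (s n) v - l v) + t\<^sup>2 * a v v"
          unfolding J_def quad[OF s(1) v] llin[OF s(1) v] by (simp add: algebra_simps)
        finally show "0 \<le> 2 * t * (a (s n) v - l v) + t\<^sup>2 * a v v + inverse (real (Suc n))"
          using s(2)[of n] by linarith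
      qed
    qed simp
    define d where "d = a w v - l v"
    have "d = 0"
    proof (rule ccontr)
      assume d: "d \<noteq> 0"
      \<comment> \<open>The added 1 keeps the denominator positive even when the form vanishes at
        \<open>v\<close>. For \<open>t = - d / ?A\<close> the inequality would give a negative upper
        bound for 0.\<close>
      let ?A = "a v v + 1"
      have A: "?A > 0" using pos[OF v] by simp
      have "0 \<le> 2 * (- d / ?A) * d + (- d / ?A)\<^sup>2 * a v v" using q[of "- d / ?A"] unfolding d_def by simp
      also have "\<dots> \<le> 2 * (- d / ?A) * d + (- d / ?A)\<^sup>2 * ?A" by (intro add_left_mono mult_left_mono) auto
      also have "\<dots> = - (d\<^sup>2 / ?A)" using A by (simp add: power2_eq_square divide_simps)
      also have "\<dots> < 0" using d A by simp
      finally show False by simp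
    qed
    then show ?thesis unfolding d_def by simp
  qed
  then show ?thesis using w(1) by blast
qed

section \<open>The energy form: coercivity, completeness and the dual problem\<close>

locale potential_problem =
  fixes L R \<sigma>\<^sub>m \<sigma>\<^sub>M :: real and \<sigma> :: "real \<times> real \<Rightarrow> real"
  assumes L: "L > 0" and R: "R > 0" and \<sigma>m: "\<sigma>\<^sub>m > 0"
    and \<sigma>_meas: "\<sigma> \<in> borel_measurable (lebesgue_on (closure (square L)))"
    and \<sigma>_bounds: "\<And>x. x \<in> closure (square L) \<Longrightarrow> \<sigma>\<^sub>m \<le> \<sigma> x \<and> \<sigma> x \<le> \<sigma>\<^sub>M"
begin

abbreviation dx where "dx \<equiv> weak_deriv (square L) 1 0"
abbreviation dy where "dy \<equiv> weak_deriv (square L) 0 1"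
abbreviation N where "N \<equiv> L2_norm (leb L)"

definition E where "E u v = (LINT z|leb L. \<sigma> z * (dx u z * dx v z + dy u z * dy v z))"

lemma \<sigma>_leb [measurable]: "\<sigma> \<in> borel_measurable (leb L)"
  by (rule measurable_restrict_mono[OF \<sigma>_meas closure_subset])

lemma \<sigma>_in: "z \<in> square L \<Longrightarrow> \<sigma>\<^sub>m \<le> \<sigma> z \<and> \<sigma> z \<le> \<sigma>\<^sub>M \<and> \<bar>\<sigma> z\<bar> \<le> \<sigma>\<^sub>M"
  using \<sigma>_bounds[of z] closure_subset[of "square L"] \<sigma>m by auto

lemma \<sigma>M: "\<sigma>\<^sub>M > 0"
proof -
  have "(0, 0) \<in> closure (square L)" using L by (simp add: closure_square)
  from \<sigma>_bounds[OF this] \<sigma>m show ?thesis by linarith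
qed

lemma \<sigma>_mult_L2: "p \<in> L2 (leb L) \<Longrightarrow> (\<lambda>z. \<sigma> z * p z) \<in> L2 (leb L)"
  by (rule L2_bounded_mult[where B = "\<sigma>\<^sub>M"]) (use \<sigma>_in in \<open>auto simp: space_restrict_space\<close>)

lemma \<sigma>_integrable:
  assumes "p \<in> L2 (leb L)" "q \<in> L2 (leb L)"
  shows "integrable (leb L) (\<lambda>z. \<sigma> z * (p z * q z))"
  using L2_mult_integrable[OF \<sigma>_mult_L2[OF assms(1)] assms(2)] by (simp add: mult.assoc)

lemma \<sigma>_integral_le:
  assumes p: "p \<in> L2 (leb L)" and q: "q \<in> L2 (leb L)"
  shows "\<bar>LINT z|leb L. \<sigma> z * (p z * q z)\<bar> \<le> \<sigma>\<^sub>M * N p * N q"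
proof -
  have "N (\<lambda>z. \<sigma> z * p z) \<le> \<sigma>\<^sub>M * N p"
  proof (rule power2_le_imp_le)
    have "(LINT z|leb L. (\<sigma> z * p z)\<^sup>2) \<le> (LINT z|leb L. \<sigma>\<^sub>M\<^sup>2 * (p z)\<^sup>2)"
    proof (rule integral_mono)
      show "integrable (leb L) (\<lambda>z. (\<sigma> z * p z)\<^sup>2)" by (rule L2_square_integrable[OF \<sigma>_mult_L2[OF p]])
      show "integrable (leb L) (\<lambda>z. \<sigma>\<^sub>M\<^sup>2 * (p z)\<^sup>2)" using L2_square_integrable[OF p] by simp
      fix z assume "z \<in> space (leb L)"
      then have "\<bar>\<sigma> z\<bar> \<le> \<sigma>\<^sub>M" using \<sigma>_in by (auto simp: space_restrict_space)
      then have "(\<sigma> z)\<^sup>2 \<le> \<sigma>\<^sub>M\<^sup>2" by (metis abs_ge_zero power2_abs power_mono)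
      then show "(\<sigma> z * p z)\<^sup>2 \<le> \<sigma>\<^sub>M\<^sup>2 * (p z)\<^sup>2" by (simp add: power_mult_distrib mult_right_mono)
    qed
    then show "(N (\<lambda>z. \<sigma> z * p z))\<^sup>2 \<le> (\<sigma>\<^sub>M * N p)\<^sup>2" by (simp add: L2_norm_power2 power_mult_distrib)
    show "0 \<le> \<sigma>\<^sub>M * N p" using \<sigma>M by simp
  qed
  then have "N (\<lambda>z. \<sigma> z * p z) * N q \<le> \<sigma>\<^sub>M * N p * N q" by (rule mult_right_mono) simp
  then show ?thesis using L2_Cauchy_Schwarz[OF \<sigma>_mult_L2[OF p] q] by (simp add: mult.assoc)
qed

lemma \<sigma>_integral_ge:
  assumes p: "p \<in> L2 (leb L)"
  shows "\<sigma>\<^sub>m * (N p)\<^sup>2 \<le> (LINT z|leb L. \<sigma> z * (p z * p z))"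
proof -
  have "\<sigma>\<^sub>m * (N p)\<^sup>2 = (LINT z|leb L. \<sigma>\<^sub>m * (p z)\<^sup>2)" by (simp add: L2_norm_power2)
  also have "\<dots> \<le> (LINT z|leb L. \<sigma> z * (p z * p z))"
  proof (rule integral_mono[OF _ \<sigma>_integrable[OF p p]])
    show "integrable (leb L) (\<lambda>z. \<sigma>\<^sub>m * (p z)\<^sup>2)" using L2_square_integrable[OF p] by simp
    show "\<sigma>\<^sub>m * (p z)\<^sup>2 \<le> \<sigma> z * (p z * p z)" if "z \<in> space (leb L)" for z
      using \<sigma>_in[of z] that by (auto simp: space_restrict_space power2_eq_square intro!: mult_right_mono)
  qed
  finally show ?thesis .
qed

lemma Vc_L2: "u \<in> Vc L \<Longrightarrow> u \<in> L2 (leb L)" "u \<in> Vc L \<Longrightarrow> dx u \<in> L2 (leb L)" "u \<in> Vc L \<Longrightarrow> dy u \<in> L2 (leb L)"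
  using Vc_trace(3)[of u L] sobolev_L2[of u 1 L] sobolev_1_weak_derivs(3,4)[of u L] by simp_all

lemma E_split:
  assumes u: "u \<in> Vc L" and v: "v \<in> Vc L"
  shows "E u v = (LINT z|leb L. \<sigma> z * (dx u z * dx v z)) + (LINT z|leb L. \<sigma> z * (dy u z * dy v z))"
  unfolding E_def distrib_left
  by (rule Bochner_Integration.integral_add) (intro \<sigma>_integrable Vc_L2 u v)+

lemma bilinear_a_eq:
  assumes u: "u \<in> Vc L" and v: "v \<in> Vc L"
  shows "bilinear_a L R \<sigma> u v = E u v + tr0 L u * tr0 L v / R"
  unfolding bilinear_a_def E_def side_integral_traces[OF L u v] side_length_eq[OF L disjI1[OF refl]]
  using L by simp

text \<open>The chosen weak derivatives of a combination and of its terms are unrelated selections,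
  so linearity holds only up to a null set.\<close>

lemma d_lincomb:
  assumes u: "u \<in> Vc L" and v: "v \<in> Vc L"
  shows "AE z in leb L. dx (\<lambda>z. a * u z + b * v z) z = a * dx u z + b * dx v z"
    and "AE z in leb L. dy (\<lambda>z. a * u z + b * v z) z = a * dy u z + b * dy v z"
proof -
  note du = sobolev_1_weak_derivs[OF Vc_trace(3)[OF u]] and dv = sobolev_1_weak_derivs[OF Vc_trace(3)[OF v]]
  show "AE z in leb L. dx (\<lambda>z. a * u z + b * v z) z = a * dx u z + b * dx v z"
    unfolding AE_leb by (rule weak_deriv_eqI[OF has_weak_deriv_lincomb[OF Vc_L2(1)[OF u] du(1) Vc_L2(1)[OF v] dv(1)]])
  show "AE z in leb L. dy (\<lambda>z. a * u z + b * v z) z = a * dy u z + b * dy v z"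
    unfolding AE_leb by (rule weak_deriv_eqI[OF has_weak_deriv_lincomb[OF Vc_L2(1)[OF u] du(2) Vc_L2(1)[OF v] dv(2)]])
qed

lemma N_d_diff:
  assumes u: "u \<in> Vc L" and v: "v \<in> Vc L"
  shows "N (dx (\<lambda>z. u z - v z)) = N (\<lambda>z. dx u z - dx v z)" "N (dy (\<lambda>z. u z - v z)) = N (\<lambda>z. dy u z - dy v z)"
proof -
  have uv: "(\<lambda>z. u z - v z) \<in> Vc L" using Vc_lincomb(1)[OF L u v, of 1 "-1"] by simp
  show "N (dx (\<lambda>z. u z - v z)) = N (\<lambda>z. dx u z - dx v z)"
    using d_lincomb(1)[OF u v, of 1 "-1"]
    by (intro L2_norm_cong_AE L2_measurable[OF Vc_L2(2)[OF uv]] L2_measurable[OF L2_diff] Vc_L2 u v) simp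
  show "N (dy (\<lambda>z. u z - v z)) = N (\<lambda>z. dy u z - dy v z)"
    using d_lincomb(2)[OF u v, of 1 "-1"]
    by (intro L2_norm_cong_AE L2_measurable[OF Vc_L2(3)[OF uv]] L2_measurable[OF L2_diff] Vc_L2 u v) simp
qed

lemma a_sym: "u \<in> Vc L \<Longrightarrow> v \<in> Vc L \<Longrightarrow> bilinear_a L R \<sigma> u v = bilinear_a L R \<sigma> v u"
  by (simp add: bilinear_a_eq E_def mult.commute)

lemma a_lin:
  assumes u: "u \<in> Vc L" and v: "v \<in> Vc L" and w: "w \<in> Vc L"
  shows "bilinear_a L R \<sigma> (\<lambda>x. \<alpha> * u x + \<beta> * v x) w = \<alpha> * bilinear_a L R \<sigma> u w + \<beta> * bilinear_a L R \<sigma> v w"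
proof -
  note uv = Vc_lincomb[OF L u v, of \<alpha> \<beta>]
  have iE: "integrable (leb L) (\<lambda>z. \<sigma> z * (dx p z * dx q z + dy p z * dy q z))" if "p \<in> Vc L" "q \<in> Vc L" for p q
    unfolding distrib_left using that by (intro Bochner_Integration.integrable_add \<sigma>_integrable Vc_L2)
  have "E (\<lambda>x. \<alpha> * u x + \<beta> * v x) w = (LINT z|leb L. \<alpha> * (\<sigma> z * (dx u z * dx w z + dy u z * dy w z))
      + \<beta> * (\<sigma> z * (dx v z * dx w z + dy v z * dy w z)))"
    unfolding E_def
  proof (rule integral_cong_AE)
    show "AE z in leb L. \<sigma> z * (dx (\<lambda>x. \<alpha> * u x + \<beta> * v x) z * dx w z + dy (\<lambda>x. \<alpha> * u x + \<beta> * v x) z * dy w z)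
      = \<alpha> * (\<sigma> z * (dx u z * dx w z + dy u z * dy w z)) + \<beta> * (\<sigma> z * (dx v z * dx w z + dy v z * dy w z))"
      using d_lincomb[OF u v, of \<alpha> \<beta>] by eventually_elim (simp add: algebra_simps)
    show "(\<lambda>z. \<sigma> z * (dx (\<lambda>x. \<alpha> * u x + \<beta> * v x) z * dx w z + dy (\<lambda>x. \<alpha> * u x + \<beta> * v x) z * dy w z)) \<in> borel_measurable (leb L)"
      by (rule borel_measurable_integrable[OF iE[OF uv(1) w]])
    show "(\<lambda>z. \<alpha> * (\<sigma> z * (dx u z * dx w z + dy u z * dy w z)) + \<beta> * (\<sigma> z * (dx v z * dx w z + dy v z * dy w z))) \<in> borel_measurable (leb L)"
      by (intro borel_measurable_integrable Bochner_Integration.integrable_add integrable_mult_right iE u v w)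
  qed
  also have "\<dots> = \<alpha> * E u w + \<beta> * E v w"
    unfolding E_def using iE[OF u w] iE[OF v w] by simp
  finally show ?thesis
    unfolding bilinear_a_eq[OF uv(1) w] bilinear_a_eq[OF u w] bilinear_a_eq[OF v w] uv(2)
    using R by (simp add: field_simps)
qed

lemma a_lower:
  assumes u: "u \<in> Vc L"
  shows "\<sigma>\<^sub>m * (N (dx u))\<^sup>2 + \<sigma>\<^sub>m * (N (dy u))\<^sup>2 + (tr0 L u)\<^sup>2 / R \<le> bilinear_a L R \<sigma> u u"
  using \<sigma>_integral_ge[OF Vc_L2(2)[OF u]] \<sigma>_integral_ge[OF Vc_L2(3)[OF u]]
  unfolding bilinear_a_eq[OF u u] E_split[OF u u] by (simp add: power2_eq_square)

lemma a_upper: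
  assumes u: "u \<in> Vc L"
  shows "bilinear_a L R \<sigma> u u \<le> \<sigma>\<^sub>M * (N (dx u))\<^sup>2 + \<sigma>\<^sub>M * (N (dy u))\<^sup>2 + (tr0 L u)\<^sup>2 / R"
  using \<sigma>_integral_le[OF Vc_L2(2)[OF u] Vc_L2(2)[OF u]] \<sigma>_integral_le[OF Vc_L2(3)[OF u] Vc_L2(3)[OF u]]
  unfolding bilinear_a_eq[OF u u] E_split[OF u u] by (simp add: power2_eq_square mult.assoc)

lemma a_nonneg:
  assumes u: "u \<in> Vc L"
  shows "0 \<le> bilinear_a L R \<sigma> u u"
proof -
  have "0 \<le> \<sigma>\<^sub>m * (N (dx u))\<^sup>2 + \<sigma>\<^sub>m * (N (dy u))\<^sup>2 + (tr0 L u)\<^sup>2 / R" using \<sigma>m R by simp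
  then show ?thesis using a_lower[OF u] by linarith
qed

text \<open>One constant for two kinds of control: \<open>1 / \<sigma>\<^sub>m\<close> comes from
  the gradient part of the energy and \<open>R\<close> from its boundary part.\<close>

definition Kc where "Kc = max (sqrt (1 / \<sigma>\<^sub>m)) (sqrt R)"

lemma Kc: "Kc > 0" using \<sigma>m R by (simp add: Kc_def less_max_iff_disj)

text \<open>Each of the three terms of the lower bound is at most the whole energy. The Poincare
  inequality then adds a bound by the trace constant and one by the derivative, each
  \<open>L * Kc\<close> times the energy norm; hence the factor 2.\<close>

lemma energy_controls:
  assumes u: "u \<in> Vc L"
  shows "N (dx u) \<le> Kc * sqrt (bilinear_a L R \<sigma> u u)" "N (dy u) \<le> Kc * sqrt (bilinear_a L R \<sigma> u u)"
    "\<bar>tr0 L u\<bar> \<le> Kc * sqrt (bilinear_a L R \<sigma> u u)" "N u \<le> 2 * L * Kc * sqrt (bilinear_a L R \<sigma> u u)"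
proof -
  define A where "A = bilinear_a L R \<sigma> u u"
  have n: "0 \<le> \<sigma>\<^sub>m * (N (dx u))\<^sup>2" "0 \<le> \<sigma>\<^sub>m * (N (dy u))\<^sup>2" "0 \<le> (tr0 L u)\<^sup>2 / R" using \<sigma>m R by auto
  have b: "\<sigma>\<^sub>m * (N (dx u))\<^sup>2 \<le> A" "\<sigma>\<^sub>m * (N (dy u))\<^sup>2 \<le> A" "(tr0 L u)\<^sup>2 / R \<le> A"
    using a_lower[OF u] n unfolding A_def by linarith+
  have A0: "0 \<le> A" unfolding A_def by (rule a_nonneg[OF u])
  have up: "sqrt (1 / \<sigma>\<^sub>m) * sqrt A \<le> Kc * sqrt A" "sqrt R * sqrt A \<le> Kc * sqrt A"
    unfolding Kc_def using A0 by (intro mult_right_mono; simp)+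
  have "N (dx u) \<le> sqrt (1 / \<sigma>\<^sub>m * A)" using b(1) \<sigma>m by (intro real_le_rsqrt) (simp add: field_simps)
  then have 1: "N (dx u) \<le> Kc * sqrt A" using up(1) unfolding real_sqrt_mult by linarith
  have "N (dy u) \<le> sqrt (1 / \<sigma>\<^sub>m * A)" using b(2) \<sigma>m by (intro real_le_rsqrt) (simp add: field_simps)
  then have 3: "N (dy u) \<le> Kc * sqrt A" using up(1) unfolding real_sqrt_mult by linarith
  have "\<bar>tr0 L u\<bar> \<le> sqrt (R * A)" using b(3) R by (intro real_le_rsqrt) (simp add: field_simps)
  then have 2: "\<bar>tr0 L u\<bar> \<le> Kc * sqrt A" using up(2) unfolding real_sqrt_mult by linarith
  have "L * \<bar>tr0 L u\<bar> + L * N (dx u) \<le> L * (Kc * sqrt A) + L * (Kc * sqrt A)"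
    using 1 2 L by (intro add_mono mult_left_mono) auto
  then have 4: "N u \<le> 2 * L * Kc * sqrt A" using Vc_poincare[OF L u] by linarith
  show "N (dx u) \<le> Kc * sqrt (bilinear_a L R \<sigma> u u)" "N (dy u) \<le> Kc * sqrt (bilinear_a L R \<sigma> u u)"
    "\<bar>tr0 L u\<bar> \<le> Kc * sqrt (bilinear_a L R \<sigma> u u)" "N u \<le> 2 * L * Kc * sqrt (bilinear_a L R \<sigma> u u)"
    using 1 2 3 4 unfolding A_def by auto
qed

text \<open>The energy controls the function, both derivatives and the trace constant, so all four
  converge. Weak derivatives and traces are closed under these limits, which puts the limit into the
  space; the upper bound of the form by the same quantities gives convergence in energy.\<close>

lemma Vc_complete:
  assumes s: "\<And>n. s n \<in> Vc L"
    and C: "\<And>e. e > 0 \<Longrightarrow> \<exists>n0 :: nat. \<forall>m\<ge>n0. \<forall>n\<ge>n0. bilinear_a L R \<sigma> (\<lambda>x. s m x - s n x) (\<lambda>x. s m x - s n x) < e"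
  shows "\<exists>u\<in>Vc L. (\<lambda>n. bilinear_a L R \<sigma> (\<lambda>x. s n x - u x) (\<lambda>x. s n x - u x)) \<longlonglongrightarrow> 0"
proof -
  have dif: "(\<lambda>x. p x - q x) \<in> Vc L" "tr0 L (\<lambda>x. p x - q x) = tr0 L p - tr0 L q" if "p \<in> Vc L" "q \<in> Vc L" for p q
    using Vc_lincomb[OF L that, of 1 "-1"] by simp_all
  \<comment> \<open>The Cauchy property is hypothesised for the square of the energy norm; here it
    is passed on to any quantity dominated by a multiple of that norm.\<close>
  have Ce: "\<exists>n0. \<forall>m\<ge>n0. \<forall>n\<ge>n0. P m n < e"
    if K: "K > 0" and P: "\<And>m n. P m n \<le> K * sqrt (bilinear_a L R \<sigma> (\<lambda>x. s m x - s n x) (\<lambda>x. s m x - s n x))" and e: "e > 0"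
    for P :: "nat \<Rightarrow> nat \<Rightarrow> real" and K e
  proof -
    have "(e / K)\<^sup>2 > 0" using K e by simp
    from C[OF this] obtain n0 where n0: "\<forall>m\<ge>n0. \<forall>n\<ge>n0. bilinear_a L R \<sigma> (\<lambda>x. s m x - s n x) (\<lambda>x. s m x - s n x) < (e / K)\<^sup>2" by blast
    have "P m n < e" if "m \<ge> n0" "n \<ge> n0" for m n
    proof -
      have "sqrt (bilinear_a L R \<sigma> (\<lambda>x. s m x - s n x) (\<lambda>x. s m x - s n x)) < e / K"
        using n0 that e K by (intro real_less_lsqrt) auto
      then have "K * sqrt (bilinear_a L R \<sigma> (\<lambda>x. s m x - s n x) (\<lambda>x. s m x - s n x)) < e"
        using K by (simp add: field_simps)
      then show ?thesis using P[of m n] by linarith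
    qed
    then show ?thesis by blast
  qed
  note fm = finite_measure_lebesgue_on_square
  have LK: "2 * L * Kc > 0" using L Kc by simp
  obtain u where u: "u \<in> L2 (leb L)" "(\<lambda>n. N (\<lambda>x. s n x - u x)) \<longlonglongrightarrow> 0"
    using L2_complete[OF fm Vc_L2(1)[OF s] Ce[OF LK energy_controls(4)[OF dif(1)[OF s s]]]] by blast
  have px: "N (\<lambda>z. dx (s m) z - dx (s n) z) \<le> Kc * sqrt (bilinear_a L R \<sigma> (\<lambda>x. s m x - s n x) (\<lambda>x. s m x - s n x))" for m n
    using energy_controls(1)[OF dif(1)[OF s s], of m n] N_d_diff(1)[OF s s, of m n] by (simp only:)
  have py: "N (\<lambda>z. dy (s m) z - dy (s n) z) \<le> Kc * sqrt (bilinear_a L R \<sigma> (\<lambda>x. s m x - s n x) (\<lambda>x. s m x - s n x))" for m n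
    using energy_controls(2)[OF dif(1)[OF s s], of m n] N_d_diff(2)[OF s s, of m n] by (simp only:)
  have pk: "\<bar>tr0 L (s m) - tr0 L (s n)\<bar> \<le> Kc * sqrt (bilinear_a L R \<sigma> (\<lambda>x. s m x - s n x) (\<lambda>x. s m x - s n x))" for m n
    using energy_controls(3)[OF dif(1)[OF s s], of m n] dif(2)[OF s s, of m n] by (simp only:)
  obtain p where p: "p \<in> L2 (leb L)" "(\<lambda>n. N (\<lambda>x. dx (s n) x - p x)) \<longlonglongrightarrow> 0"
    using L2_complete[OF fm Vc_L2(2)[OF s] Ce[OF Kc px]] by blast
  obtain q where q: "q \<in> L2 (leb L)" "(\<lambda>n. N (\<lambda>x. dy (s n) x - q x)) \<longlonglongrightarrow> 0"
    using L2_complete[OF fm Vc_L2(3)[OF s] Ce[OF Kc py]] by blast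
  have "Cauchy (\<lambda>n. tr0 L (s n))"
    unfolding Cauchy_def dist_real_def using Ce[OF Kc pk] by blast
  then obtain k where k: "(\<lambda>n. tr0 L (s n)) \<longlonglongrightarrow> k" using Cauchy_convergent convergentD by blast
  note ds = sobolev_1_weak_derivs[OF Vc_trace(3)[OF s]]
  have wx: "has_weak_deriv (square L) 1 0 u p" by (rule has_weak_deriv_limit[OF Vc_L2(1)[OF s] u ds(1) p])
  have wy: "has_weak_deriv (square L) 0 1 u q" by (rule has_weak_deriv_limit[OF Vc_L2(1)[OF s] u ds(2) q])
  have us: "u \<in> sobolev 1 (square L)" by (rule sobolev_1I[OF u(1) wx wy])
  have H1: "(\<lambda>n. sobolev_norm 1 (square L) (\<lambda>x. s n x - u x)) \<longlonglongrightarrow> 0"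
  proof (rule Lim_null_comparison[OF always_eventually])
    show "\<forall>n. norm (sobolev_norm 1 (square L) (\<lambda>x. s n x - u x)) \<le> N (\<lambda>x. s n x - u x) + N (\<lambda>x. dx (s n) x - p x) + N (\<lambda>x. dy (s n) x - q x)"
    proof
      fix n
      have 1: "has_weak_deriv (square L) 1 0 (\<lambda>x. s n x - u x) (\<lambda>x. dx (s n) x - p x)"
        using has_weak_deriv_lincomb[OF Vc_L2(1)[OF s] ds(1) u(1) wx, of 1 n "-1"] by simp
      have 2: "has_weak_deriv (square L) 0 1 (\<lambda>x. s n x - u x) (\<lambda>x. dy (s n) x - q x)"
        using has_weak_deriv_lincomb[OF Vc_L2(1)[OF s] ds(2) u(1) wy, of 1 n "-1"] by simp
      show "norm (sobolev_norm 1 (square L) (\<lambda>x. s n x - u x)) \<le> N (\<lambda>x. s n x - u x) + N (\<lambda>x. dx (s n) x - p x) + N (\<lambda>x. dy (s n) x - q x)"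
        using sobolev_norm_1_bounds(4)[OF L2_diff[OF Vc_L2(1)[OF s] u(1)] 1 2]
        unfolding real_norm_def abs_of_nonneg[OF sobolev_norm_nonneg] .
    qed
    show "(\<lambda>n. N (\<lambda>x. s n x - u x) + N (\<lambda>x. dx (s n) x - p x) + N (\<lambda>x. dy (s n) x - q x)) \<longlonglongrightarrow> 0"
      using tendsto_add[OF tendsto_add[OF u(2) p(2)] q(2)] by simp
  qed
  have cL2: "(\<lambda>_. c) \<in> L2 (side_measure L x)" if "x = 0 \<or> x = L" for c x
    by (rule continuous_L2_side[OF L that]) simp
  have "has_trace L 0 u (\<lambda>_. k)"
  proof (rule has_trace_limit[OF L _ Vc_trace(1)[OF s] us cL2 H1])
    have nk: "L2_norm (side_measure L 0) (\<lambda>_. tr0 L (s n) - k) = sqrt L * \<bar>tr0 L (s n) - k\<bar>" for n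
    proof -
      have "L2_norm (side_measure L 0) (\<lambda>_. tr0 L (s n) - k) = L2_norm (lseg L) (vline L 0 (\<lambda>_. tr0 L (s n) - k))"
        by (rule L2_side_vline(2)[OF L _ cL2]) auto
      also have "\<dots> = L2_norm (lseg L) (\<lambda>y. tr0 L (s n) - k)"
      proof (rule L2_norm_cong_AE)
        show "AE y in lseg L. vline L 0 (\<lambda>_. tr0 L (s n) - k) y = tr0 L (s n) - k"
          using AE_lseg_in[of L] by eventually_elim (simp add: vline_def)
        show "vline L 0 (\<lambda>_. tr0 L (s n) - k) \<in> borel_measurable (lseg L)"
          by (intro L2_measurable L2_side_vline(1)[OF L _ cL2]) auto
      qed simp
      also have "\<dots> = sqrt L * \<bar>tr0 L (s n) - k\<bar>"
        using L by (simp add: L2_norm_def measure_lseg real_sqrt_mult)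
      finally show ?thesis .
    qed
    show "(\<lambda>n. L2_norm (side_measure L 0) (\<lambda>_. tr0 L (s n) - k)) \<longlonglongrightarrow> 0"
      unfolding nk by (rule tendsto_mult_right_zero[OF tendsto_rabs_zero[OF LIM_zero[OF k]]])
  qed auto
  moreover have "has_trace L L u (\<lambda>_. 0)"
  proof (rule has_trace_limit[OF L _ Vc_trace(2)[OF s] us cL2 H1])
    show "(\<lambda>n. L2_norm (side_measure L L) (\<lambda>x. 0 - 0)) \<longlonglongrightarrow> 0" by (simp add: L2_norm_def)
  qed auto
  ultimately have uV: "u \<in> Vc L" and uk: "tr0 L u = k" using VcI tr0_eqI[OF L] by auto
  have "(\<lambda>n. bilinear_a L R \<sigma> (\<lambda>x. s n x - u x) (\<lambda>x. s n x - u x)) \<longlonglongrightarrow> 0"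
  proof (rule Lim_null_comparison[OF always_eventually])
    show "\<forall>n. norm (bilinear_a L R \<sigma> (\<lambda>x. s n x - u x) (\<lambda>x. s n x - u x)) \<le>
      \<sigma>\<^sub>M * (N (\<lambda>x. dx (s n) x - p x))\<^sup>2 + \<sigma>\<^sub>M * (N (\<lambda>x. dy (s n) x - q x))\<^sup>2 + (tr0 L (s n) - k)\<^sup>2 / R"
    proof
      fix n
      have 1: "N (\<lambda>x. dx (s n) x - dx u x) = N (\<lambda>x. dx (s n) x - p x)"
      proof (rule L2_norm_cong_AE)
        show "AE x in leb L. dx (s n) x - dx u x = dx (s n) x - p x"
          unfolding AE_leb using weak_deriv_eqI[OF wx] by eventually_elim simp
      qed (intro L2_measurable L2_diff Vc_L2 s uV p)+
      have 2: "N (\<lambda>x. dy (s n) x - dy u x) = N (\<lambda>x. dy (s n) x - q x)"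
      proof (rule L2_norm_cong_AE)
        show "AE x in leb L. dy (s n) x - dy u x = dy (s n) x - q x"
          unfolding AE_leb using weak_deriv_eqI[OF wy] by eventually_elim simp
      qed (intro L2_measurable L2_diff Vc_L2 s uV q)+
      show "norm (bilinear_a L R \<sigma> (\<lambda>x. s n x - u x) (\<lambda>x. s n x - u x)) \<le>
        \<sigma>\<^sub>M * (N (\<lambda>x. dx (s n) x - p x))\<^sup>2 + \<sigma>\<^sub>M * (N (\<lambda>x. dy (s n) x - q x))\<^sup>2 + (tr0 L (s n) - k)\<^sup>2 / R"
        using a_upper[OF dif(1)[OF s uV], of n]
        unfolding real_norm_def abs_of_nonneg[OF a_nonneg[OF dif(1)[OF s uV]]] dif(2)[OF s uV] N_d_diff[OF s uV] uk 1 2 .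
    qed
    have "(\<lambda>n. \<sigma>\<^sub>M * (N (\<lambda>x. dx (s n) x - p x))\<^sup>2 + \<sigma>\<^sub>M * (N (\<lambda>x. dy (s n) x - q x))\<^sup>2 + (tr0 L (s n) - k)\<^sup>2 / R)
      \<longlonglongrightarrow> \<sigma>\<^sub>M * 0\<^sup>2 + \<sigma>\<^sub>M * 0\<^sup>2 + 0\<^sup>2 / R"
      using R by (intro tendsto_add tendsto_mult tendsto_divide tendsto_power tendsto_const p(2) q(2) LIM_zero[OF k]) auto
    then show "(\<lambda>n. \<sigma>\<^sub>M * (N (\<lambda>x. dx (s n) x - p x))\<^sup>2 + \<sigma>\<^sub>M * (N (\<lambda>x. dy (s n) x - q x))\<^sup>2 + (tr0 L (s n) - k)\<^sup>2 / R) \<longlonglongrightarrow> 0"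
      by simp
  qed
  then show ?thesis using uV by blast
qed

text \<open>The functional is bounded in the energy norm by Cauchy-Schwarz and the energy bound on
  the L2 norm. The element \<open>u0\<close> only witnesses that the space is inhabited.\<close>

lemma dual_solution_exists:
  assumes g: "g \<in> L2 (leb L)" and ne: "u0 \<in> Vc L"
  shows "\<exists>w\<in>Vc L. \<forall>v\<in>Vc L. bilinear_a L R \<sigma> w v = (LINT z|leb L. g z * v z)"
proof (rule riesz_representation[where K = "N g * (2 * L * Kc)", OF Vc_lincomb(1)[OF L] ne a_sym a_lin a_nonneg _ _ Vc_complete])
  show "(LINT z|leb L. g z * (\<alpha> * u z + \<beta> * v z)) = \<alpha> * (LINT z|leb L. g z * u z) + \<beta> * (LINT z|leb L. g z * v z)"
    if u: "u \<in> Vc L" and v: "v \<in> Vc L" for u v \<alpha> \<beta>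
  proof -
    have "(\<lambda>z. g z * (\<alpha> * u z + \<beta> * v z)) = (\<lambda>z. \<alpha> * (g z * u z) + \<beta> * (g z * v z))" by (auto simp: algebra_simps)
    then show ?thesis
      using L2_mult_integrable[OF g Vc_L2(1)[OF u]] L2_mult_integrable[OF g Vc_L2(1)[OF v]] by simp
  qed
  show "\<bar>LINT z|leb L. g z * u z\<bar> \<le> N g * (2 * L * Kc) * sqrt (bilinear_a L R \<sigma> u u)" if u: "u \<in> Vc L" for u
  proof -
    have "\<bar>LINT z|leb L. g z * u z\<bar> \<le> N g * N u" by (rule L2_Cauchy_Schwarz[OF g Vc_L2(1)[OF u]])
    also have "\<dots> \<le> N g * (2 * L * Kc * sqrt (bilinear_a L R \<sigma> u u))"
      by (intro mult_left_mono energy_controls(4)[OF u]) simp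
    finally show ?thesis by (simp add: mult.assoc)
  qed
qed

end

section \<open>Approximation by edge averages\<close>

lemma primy_measurable [measurable]:
  assumes [measurable]: "g \<in> borel_measurable (borel \<Otimes>\<^sub>M borel)"
  shows "primy L g \<in> borel_measurable (borel \<Otimes>\<^sub>M borel)"
  unfolding primy_def by measurable

lemma L2_lsq_sections_y:
  assumes g: "g \<in> L2 (lsq L)"
  shows "AE x in lseg L. (\<lambda>y. g (x, y)) \<in> L2 (lseg L)"
  using L2_lsq_sections[OF L2_swap_lsq[OF g]] by simp

lemma integral_lseg_interval:
  assumes "0 \<le> a" "a \<le> b" "b \<le> L"
  shows "(LINT s|lseg L. indicator {a..<b} s) = b - a"
proof -
  have F: "(LINT x|lseg L. indicator {c<..} x * (1 :: real)) = L - c" if "0 \<le> c" "c \<le> L" for c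
    by (rule lseg_FTC) (use that in \<open>auto intro!: derivative_eq_intros\<close>)
  have i: "integrable (lseg L) (\<lambda>x. indicator {c<..} x :: real)" for c
    by (rule lseg.integrable_const_bound[where B = 1]) auto
  have "(LINT s|lseg L. indicator {a..<b} s :: real) = (LINT s|lseg L. indicator {a<..} s - indicator {b<..} s)"
  proof (rule integral_cong_AE)
    have "AE s in lborel. s \<noteq> a" "AE s in lborel. s \<noteq> b" by (rule AE_lborel_singleton)+
    then have "AE s in lseg L. s \<noteq> a \<and> s \<noteq> b" unfolding AE_lseg by eventually_elim simp
    then show "AE s in lseg L. indicator {a..<b} s = indicator {a<..} s - (indicator {b<..} s :: real)"
      by eventually_elim (use assms in \<open>auto simp: indicator_def\<close>)
  qed measurable
  also have "\<dots> = (L - a) - (L - b)" using F[of a] F[of b] i assms by simp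
  finally show ?thesis by simp
qed

lemma interval_primitive_diff_le:
  fixes f :: "real \<Rightarrow> real"
  assumes f: "integrable (lseg L) f" and "x \<in> {a..b}" "x' \<in> {a..b}"
  shows "\<bar>(LINT r|lseg L. (if r < x then f r else 0)) - (LINT r|lseg L. (if r < x' then f r else 0))\<bar>
    \<le> (LINT r|lseg L. indicator {a..<b} r * \<bar>f r\<bar>)"
proof -
  note i = integrable_if_less[OF f]
  have "\<bar>(LINT r|lseg L. (if r < x then f r else 0)) - (LINT r|lseg L. (if r < x' then f r else 0))\<bar>
    = \<bar>LINT r|lseg L. (if r < x then f r else 0) - (if r < x' then f r else 0)\<bar>"
    using i[of x] i[of x'] by simp
  also have "\<dots> \<le> (LINT r|lseg L. \<bar>(if r < x then f r else 0) - (if r < x' then f r else 0)\<bar>)"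
    using integral_norm_bound[of "lseg L" "\<lambda>r. (if r < x then f r else 0) - (if r < x' then f r else 0)"] by simp
  also have "\<dots> \<le> (LINT r|lseg L. indicator {a..<b} r * \<bar>f r\<bar>)"
  proof (rule integral_mono)
    show "integrable (lseg L) (\<lambda>r. \<bar>(if r < x then f r else 0) - (if r < x' then f r else 0)\<bar>)"
      using i[of x] i[of x'] by simp
    show "integrable (lseg L) (\<lambda>r. indicator {a..<b} r * \<bar>f r\<bar>)"
      using integrable_mult_indicator[of "{a..<b}" "lseg L" "\<lambda>r. \<bar>f r\<bar>"] f by simp
  qed (use assms in \<open>auto simp: indicator_def\<close>)
  finally show ?thesis .
qed

lemma Cauchy_Schwarz_indicator:
  assumes M: "finite_measure M" and S: "S \<in> sets M" and f: "f \<in> L2 M"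
  shows "(LINT x|M. indicator S x * \<bar>f x\<bar>)\<^sup>2 \<le> (LINT x|M. indicator S x) * (LINT x|M. indicator S x * (f x)\<^sup>2)"
proof -
  have fm: "f \<in> borel_measurable M" by (rule L2_measurable[OF f])
  have I: "(\<lambda>x. indicator S x :: real) \<in> L2 M" by (rule L2_bounded[OF M, of _ 1]) (use S in auto)
  have "(\<lambda>x. \<bar>f x\<bar>) \<in> L2 M" using f by (auto simp: L2_def)
  then have g: "(\<lambda>x. indicator S x * \<bar>f x\<bar>) \<in> L2 M"
    by (rule L2_bounded_mult[where B = 1]) (use S in \<open>auto simp: indicator_def\<close>)
  have eq: "indicator S x * (indicator S x * \<bar>f x\<bar>) = indicator S x * \<bar>f x\<bar>"
    "(indicator S x * \<bar>f x\<bar>)\<^sup>2 = indicator S x * (f x)\<^sup>2" "(indicator S x :: real)\<^sup>2 = indicator S x" for x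
    by (auto simp: indicator_def)
  have "\<bar>LINT x|M. indicator S x * \<bar>f x\<bar>\<bar>\<^sup>2 \<le> (L2_norm M (indicator S) * L2_norm M (\<lambda>x. indicator S x * \<bar>f x\<bar>))\<^sup>2"
    using L2_Cauchy_Schwarz[OF I g] unfolding eq by (intro power_mono) auto
  then show ?thesis unfolding power_mult_distrib L2_norm_power2 eq by simp
qed

text \<open>Here \<open>F\<close> stands for a first derivative of an \<open>H\<^sup>2\<close> function, with \<open>m\<close> and \<open>n\<close> its derivatives in \<open>y\<close> and \<open>x\<close>.
  That \<open>F\<close> is given everywhere by a primitive in \<open>y\<close> makes its values on horizontal mesh edges meaningful.\<close>

context
  fixes L :: real and F m n :: "real \<times> real \<Rightarrow> real" and p c :: "real \<Rightarrow> real"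
  assumes L: "L > 0" and m: "m \<in> L2 (lsq L)" and n: "n \<in> L2 (lsq L)" and p: "p \<in> L2 (lseg L)"
    and F: "\<And>x y. F (x, y) = p x + primy L m (x, y)"
    and Feq: "AE z in lsq L. F z = c (snd z) + primx L n z"
    and FL2: "F \<in> L2 (lsq L)"
begin

lemma data_measurable: "m \<in> borel_measurable (borel \<Otimes>\<^sub>M borel)" "n \<in> borel_measurable (borel \<Otimes>\<^sub>M borel)"
   "F \<in> borel_measurable (borel \<Otimes>\<^sub>M borel)" "p \<in> borel_measurable borel"
  using L2_measurable[OF m] L2_measurable[OF n] L2_measurable[OF FL2] L2_measurable[OF p] by auto

text \<open>This holds on every horizontal line and not only on almost every one: the bound
  \<open>\<bar>p s\<bar>\<close> plus the integral of \<open>\<bar>m\<bar>\<close> over the vertical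
  line through \<open>s\<close> does not depend on \<open>y\<close>. Mesh lines form a null set, so
  an almost-everywhere statement would say nothing about them.\<close>

lemma section_integrable: "integrable (lseg L) (\<lambda>s. F (s, y))"
proof -
  note data_measurable [measurable]
  show ?thesis
  proof (rule Bochner_Integration.integrable_bound)
  have mabs: "integrable (lsq L) (\<lambda>z. \<bar>m (prod.swap z)\<bar>)" using lsq_integrable[OF L2_swap_lsq[OF m]] by simp
  have "integrable (lseg L) (\<lambda>s. LINT t|lseg L. \<bar>m (s, t)\<bar>)"
    using integral_lsq_yx(3)[OF mabs] by simp
  then show "integrable (lseg L) (\<lambda>s. \<bar>p s\<bar> + (LINT t|lseg L. \<bar>m (s, t)\<bar>))"
    using lseg_integrable[OF p] by simp
  show "AE s in lseg L. norm (F (s, y)) \<le> norm (\<bar>p s\<bar> + (LINT t|lseg L. \<bar>m (s, t)\<bar>))"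
    using L2_lsq_sections_y[OF m]
  proof eventually_elim
    case (elim s)
    have "\<bar>primy L m (s, y)\<bar> \<le> (LINT t|lseg L. \<bar>m (s, t)\<bar>)"
      using primx_abs_le[of L "\<lambda>z. m (prod.swap z)" "(y, s)"] lseg_integrable[OF elim]
        primy_swap[of L m "(y, s)"] by simp
    then show ?case unfolding F by (simp add: abs_if split: if_splits)
  qed
qed measurable
qed

text \<open>\<open>F (x, y)\<close> is compared with \<open>F (s, ys)\<close> by going horizontally
  from \<open>x\<close> to \<open>s\<close> at height \<open>y\<close>, then vertically to height
  \<open>ys\<close>, and averaging over \<open>s\<close>. The first way costs an integral of
  \<open>n\<close> along one line, the second an integral of \<open>m\<close> over the cell. The
  height \<open>ys\<close> stands for either horizontal edge.\<close>

lemma cell_pointwise: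
  assumes h: "h > 0" and a: "0 \<le> a" "a + h \<le> L" and b: "0 \<le> b" "b + h \<le> L" and ys: "b \<le> ys" "ys \<le> b + h"
  defines "K \<equiv> {a..<a + h} \<times> {b..<b + h}" and "Dq \<equiv> (LINT s|lseg L. indicator {a..<a + h} s * F (s, ys)) / h"
  shows "AE z in lsq L. z \<in> K \<longrightarrow> (F z - Dq)\<^sup>2 \<le>
    2 * h * (LINT s|lseg L. indicator {a..<a + h} s * (n (s, snd z))\<^sup>2) + 2 * (LINT w|lsq L. indicator K w * (m w)\<^sup>2)"
proof (rule AE_lsq_if_yx)
  note data_measurable [measurable]
  have [measurable]: "K \<in> sets (borel \<Otimes>\<^sub>M borel)" unfolding K_def by measurable
  show "Measurable.pred (borel \<Otimes>\<^sub>M borel) (\<lambda>z. z \<in> K \<longrightarrow> (F z - Dq)\<^sup>2 \<le>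
    2 * h * (LINT s|lseg L. indicator {a..<a + h} s * (n (s, snd z))\<^sup>2) + 2 * (LINT w|lsq L. indicator K w * (m w)\<^sup>2))"
    by measurable
  let ?I = "\<lambda>s. indicator {a..<a + h} s :: real" and ?J = "\<lambda>t. indicator {b..<b + h} t :: real"
  \<comment> \<open>Bounds the vertical way at abscissa \<open>s\<close> for all heights within the
    cell; integrated over \<open>s\<close> it becomes the integral \<open>BK\<close> of
    \<open>\<bar>m\<bar>\<close> over the cell.\<close>
  define B where "B s = (LINT t|lseg L. ?J t * \<bar>m (s, t)\<bar>)" for s
  define BK where "BK = (LINT w|lsq L. indicator K w * \<bar>m w\<bar>)"
  have mK: "integrable (lsq L) (\<lambda>w. indicator K w * \<bar>m w\<bar>)"
    using integrable_mult_indicator[of K "lsq L" "\<lambda>w. \<bar>m w\<bar>"] lsq_integrable[OF m] by simp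
  have BKeq: "BK = (LINT s|lseg L. ?I s * B s)"
  proof -
    have "(LINT t|lseg L. indicator K (s, t) * \<bar>m (s, t)\<bar>) = ?I s * B s" for s
    proof -
      have "(LINT t|lseg L. indicator K (s, t) * \<bar>m (s, t)\<bar>) = (LINT t|lseg L. ?I s * (?J t * \<bar>m (s, t)\<bar>))"
        by (rule Bochner_Integration.integral_cong) (auto simp: K_def indicator_def)
      then show ?thesis by (simp add: B_def)
    qed
    then show ?thesis unfolding BK_def using integral_lsq_xy[OF mK] by simp
  qed
  have IB: "integrable (lseg L) (\<lambda>s. ?I s * B s)"
  proof -
    have "integrable (lsq L) (\<lambda>w. indicator K (prod.swap w) * \<bar>m (prod.swap w)\<bar>)"
      using integrable_swap_lsq[of "\<lambda>w. indicator K w * \<bar>m w\<bar>" L] mK by simp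
    from integral_lsq_yx(3)[OF this]
    have "integrable (lseg L) (\<lambda>s. LINT t|lseg L. indicator K (s, t) * \<bar>m (s, t)\<bar>)" by simp
    moreover have "(LINT t|lseg L. indicator K (s, t) * \<bar>m (s, t)\<bar>) = ?I s * B s" for s
    proof -
      have "(LINT t|lseg L. indicator K (s, t) * \<bar>m (s, t)\<bar>) = (LINT t|lseg L. ?I s * (?J t * \<bar>m (s, t)\<bar>))"
        by (rule Bochner_Integration.integral_cong) (auto simp: K_def indicator_def)
      then show ?thesis by (simp add: B_def)
    qed
    ultimately show ?thesis by simp
  qed
  have Ih: "(LINT s|lseg L. ?I s) = h" using integral_lseg_interval[OF a(1) _ a(2)] h by simp
  have Jh: "(LINT s|lseg L. ?J s) = h" using integral_lseg_interval[OF b(1) _ b(2)] h by simp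
  have Ii: "integrable (lseg L) ?I" by (rule lseg.integrable_const_bound[where B = 1]) auto
  have IF: "integrable (lseg L) (\<lambda>s. ?I s * F (s, ys))"
    using integrable_mult_indicator[of "{a..<a + h}" "lseg L" "\<lambda>s. F (s, ys)"] section_integrable by simp
  have vert: "AE s in lseg L. \<forall>y\<in>{b..b + h}. \<bar>F (s, y) - F (s, ys)\<bar> \<le> B s"
    using L2_lsq_sections_y[OF m]
  proof eventually_elim
    case (elim s)
    show ?case
    proof
      fix y assume "y \<in> {b..b + h}"
      then have "\<bar>primy L m (s, y) - primy L m (s, ys)\<bar> \<le> B s"
        unfolding primy_Pair B_def using ys by (intro interval_primitive_diff_le lseg_integrable elim) auto
      then show "\<bar>F (s, y) - F (s, ys)\<bar> \<le> B s" by (simp add: F)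
    qed
  qed
  \<comment> \<open>Cauchy-Schwarz on the cell, whose area is \<open>h^2\<close>; this factor
    cancels the division by \<open>h\<close> below.\<close>
  have BK2: "BK\<^sup>2 \<le> h\<^sup>2 * (LINT w|lsq L. indicator K w * (m w)\<^sup>2)"
  proof -
    have KI: "integrable (lsq L) (\<lambda>w. indicator K w :: real)"
      by (rule lsqf.integrable_const_bound[where B = 1]) auto
    have "(LINT w|lsq L. indicator K w) = (LINT x|lseg L. LINT y|lseg L. ?I x * ?J y)"
      unfolding integral_lsq_xy[OF KI] by (intro Bochner_Integration.integral_cong) (auto simp: K_def indicator_def)
    also have "\<dots> = h\<^sup>2" using Ih Jh by (simp add: power2_eq_square)
    finally have "(LINT w|lsq L. indicator K w) = h\<^sup>2" .
    then show ?thesis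
      unfolding BK_def using Cauchy_Schwarz_indicator[OF finite_measure_lsq, of K L m] m by simp
  qed
  show "AE y in lseg L. AE x in lseg L. (x, y) \<in> K \<longrightarrow> (F (x, y) - Dq)\<^sup>2 \<le>
    2 * h * (LINT s|lseg L. ?I s * (n (s, snd (x, y)))\<^sup>2) + 2 * (LINT w|lsq L. indicator K w * (m w)\<^sup>2)"
    using AE_lsq_yx[OF Feq] L2_lsq_sections[OF n]
  proof eventually_elim
    case (elim y)
    define A where "A = (LINT r|lseg L. ?I r * \<bar>n (r, y)\<bar>)"
    have hor: "\<bar>F (x, y) - F (s, y)\<bar> \<le> A"
      if "F (x, y) = c (snd (x, y)) + primx L n (x, y)" "F (s, y) = c (snd (s, y)) + primx L n (s, y)"
        "x \<in> {a..a + h}" "s \<in> {a..a + h}" for x s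
    proof -
      have "\<bar>primx L n (x, y) - primx L n (s, y)\<bar> \<le> A"
        unfolding primx_Pair A_def using that by (intro interval_primitive_diff_le lseg_integrable elim)
      then show ?thesis using that(1,2) by simp
    qed
    have A2: "A\<^sup>2 \<le> h * (LINT s|lseg L. ?I s * (n (s, y))\<^sup>2)"
      unfolding A_def using Cauchy_Schwarz_indicator[OF lseg.finite_measure_axioms, of "{a..<a + h}" L "\<lambda>s. n (s, y)"] elim(2) Ih
      by simp
    show ?case
      using elim(1)
    proof (eventually_elim, intro impI)
      fix x assume x: "F (x, y) = c (snd (x, y)) + primx L n (x, y)" and xy: "(x, y) \<in> K"
      \<comment> \<open>Both terms are written as integrals over the edge, so that the comparison
        can be made for each \<open>s\<close> separately.\<close>
      have "\<bar>h * (F (x, y) - Dq)\<bar> = \<bar>LINT s|lseg L. ?I s * F (x, y) - ?I s * F (s, ys)\<bar>"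
        using IF Ii Ih h by (simp add: Dq_def right_diff_distrib)
      also have "\<dots> \<le> (LINT s|lseg L. \<bar>?I s * F (x, y) - ?I s * F (s, ys)\<bar>)"
        using integral_norm_bound[of "lseg L" "\<lambda>s. ?I s * F (x, y) - ?I s * F (s, ys)"] by simp
      also have "\<dots> \<le> (LINT s|lseg L. ?I s * A + ?I s * B s)"
      proof (rule integral_mono_AE)
        show "integrable (lseg L) (\<lambda>s. \<bar>?I s * F (x, y) - ?I s * F (s, ys)\<bar>)" using IF Ii by simp
        show "integrable (lseg L) (\<lambda>s. ?I s * A + ?I s * B s)" using IB Ii by simp
        show "AE s in lseg L. \<bar>?I s * F (x, y) - ?I s * F (s, ys)\<bar> \<le> ?I s * A + ?I s * B s"
          using vert elim(1)
        proof eventually_elim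
          case (elim s)
          show ?case
          proof (cases "s \<in> {a..<a + h}")
            case True
            have "\<bar>F (x, y) - F (s, y)\<bar> \<le> A" by (rule hor[OF x elim(2)]) (use xy True in \<open>auto simp: K_def\<close>)
            moreover have "\<bar>F (s, y) - F (s, ys)\<bar> \<le> B s" using elim(1) xy by (auto simp: K_def)
            ultimately show ?thesis using True by (simp add: indicator_def)
          qed simp
        qed
      qed
      also have "\<dots> = h * A + BK" using IB Ii Ih BKeq by simp
      finally have "h * \<bar>F (x, y) - Dq\<bar> \<le> h * A + BK" unfolding abs_mult using h by simp
      then have "\<bar>F (x, y) - Dq\<bar> \<le> A + BK / h" using h by (simp add: field_simps)
      then have "\<bar>F (x, y) - Dq\<bar>\<^sup>2 \<le> (A + BK / h)\<^sup>2" by (rule power_mono) simp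
      also have "\<dots> \<le> 2 * A\<^sup>2 + 2 * (BK / h)\<^sup>2"
        using sum_squares_bound[of A "BK / h"] by (simp add: power2_sum)
      also have "(BK / h)\<^sup>2 \<le> (LINT w|lsq L. indicator K w * (m w)\<^sup>2)"
        using BK2 h by (simp add: power_divide field_simps)
      finally show "(F (x, y) - Dq)\<^sup>2 \<le> 2 * h * (LINT s|lseg L. ?I s * (n (s, snd (x, y)))\<^sup>2) + 2 * (LINT w|lsq L. indicator K w * (m w)\<^sup>2)"
        using A2 by simp
    qed
  qed
qed

text \<open>Integrating the pointwise bound, the term with \<open>n\<close> is constant in
  \<open>x\<close> and gains a factor \<open>h\<close>, while the term with \<open>m\<close> is
  constant on the cell and gains its area; both end up with \<open>h^2\<close>.\<close>

lemma cell_integral: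
  assumes h: "h > 0" and a: "0 \<le> a" "a + h \<le> L" and b: "0 \<le> b" "b + h \<le> L" and ys: "b \<le> ys" "ys \<le> b + h"
  defines "K \<equiv> {a..<a + h} \<times> {b..<b + h}" and "Dq \<equiv> (LINT s|lseg L. indicator {a..<a + h} s * F (s, ys)) / h"
  shows "(LINT z|lsq L. indicator K z * (F z - Dq)\<^sup>2) \<le>
    2 * h\<^sup>2 * ((LINT z|lsq L. indicator K z * (n z)\<^sup>2) + (LINT z|lsq L. indicator K z * (m z)\<^sup>2))"
proof -
  note data_measurable [measurable]
  have [measurable]: "K \<in> sets (borel \<Otimes>\<^sub>M borel)" unfolding K_def by measurable
  have Dc: "(\<lambda>_. Dq) \<in> L2 (lsq L)" by (rule L2_bounded[OF finite_measure_lsq]) auto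
  let ?I = "\<lambda>s. indicator {a..<a + h} s :: real" and ?J = "\<lambda>t. indicator {b..<b + h} t :: real"
  let ?G = "\<lambda>y. LINT s|lseg L. ?I s * (n (s, y))\<^sup>2" and ?Q = "LINT w|lsq L. indicator K w * (m w)\<^sup>2"
  have ik: "integrable (lsq L) (\<lambda>z. indicator K z * f z)" if "integrable (lsq L) f" for f :: "real \<times> real \<Rightarrow> real"
    using integrable_mult_indicator[OF _ that, of K] by simp
  have iF: "integrable (lsq L) (\<lambda>z. indicator K z * (F z - Dq)\<^sup>2)"
    by (rule ik[OF L2_square_integrable[OF L2_diff[OF FL2 Dc]]])
  have in2: "integrable (lsq L) (\<lambda>z. ?I (fst z) * (n z)\<^sup>2)"
    using integrable_mult_indicator[OF _ L2_square_integrable[OF n], of "{a..<a + h} \<times> UNIV"]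
    by (simp add: indicator_times)
  have G: "integrable (lseg L) ?G" using integral_lsq_yx(3)[OF in2] by simp
  have iG: "integrable (lsq L) (\<lambda>z. indicator K z * ?G (snd z))"
    by (rule ik[OF lseg_product_snd(1)[OF G L]])
  have iK: "integrable (lsq L) (\<lambda>z. indicator K z :: real)"
    by (rule lsqf.integrable_const_bound[where B = 1]) auto
  have Ih: "(LINT s|lseg L. ?I s) = h" using integral_lseg_interval[OF a(1) _ a(2)] h by simp
  have Jh: "(LINT s|lseg L. ?J s) = h" using integral_lseg_interval[OF b(1) _ b(2)] h by simp
  have Kd: "indicator K (x, y) = ?I x * ?J y" for x y by (auto simp: K_def indicator_def)
  have mK: "(LINT w|lsq L. indicator K w) = h\<^sup>2"
    using integral_lsq_xy[OF iK] Ih Jh by (simp add: Kd power2_eq_square)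
  have "(LINT z|lsq L. indicator K z * ?G (snd z)) = (LINT y|lseg L. LINT x|lseg L. ?I x * (?J y * ?G y))"
    using integral_lsq_yx(1)[OF iG] by (simp add: Kd mult.assoc)
  also have "\<dots> = h * (LINT y|lseg L. ?J y * ?G y)" using Ih by simp
  also have "(LINT y|lseg L. ?J y * ?G y) = (LINT y|lseg L. LINT s|lseg L. ?J y * (?I s * (n (s, y))\<^sup>2))" by simp
  also have "\<dots> = (LINT z|lsq L. indicator K z * (n z)\<^sup>2)"
    using integral_lsq_yx(1)[OF ik[OF L2_square_integrable[OF n]]] by (simp add: Kd mult.assoc mult.left_commute)
  finally have Gn: "(LINT z|lsq L. indicator K z * ?G (snd z)) = h * (LINT z|lsq L. indicator K z * (n z)\<^sup>2)" .
  have "(LINT z|lsq L. indicator K z * (F z - Dq)\<^sup>2) \<le>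
      (LINT z|lsq L. 2 * h * (indicator K z * ?G (snd z)) + (2 * ?Q) * indicator K z)"
  proof (rule integral_mono_AE[OF iF])
    show "integrable (lsq L) (\<lambda>z. 2 * h * (indicator K z * ?G (snd z)) + (2 * ?Q) * indicator K z)"
      using iG iK by simp
    show "AE z in lsq L. indicator K z * (F z - Dq)\<^sup>2 \<le> 2 * h * (indicator K z * ?G (snd z)) + (2 * ?Q) * indicator K z"
      using cell_pointwise[OF h a b ys] unfolding K_def[symmetric] Dq_def[symmetric]
      by eventually_elim (simp add: indicator_def)
  qed
  also have "\<dots> = 2 * h * (LINT z|lsq L. indicator K z * ?G (snd z)) + (2 * ?Q) * (LINT z|lsq L. indicator K z)"
    using iG iK by simp
  also have "\<dots> = 2 * h\<^sup>2 * ((LINT z|lsq L. indicator K z * (n z)\<^sup>2) + ?Q)"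
    unfolding Gn mK by (simp add: power2_eq_square algebra_simps)
  finally show ?thesis .
qed

end

lemma has_weak_deriv_cong_AE:
  assumes w: "has_weak_deriv (square L) i j u' g" and u: "u \<in> borel_measurable (leb L)"
    and u': "u' \<in> borel_measurable (borel \<Otimes>\<^sub>M borel)" and eq: "AE z in lsq L. u z = u' z"
  shows "has_weak_deriv (square L) i j u g"
  unfolding has_weak_deriv_def
proof (intro conjI ballI has_weak_deriv_L2[OF w])
  fix \<phi> assume \<phi>: "\<phi> \<in> test_functions (square L)"
  have d: "D i j \<phi> \<in> borel_measurable (borel \<Otimes>\<^sub>M borel)"
    by (rule test_functions_borel[OF D_test_functions[OF \<phi>]])
  have "(LINT z|leb L. u z * D i j \<phi> z) = (LINT z|leb L. u' z * D i j \<phi> z)"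
    using integral_leb_version[OF u u' d eq]
      integral_leb_version[OF borel_measurable_lebesgue_on_square[OF u'] u' d] by simp
  then show "(LINT z|leb L. u z * D i j \<phi> z) = (-1) ^ (i + j) * (LINT z|leb L. g z * \<phi> z)"
    using w \<phi> by (simp add: has_weak_deriv_def)
qed

text \<open>Two readings of one double integral. The first, over a quadrant, shows continuity in
  \<open>y\<close>; the second exhibits \<open>primx L m\<close> as the vertical derivative,
  although \<open>F\<close> was given as a horizontal one.\<close>

lemma primx_primy_Fubini:
  assumes m: "m \<in> L2 (lsq L)" and p: "integrable (lseg L) p" and F: "\<And>x y. F (x, y) = p x + primy L m (x, y)"
  shows "primx L F (x, y) = (LINT s|lseg L. (if s < x then p s else 0)) + (LINT z|lsq L. (if fst z < x \<and> snd z < y then m z else 0))"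
    and "primx L F (x, y) = (LINT s|lseg L. (if s < x then p s else 0)) + primy L (primx L m) (x, y)"
proof -
  have [measurable]: "m \<in> borel_measurable (borel \<Otimes>\<^sub>M borel)" using L2_measurable[OF m] by simp
  let ?m = "\<lambda>z. (if fst z < x \<and> snd z < y then m z else 0)"
  have i: "integrable (lsq L) ?m"
    by (rule Bochner_Integration.integrable_bound[OF lsq_integrable[OF m]]) auto
  have xm: "(LINT t|lseg L. ?m (s, t)) = (if s < x then primy L m (s, y) else 0)" for s
    unfolding primy_Pair by (auto intro!: Bochner_Integration.integral_cong)
  have ym: "(LINT s|lseg L. ?m (s, t)) = (if t < y then primx L m (x, t) else 0)" for t
    unfolding primx_Pair by (auto intro!: Bochner_Integration.integral_cong)
  have "integrable (lsq L) (\<lambda>z. ?m (prod.swap z))" using integrable_swap_lsq[of ?m L] i by simp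
  from integral_lsq_yx(3)[OF this] have iy: "integrable (lseg L) (\<lambda>s. if s < x then primy L m (s, y) else 0)"
    unfolding xm[symmetric] by (simp cong: if_cong)
  have "primx L F (x, y) = (LINT s|lseg L. (if s < x then p s else 0) + (if s < x then primy L m (s, y) else 0))"
    unfolding primx_Pair F by (rule Bochner_Integration.integral_cong) auto
  also have "\<dots> = (LINT s|lseg L. (if s < x then p s else 0)) + (LINT s|lseg L. (if s < x then primy L m (s, y) else 0))"
    by (rule Bochner_Integration.integral_add[OF integrable_if_less[OF p] iy])
  also have "(LINT s|lseg L. (if s < x then primy L m (s, y) else 0)) = (LINT z|lsq L. ?m z)"
    unfolding integral_lsq_xy[OF i] xm ..
  finally show 1: "primx L F (x, y) = (LINT s|lseg L. (if s < x then p s else 0)) + (LINT z|lsq L. ?m z)" .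
  have "(LINT z|lsq L. ?m z) = primy L (primx L m) (x, y)"
    unfolding integral_lsq_yx(1)[OF i] ym primy_Pair ..
  then show "primx L F (x, y) = (LINT s|lseg L. (if s < x then p s else 0)) + primy L (primx L m) (x, y)"
    using 1 by simp
qed

section \<open>Nodal interpolation\<close>

text \<open>For \<open>s = 1\<close> this is the nodal basis function of \<open>mesh_up\<close> at the origin (for unit mesh size),
  for \<open>s = - 1\<close> that of \<open>mesh_down\<close>.\<close>

definition hat :: "real \<Rightarrow> real \<Rightarrow> real \<Rightarrow> real" where
  "hat s x y = max 0 (min (min (1 - \<bar>x\<bar>) (1 - \<bar>y\<bar>)) (1 - \<bar>x - s * y\<bar>))"

text \<open>As a combination of translated hats the interpolant is continuous and bounded on the
  whole plane at once, without gluing triangles; that it is affine on each triangle is derived from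
  local formulas.\<close>

definition interp :: "real \<Rightarrow> real \<Rightarrow> nat \<Rightarrow> (nat \<Rightarrow> nat \<Rightarrow> real) \<Rightarrow> real \<times> real \<Rightarrow> real" where
  "interp s h M W z = (\<Sum>i\<le>M. \<Sum>j\<le>M. W i j * hat s (fst z / h - real i) (snd z / h - real j))"

text \<open>In local coordinates on the unit cell, the triangle that contains the bottom edge; the
  other one contains the top edge.\<close>

definition lower_half :: "real \<Rightarrow> real \<Rightarrow> real \<Rightarrow> bool" where
  "lower_half s \<xi> \<eta> \<longleftrightarrow> (if s = 1 then \<eta> \<le> \<xi> else \<xi> + \<eta> \<le> 1)"

text \<open>Half open, so that each point of the square belongs to exactly one cell and sums over
  cells collapse without null sets.\<close>

definition cell :: "real \<Rightarrow> nat \<times> nat \<Rightarrow> (real \<times> real) set" where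
  "cell h p = {real (fst p) * h..<real (fst p) * h + h} \<times> {real (snd p) * h..<real (snd p) * h + h}"

definition slope :: "real \<Rightarrow> (nat \<Rightarrow> nat \<Rightarrow> real) \<Rightarrow> nat \<Rightarrow> nat \<Rightarrow> real" where
  "slope h W a b = (W (Suc a) b - W a b) / h"

text \<open>An affine function has as its horizontal derivative the difference quotient along the
  single horizontal edge of its triangle: the bottom edge of the cell in the lower half, the top
  edge in the upper half.\<close>

definition interp_dx :: "real \<Rightarrow> real \<Rightarrow> nat \<Rightarrow> (nat \<Rightarrow> nat \<Rightarrow> real) \<Rightarrow> real \<times> real \<Rightarrow> real" where
  "interp_dx s h M W z = (\<Sum>p\<in>{..<M} \<times> {..<M}. indicator (cell h p) z *
     (if lower_half s (fst z / h - real (fst p)) (snd z / h - real (snd p))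
      then slope h W (fst p) (snd p) else slope h W (fst p) (Suc (snd p))))"

lemma hat_bounds: "0 \<le> hat s x y" "hat s x y \<le> 1"
  by (auto simp: hat_def)

lemma hat_eq_0: "\<bar>x\<bar> \<ge> 1 \<or> \<bar>y\<bar> \<ge> 1 \<Longrightarrow> hat s x y = 0"
  by (auto simp: hat_def)

lemma hat_commute: "s = 1 \<or> s = -1 \<Longrightarrow> hat s x y = hat s y x"
  by (auto simp: hat_def abs_minus_commute min.commute add.commute)

lemma continuous_interp: "h > 0 \<Longrightarrow> continuous_on S (interp s h M W)"
  unfolding interp_def hat_def by (intro continuous_intros) auto

lemma interp_bounded: "\<bar>interp s h M W z\<bar> \<le> (\<Sum>i\<le>M. \<Sum>j\<le>M. \<bar>W i j\<bar>)"
proof -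
  have "\<bar>interp s h M W z\<bar> \<le> (\<Sum>i\<le>M. \<bar>\<Sum>j\<le>M. W i j * hat s (fst z / h - real i) (snd z / h - real j)\<bar>)"
    unfolding interp_def by (rule sum_abs)
  also have "\<dots> \<le> (\<Sum>i\<le>M. \<Sum>j\<le>M. \<bar>W i j\<bar>)"
  proof (rule sum_mono)
    fix i
    have "\<bar>\<Sum>j\<le>M. W i j * hat s (fst z / h - real i) (snd z / h - real j)\<bar> \<le>
      (\<Sum>j\<le>M. \<bar>W i j * hat s (fst z / h - real i) (snd z / h - real j)\<bar>)" by (rule sum_abs)
    also have "\<dots> \<le> (\<Sum>j\<le>M. \<bar>W i j\<bar>)"
      by (rule sum_mono) (use hat_bounds in \<open>auto simp: abs_mult intro!: mult_left_le\<close>)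
    finally show "\<bar>\<Sum>j\<le>M. W i j * hat s (fst z / h - real i) (snd z / h - real j)\<bar> \<le> (\<Sum>j\<le>M. \<bar>W i j\<bar>)" .
  qed
  finally show ?thesis .
qed

text \<open>Both meshes are symmetric under reflection in the main diagonal, so vertical derivatives
  are obtained from horizontal ones with transposed nodal values.\<close>

lemma interp_transpose:
  assumes "s = 1 \<or> s = -1"
  shows "interp s h M W (prod.swap z) = interp s h M (\<lambda>i j. W j i) z"
proof -
  have "interp s h M W (prod.swap z) = (\<Sum>i\<le>M. \<Sum>j\<le>M. W i j * hat s (fst z / h - real j) (snd z / h - real i))"
    unfolding interp_def by (intro sum.cong refl) (simp add: hat_commute[OF assms])
  also have "\<dots> = interp s h M (\<lambda>i j. W j i) z" unfolding interp_def by (rule sum.swap)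
  finally show ?thesis .
qed

section \<open>Local formulas on a cell and on its triangles\<close>

lemma sum_two_neighbours:
  fixes f :: "nat \<Rightarrow> real"
  assumes "a < M" "\<And>i. i \<noteq> a \<Longrightarrow> i \<noteq> Suc a \<Longrightarrow> f i = 0"
  shows "(\<Sum>i\<le>M. f i) = f a + f (Suc a)"
proof -
  have "(\<Sum>i\<le>M. f i) = (\<Sum>i\<in>{a, Suc a}. f i)"
    by (rule sum.mono_neutral_right) (use assms in auto)
  then show ?thesis by simp
qed

lemma neighbour_distance:
  assumes "0 \<le> x - real a" "x - real a \<le> 1" "i \<noteq> a" "i \<noteq> Suc a"
  shows "\<bar>x - real i\<bar> \<ge> 1"
proof (cases "i < a")
  case True
  then have "real i + 1 \<le> real a" by linarith
  then show ?thesis using assms(1) by linarith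
next
  case False
  then have "Suc (Suc a) \<le> i" using assms by linarith
  then have "real a + 2 \<le> real i" by linarith
  then show ?thesis using assms(2) by linarith
qed

text \<open>A hat vanishes at distance at least 1 in either coordinate, so only the four corners of
  the cell contribute.\<close>

lemma interp_cell:
  assumes ab: "a < M" "b < M" and x: "0 \<le> fst z / h - real a" "fst z / h - real a \<le> 1"
    and y: "0 \<le> snd z / h - real b" "snd z / h - real b \<le> 1"
  defines "\<xi> \<equiv> fst z / h - real a" and "\<eta> \<equiv> snd z / h - real b"
  shows "interp s h M W z = W a b * hat s \<xi> \<eta> + W a (Suc b) * hat s \<xi> (\<eta> - 1)
    + (W (Suc a) b * hat s (\<xi> - 1) \<eta> + W (Suc a) (Suc b) * hat s (\<xi> - 1) (\<eta> - 1))"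
proof -
  have inner: "(\<Sum>j\<le>M. W i j * hat s X (snd z / h - real j)) = W i b * hat s X \<eta> + W i (Suc b) * hat s X (\<eta> - 1)" for i X
    by (subst sum_two_neighbours[OF ab(2)])
      (use neighbour_distance[OF y] in \<open>auto simp: hat_eq_0 \<eta>_def algebra_simps\<close>)
  have "interp s h M W z = (\<Sum>i\<le>M. W i b * hat s (fst z / h - real i) \<eta> + W i (Suc b) * hat s (fst z / h - real i) (\<eta> - 1))"
    unfolding interp_def inner ..
  also have "\<dots> = W a b * hat s \<xi> \<eta> + W a (Suc b) * hat s \<xi> (\<eta> - 1)
    + (W (Suc a) b * hat s (\<xi> - 1) \<eta> + W (Suc a) (Suc b) * hat s (\<xi> - 1) (\<eta> - 1))"
    by (subst sum_two_neighbours[OF ab(1)])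
      (use neighbour_distance[OF x] in \<open>auto simp: hat_eq_0 \<xi>_def algebra_simps\<close>)
  finally show ?thesis .
qed

text \<open>The nonzero values are the barycentric coordinates of the point in the triangle below,
  respectively above, the diagonal.\<close>

lemma hat_up:
  assumes "0 \<le> \<xi>" "\<xi> \<le> 1" "0 \<le> \<eta>" "\<eta> \<le> 1"
  shows "\<eta> \<le> \<xi> \<Longrightarrow> hat 1 \<xi> \<eta> = 1 - \<xi> \<and> hat 1 (\<xi> - 1) \<eta> = \<xi> - \<eta> \<and> hat 1 \<xi> (\<eta> - 1) = 0 \<and> hat 1 (\<xi> - 1) (\<eta> - 1) = \<eta>"
    and "\<xi> \<le> \<eta> \<Longrightarrow> hat 1 \<xi> \<eta> = 1 - \<eta> \<and> hat 1 (\<xi> - 1) \<eta> = 0 \<and> hat 1 \<xi> (\<eta> - 1) = \<eta> - \<xi> \<and> hat 1 (\<xi> - 1) (\<eta> - 1) = \<xi>"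
  using assms by (auto simp: hat_def)

lemma hat_down:
  assumes "0 \<le> \<xi>" "\<xi> \<le> 1" "0 \<le> \<eta>" "\<eta> \<le> 1"
  shows "\<xi> + \<eta> \<le> 1 \<Longrightarrow> hat (-1) \<xi> \<eta> = 1 - \<xi> - \<eta> \<and> hat (-1) (\<xi> - 1) \<eta> = \<xi> \<and> hat (-1) \<xi> (\<eta> - 1) = \<eta> \<and> hat (-1) (\<xi> - 1) (\<eta> - 1) = 0"
    and "1 \<le> \<xi> + \<eta> \<Longrightarrow> hat (-1) \<xi> \<eta> = 0 \<and> hat (-1) (\<xi> - 1) \<eta> = 1 - \<eta> \<and> hat (-1) \<xi> (\<eta> - 1) = 1 - \<xi> \<and> hat (-1) (\<xi> - 1) (\<eta> - 1) = \<xi> + \<eta> - 1"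
  using assms by (auto simp: hat_def)

lemma interp_lower_half:
  assumes s: "s = 1 \<or> s = -1" and ab: "a < M" "b < M" and x: "0 \<le> fst z / h - real a" "fst z / h - real a \<le> 1"
    and y: "0 \<le> snd z / h - real b" "snd z / h - real b \<le> 1"
    and l: "lower_half s (fst z / h - real a) (snd z / h - real b)"
  shows "interp s h M W z = W a b + (W (Suc a) b - W a b) * (fst z / h - real a)
    + (if s = 1 then W (Suc a) (Suc b) - W (Suc a) b else W a (Suc b) - W a b) * (snd z / h - real b)"
  unfolding interp_cell[OF ab x y]
  using s l hat_up(1)[OF x y] hat_down(1)[OF x y]
  by (auto simp: lower_half_def) (simp_all add: algebra_simps)

text \<open>For \<open>s = -1\<close> this triangle misses the lower left corner, and the constant
  term is the affine extrapolation of its three nodal values to that corner.\<close>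

lemma interp_upper_half:
  assumes s: "s = 1 \<or> s = -1" and ab: "a < M" "b < M" and x: "0 \<le> fst z / h - real a" "fst z / h - real a \<le> 1"
    and y: "0 \<le> snd z / h - real b" "snd z / h - real b \<le> 1"
    and l: "if s = 1 then fst z / h - real a \<le> snd z / h - real b else 1 \<le> (fst z / h - real a) + (snd z / h - real b)"
  shows "interp s h M W z = (if s = 1 then W a b else W (Suc a) b + W a (Suc b) - W (Suc a) (Suc b))
    + (W (Suc a) (Suc b) - W a (Suc b)) * (fst z / h - real a)
    + (if s = 1 then W a (Suc b) - W a b else W (Suc a) (Suc b) - W (Suc a) b) * (snd z / h - real b)"
  unfolding interp_cell[OF ab x y]
  using s l hat_up(2)[OF x y] hat_down(2)[OF x y]
  by auto (simp_all add: algebra_simps)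

text \<open>All that is used of a mesh triangle is that it lies in the half-planes containing its
  vertices, so linear inequalities are checked at vertices only.\<close>

lemma convex_hull_halfspace:
  fixes S :: "(real \<times> real) set"
  assumes "\<And>q. q \<in> S \<Longrightarrow> \<alpha> * fst q + \<beta> * snd q \<le> \<gamma>" "q \<in> convex hull S"
  shows "\<alpha> * fst q + \<beta> * snd q \<le> \<gamma>"
proof -
  have "convex {q :: real \<times> real. (\<alpha>, \<beta>) \<bullet> q \<le> \<gamma>}" by (rule convex_halfspace_le)
  moreover have "S \<subseteq> {q. (\<alpha>, \<beta>) \<bullet> q \<le> \<gamma>}" using assms(1) by (auto simp: inner_prod_def)
  ultimately have "convex hull S \<subseteq> {q. (\<alpha>, \<beta>) \<bullet> q \<le> \<gamma>}" by (intro hull_minimal)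
  then show ?thesis using assms(2) by (auto simp: inner_prod_def)
qed

lemma P1_on_if_affine:
  assumes "\<And>z. z \<in> K \<Longrightarrow> u z = A + B * (fst z / h - p) + C * (snd z / h - q)"
  shows "P1_on K u"
  unfolding P1_on_def
proof (intro exI ballI, clarify)
  fix x y assume "(x, y) \<in> K"
  from assms[OF this] show "u (x, y) = (A - B * p - C * q) + (B / h) * x + (C / h) * y"
    by (simp add: algebra_simps)
qed

lemma hull_cell_bounds:
  assumes h: "h > 0" and S: "S \<subseteq> {real a * h, real (Suc a) * h} \<times> {real b * h, real (Suc b) * h}"
    and z: "z \<in> convex hull S"
  shows "0 \<le> fst z / h - real a" "fst z / h - real a \<le> 1" "0 \<le> snd z / h - real b" "snd z / h - real b \<le> 1"
proof -
  have "(-1) * fst z + 0 * snd z \<le> - (real a * h)"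
    by (rule convex_hull_halfspace[OF _ z]) (use S h in \<open>auto simp: algebra_simps\<close>)
  then show "0 \<le> fst z / h - real a" using h by (simp add: field_simps)
  have "1 * fst z + 0 * snd z \<le> real (Suc a) * h"
    by (rule convex_hull_halfspace[OF _ z]) (use S h in \<open>auto simp: algebra_simps\<close>)
  then show "fst z / h - real a \<le> 1" using h by (simp add: field_simps)
  have "0 * fst z + (-1) * snd z \<le> - (real b * h)"
    by (rule convex_hull_halfspace[OF _ z]) (use S h in \<open>auto simp: algebra_simps\<close>)
  then show "0 \<le> snd z / h - real b" using h by (simp add: field_simps)
  have "0 * fst z + 1 * snd z \<le> real (Suc b) * h"
    by (rule convex_hull_halfspace[OF _ z]) (use S h in \<open>auto simp: algebra_simps\<close>)
  then show "snd z / h - real b \<le> 1" using h by (simp add: field_simps)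
qed

text \<open>The last hypothesis is the inequality of the cell's diagonal tested at the vertices. The
  summand \<open>h\<close> for \<open>s = -1\<close> places that diagonal through the lower right
  and upper left corners.\<close>

lemma interp_P1_lower_half:
  assumes s: "s = 1 \<or> s = -1" and h: "h > 0" and ab: "a < M" "b < M"
    and S: "S \<subseteq> {real a * h, real (Suc a) * h} \<times> {real b * h, real (Suc b) * h}"
    and l: "\<And>q. q \<in> S \<Longrightarrow> - s * fst q + snd q \<le> - s * (real a * h) + real b * h + (if s = 1 then 0 else h)"
  shows "P1_on (convex hull S) (interp s h M W)"
proof (rule P1_on_if_affine)
  fix z assume z: "z \<in> convex hull S"
  note c = hull_cell_bounds[OF h S z]
  have "- s * fst z + 1 * snd z \<le> - s * (real a * h) + real b * h + (if s = 1 then 0 else h)"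
    by (rule convex_hull_halfspace[OF _ z]) (use l in simp)
  moreover define X Y where "X = fst z / h - real a" and "Y = snd z / h - real b"
  then have "fst z = (X + real a) * h" "snd z = (Y + real b) * h" using h by (auto simp: field_simps)
  ultimately have "(- s * X + Y) * h \<le> (if s = 1 then 0 else 1) * h" by (auto simp: algebra_simps)
  then have "lower_half s (fst z / h - real a) (snd z / h - real b)"
    using s h unfolding lower_half_def X_def[symmetric] Y_def[symmetric] by auto
  from interp_lower_half[OF s ab c this]
  show "interp s h M W z = W a b + (W (Suc a) b - W a b) * (fst z / h - real a)
    + (if s = 1 then W (Suc a) (Suc b) - W (Suc a) b else W a (Suc b) - W a b) * (snd z / h - real b)" .
qed

lemma interp_P1_upper_half:
  assumes s: "s = 1 \<or> s = -1" and h: "h > 0" and ab: "a < M" "b < M"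
    and S: "S \<subseteq> {real a * h, real (Suc a) * h} \<times> {real b * h, real (Suc b) * h}"
    and l: "\<And>q. q \<in> S \<Longrightarrow> s * fst q - snd q \<le> s * (real a * h) - real b * h - (if s = 1 then 0 else h)"
  shows "P1_on (convex hull S) (interp s h M W)"
proof (rule P1_on_if_affine)
  fix z assume z: "z \<in> convex hull S"
  note c = hull_cell_bounds[OF h S z]
  have "s * fst z + (-1) * snd z \<le> s * (real a * h) - real b * h - (if s = 1 then 0 else h)"
    by (rule convex_hull_halfspace[OF _ z]) (use l in simp)
  moreover define X Y where "X = fst z / h - real a" and "Y = snd z / h - real b"
  then have "fst z = (X + real a) * h" "snd z = (Y + real b) * h" using h by (auto simp: field_simps)
  ultimately have "(s * X - Y) * h \<le> (if s = 1 then 0 else -1) * h" by (auto simp: algebra_simps)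
  then have "if s = 1 then fst z / h - real a \<le> snd z / h - real b else 1 \<le> (fst z / h - real a) + (snd z / h - real b)"
    using s h unfolding X_def[symmetric] Y_def[symmetric] by auto
  from interp_upper_half[OF s ab c this]
  show "interp s h M W z = (if s = 1 then W a b else W (Suc a) b + W a (Suc b) - W (Suc a) (Suc b))
    + (W (Suc a) (Suc b) - W a (Suc b)) * (fst z / h - real a)
    + (if s = 1 then W a (Suc b) - W a b else W (Suc a) (Suc b) - W (Suc a) b) * (snd z / h - real b)" .
qed

lemma interp_P1_mesh_up:
  assumes L: "L > 0" and M: "M \<ge> 1" and K: "K \<in> mesh_up L M"
  shows "P1_on K (interp 1 (L / real M) M W)"
proof -
  let ?h = "L / real M"
  have h: "?h > 0" using L M by simp
  from K obtain i j where ij: "i < M" "j < M"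
    and "K = convex hull {(real i * ?h, real j * ?h), (real (Suc i) * ?h, real j * ?h), (real (Suc i) * ?h, real (Suc j) * ?h)}
      \<or> K = convex hull {(real i * ?h, real j * ?h), (real i * ?h, real (Suc j) * ?h), (real (Suc i) * ?h, real (Suc j) * ?h)}"
    unfolding mesh_up_def Let_def by blast
  then show ?thesis
  proof (elim disjE)
    assume K: "K = convex hull {(real i * ?h, real j * ?h), (real (Suc i) * ?h, real j * ?h), (real (Suc i) * ?h, real (Suc j) * ?h)}"
    show ?thesis unfolding K
      by (rule interp_P1_lower_half[OF _ h ij]) (use h in \<open>auto simp: algebra_simps simp del: times_divide_eq_right times_divide_eq_left\<close>)
  next
    assume K: "K = convex hull {(real i * ?h, real j * ?h), (real i * ?h, real (Suc j) * ?h), (real (Suc i) * ?h, real (Suc j) * ?h)}"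
    show ?thesis unfolding K
      by (rule interp_P1_upper_half[OF _ h ij]) (use h in \<open>auto simp: algebra_simps simp del: times_divide_eq_right times_divide_eq_left\<close>)
  qed
qed

lemma interp_P1_mesh_down:
  assumes L: "L > 0" and M: "M \<ge> 1" and K: "K \<in> mesh_down L M"
  shows "P1_on K (interp (-1) (L / real M) M W)"
proof -
  let ?h = "L / real M"
  have h: "?h > 0" using L M by simp
  from K obtain i j where ij: "i < M" "j < M"
    and "K = convex hull {(real i * ?h, real j * ?h), (real (Suc i) * ?h, real j * ?h), (real i * ?h, real (Suc j) * ?h)}
      \<or> K = convex hull {(real (Suc i) * ?h, real j * ?h), (real i * ?h, real (Suc j) * ?h), (real (Suc i) * ?h, real (Suc j) * ?h)}"
    unfolding mesh_down_def Let_def by blast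
  then show ?thesis
  proof (elim disjE)
    assume K: "K = convex hull {(real i * ?h, real j * ?h), (real (Suc i) * ?h, real j * ?h), (real i * ?h, real (Suc j) * ?h)}"
    show ?thesis unfolding K
      by (rule interp_P1_lower_half[OF _ h ij]) (use h in \<open>auto simp: algebra_simps simp del: times_divide_eq_right times_divide_eq_left\<close>)
  next
    assume K: "K = convex hull {(real (Suc i) * ?h, real j * ?h), (real i * ?h, real (Suc j) * ?h), (real (Suc i) * ?h, real (Suc j) * ?h)}"
    show ?thesis unfolding K
      by (rule interp_P1_upper_half[OF _ h ij]) (use h in \<open>auto simp: algebra_simps simp del: times_divide_eq_right times_divide_eq_left\<close>)
  qed
qed

section \<open>Grid cells and the weak gradient of the interpolant\<close>

lemma ex_grid_interval:
  assumes h: "h > 0" and x: "0 \<le> x" "x < real M * h"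
  obtains a where "a < M" "real a * h \<le> x" "x < real a * h + h"
proof -
  define a where "a = nat \<lfloor>x / h\<rfloor>"
  have "0 \<le> x / h" using x h by simp
  then have "real a \<le> x / h" "x / h < real a + 1" unfolding a_def by linarith+
  then have 1: "real a * h \<le> x" "x < real a * h + h" using h by (auto simp: field_simps)
  have "real a * h < real M * h" using 1 x by linarith
  then have "a < M" using h by simp
  then show ?thesis using that 1 by blast
qed

lemma grid_interval_unique:
  assumes h: "h > 0" and "real a * h \<le> x" "x < real a * h + h" "real a' * h \<le> x" "x < real a' * h + h"
  shows "a = a'"
proof -
  have "real a * h < (real a' + 1) * h" "real a' * h < (real a + 1) * h" using assms by (auto simp: algebra_simps)
  then have "real a < real a' + 1" "real a' < real a + 1" using h by auto
  then show ?thesis by linarith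
qed

lemma cells_partition:
  assumes h: "h > 0" and L: "L = real M * h" and z: "z \<in> square L"
  obtains p where "p \<in> {..<M} \<times> {..<M}" "z \<in> cell h p"
    "\<And>f :: nat \<times> nat \<Rightarrow> real. (\<Sum>q\<in>{..<M} \<times> {..<M}. indicator (cell h q) z * f q) = f p"
proof -
  obtain x y where xy: "z = (x, y)" by (cases z)
  have r: "0 < x" "x < real M * h" "0 < y" "y < real M * h" using z L by (auto simp: square_def xy)
  obtain a where a: "a < M" "real a * h \<le> x" "x < real a * h + h"
    using ex_grid_interval[OF h less_imp_le[OF r(1)] r(2)] by blast
  obtain b where b: "b < M" "real b * h \<le> y" "y < real b * h + h"
    using ex_grid_interval[OF h less_imp_le[OF r(3)] r(4)] by blast
  let ?p = "(a, b)"
  have p: "?p \<in> {..<M} \<times> {..<M}" "z \<in> cell h ?p" using a b by (auto simp: cell_def xy)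
  have "(\<Sum>q\<in>{..<M} \<times> {..<M}. indicator (cell h q) z * f q) = f ?p" for f :: "nat \<times> nat \<Rightarrow> real"
  proof -
    have "(\<Sum>q\<in>{..<M} \<times> {..<M}. indicator (cell h q) z * f q) = (\<Sum>q\<in>{?p}. indicator (cell h q) z * f q)"
    proof (rule sum.mono_neutral_right)
      show "\<forall>q\<in>{..<M} \<times> {..<M} - {?p}. indicator (cell h q) z * f q = 0"
      proof
        fix q assume q: "q \<in> {..<M} \<times> {..<M} - {?p}"
        have "z \<notin> cell h q"
        proof
          assume "z \<in> cell h q"
          then have "fst q = a" "snd q = b"
            using grid_interval_unique[OF h _ _ a(2,3)] grid_interval_unique[OF h _ _ b(2,3)] by (auto simp: cell_def xy)
          then show False using q by auto
        qed
        then show "indicator (cell h q) z * f q = 0" by simp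
      qed
    qed (use p in auto)
    then show ?thesis using p by simp
  qed
  then show ?thesis using that p by blast
qed

lemma interp_dx_measurable [measurable]: "interp_dx s h M W \<in> borel_measurable (borel \<Otimes>\<^sub>M borel)"
  unfolding interp_dx_def lower_half_def cell_def by measurable

lemma interp_dx_bounded: "\<bar>interp_dx s h M W z\<bar> \<le> (\<Sum>p\<in>{..<M} \<times> {..<M}. \<bar>slope h W (fst p) (snd p)\<bar> + \<bar>slope h W (fst p) (Suc (snd p))\<bar>)"
  unfolding interp_dx_def by (rule sum_norm_le[where 'a = real, simplified]) (auto simp: indicator_def)

text \<open>At a fixed height the interpolant is piecewise affine. The excluded set consists of the
  crossings with vertical mesh lines and with the diagonals, one of the latter per cell.\<close>

lemma interp_line_deriv:
  assumes s: "s = 1 \<or> s = -1" and h: "h > 0" and L: "L = real M * h" and b: "b < M" "real b * h \<le> y" "y < real b * h + h"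
    and y: "0 < y" and x: "0 < x" "x < L"
    and nb: "x \<notin> (\<lambda>a. real a * h) ` {..M} \<union> (\<lambda>a. (real a + (if s = 1 then y / h - real b else 1 - (y / h - real b))) * h) ` {..<M}"
  shows "((\<lambda>x. interp s h M W (x, y)) has_real_derivative interp_dx s h M W (x, y)) (at x)"
proof -
  define \<eta> where "\<eta> = y / h - real b"
  \<comment> \<open>The local abscissa at which the diagonal of the cell meets the line at height
    \<open>y\<close>.\<close>
  define \<theta> where "\<theta> = (if s = 1 then \<eta> else 1 - \<eta>)"
  have \<eta>: "0 \<le> \<eta>" "\<eta> \<le> 1" using b h by (auto simp: \<eta>_def field_simps)
  then have \<theta>: "0 \<le> \<theta>" "\<theta> \<le> 1" by (auto simp: \<theta>_def)
  obtain a where a: "a < M" "real a * h \<le> x" "x < real a * h + h"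
    using ex_grid_interval[OF h less_imp_le[OF x(1)]] x(2) L by blast
  have xa: "real a * h < x" using nb a by force
  have x\<theta>: "x \<noteq> (real a + \<theta>) * h" using nb a(1) unfolding \<theta>_def \<eta>_def by blast
  have yL: "y < L"
  proof -
    have "(real b + 1) * h \<le> real M * h" using b(1) h by (intro mult_right_mono) auto
    then show ?thesis using b(3) L by (simp add: algebra_simps)
  qed
  have "(x, y) \<in> square L" using x y yL by (simp add: square_def)
  from cells_partition[OF h L this] obtain p where p: "p \<in> {..<M} \<times> {..<M}" "(x, y) \<in> cell h p"
    "\<And>f :: nat \<times> nat \<Rightarrow> real. (\<Sum>q\<in>{..<M} \<times> {..<M}. indicator (cell h q) (x, y) * f q) = f p" by blast
  have "fst p = a" "snd p = b"
    using p(2) grid_interval_unique[OF h _ _ a(2,3)] grid_interval_unique[OF h _ _ b(2,3)] by (auto simp: cell_def)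
  then have dx: "interp_dx s h M W (x, y) = (if lower_half s (x / h - real a) \<eta> then slope h W a b else slope h W a (Suc b))"
    unfolding interp_dx_def p(3) by (simp add: \<eta>_def)
  \<comment> \<open>It suffices to find an open interval around \<open>x\<close> on which a single
    affine formula holds; the four cases below provide it on either side of the diagonal, for both
    directions of it.\<close>
  have fin: ?thesis
    if O: "lo < x" "x < hi" and eq: "\<And>x'. lo < x' \<Longrightarrow> x' < hi \<Longrightarrow> interp s h M W (x', y) = A + slope h W a b' * h * (x' / h - real a)"
      and d: "interp_dx s h M W (x, y) = slope h W a b'" for lo hi A b'
  proof -
    have "((\<lambda>x'. A + slope h W a b' * h * (x' / h - real a)) has_real_derivative slope h W a b') (at x)"
      using h by (auto intro!: derivative_eq_intros)
    then have "((\<lambda>x. interp s h M W (x, y)) has_real_derivative slope h W a b') (at x)"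
      by (rule has_field_derivative_transform_within_open[OF _ open_greaterThanLessThan[of lo hi]])
        (use O eq in auto)
    then show ?thesis unfolding d .
  qed
  have box: "0 \<le> x' / h - real a" "x' / h - real a \<le> 1" if "real a * h < x'" "x' < real a * h + h" for x'
    using that h by (auto simp: field_simps)
  have lowf: "interp s h M W (x', y) = (W a b + (if s = 1 then W (Suc a) (Suc b) - W (Suc a) b else W a (Suc b) - W a b) * \<eta>) + slope h W a b * h * (x' / h - real a)"
    if x': "real a * h < x'" "x' < real a * h + h" and l: "lower_half s (x' / h - real a) \<eta>" for x'
    using interp_lower_half[OF s a(1) b(1), of "(x', y)" h W] box[OF x'] \<eta> l h by (simp add: \<eta>_def slope_def)
  have upf: "interp s h M W (x', y) = ((if s = 1 then W a b else W (Suc a) b + W a (Suc b) - W (Suc a) (Suc b))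
      + (if s = 1 then W a (Suc b) - W a b else W (Suc a) (Suc b) - W (Suc a) b) * \<eta>) + slope h W a (Suc b) * h * (x' / h - real a)"
    if x': "real a * h < x'" "x' < real a * h + h" and l: "if s = 1 then x' / h - real a \<le> \<eta> else 1 \<le> (x' / h - real a) + \<eta>" for x'
  proof -
    have "if s = 1 then fst (x', y) / h - real a \<le> snd (x', y) / h - real b else 1 \<le> (fst (x', y) / h - real a) + (snd (x', y) / h - real b)"
      using l unfolding \<eta>_def fst_conv snd_conv .
    from interp_upper_half[OF s a(1) b(1) _ _ _ _ this, of W] box[OF x'] \<eta> h show ?thesis by (simp add: \<eta>_def slope_def)
  qed
  have mid: "real a * h \<le> (real a + \<theta>) * h" "(real a + \<theta>) * h \<le> real a * h + h"
    using \<theta> h by (auto simp: algebra_simps)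
  have lt: "x' / h - real a < \<theta> \<longleftrightarrow> x' < (real a + \<theta>) * h" "\<theta> < x' / h - real a \<longleftrightarrow> (real a + \<theta>) * h < x'" for x'
    using h by (auto simp: field_simps)
  show ?thesis
  proof (cases "x < (real a + \<theta>) * h")
    case True
    show ?thesis
    proof (cases "s = 1")
      case s1: True
      have "\<not> lower_half s (x / h - real a) \<eta>" using True s1 lt(1)[of x] by (simp add: lower_half_def \<theta>_def)
      then have d: "interp_dx s h M W (x, y) = slope h W a (Suc b)" using dx by simp
      show ?thesis
        by (rule fin[OF xa True upf d]) (use mid lt(1) s1 in \<open>auto simp: \<theta>_def less_imp_le\<close>)
    next
      case s2: False
      have l: "lower_half s (x' / h - real a) \<eta>" if "x' < (real a + \<theta>) * h" for x'
        using that s2 lt(1)[of x'] by (simp add: lower_half_def \<theta>_def)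
      have d: "interp_dx s h M W (x, y) = slope h W a b" using dx l[OF True] by simp
      show ?thesis
        by (rule fin[OF xa True lowf d]) (use mid l in auto)
    qed
  next
    case False
    then have gt: "(real a + \<theta>) * h < x" using x\<theta> by simp
    show ?thesis
    proof (cases "s = 1")
      case s1: True
      have l: "lower_half s (x' / h - real a) \<eta>" if "(real a + \<theta>) * h < x'" for x'
        using that s1 lt(2)[of x'] by (simp add: lower_half_def \<theta>_def)
      have d: "interp_dx s h M W (x, y) = slope h W a b" using dx l[OF gt] by simp
      show ?thesis
        by (rule fin[OF gt a(3) lowf d]) (use mid l in auto)
    next
      case s2: False
      have "\<not> lower_half s (x / h - real a) \<eta>" using gt s2 lt(2)[of x] by (simp add: lower_half_def \<theta>_def)
      then have d: "interp_dx s h M W (x, y) = slope h W a (Suc b)" using dx by simp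
      have l: "if s = 1 then x' / h - real a \<le> \<eta> else 1 \<le> (x' / h - real a) + \<eta>" if "(real a + \<theta>) * h < x'" for x'
        using that s2 lt(2)[of x'] by (simp add: \<theta>_def)
      show ?thesis
        by (rule fin[OF gt a(3) upf d]) (use mid l in auto)
    qed
  qed
qed

text \<open>A continuous function that is differentiable off finitely many points is the integral of
  its derivative; the exceptional points are those of \<open>interp_line_deriv\<close>.\<close>

lemma interp_ac:
  assumes s: "s = 1 \<or> s = -1" and h: "h > 0" and L: "L = real M * h" and z: "(x, y) \<in> square L"
  shows "interp s h M W (x, y) = interp s h M W (0, y) + primx L (interp_dx s h M W) (x, y)"
proof -
  have xy: "0 < x" "x < L" "0 < y" "y < L" using z by (auto simp: square_def)
  obtain b where b: "b < M" "real b * h \<le> y" "y < real b * h + h"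
    using ex_grid_interval[OF h less_imp_le[OF xy(3)]] xy(4) L by blast
  let ?S = "(\<lambda>a. real a * h) ` {..M} \<union> (\<lambda>a. (real a + (if s = 1 then y / h - real b else 1 - (y / h - real b))) * h) ` {..<M}"
  let ?g = "interp_dx s h M W"
  have [measurable]: "(\<lambda>t. ?g (t, y)) \<in> borel_measurable borel" by measurable
  have "((\<lambda>t. ?g (t, y)) has_integral (interp s h M W (x, y) - interp s h M W (0, y))) {0..x}"
  proof (rule fundamental_theorem_of_calculus_interior_strong[where S = ?S])
    show "continuous_on {0..x} (\<lambda>t. interp s h M W (t, y))"
      by (rule continuous_on_compose2[OF continuous_interp[OF h, of UNIV]]) (auto intro!: continuous_intros)
    fix t assume t: "t \<in> {0<..<x} - ?S"
    show "((\<lambda>t. interp s h M W (t, y)) has_vector_derivative ?g (t, y)) (at t)"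
      unfolding has_real_derivative_iff_has_vector_derivative[symmetric]
      by (rule interp_line_deriv[OF s h L b xy(3)]) (use t xy in auto)
  qed (use xy in auto)
  then have 1: "((\<lambda>t. if t \<in> {0..x} then ?g (t, y) else 0) has_integral (interp s h M W (x, y) - interp s h M W (0, y))) UNIV"
    by (simp only: has_integral_restrict_UNIV)
  let ?f = "\<lambda>t. indicator {0..x} t * ?g (t, y)"
  obtain B where B: "\<And>z. \<bar>?g z\<bar> \<le> B" using interp_dx_bounded by blast
  have fi: "integrable lborel ?f"
  proof (rule Bochner_Integration.integrable_bound)
    show "integrable lborel (\<lambda>t. indicator {0..x} t * B)" by (intro integrable_mult_left integrable_real_indicator) (use xy in auto)
    show "AE t in lborel. norm (?f t) \<le> norm (indicator {0..x} t * B)"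
      using order_trans[OF B abs_ge_self] by (intro AE_I2) (auto simp: indicator_def)
  qed measurable
  have "(\<lambda>t. if t \<in> {0..x} then ?g (t, y) else 0) = ?f" by (auto simp: indicator_def)
  then have I: "integral\<^sup>L lborel ?f = interp s h M W (x, y) - interp s h M W (0, y)"
    using has_integral_unique[OF has_integral_integral_lborel[OF fi]] 1 by simp
  have "primx L ?g (x, y) = (LINT t|lborel. indicator {0<..<L} t * (if t < x then ?g (t, y) else 0))"
    unfolding primx_Pair by (rule integral_lseg) measurable
  also have "\<dots> = integral\<^sup>L lborel ?f"
  proof (rule integral_cong_AE)
    have "AE t in lborel. t \<noteq> 0" "AE t in lborel. t \<noteq> x" by (rule AE_lborel_singleton)+
    then show "AE t in lborel. indicator {0<..<L} t * (if t < x then ?g (t, y) else 0) = ?f t"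
      by eventually_elim (use xy in \<open>auto simp: indicator_def\<close>)
  qed measurable
  finally show ?thesis using I by simp
qed

lemma interp_measurable [measurable]:
  assumes "h > 0"
  shows "interp s h M W \<in> borel_measurable (borel \<Otimes>\<^sub>M borel)"
  unfolding borel_prod by (rule borel_measurable_continuous_onI[OF continuous_interp[OF assms]])

lemma interp_L2: "h > 0 \<Longrightarrow> interp s h M W \<in> L2 (lsq L)"
  by (rule L2_bounded[OF finite_measure_lsq]) (use interp_measurable interp_bounded in auto)

lemma interp_dx_L2: "interp_dx s h M W \<in> L2 (lsq L)"
  by (rule L2_bounded[OF finite_measure_lsq]) (use interp_dx_measurable interp_dx_bounded in auto)

lemma interp_line_L2:
  assumes "h > 0"
  shows "(\<lambda>y. interp s h M W (0, y)) \<in> L2 (lseg L)"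
proof (rule L2_bounded[OF lseg.finite_measure_axioms])
  have [measurable]: "interp s h M W \<in> borel_measurable (borel \<Otimes>\<^sub>M borel)" by (rule interp_measurable[OF assms])
  show "(\<lambda>y. interp s h M W (0, y)) \<in> borel_measurable (lseg L)" by measurable
qed (rule interp_bounded)

lemma interp_weak_derivs:
  assumes s: "s = 1 \<or> s = -1" and h: "h > 0" and L: "L = real M * h" "L > 0"
  shows "has_weak_deriv (square L) 1 0 (interp s h M W) (interp_dx s h M W)"
    and "has_weak_deriv (square L) 0 1 (interp s h M W) (\<lambda>z. interp_dx s h M (\<lambda>i j. W j i) (prod.swap z))"
proof -
  have ac: "AE z in lsq L. interp s h M W z = interp s h M W (0, snd z) + primx L (interp_dx s h M W) z" for W
    using AE_lsq_in by eventually_elim (use interp_ac[OF s h L(1)] in force)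
  show "has_weak_deriv (square L) 1 0 (interp s h M W) (interp_dx s h M W)"
    by (rule ac_imp_has_weak_deriv_x[OF interp_line_L2[OF h] interp_dx_L2 interp_measurable[OF h] ac L(2)])
  have "AE z in lsq L. interp s h M W z = interp s h M (\<lambda>i j. W j i) (0, fst z)
      + primy L (\<lambda>z. interp_dx s h M (\<lambda>i j. W j i) (prod.swap z)) z"
    using AE_swap_lsq[OF ac[of "\<lambda>i j. W j i"]]
  proof eventually_elim
    case (elim z)
    have "primy L (\<lambda>z. interp_dx s h M (\<lambda>i j. W j i) (prod.swap z)) z = primx L (interp_dx s h M (\<lambda>i j. W j i)) (prod.swap z)"
      using primy_swap[of L "\<lambda>z. interp_dx s h M (\<lambda>i j. W j i) (prod.swap z)" "prod.swap z"] by simp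
    then show ?case using elim interp_transpose[OF s, of h M "\<lambda>i j. W j i" z] by simp
  qed
  then show "has_weak_deriv (square L) 0 1 (interp s h M W) (\<lambda>z. interp_dx s h M (\<lambda>i j. W j i) (prod.swap z))"
    by (rule ac_imp_has_weak_deriv_y[OF interp_line_L2[OF h] L2_swap_lsq[OF interp_dx_L2] interp_measurable[OF h] _ L(2)])
qed

lemma interp_left:
  assumes s: "s = 1 \<or> s = -1" and h: "h > 0" and M: "M \<ge> 1" and y: "0 \<le> y" "y \<le> real M * h"
    and W: "\<And>j. j \<le> M \<Longrightarrow> W 0 j = k"
  shows "interp s h M W (0, y) = k"
proof -
  obtain b where b: "b < M" "0 \<le> y / h - real b" "y / h - real b \<le> 1"
  proof (cases "y < real M * h")
    case True
    from ex_grid_interval[OF h y(1) True] obtain b where "b < M" "real b * h \<le> y" "y < real b * h + h" by blast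
    then show ?thesis using that[of b] h by (auto simp: field_simps)
  next
    case False
    then have "y = real M * h" using y by simp
    \<comment> \<open>The upper end of the side lies in no half-open grid interval below
      \<open>M\<close>; it is the top of the last one, with local coordinate 1.\<close>
    then show ?thesis using that[of "M - 1"] h M by (auto simp: of_nat_diff)
  qed
  have M0: "0 < M" using M by simp
  have Wb: "W 0 b = k" "W 0 (Suc b) = k" using W b by auto
  show ?thesis
  proof (cases "lower_half s 0 (y / h - real b)")
    case True
    show ?thesis
      using interp_lower_half[OF s M0 b(1), of "(0, y)" h W] b True Wb by (auto simp: lower_half_def split: if_splits)
  next
    case False
    then show ?thesis
      using interp_upper_half[OF s M0 b(1), of "(0, y)" h W] b Wb by (auto simp: lower_half_def split: if_splits)
  qed
qed

lemma interp_right: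
  assumes s: "s = 1 \<or> s = -1" and h: "h > 0" and M: "M \<ge> 1" and y: "0 \<le> y" "y \<le> real M * h"
    and W: "\<And>j. j \<le> M \<Longrightarrow> W M j = k"
  shows "interp s h M W (real M * h, y) = k"
proof -
  obtain b where b: "b < M" "0 \<le> y / h - real b" "y / h - real b \<le> 1"
  proof (cases "y < real M * h")
    case True
    from ex_grid_interval[OF h y(1) True] obtain b where "b < M" "real b * h \<le> y" "y < real b * h + h" by blast
    then show ?thesis using that[of b] h by (auto simp: field_simps)
  next
    case False
    then have "y = real M * h" using y by simp
    then show ?thesis using that[of "M - 1"] h M by (auto simp: of_nat_diff)
  qed
  obtain a where a: "M = Suc a" using M by (cases M) auto
  have aM: "a < M" using a by simp
  have Wb: "W (Suc a) b = k" "W (Suc a) (Suc b) = k" using W[of b] W[of "Suc b"] b a by auto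
  have x: "real M * h / h - real a = 1" using h a by simp
  show ?thesis
  proof (cases "lower_half s 1 (y / h - real b)")
    case True
    then show ?thesis
      using interp_lower_half[OF s aM b(1), of "(real M * h, y)" h W] b x Wb by (auto simp: lower_half_def split: if_splits)
  next
    case False
    then show ?thesis
      using interp_upper_half[OF s aM b(1), of "(real M * h, y)" h W] b x Wb s by (auto simp: lower_half_def algebra_simps split: if_splits)
  qed
qed

text \<open>The hypothesis on \<open>W\<close> makes every slope an edge average of
  \<open>F\<close>, so \<open>cell_integral\<close> applies to each cell with either horizontal
  edge. Counting both edges gives \<open>4 h^2\<close> in the square, hence
  \<open>2 h\<close>.\<close>

lemma interp_dx_error:
  assumes L: "L > 0" and m: "m \<in> L2 (lsq L)" and n: "n \<in> L2 (lsq L)" and p: "p \<in> L2 (lseg L)"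
    and F: "\<And>x y. F (x, y) = p x + primy L m (x, y)"
    and Feq: "AE z in lsq L. F z = c (snd z) + primx L n z" and FL2: "F \<in> L2 (lsq L)"
    and h: "h > 0" and LM: "L = real M * h"
    and W: "\<And>i j. i < M \<Longrightarrow> j \<le> M \<Longrightarrow> W (Suc i) j - W i j =
      (LINT s|lseg L. indicator {real i * h..<real i * h + h} s * F (s, real j * h))"
  shows "L2_norm (lsq L) (\<lambda>z. F z - interp_dx s h M W z) \<le> 2 * h * (L2_norm (lsq L) m + L2_norm (lsq L) n)"
proof -
  let ?P = "{..<M} \<times> {..<M}"
  have [measurable]: "cell h q \<in> sets (borel \<Otimes>\<^sub>M borel)" for q unfolding cell_def by measurable
  let ?Db = "\<lambda>q. slope h W (fst q) (snd q)" and ?Dt = "\<lambda>q. slope h W (fst q) (Suc (snd q))"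
  have cst: "(\<lambda>_. d) \<in> L2 (lsq L)" for d by (rule L2_bounded[OF finite_measure_lsq]) auto
  have ik: "integrable (lsq L) (\<lambda>z. indicator (cell h q) z * f z)" if "integrable (lsq L) f" for f :: "real \<times> real \<Rightarrow> real" and q
    using integrable_mult_indicator[OF _ that, of "cell h q"] by simp
  note iF = ik[OF L2_square_integrable[OF L2_diff[OF FL2 cst]]]
  have gm: "interp_dx s h M W \<in> L2 (lsq L)" by (rule interp_dx_L2)
  let ?J = "\<lambda>q. (LINT z|lsq L. indicator (cell h q) z * (n z)\<^sup>2) + (LINT z|lsq L. indicator (cell h q) z * (m z)\<^sup>2)"
  have est: "(LINT z|lsq L. indicator (cell h q) z * (F z - slope h W (fst q) j)\<^sup>2) \<le> 2 * h\<^sup>2 * ?J q"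
    if q: "q \<in> ?P" and j: "j = snd q \<or> j = Suc (snd q)" for q j
  proof -
    have q': "fst q < M" "snd q < M" using q by auto
    have e: "real i * h + h \<le> L" if "i < M" for i
    proof -
      have "(real i + 1) * h \<le> real M * h" using that h by (intro mult_right_mono) auto
      then show ?thesis using LM by (simp add: algebra_simps)
    qed
    have sl: "slope h W (fst q) j = (LINT s|lseg L. indicator {real (fst q) * h..<real (fst q) * h + h} s * F (s, real j * h)) / h"
      unfolding slope_def using W[of "fst q" j] q' j by auto
    show ?thesis
      unfolding sl cell_def
      by (rule cell_integral[OF L m n p F Feq FL2 h _ e[OF q'(1)] _ e[OF q'(2)]])
        (use h j in \<open>auto simp: algebra_simps\<close>)
  qed
  have "(LINT z|lsq L. (F z - interp_dx s h M W z)\<^sup>2) \<le>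
    (LINT z|lsq L. (\<Sum>q\<in>?P. indicator (cell h q) z * (F z - ?Db q)\<^sup>2 + indicator (cell h q) z * (F z - ?Dt q)\<^sup>2))"
  proof (rule integral_mono_AE)
    show "integrable (lsq L) (\<lambda>z. (F z - interp_dx s h M W z)\<^sup>2)" by (rule L2_square_integrable[OF L2_diff[OF FL2 gm]])
    show "integrable (lsq L) (\<lambda>z. \<Sum>q\<in>?P. indicator (cell h q) z * (F z - ?Db q)\<^sup>2 + indicator (cell h q) z * (F z - ?Dt q)\<^sup>2)"
      by (intro Bochner_Integration.integrable_sum Bochner_Integration.integrable_add iF)
    show "AE z in lsq L. (F z - interp_dx s h M W z)\<^sup>2 \<le>
        (\<Sum>q\<in>?P. indicator (cell h q) z * (F z - ?Db q)\<^sup>2 + indicator (cell h q) z * (F z - ?Dt q)\<^sup>2)"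
      using AE_lsq_in
    proof eventually_elim
      case (elim z)
      from cells_partition[OF h LM elim] obtain q where
        q: "\<And>f :: nat \<times> nat \<Rightarrow> real. (\<Sum>q\<in>?P. indicator (cell h q) z * f q) = f q" by blast
      \<comment> \<open>On a cell the derivative is one of two edge averages. Adding both squared
        errors avoids integrating over the triangles separately.\<close>
      have "interp_dx s h M W z \<in> {?Db q, ?Dt q}" unfolding interp_dx_def q by simp
      moreover have "(\<Sum>q\<in>?P. indicator (cell h q) z * (F z - ?Db q)\<^sup>2 + indicator (cell h q) z * (F z - ?Dt q)\<^sup>2)
          = (F z - ?Db q)\<^sup>2 + (F z - ?Dt q)\<^sup>2"
        unfolding distrib_left[symmetric] q ..
      ultimately show ?case by auto
    qed
  qed
  also have "\<dots> = (\<Sum>q\<in>?P. (LINT z|lsq L. indicator (cell h q) z * (F z - ?Db q)\<^sup>2) + (LINT z|lsq L. indicator (cell h q) z * (F z - ?Dt q)\<^sup>2))"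
    by (subst Bochner_Integration.integral_sum) (use iF in \<open>auto intro!: sum.cong\<close>)
  also have "\<dots> \<le> (\<Sum>q\<in>?P. 2 * h\<^sup>2 * ?J q + 2 * h\<^sup>2 * ?J q)"
    by (intro sum_mono add_mono est) auto
  also have "\<dots> = 4 * h\<^sup>2 * (\<Sum>q\<in>?P. ?J q)" by (simp add: sum_distrib_left algebra_simps)
  also have "(\<Sum>q\<in>?P. ?J q) = (L2_norm (lsq L) n)\<^sup>2 + (L2_norm (lsq L) m)\<^sup>2"
  proof -
    have S: "(\<Sum>q\<in>?P. (LINT z|lsq L. indicator (cell h q) z * (f z)\<^sup>2)) = (L2_norm (lsq L) f)\<^sup>2" if f: "f \<in> L2 (lsq L)" for f
    proof -
      have [measurable]: "f \<in> borel_measurable (borel \<Otimes>\<^sub>M borel)" using L2_measurable[OF f] by simp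
      have "(\<Sum>q\<in>?P. (LINT z|lsq L. indicator (cell h q) z * (f z)\<^sup>2)) = (LINT z|lsq L. (\<Sum>q\<in>?P. indicator (cell h q) z * (f z)\<^sup>2))"
        by (rule Bochner_Integration.integral_sum[symmetric]) (rule ik[OF L2_square_integrable[OF f]])
      also have "\<dots> = (LINT z|lsq L. (f z)\<^sup>2)"
      proof (rule integral_cong_AE)
        show "AE z in lsq L. (\<Sum>q\<in>?P. indicator (cell h q) z * (f z)\<^sup>2) = (f z)\<^sup>2"
          using AE_lsq_in
        proof eventually_elim
          case (elim z)
          from cells_partition[OF h LM elim] obtain q where
            q: "\<And>f :: nat \<times> nat \<Rightarrow> real. (\<Sum>q\<in>?P. indicator (cell h q) z * f q) = f q" by blast
          show ?case using q[of "\<lambda>_. (f z)\<^sup>2"] by simp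
        qed
      qed measurable
      finally show ?thesis by (simp add: L2_norm_power2)
    qed
    show ?thesis unfolding sum.distrib S[OF m] S[OF n] ..
  qed
  also have "4 * h\<^sup>2 * ((L2_norm (lsq L) n)\<^sup>2 + (L2_norm (lsq L) m)\<^sup>2) \<le> (2 * h * (L2_norm (lsq L) m + L2_norm (lsq L) n))\<^sup>2"
  proof -
    have "(L2_norm (lsq L) n)\<^sup>2 + (L2_norm (lsq L) m)\<^sup>2 \<le> (L2_norm (lsq L) m + L2_norm (lsq L) n)\<^sup>2"
      by (simp add: power2_sum)
    then show ?thesis unfolding power_mult_distrib by (intro mult_mono) auto
  qed
  finally have "(L2_norm (lsq L) (\<lambda>z. F z - interp_dx s h M W z))\<^sup>2 \<le> (2 * h * (L2_norm (lsq L) m + L2_norm (lsq L) n))\<^sup>2"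
    unfolding L2_norm_power2[of "lsq L" "\<lambda>z. F z - interp_dx s h M W z"] .
  then show ?thesis by (rule power2_le_imp_le) (use h in simp)
qed

section \<open>The error estimates\<close>

lemma weak_deriv_le_sobolev_norm:
  assumes "i + j \<le> m"
  shows "L2_norm (lebesgue_on S) (weak_deriv S i j u) \<le> sobolev_norm m S u"
  unfolding sobolev_norm_def
proof (rule real_le_rsqrt)
  let ?f = "\<lambda>i j. (L2_norm (lebesgue_on S) (weak_deriv S i j u))\<^sup>2"
  have "?f i j \<le> (\<Sum>j\<le>m - i. ?f i j)" by (rule member_le_sum) (use assms in auto)
  also have "\<dots> \<le> (\<Sum>i\<le>m. \<Sum>j\<le>m - i. ?f i j)"
    by (rule member_le_sum[of i "{..m}" "\<lambda>i. \<Sum>j\<le>m - i. ?f i j"]) (use assms in \<open>auto intro: sum_nonneg\<close>)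
  finally show "?f i j \<le> (\<Sum>i\<le>m. \<Sum>j\<le>m - i. ?f i j)" .
qed

lemma L2_norm_swap_lsq:
  assumes "f \<in> L2 (lsq L)"
  shows "L2_norm (lsq L) (\<lambda>z. f (prod.swap z)) = L2_norm (lsq L) f"
proof -
  have [measurable]: "f \<in> borel_measurable (borel \<Otimes>\<^sub>M borel)" using L2_measurable[OF assms] by simp
  show ?thesis unfolding L2_norm_def by (simp add: integral_swap_lsq[of "\<lambda>z. (f z)\<^sup>2"])
qed

lemma interval_primitive_diff:
  fixes f :: "real \<Rightarrow> real"
  assumes f: "integrable (lseg L) f" and "a \<le> b"
  shows "(LINT r|lseg L. (if r < b then f r else 0)) - (LINT r|lseg L. (if r < a then f r else 0)) = (LINT r|lseg L. indicator {a..<b} r * f r)"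
proof -
  have "(LINT r|lseg L. indicator {a..<b} r * f r) = (LINT r|lseg L. (if r < b then f r else 0) - (if r < a then f r else 0))"
    by (rule Bochner_Integration.integral_cong) (use assms(2) in \<open>auto simp: indicator_def\<close>)
  then show ?thesis using integrable_if_less[OF f, of a] integrable_if_less[OF f, of b] by simp
qed

text \<open>Dominated convergence; the integrands converge except on one horizontal line. It yields
  continuity in \<open>y\<close> of the representative on each vertical line.\<close>

lemma quadrant_integral_tendsto:
  assumes m: "m \<in> L2 (lsq L)" and y: "y \<longlonglongrightarrow> y0"
  shows "(\<lambda>n. LINT z|lsq L. (if fst z < x \<and> snd z < y n then m z else 0)) \<longlonglongrightarrow> (LINT z|lsq L. (if fst z < x \<and> snd z < y0 then m z else 0))"
proof (rule integral_dominated_convergence[where w = "\<lambda>z. \<bar>m z\<bar>"])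
  have mm [measurable]: "m \<in> borel_measurable (borel \<Otimes>\<^sub>M borel)" using L2_measurable[OF m] by simp
  show "(\<lambda>z. if fst z < x \<and> snd z < y0 then m z else 0) \<in> borel_measurable (lsq L)"
    "(\<lambda>z. if fst z < x \<and> snd z < y n then m z else 0) \<in> borel_measurable (lsq L)" for n by measurable
  show "integrable (lsq L) (\<lambda>z. \<bar>m z\<bar>)" using lsq_integrable[OF m] by simp
  have "AE t in lborel. t \<noteq> y0" by (rule AE_lborel_singleton)
  then have "AE t in lseg L. t \<noteq> y0" unfolding AE_lseg by eventually_elim simp
  from AE_lsq_snd[OF this]
  show "AE z in lsq L. (\<lambda>n. if fst z < x \<and> snd z < y n then m z else 0) \<longlonglongrightarrow> (if fst z < x \<and> snd z < y0 then m z else 0)"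
  proof eventually_elim
    case (elim z)
    have "\<forall>\<^sub>F n in sequentially. (if fst z < x \<and> snd z < y n then m z else 0) = (if fst z < x \<and> snd z < y0 then m z else 0)"
    proof (cases "snd z < y0")
      case True
      from order_tendstoD(1)[OF y this] show ?thesis by eventually_elim (use True in simp)
    next
      case False
      then have "y0 < snd z" using elim by simp
      from order_tendstoD(2)[OF y this] show ?thesis by eventually_elim (use \<open>y0 < snd z\<close> in simp)
    qed
    then show ?case by (simp add: tendsto_eventually)
  qed
  show "AE z in lsq L. norm (if fst z < x \<and> snd z < y n then m z else 0) \<le> \<bar>m z\<bar>" for n by simp
qed

text \<open>The interpolated nodal values are those of the representative
  \<open>tr0 L u + primx L F\<close>, which is defined at every point. Its differences along edges
  are integrals of \<open>F\<close> or \<open>G\<close>, versions of the two first derivatives, so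
  \<open>interp_dx_error\<close> applies to each; two second derivatives of norm at most
  \<open>S\<close> turn \<open>2 h\<close> into \<open>4 h\<close>.\<close>

lemma H2_interpolation:
  assumes L: "L > 0" and mesh: "uniform_mesh L M T" and u: "u \<in> Vc L" and u2: "u \<in> sobolev 2 (square L)"
  defines "S \<equiv> sobolev_norm 2 (square L) u"
  obtains v where "v \<in> Vhc L T" "tr0 L v = tr0 L u"
    "L2_norm (leb L) (\<lambda>z. weak_deriv (square L) 1 0 u z - weak_deriv (square L) 1 0 v z) \<le> 4 * (L / real M) * S"
    "L2_norm (leb L) (\<lambda>z. weak_deriv (square L) 0 1 u z - weak_deriv (square L) 0 1 v z) \<le> 4 * (L / real M) * S"
proof -
  let ?dx = "weak_deriv (square L) 1 0" and ?dy = "weak_deriv (square L) 0 1"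
  note wd = has_weak_deriv_weak_deriv[OF u2]
  have w10: "has_weak_deriv (square L) 1 0 u (?dx u)" and w01: "has_weak_deriv (square L) 0 1 u (?dy u)"
    and w20: "has_weak_deriv (square L) 2 0 u (weak_deriv (square L) 2 0 u)"
    and w11: "has_weak_deriv (square L) 1 1 u (weak_deriv (square L) 1 1 u)"
    and w02: "has_weak_deriv (square L) 0 2 u (weak_deriv (square L) 0 2 u)"
    by (rule wd; simp)+
  have uL: "u \<in> L2 (leb L)" by (rule sobolev_L2[OF u2])
  have bv: "\<exists>g\<in>L2 (lsq L). (AE z in lsq L. weak_deriv (square L) i j u z = g z) \<and> L2_norm (lsq L) g \<le> S" if "i + j \<le> 2" for i j
  proof -
    have l: "weak_deriv (square L) i j u \<in> L2 (leb L)" by (rule has_weak_deriv_L2[OF wd[OF that]])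
    obtain g where g: "g \<in> L2 (lsq L)" "AE z in lsq L. weak_deriv (square L) i j u z = g z"
      using ex_L2_borel_version[OF l] by blast
    have "L2_norm (lsq L) g \<le> S"
      using L2_norm_leb_lsq[OF l g] weak_deriv_le_sobolev_norm[OF that, of "square L" u] unfolding S_def by simp
    then show ?thesis using g by blast
  qed
  obtain m where m: "m \<in> L2 (lsq L)" "AE z in lsq L. weak_deriv (square L) 1 1 u z = m z" "L2_norm (lsq L) m \<le> S"
    using bv[of 1 1] by auto
  obtain n1 where n1: "n1 \<in> L2 (lsq L)" "AE z in lsq L. weak_deriv (square L) 2 0 u z = n1 z" "L2_norm (lsq L) n1 \<le> S"
    using bv[of 2 0] by auto
  obtain n2 where n2: "n2 \<in> L2 (lsq L)" "AE z in lsq L. weak_deriv (square L) 0 2 u z = n2 z" "L2_norm (lsq L) n2 \<le> S"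
    using bv[of 0 2] by auto
  have dxL: "?dx u \<in> L2 (leb L)" and dyL: "?dy u \<in> L2 (leb L)" using has_weak_deriv_L2 w10 w01 by auto
  have [measurable]: "m \<in> borel_measurable (borel \<Otimes>\<^sub>M borel)" using L2_measurable[OF m(1)] by simp
  obtain p where p: "p \<in> L2 (lseg L)" "AE z in lsq L. ?dx u z = p (fst z) + primy L m z"
    using has_weak_deriv_y_imp_ac[OF dxL has_weak_deriv_iterate(2)[OF w10 w11] L m(1,2)] by blast
  have [measurable]: "p \<in> borel_measurable borel" using L2_measurable[OF p(1)] by simp
  \<comment> \<open>The version of the horizontal derivative that is a primitive in \<open>y\<close>
    of the mixed derivative at every point, hence has definite values on the horizontal
    edges.\<close>
  define F where "F z = p (fst z) + primy L m z" for z
  have Fp: "F (x, y) = p x + primy L m (x, y)" for x y by (simp add: F_def)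
  have [measurable]: "F \<in> borel_measurable (borel \<Otimes>\<^sub>M borel)" unfolding F_def by measurable
  have Fu: "AE z in lsq L. ?dx u z = F z" using p(2) by (simp add: F_def)
  have FL2: "F \<in> L2 (lsq L)"
  proof -
    obtain f where f: "f \<in> L2 (lsq L)" "AE z in lsq L. ?dx u z = f z" using ex_L2_borel_version[OF dxL] by blast
    show ?thesis by (rule L2_AE_cong[OF f(1)], measurable) (use f(2) Fu in eventually_elim, simp)
  qed
  obtain c where c: "c \<in> L2 (lseg L)" "AE z in lsq L. ?dx u z = c (snd z) + primx L n1 z"
    using has_weak_deriv_x_imp_ac[OF dxL has_weak_deriv_iterate(1)[OF w10 w20] L n1(1,2)] by blast
  have Fc: "AE z in lsq L. F z = c (snd z) + primx L n1 z" using c(2) Fu by eventually_elim simp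
  have pint: "integrable (lseg L) p" by (rule lseg_integrable[OF p(1)])
  define P where "P x = (LINT s|lseg L. (if s < x then p s else 0))" for x
  have [measurable]: "P \<in> borel_measurable borel" unfolding P_def by measurable
  note fub1 = primx_primy_Fubini(1)[OF m(1) pint Fp, folded P_def] and fub2 = primx_primy_Fubini(2)[OF m(1) pint Fp, folded P_def]
  note rep = Vc_repr[OF L u FL2 Fu]
  have GL2: "primx L m \<in> L2 (lsq L)" by (rule L2_primx(1)[OF m(1) L])
  have PL2: "(\<lambda>x. tr0 L u + P x) \<in> L2 (lseg L)"
  proof (rule L2_bounded[OF lseg.finite_measure_axioms])
    fix x
    have "\<bar>P x\<bar> \<le> (LINT s|lseg L. \<bar>p s\<bar>)"
      using primx_abs_le[of L "\<lambda>z. p (fst z)" "(x, 0)", unfolded primx_Pair fst_conv snd_conv] pint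
      unfolding P_def by blast
    then show "\<bar>tr0 L u + P x\<bar> \<le> \<bar>tr0 L u\<bar> + (LINT s|lseg L. \<bar>p s\<bar>)" by linarith
  qed measurable
  \<comment> \<open>The vertical derivative is read off from the representation of \<open>u\<close>
    after Fubini. It has no term depending on \<open>y\<close> alone, because \<open>u\<close> is
    constant on the left side.\<close>
  have dyu: "AE z in lsq L. ?dy u z = primx L m z"
  proof (rule weak_deriv_eqI)
    let ?u' = "\<lambda>z. tr0 L u + primx L F z"
    have um: "?u' \<in> borel_measurable (borel \<Otimes>\<^sub>M borel)" by measurable
    have "AE z in lsq L. ?u' z = (tr0 L u + P (fst z)) + primy L (primx L m) z"
      by (rule AE_I2) (metis add.assoc fub2 prod.collapse)
    from ac_imp_has_weak_deriv_y[OF PL2 GL2 um this L]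
    show "has_weak_deriv (square L) 0 1 u (primx L m)"
      by (rule has_weak_deriv_cong_AE[OF _ L2_measurable[OF uL] um rep(1)])
  qed
  obtain d where d: "d \<in> L2 (lseg L)" "AE z in lsq L. ?dy u z = d (fst z) + primy L n2 z"
    using has_weak_deriv_y_imp_ac[OF dyL has_weak_deriv_iterate_y[OF w01 w02] L n2(1,2)] by blast
  \<comment> \<open>With the coordinates exchanged, the vertical derivative takes the role of
    \<open>F\<close>; its one-variable part is zero, so \<open>p\<close> is replaced by the zero
    function.\<close>
  define G where "G z = primx L m (prod.swap z)" for z
  let ?ms = "\<lambda>z. m (prod.swap z)" and ?ns = "\<lambda>z. n2 (prod.swap z)"
  have Gp: "G (x, y) = 0 + primy L ?ms (x, y)" for x y
    using primy_swap[of L ?ms "(y, x)"] by (simp add: G_def)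
  have GsL2: "G \<in> L2 (lsq L)" unfolding G_def by (rule L2_swap_lsq[OF GL2])
  have Gc: "AE z in lsq L. G z = d (snd z) + primx L ?ns z"
    using AE_swap_lsq[OF dyu] AE_swap_lsq[OF d(2)] by eventually_elim (simp add: G_def primy_swap)
  have z0: "(\<lambda>_. 0 :: real) \<in> L2 (lseg L)" by (rule L2_bounded[OF lseg.finite_measure_axioms, of _ _ 0]) auto
  define Wf where "Wf x y = tr0 L u + primx L F (x, y)" for x y
  have W0: "Wf 0 y = tr0 L u" for y by (simp add: Wf_def primx_at_0)
  \<comment> \<open>The zero trace gives this for almost every \<open>y\<close> only, which may miss
    the nodes; continuity in \<open>y\<close> extends it to the whole side.\<close>
  have WL: "Wf L y = 0" if y: "0 \<le> y" "y \<le> L" for y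
  proof -
    have "\<exists>t. \<bar>t - y\<bar> \<le> L * inverse (real (Suc n)) \<and> Wf L t = 0" for n
    proof -
      define e where "e = L * inverse (real (Suc n))"
      have e: "0 < e" unfolding e_def using L by simp
      obtain t where "max 0 (y - e) < t" "t < min L (y + e)" "tr0 L u + primx L F (L, t) = 0"
        using AE_lseg_ex[OF rep(2), of "max 0 (y - e)" "min L (y + e)"] e y L by auto
      then have "\<bar>t - y\<bar> \<le> e \<and> Wf L t = 0" by (auto simp: Wf_def)
      then show ?thesis unfolding e_def by blast
    qed
    then obtain t where t: "\<And>n. \<bar>t n - y\<bar> \<le> L * inverse (real (Suc n))" "\<And>n. Wf L (t n) = 0" by metis
    have "t \<longlonglongrightarrow> y"
    proof (rule LIM_zero_cancel, rule Lim_null_comparison[OF always_eventually])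
      show "\<forall>n. norm (t n - y) \<le> L * inverse (real (Suc n))" using t(1) by simp
      show "(\<lambda>n. L * inverse (real (Suc n))) \<longlonglongrightarrow> 0"
        by (rule tendsto_mult_right_zero[OF LIMSEQ_inverse_real_of_nat])
    qed
    from tendsto_add[OF tendsto_const quadrant_integral_tendsto[OF m(1) this], of "tr0 L u + P L" L]
    have "(\<lambda>n. Wf L (t n)) \<longlonglongrightarrow> Wf L y" unfolding Wf_def fub1 by (simp add: add.assoc)
    then show ?thesis unfolding t(2) using LIMSEQ_unique[OF _ tendsto_const] by blast
  qed
  have M: "M \<ge> 1" and Tm: "T = mesh_up L M \<or> T = mesh_down L M" using mesh by (auto simp: uniform_mesh_def)
  define h where "h = L / real M"
  have h: "h > 0" and LM: "L = real M * h" using L M by (auto simp: h_def)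
  \<comment> \<open>Selects the hats that fit the diagonals of \<open>T\<close>.\<close>
  define s :: real where "s = (if T = mesh_up L M then 1 else -1)"
  have s: "s = 1 \<or> s = -1" by (simp add: s_def)
  define W where "W i j = Wf (real i * h) (real j * h)" for i j :: nat
  have Wx: "W (Suc i) j - W i j = (LINT t|lseg L. indicator {real i * h..<real i * h + h} t * F (t, real j * h))" for i j
  proof -
    have "W (Suc i) j - W i j = primx L F (real i * h + h, real j * h) - primx L F (real i * h, real j * h)"
      by (simp add: W_def Wf_def algebra_simps)
    also have "\<dots> = (LINT t|lseg L. indicator {real i * h..<real i * h + h} t * F (t, real j * h))"
      unfolding primx_Pair
      by (rule interval_primitive_diff[OF section_integrable[OF L m(1) n1(1) p(1) Fp Fc FL2]]) (use h in simp)
    finally show ?thesis .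
  qed
  \<comment> \<open>Vertical edges become horizontal ones after the exchange of coordinates, with
    the transposed nodal values.\<close>
  have Wy: "W j (Suc i) - W j i = (LINT t|lseg L. indicator {real i * h..<real i * h + h} t * G (t, real j * h))" for i j
  proof -
    have "W j (Suc i) - W j i = primy L (primx L m) (real j * h, real i * h + h) - primy L (primx L m) (real j * h, real i * h)"
      by (simp add: W_def Wf_def fub2 algebra_simps)
    also have "\<dots> = (LINT t|lseg L. (if t < real i * h + h then G (t, real j * h) else 0)) - (LINT t|lseg L. (if t < real i * h then G (t, real j * h) else 0))"
      unfolding primy_Pair G_def swap_simp ..
    also have "\<dots> = (LINT t|lseg L. indicator {real i * h..<real i * h + h} t * G (t, real j * h))"
      by (rule interval_primitive_diff[OF section_integrable[OF L L2_swap_lsq[OF m(1)] L2_swap_lsq[OF n2(1)] z0 Gp Gc GsL2]]) (use h in simp)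
    finally show ?thesis .
  qed
  define v where "v = interp s h M W"
  let ?gx = "interp_dx s h M W" and ?gy = "interp_dx s h M (\<lambda>i j. W j i)"
  have ex: "L2_norm (lsq L) (\<lambda>z. F z - ?gx z) \<le> 2 * h * (L2_norm (lsq L) m + L2_norm (lsq L) n1)"
    by (rule interp_dx_error[OF L m(1) n1(1) p(1) Fp Fc FL2 h LM Wx])
  have ey: "L2_norm (lsq L) (\<lambda>z. G z - ?gy z) \<le> 2 * h * (L2_norm (lsq L) ?ms + L2_norm (lsq L) ?ns)"
    by (rule interp_dx_error[OF L L2_swap_lsq[OF m(1)] L2_swap_lsq[OF n2(1)] z0 Gp Gc GsL2 h LM Wy])
  note vd = interp_weak_derivs[OF s h LM L, of W, folded v_def]
  have vL: "v \<in> L2 (leb L)" unfolding v_def by (rule L2_lsq_imp[OF interp_L2[OF h]])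
  have v1: "v \<in> sobolev 1 (square L)" by (rule sobolev_1I[OF vL vd])
  have vc: "continuous_on (closure (square L)) v" unfolding v_def by (rule continuous_interp[OF h])
  have t0: "has_trace L 0 v (\<lambda>_. tr0 L u)"
  proof (rule has_trace_continuous[OF L _ v1 vc])
    fix y assume "0 \<le> y" "y \<le> L"
    then show "v (0, y) = tr0 L u" unfolding v_def using LM by (intro interp_left[OF s h M]) (auto simp: W_def W0)
  qed simp
  have tL: "has_trace L L v (\<lambda>_. 0)"
  proof (rule has_trace_continuous[OF L _ v1 vc])
    fix y assume y: "0 \<le> y" "y \<le> L"
    have "W M j = 0" if "j \<le> M" for j
    proof -
      have "real j * h \<le> L" unfolding LM using that h by (intro mult_right_mono) auto
      then show ?thesis using WL[of "real j * h"] h LM by (simp add: W_def)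
    qed
    then have "interp s h M W (real M * h, y) = 0" using y LM by (intro interp_right[OF s h M]) auto
    then show "v (L, y) = 0" unfolding v_def using LM by simp
  qed simp
  have vV: "v \<in> Vc L" by (rule VcI[OF t0 tL])
  have "P1_on K v" if K: "K \<in> T" for K
  proof (cases "T = mesh_up L M")
    case True
    then show ?thesis using interp_P1_mesh_up[OF L M, of K W] K by (simp add: v_def s_def h_def)
  next
    case False
    then show ?thesis using interp_P1_mesh_down[OF L M, of K W] K Tm by (simp add: v_def s_def h_def)
  qed
  then have vh: "v \<in> Vhc L T" using vV vc by (simp add: Vhc_def)
  have trv: "tr0 L v = tr0 L u" by (rule tr0_eqI[OF L t0])
  have dvL: "?dx v \<in> L2 (leb L)" "?dy v \<in> L2 (leb L)" using sobolev_1_weak_derivs(3,4)[OF v1] by auto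
  have "L2_norm (leb L) (\<lambda>z. ?dx u z - ?dx v z) = L2_norm (lsq L) (\<lambda>z. F z - ?gx z)"
  proof (rule L2_norm_leb_lsq[OF L2_diff[OF dxL dvL(1)] L2_diff[OF FL2 interp_dx_L2]])
    show "AE z in lsq L. ?dx u z - ?dx v z = F z - ?gx z"
      using Fu weak_deriv_eqI[OF vd(1)] by eventually_elim simp
  qed
  also have "\<dots> \<le> 2 * h * (S + S)"
    by (rule order_trans[OF ex]) (use h m(3) n1(3) in \<open>intro mult_left_mono add_mono; simp\<close>)
  finally have r1: "L2_norm (leb L) (\<lambda>z. ?dx u z - ?dx v z) \<le> 4 * (L / real M) * S" by (simp add: h_def)
  have "L2_norm (leb L) (\<lambda>z. ?dy u z - ?dy v z) = L2_norm (lsq L) (\<lambda>z. G (prod.swap z) - ?gy (prod.swap z))"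
  proof (rule L2_norm_leb_lsq[OF L2_diff[OF dyL dvL(2)] L2_diff[OF L2_swap_lsq[OF GsL2] L2_swap_lsq[OF interp_dx_L2]]])
    show "AE z in lsq L. ?dy u z - ?dy v z = G (prod.swap z) - ?gy (prod.swap z)"
      using dyu weak_deriv_eqI[OF vd(2)] by eventually_elim (simp add: G_def)
  qed
  also have "\<dots> = L2_norm (lsq L) (\<lambda>z. G z - ?gy z)"
    by (rule L2_norm_swap_lsq[OF L2_diff[OF GsL2 interp_dx_L2]])
  also have "\<dots> \<le> 2 * h * (S + S)"
    by (rule order_trans[OF ey])
      (use h m(3) n2(3) L2_norm_swap_lsq[OF m(1)] L2_norm_swap_lsq[OF n2(1)] in \<open>intro mult_left_mono add_mono; simp\<close>)
  finally have r2: "L2_norm (leb L) (\<lambda>z. ?dy u z - ?dy v z) \<le> 4 * (L / real M) * S" by (simp add: h_def)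
  show ?thesis by (rule that[OF vh trv r1 r2])
qed

context potential_problem
begin

text \<open>One bound for the error paired with an arbitrary H2 function is used twice: with the
  solution it gives the energy estimate, with the dual solution the L2 estimate. The constants 8 and
  4 of these two uses multiply to 32.\<close>

lemma L2_error_estimate:
  assumes reg: "H2_regular L R \<sigma> C\<^sub>r\<^sub>e\<^sub>g" and mesh: "uniform_mesh L M T"
    and sol: "weak_solution L R \<sigma> U f \<Phi>" and \<Phi>2: "\<Phi> \<in> sobolev 2 (square L)" and fe: "fe_solution L R \<sigma> U f T \<Phi>\<^sub>h"
  shows "N (\<lambda>x. \<Phi> x - \<Phi>\<^sub>h x) \<le> 32 * \<sigma>\<^sub>M\<^sup>2 / \<sigma>\<^sub>m * \<bar>C\<^sub>r\<^sub>e\<^sub>g\<bar> * (L / real M)\<^sup>2 * sobolev_norm 2 (square L) \<Phi>"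
proof -
  define h where "h = L / real M"
  have h0: "h \<ge> 0" unfolding h_def using L by simp
  define S where "S = sobolev_norm 2 (square L) \<Phi>"
  have S0: "S \<ge> 0" unfolding S_def by (rule sobolev_norm_nonneg)
  have \<Phi>: "\<Phi> \<in> Vc L" "\<And>v. v \<in> Vc L \<Longrightarrow> bilinear_a L R \<sigma> \<Phi> v = load L R U f v" using sol by (auto simp: weak_solution_def)
  have \<Phi>h: "\<Phi>\<^sub>h \<in> Vhc L T" "\<And>v. v \<in> Vhc L T \<Longrightarrow> bilinear_a L R \<sigma> \<Phi>\<^sub>h v = load L R U f v" using fe by (auto simp: fe_solution_def)
  have sub: "v \<in> Vc L" if "v \<in> Vhc L T" for v using that by (simp add: Vhc_def)
  have dif: "(\<lambda>x. p x - q x) \<in> Vc L" "tr0 L (\<lambda>x. p x - q x) = tr0 L p - tr0 L q" if "p \<in> Vc L" "q \<in> Vc L" for p q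
    using Vc_lincomb[OF L that, of 1 "-1"] by simp_all
  define e where "e = (\<lambda>x. \<Phi> x - \<Phi>\<^sub>h x)"
  have e: "e \<in> Vc L" unfolding e_def by (rule dif(1)[OF \<Phi>(1) sub[OF \<Phi>h(1)]])
  have orth: "bilinear_a L R \<sigma> e v = 0" if v: "v \<in> Vhc L T" for v
    using a_lin[OF \<Phi>(1) sub[OF \<Phi>h(1)] sub[OF v], of 1 "-1"] \<Phi>(2)[OF sub[OF v]] \<Phi>h(2)[OF v] by (simp add: e_def)
  have adiff: "bilinear_a L R \<sigma> e (\<lambda>x. p x - v x) = bilinear_a L R \<sigma> e p" if p: "p \<in> Vc L" and v: "v \<in> Vhc L T" for p v
    using a_lin[OF p sub[OF v] e, of 1 "-1"] a_sym[OF e p] a_sym[OF e sub[OF v]] a_sym[OF e dif(1)[OF p sub[OF v]]] orth[OF v] by simp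
  \<comment> \<open>By orthogonality the interpolant may be subtracted from \<open>p\<close>. It has
    the same trace constant, so the boundary term drops out and only the gradient part
    remains.\<close>
  have bound: "\<bar>bilinear_a L R \<sigma> e p\<bar> \<le> \<sigma>\<^sub>M * (N (dx e) + N (dy e)) * (4 * h * sobolev_norm 2 (square L) p)"
    if p: "p \<in> Vc L" "p \<in> sobolev 2 (square L)" for p
  proof -
    obtain v where v: "v \<in> Vhc L T" "tr0 L v = tr0 L p" "N (\<lambda>z. dx p z - dx v z) \<le> 4 * h * sobolev_norm 2 (square L) p"
      "N (\<lambda>z. dy p z - dy v z) \<le> 4 * h * sobolev_norm 2 (square L) p"
      using H2_interpolation[OF L mesh p] unfolding h_def by blast
    let ?q = "\<lambda>x. p x - v x"
    have q: "?q \<in> Vc L" "tr0 L ?q = 0" using dif[OF p(1) sub[OF v(1)]] v(2) by auto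
    have "\<bar>bilinear_a L R \<sigma> e p\<bar> = \<bar>E e ?q\<bar>"
      using adiff[OF p(1) v(1)] bilinear_a_eq[OF e q(1)] q(2) by simp
    also have "\<dots> \<le> \<sigma>\<^sub>M * N (dx e) * N (dx ?q) + \<sigma>\<^sub>M * N (dy e) * N (dy ?q)"
      unfolding E_split[OF e q(1)]
      using \<sigma>_integral_le[OF Vc_L2(2)[OF e] Vc_L2(2)[OF q(1)]] \<sigma>_integral_le[OF Vc_L2(3)[OF e] Vc_L2(3)[OF q(1)]] by linarith
    also have "\<dots> \<le> \<sigma>\<^sub>M * N (dx e) * (4 * h * sobolev_norm 2 (square L) p) + \<sigma>\<^sub>M * N (dy e) * (4 * h * sobolev_norm 2 (square L) p)"
      unfolding N_d_diff[OF p(1) sub[OF v(1)]] using \<sigma>M v(3,4) by (intro add_mono mult_left_mono) auto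
    finally show ?thesis by (simp add: algebra_simps)
  qed
  define \<delta> where "\<delta> = N (dx e) + N (dy e)"
  have d0: "\<delta> \<ge> 0" by (simp add: \<delta>_def)
  \<comment> \<open>The square of the sum of the two derivative norms is at most twice the sum of
    their squares, which turns the interpolation constant 4 into 8. One factor of the error
    cancels.\<close>
  have energy: "\<sigma>\<^sub>m * \<delta> \<le> 8 * \<sigma>\<^sub>M * h * S"
  proof -
    have "\<sigma>\<^sub>m * \<delta>\<^sup>2 \<le> 2 * (\<sigma>\<^sub>m * (N (dx e))\<^sup>2 + \<sigma>\<^sub>m * (N (dy e))\<^sup>2)"
    proof -
      have "\<delta>\<^sup>2 \<le> 2 * ((N (dx e))\<^sup>2 + (N (dy e))\<^sup>2)"
        unfolding \<delta>_def using sum_squares_bound[of "N (dx e)" "N (dy e)"] by (simp add: power2_sum)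
      then have "\<sigma>\<^sub>m * \<delta>\<^sup>2 \<le> \<sigma>\<^sub>m * (2 * ((N (dx e))\<^sup>2 + (N (dy e))\<^sup>2))" using \<sigma>m by (intro mult_left_mono) auto
      then show ?thesis by (simp add: algebra_simps)
    qed
    also have "\<dots> \<le> 2 * bilinear_a L R \<sigma> e e"
    proof -
      have "0 \<le> (tr0 L e)\<^sup>2 / R" using R by simp
      moreover have "2 * (p + q) \<le> 2 * b" if "p + q + r \<le> b" "0 \<le> r" for p q r b :: real using that by simp
      ultimately show ?thesis using a_lower[OF e] by blast
    qed
    also have "bilinear_a L R \<sigma> e e = bilinear_a L R \<sigma> e \<Phi>"
      using adiff[OF \<Phi>(1) \<Phi>h(1)] by (simp add: e_def)
    also have "2 * \<dots> \<le> 2 * (\<sigma>\<^sub>M * \<delta> * (4 * h * S))"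
      using abs_le_D1[OF bound[OF \<Phi>(1) \<Phi>2]] unfolding \<delta>_def S_def by (simp add: algebra_simps)
    finally have *: "(\<sigma>\<^sub>m * \<delta>) * \<delta> \<le> (8 * \<sigma>\<^sub>M * h * S) * \<delta>" by (simp add: power2_eq_square algebra_simps)
    show ?thesis
    proof (cases "\<delta> = 0")
      case True
      then show ?thesis using \<sigma>M h0 S0 by simp
    next
      case False
      then show ?thesis using * d0 by (simp add: mult_le_cancel_right)
    qed
  qed
  \<comment> \<open>The Aubin-Nitsche dual problem has the error itself as right-hand side, so
    pairing \<open>w\<close> with the error yields the square of its L2 norm.\<close>
  obtain w where w: "w \<in> Vc L" "\<And>v. v \<in> Vc L \<Longrightarrow> bilinear_a L R \<sigma> w v = (LINT z|leb L. e z * v z)"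
    using dual_solution_exists[OF Vc_L2(1)[OF e] e] by blast
  have w2: "w \<in> sobolev 2 (square L)" "sobolev_norm 2 (square L) w \<le> C\<^sub>r\<^sub>e\<^sub>g * N e"
    using reg w Vc_L2(1)[OF e] unfolding H2_regular_def by blast+
  \<comment> \<open>The regularity constant carries no sign hypothesis; with its absolute value the
    later multiplications are monotone.\<close>
  have w3: "sobolev_norm 2 (square L) w \<le> \<bar>C\<^sub>r\<^sub>e\<^sub>g\<bar> * N e"
    by (rule order_trans[OF w2(2)]) (intro mult_right_mono; simp)
  have "(N e)\<^sup>2 = bilinear_a L R \<sigma> e w"
    unfolding L2_norm_power2 using w(2)[OF e] a_sym[OF w(1) e] by (simp add: power2_eq_square)
  also have "\<dots> \<le> \<sigma>\<^sub>M * \<delta> * (4 * h * sobolev_norm 2 (square L) w)"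
    using bound[OF w(1) w2(1)] unfolding \<delta>_def by linarith
  also have "\<dots> \<le> \<sigma>\<^sub>M * \<delta> * (4 * h * (\<bar>C\<^sub>r\<^sub>e\<^sub>g\<bar> * N e))"
    using \<sigma>M d0 h0 w3 by (intro mult_left_mono) auto
  finally have *: "N e * N e \<le> (4 * \<sigma>\<^sub>M * \<delta> * h * \<bar>C\<^sub>r\<^sub>e\<^sub>g\<bar>) * N e" by (simp add: power2_eq_square algebra_simps)
  have "N e \<le> 4 * \<sigma>\<^sub>M * \<delta> * h * \<bar>C\<^sub>r\<^sub>e\<^sub>g\<bar>"
  proof (cases "N e = 0")
    case True
    then show ?thesis using \<sigma>M h0 d0 by simp
  next
    case False
    then have "N e > 0" using L2_norm_nonneg[of "leb L" e] by linarith
    then show ?thesis using * by (simp add: mult_le_cancel_right)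
  qed
  also have "\<delta> \<le> 8 * \<sigma>\<^sub>M * h * S / \<sigma>\<^sub>m" using energy \<sigma>m by (simp add: field_simps)
  then have "4 * \<sigma>\<^sub>M * \<delta> * h * \<bar>C\<^sub>r\<^sub>e\<^sub>g\<bar> \<le> 4 * \<sigma>\<^sub>M * (8 * \<sigma>\<^sub>M * h * S / \<sigma>\<^sub>m) * h * \<bar>C\<^sub>r\<^sub>e\<^sub>g\<bar>"
    using \<sigma>M h0 by (intro mult_right_mono mult_left_mono) auto
  also have "\<dots> = 32 * \<sigma>\<^sub>M\<^sup>2 / \<sigma>\<^sub>m * \<bar>C\<^sub>r\<^sub>e\<^sub>g\<bar> * h\<^sup>2 * S" by (simp add: power2_eq_square algebra_simps)
  finally show ?thesis unfolding e_def h_def S_def .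
qed

end

theorem theorem3:
  fixes L R \<sigma>\<^sub>m \<sigma>\<^sub>M C\<^sub>r\<^sub>e\<^sub>g :: real and \<sigma> :: "real \<times> real \<Rightarrow> real"
  assumes "L > 0" and "R > 0"
    and "\<sigma>\<^sub>m > 0" and "\<sigma>\<^sub>M > 0"
    and "\<sigma> \<in> borel_measurable (lebesgue_on (closure (square L)))"
    and "\<And>x. x \<in> closure (square L) \<Longrightarrow> \<sigma>\<^sub>m \<le> \<sigma> x \<and> \<sigma> x \<le> \<sigma>\<^sub>M"
    and "H2_regular L R \<sigma> C\<^sub>r\<^sub>e\<^sub>g"
  shows "(\<exists>C>0. \<forall>M T U f \<Phi> \<Phi>\<^sub>h.
            uniform_mesh L M T \<longrightarrow>
            f \<in> L2 (lebesgue_on (square L)) \<longrightarrow>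
            weak_solution L R \<sigma> U f \<Phi> \<longrightarrow>
            \<Phi> \<in> sobolev 2 (square L) \<longrightarrow>
            fe_solution L R \<sigma> U f T \<Phi>\<^sub>h \<longrightarrow>
            L2_norm (lebesgue_on (square L)) (\<lambda>x. \<Phi> x - \<Phi>\<^sub>h x)
              \<le> C * (L / real M)\<^sup>2 * sobolev_norm 2 (square L) \<Phi>)
       \<and> (\<exists>C'>0. \<forall>M T U f \<Phi> \<Phi>\<^sub>h.
            uniform_mesh L M T \<longrightarrow>
            f \<in> L2 (lebesgue_on (square L)) \<longrightarrow>
            weak_solution L R \<sigma> U f \<Phi> \<longrightarrow>
            \<Phi> \<in> sobolev 2 (square L) \<longrightarrow>
            fe_solution L R \<sigma> U f T \<Phi>\<^sub>h \<longrightarrow>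
            sobolev_norm 2 (square L) \<Phi> \<le> C\<^sub>r\<^sub>e\<^sub>g * L2_norm (lebesgue_on (square L)) f \<longrightarrow>
            L2_norm (lebesgue_on (square L)) (\<lambda>x. \<Phi> x - \<Phi>\<^sub>h x)
              \<le> C' * (L / real M)\<^sup>2 * L2_norm (lebesgue_on (square L)) f)"
proof -
  interpret potential_problem L R \<sigma>\<^sub>m \<sigma>\<^sub>M \<sigma>
    using assms(1,2,3,5,6) by unfold_locales auto
  define C where "C = 32 * \<sigma>\<^sub>M\<^sup>2 / \<sigma>\<^sub>m * \<bar>C\<^sub>r\<^sub>e\<^sub>g\<bar>"
  have C: "C \<ge> 0" using assms(3) by (simp add: C_def)
  have est: "N (\<lambda>x. \<Phi> x - \<Phi>\<^sub>h x) \<le> C * (L / real M)\<^sup>2 * sobolev_norm 2 (square L) \<Phi>"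
    if "uniform_mesh L M T" "weak_solution L R \<sigma> U f \<Phi>" "\<Phi> \<in> sobolev 2 (square L)" "fe_solution L R \<sigma> U f T \<Phi>\<^sub>h"
    for M T U f \<Phi> \<Phi>\<^sub>h
    unfolding C_def by (rule L2_error_estimate[OF assms(7) that])
  \<comment> \<open>\<open>C\<close> is zero when the regularity constant is; adding 1 makes the
    constant positive as claimed.\<close>
  have est1: "N (\<lambda>x. \<Phi> x - \<Phi>\<^sub>h x) \<le> (C + 1) * (L / real M)\<^sup>2 * sobolev_norm 2 (square L) \<Phi>"
    if "uniform_mesh L M T" "weak_solution L R \<sigma> U f \<Phi>" "\<Phi> \<in> sobolev 2 (square L)" "fe_solution L R \<sigma> U f T \<Phi>\<^sub>h"
    for M T U f \<Phi> \<Phi>\<^sub>h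
    by (rule order_trans[OF est[OF that]]) (intro mult_right_mono sobolev_norm_nonneg; simp)
  have est2: "N (\<lambda>x. \<Phi> x - \<Phi>\<^sub>h x) \<le> (C * \<bar>C\<^sub>r\<^sub>e\<^sub>g\<bar> + 1) * (L / real M)\<^sup>2 * N f"
    if a: "uniform_mesh L M T" "weak_solution L R \<sigma> U f \<Phi>" "\<Phi> \<in> sobolev 2 (square L)" "fe_solution L R \<sigma> U f T \<Phi>\<^sub>h"
      and reg: "sobolev_norm 2 (square L) \<Phi> \<le> C\<^sub>r\<^sub>e\<^sub>g * N f"
    for M T U f \<Phi> \<Phi>\<^sub>h
  proof -
    let ?h2 = "(L / real M)\<^sup>2"
    have "C\<^sub>r\<^sub>e\<^sub>g * N f \<le> \<bar>C\<^sub>r\<^sub>e\<^sub>g\<bar> * N f" by (intro mult_right_mono) auto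
    with reg have "sobolev_norm 2 (square L) \<Phi> \<le> \<bar>C\<^sub>r\<^sub>e\<^sub>g\<bar> * N f" by linarith
    then have "C * ?h2 * sobolev_norm 2 (square L) \<Phi> \<le> C * ?h2 * (\<bar>C\<^sub>r\<^sub>e\<^sub>g\<bar> * N f)"
      using C by (intro mult_left_mono) auto
    also have "\<dots> = (C * \<bar>C\<^sub>r\<^sub>e\<^sub>g\<bar>) * ?h2 * N f" by simp
    also have "\<dots> \<le> (C * \<bar>C\<^sub>r\<^sub>e\<^sub>g\<bar> + 1) * ?h2 * N f" by (intro mult_right_mono) auto
    finally show ?thesis using est[OF a] by linarith
  qed
  have pos: "C + 1 > 0" "C * \<bar>C\<^sub>r\<^sub>e\<^sub>g\<bar> + 1 > 0" using C by (auto intro: add_nonneg_pos)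
  show ?thesis
    by (rule conjI; (rule exI[of _ "C + 1"], rule conjI[OF pos(1)], use est1 in blast)?;
        (rule exI[of _ "C * \<bar>C\<^sub>r\<^sub>e\<^sub>g\<bar> + 1"], rule conjI[OF pos(2)], use est2 in blast)?)
qed

end
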